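(* Let $C$ be the capacity of the noncoherent OFDM channel described in the context, with SNR parameter $p_x>0$ and effective coherence time $\hat T_{\rm c}(\cdot)$. Let $u\sim\mathcal{CN}(0,1)$ and, for $\rho\ge0$, let $$C_{\rm QPSK}(\rho)=\log4-\sqrt{\tfrac2\pi}\int_{-\infty}^\infty e^{-y^2/2}\log\left(1+e^{-2(\rho+\sqrt\rho\,y)}\right)dy$$ (the mutual information achieved by equiprobable QPSK over an AWGN channel with SNR $\rho$). For an integer $1\le r\le N$ and real $\beta\ge1$ set $$e_{r,\beta}=\begin{cases}\dfrac{1}{1+\frac{\beta}{r}\frac{p_x}{2}\left(\hat T_{\rm c}\left(\frac{\beta}{r}p_x\right)-N\right)}, & r<N,\\[3mm] \dfrac{1}{1+\frac{\beta}{L}\frac{p_x}{2}\left(\hat T_{\rm c}(\beta p_x)-N\right)}, & r=N,\end{cases}$$ and $$\mathrm{LB}_{\rm QPSK}(p_x,r,\beta)=\frac{r}{N\beta}\,E\left[C_{\rm QPSK}\left(\frac{\left|\sqrt N\,E[\tilde h_{0,0}]+\sqrt{1-e_{r,\beta}}\;u\right|^2}{\frac rN\frac1{\beta p_x}+e_{r,\beta}}\right)\right],$$ the outer expectation being over $u$. Then under the peak power constraint $$C\ge\max_{1\le r\le N}\mathrm{LB}_{\rm QPSK}(p_x,r,1),$$ and under the quadratic power constraint (with constant $\alpha\ge1$) $$C\ge\max_{1\le r\le N}\ \max_{1\le\beta\le\alpha}\mathrm{LB}_{\rm QPSK}(p_x,r,\beta).$$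
   Context: Conventions: logarithms are natural, $\dagger$ is conjugate transpose, indices start at $0$, $\mathcal{CN}(m,\Sigma)$ is the proper (circularly symmetric) complex Gaussian law. Channel model. Fix integers $1\le L\le N$ and $p_x>0$. Let $F$ be the $N\times N$ DFT matrix, $F_{m,n}=N^{-1/2}e^{-2\pi j mn/N}$. For $k\ge0$ let $H_k=(h_{k,0},\dots,h_{k,L-1},0,\dots,0)^T\in\mathbb C^N$ be the random channel impulse response and $\tilde H_k=F^\dagger H_k=(\tilde h_{k,0},\dots,\tilde h_{k,N-1})^T$. Assumptions: the sequence $(H_k)$ is jointly proper complex Gaussian, stationary and ergodic in $k$; different taps are uncorrelated and all taps have the same normalized autocorrelation, so that the covariance matrix of the stacked vector $(H_0^T,\dots,H_k^T)^T$ is the Kronecker product $\Delta_k\otimes \mathsf C_H$, where $\mathsf C_H$ is an $N\times N$ diagonal nonnegative matrix (zero outside its first $L$ diagonal entries) with $\mathrm{Tr}\,\mathsf C_H=1$, and $\Delta_k$ is the $(k+1)\times(k+1)$ Toeplitz positive semi-definite matrix, with unit diagonal, of the common normalized tap autocorrelation. $D_k\in\mathbb C^k$ is the vector with entries $(\Delta_k)_{i,k}$, $i=0,\dots,k-1$. The mean $E[H_k]$ does not depend on $k$ and has at most one nonzero entry (frequency-flat mean). The received signal is $$\tilde Y_k=\sqrt N\,\mathrm{diag}(\tilde H_k)\tilde X_k+\tilde W_k,$$ with $\tilde W_k$ i.i.d. $\mathcal{CN}(0,I)$ in $\mathbb C^N$, and with inputs, channel and noise mutually independent (neither transmitter nor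 receiver knows the channel realization; both know its statistics). Power constraints. With $p_k=\tilde X_k^\dagger\tilde X_k$: the peak constraint is $p_k\le Np_x$ almost surely for all $k$; the quadratic constraint is $E[p_k]\le Np_x$ and $E[p_k^2]\le\alpha N^2p_x^2$ for all $k$, where $\alpha\ge1$ is a constant. Capacity. $C=\lim_{n\to\infty}\sup\frac1{N(n+1)}I(\tilde X_0,\dots,\tilde X_n;\tilde Y_0,\dots,\tilde Y_n)$, the supremum being over input distributions of $(\tilde X_0,\dots,\tilde X_n)$ satisfying the constraint under consideration. Effective coherence time. For $p>0$, $$\hat T_{\rm c}(p)=2N\lim_{k\to\infty}D_k^\dagger\left(Np\,[\Delta_{k-1}-D_kD_k^\dagger]+I\right)^{-1}D_k+N .$$ If $\hat T_{\rm c}=+\infty$, expressions in $\hat T_{\rm c}$ are read as limits. *)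

theory Defs
  imports
    "HOL-Probability.Probability"
    "Jordan_Normal_Form.Gauss_Jordan_Elimination"
    "Jordan_Normal_Form.Schur_Decomposition"
begin

text \<open>
  Conventions: indices start at 0; vectors of \<open>\<complex>\<^sup>N\<close> occurring as random variables are functions on
  \<open>{..<N}\<close>; deterministic matrices are those of \<open>Jordan_Normal_Form\<close>.
\<close>

text \<open>The law of mean \<open>m\<close> and standard deviation \<open>s\<close>, including the degenerate case \<open>s = 0\<close>
  (needed because some taps may vanish).\<close>

definition normal_law :: "real \<Rightarrow> real \<Rightarrow> real measure" where
  "normal_law m s =
     (if s = 0 then return borel m else density lborel (\<lambda>x. ennreal (normal_density m s x)))"

definition jointly_gaussian :: "'a measure \<Rightarrow> 'i set \<Rightarrow> ('i \<Rightarrow> 'a \<Rightarrow> complex) \<Rightarrow> bool" where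
  "jointly_gaussian M I Z \<longleftrightarrow>
     (\<forall>i\<in>I. Z i \<in> borel_measurable M) \<and>
     (\<forall>J c d. finite J \<longrightarrow> J \<subseteq> I \<longrightarrow>
        (\<exists>m s. s \<ge> 0 \<and>
           distr M borel (\<lambda>\<omega>. \<Sum>i\<in>J. c i * Re (Z i \<omega>) + d i * Im (Z i \<omega>)) = normal_law m s))"

definition mean :: "'a measure \<Rightarrow> ('a \<Rightarrow> complex) \<Rightarrow> complex" where
  "mean M U = (\<integral>\<omega>. U \<omega> \<partial>M)"

definition covar :: "'a measure \<Rightarrow> ('a \<Rightarrow> complex) \<Rightarrow> ('a \<Rightarrow> complex) \<Rightarrow> complex" where
  "covar M U V = (\<integral>\<omega>. (U \<omega> - mean M U) * cnj (V \<omega> - mean M V) \<partial>M)"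

definition pseudo_covar :: "'a measure \<Rightarrow> ('a \<Rightarrow> complex) \<Rightarrow> ('a \<Rightarrow> complex) \<Rightarrow> complex" where
  "pseudo_covar M U V = (\<integral>\<omega>. (U \<omega> - mean M U) * (V \<omega> - mean M V) \<partial>M)"

definition proper_gaussian :: "'a measure \<Rightarrow> 'i set \<Rightarrow> ('i \<Rightarrow> 'a \<Rightarrow> complex) \<Rightarrow> bool" where
  "proper_gaussian M I Z \<longleftrightarrow>
     jointly_gaussian M I Z \<and> (\<forall>i\<in>I. \<forall>j\<in>I. pseudo_covar M (Z i) (Z j) = 0)"

text \<open>\<open>\<C>\<N>(0, 1)\<close>: independent real and imaginary parts of variance \<open>1/2\<close> each.\<close>

definition std_CN :: "complex measure" where
  "std_CN = density lborel (\<lambda>z. ennreal (exp (- (cmod z)\<^sup>2) / pi))"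

definition vec_space :: "nat \<Rightarrow> (nat \<Rightarrow> complex) measure" where
  "vec_space N = (\<Pi>\<^sub>M m\<in>{..<N}. borel)"

definition block_space :: "nat \<Rightarrow> nat \<Rightarrow> (nat \<Rightarrow> nat \<Rightarrow> complex) measure" where
  "block_space N n = (\<Pi>\<^sub>M k\<in>{..n}. vec_space N)"

definition seq_space :: "nat \<Rightarrow> (nat \<Rightarrow> nat \<Rightarrow> complex) measure" where
  "seq_space N = (\<Pi>\<^sub>M k\<in>UNIV. vec_space N)"

definition process_law ::
  "nat \<Rightarrow> 'a measure \<Rightarrow> (nat \<Rightarrow> 'a \<Rightarrow> nat \<Rightarrow> complex) \<Rightarrow> (nat \<Rightarrow> nat \<Rightarrow> complex) measure" where
  "process_law N M Z = distr M (seq_space N) (\<lambda>\<omega> k. Z k \<omega>)"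

definition shift :: "(nat \<Rightarrow> 'b) \<Rightarrow> nat \<Rightarrow> 'b" where
  "shift f = (\<lambda>k. f (Suc k))"

definition stationary :: "nat \<Rightarrow> 'a measure \<Rightarrow> (nat \<Rightarrow> 'a \<Rightarrow> nat \<Rightarrow> complex) \<Rightarrow> bool" where
  "stationary N M Z \<longleftrightarrow> distr (process_law N M Z) (seq_space N) shift = process_law N M Z"

definition ergodic :: "nat \<Rightarrow> 'a measure \<Rightarrow> (nat \<Rightarrow> 'a \<Rightarrow> nat \<Rightarrow> complex) \<Rightarrow> bool" where
  "ergodic N M Z \<longleftrightarrow>
     (\<forall>A\<in>sets (seq_space N). shift -` A \<inter> space (seq_space N) = A \<longrightarrow>
        measure (process_law N M Z) A = 0 \<or> measure (process_law N M Z) A = 1)"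

definition dft :: "nat \<Rightarrow> nat \<Rightarrow> nat \<Rightarrow> complex" where
  "dft N m n =
     complex_of_real (1 / sqrt (real N)) * exp (- (2 * complex_of_real pi * \<i> * of_nat m * of_nat n / of_nat N))"

text \<open>\<open>freq_resp N h\<close> is \<open>F\<^sup>\<dagger> h\<close>.\<close>

definition freq_resp :: "nat \<Rightarrow> (nat \<Rightarrow> complex) \<Rightarrow> nat \<Rightarrow> complex" where
  "freq_resp N h m = (\<Sum>n<N. cnj (dft N n m) * h n)"

text \<open>The Toeplitz matrix \<open>\<Delta>\<^sub>k\<close> is of size \<open>k + 1\<close>; \<open>\<rho>\<close> is the normalized tap autocorrelation.\<close>

definition Delta :: "(int \<Rightarrow> complex) \<Rightarrow> nat \<Rightarrow> complex mat" where
  "Delta \<rho> k = mat (Suc k) (Suc k) (\<lambda>(i, j). \<rho> (int i - int j))"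

text \<open>\<open>D\<^sub>k\<close>, as a matrix with \<open>k\<close> rows and one column.\<close>

definition Dcol :: "(int \<Rightarrow> complex) \<Rightarrow> nat \<Rightarrow> complex mat" where
  "Dcol \<rho> k = mat k 1 (\<lambda>(i, j). Delta \<rho> k $$ (i, k))"

locale ofdm_channel = prob_space M
  for M :: "'a measure" +
  fixes N L :: nat
    and \<rho> :: "int \<Rightarrow> complex"
    and cH :: "nat \<Rightarrow> real"  \<comment> \<open>diagonal of \<open>C\<^sub>H\<close>\<close>
    and H W :: "nat \<Rightarrow> 'a \<Rightarrow> nat \<Rightarrow> complex"
  assumes L_pos: "1 \<le> L" and L_le_N: "L \<le> N"
    and H_meas: "\<And>k. H k \<in> measurable M (vec_space N)"
    and W_meas: "\<And>k. W k \<in> measurable M (vec_space N)"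
    and H_taps: "\<And>k l \<omega>. \<omega> \<in> space M \<Longrightarrow> L \<le> l \<Longrightarrow> l < N \<Longrightarrow> H k \<omega> l = 0"
    and H_gaussian: "proper_gaussian M (UNIV \<times> {..<N}) (\<lambda>(k, l) \<omega>. H k \<omega> l)"
    and H_stationary: "stationary N M H"
    and H_ergodic: "ergodic N M H"
    and cH_nonneg: "\<And>l. l < N \<Longrightarrow> 0 \<le> cH l"
    and cH_zero: "\<And>l. L \<le> l \<Longrightarrow> l < N \<Longrightarrow> cH l = 0"
    and cH_trace: "(\<Sum>l<N. cH l) = 1"
    and Delta_diag: "\<rho> 0 = 1"
    and Delta_psd: "\<And>k v. v \<in> carrier_vec (Suc k) \<Longrightarrow> (Delta \<rho> k *\<^sub>v v) \<bullet>c v \<in> \<real>\<^sub>\<ge>\<^sub>0"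
    and H_cov: \<comment> \<open>the stacked vector \<open>(H\<^sub>0, \<dots>, H\<^sub>k)\<close> has covariance matrix \<open>\<Delta>\<^sub>k \<otimes> C\<^sub>H\<close>\<close>
      "\<And>k i j l l'. i \<le> k \<Longrightarrow> j \<le> k \<Longrightarrow> l < N \<Longrightarrow> l' < N \<Longrightarrow>
         covar M (\<lambda>\<omega>. H i \<omega> l) (\<lambda>\<omega>. H j \<omega> l') =
           Delta \<rho> k $$ (i, j) * (if l = l' then complex_of_real (cH l) else 0)"
    and H_mean_const: "\<And>k l. l < N \<Longrightarrow> mean M (\<lambda>\<omega>. H k \<omega> l) = mean M (\<lambda>\<omega>. H 0 \<omega> l)"
    and H_mean_flat: "\<exists>l\<^sub>0<N. \<forall>k. \<forall>l<N. l \<noteq> l\<^sub>0 \<longrightarrow> mean M (\<lambda>\<omega>. H k \<omega> l) = 0"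
    and W_indep: "indep_vars (\<lambda>_. vec_space N) W UNIV"
    and W_gaussian: "\<And>k. proper_gaussian M {..<N} (\<lambda>m \<omega>. W k \<omega> m)"
    and W_mean: "\<And>k m. m < N \<Longrightarrow> mean M (\<lambda>\<omega>. W k \<omega> m) = 0"
    and W_cov: "\<And>k m m'. m < N \<Longrightarrow> m' < N \<Longrightarrow>
         covar M (\<lambda>\<omega>. W k \<omega> m) (\<lambda>\<omega>. W k \<omega> m') = (if m = m' then 1 else 0)"
    and H_W_indep: "indep_var (seq_space N) (\<lambda>\<omega> k. H k \<omega>) (seq_space N) (\<lambda>\<omega> k. W k \<omega>)"

definition channel_output ::
  "nat \<Rightarrow> (nat \<Rightarrow> 'a \<Rightarrow> nat \<Rightarrow> complex) \<Rightarrow> (nat \<Rightarrow> 'a \<Rightarrow> nat \<Rightarrow> complex) \<Rightarrow> nat \<Rightarrow>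
   (nat \<Rightarrow> nat \<Rightarrow> complex) \<Rightarrow> 'a \<Rightarrow> nat \<Rightarrow> nat \<Rightarrow> complex" where
  "channel_output N H W n x \<omega> =
     (\<lambda>k\<in>{..n}. \<lambda>m\<in>{..<N}.
        complex_of_real (sqrt (real N)) * freq_resp N (H k \<omega>) m * x k m + W k \<omega> m)"

definition tx_power :: "nat \<Rightarrow> (nat \<Rightarrow> complex) \<Rightarrow> real" where
  "tx_power N x = (\<Sum>m<N. (cmod (x m))\<^sup>2)"

definition input_laws :: "nat \<Rightarrow> nat \<Rightarrow> (nat \<Rightarrow> nat \<Rightarrow> complex) measure set" where
  "input_laws N n = {\<mu>. prob_space \<mu> \<and> sets \<mu> = sets (block_space N n)}"

definition peak_inputs :: "nat \<Rightarrow> real \<Rightarrow> nat \<Rightarrow> (nat \<Rightarrow> nat \<Rightarrow> complex) measure set" where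
  "peak_inputs N px n =
     {\<mu> \<in> input_laws N n. \<forall>k\<le>n. AE x in \<mu>. tx_power N (x k) \<le> real N * px}"

definition quadratic_inputs :: "nat \<Rightarrow> real \<Rightarrow> real \<Rightarrow> nat \<Rightarrow> (nat \<Rightarrow> nat \<Rightarrow> complex) measure set" where
  "quadratic_inputs N px \<alpha> n =
     {\<mu> \<in> input_laws N n. \<forall>k\<le>n.
        (\<integral>\<^sup>+x. ennreal (tx_power N (x k)) \<partial>\<mu>) \<le> ennreal (real N * px) \<and>
        (\<integral>\<^sup>+x. ennreal ((tx_power N (x k))\<^sup>2) \<partial>\<mu>) \<le> ennreal (\<alpha> * (real N)\<^sup>2 * px\<^sup>2)}"

text \<open>Mutual information (in nats) of the input block of law \<open>\<mu>\<close> and the output block. The product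
  measure makes the input independent of channel and noise. The real-valued library notion is
  meaningful because the mutual information is finite under either power constraint.\<close>

definition block_information ::
  "'a measure \<Rightarrow> nat \<Rightarrow> (nat \<Rightarrow> 'a \<Rightarrow> nat \<Rightarrow> complex) \<Rightarrow> (nat \<Rightarrow> 'a \<Rightarrow> nat \<Rightarrow> complex) \<Rightarrow> nat \<Rightarrow>
   (nat \<Rightarrow> nat \<Rightarrow> complex) measure \<Rightarrow> real" where
  "block_information M N H W n \<mu> =
     prob_space.mutual_information (\<mu> \<Otimes>\<^sub>M M) (exp 1) (block_space N n) (block_space N n)
       fst (\<lambda>(x, \<omega>). channel_output N H W n x \<omega>)"

definition capacity ::
  "'a measure \<Rightarrow> nat \<Rightarrow> (nat \<Rightarrow> 'a \<Rightarrow> nat \<Rightarrow> complex) \<Rightarrow> (nat \<Rightarrow> 'a \<Rightarrow> nat \<Rightarrow> complex) \<Rightarrow>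
   (nat \<Rightarrow> (nat \<Rightarrow> nat \<Rightarrow> complex) measure set) \<Rightarrow> ereal" where
  "capacity M N H W inputs =
     lim (\<lambda>n. SUP \<mu>\<in>inputs n. ereal (block_information M N H W n \<mu> / (real N * real (n + 1))))"

text \<open>The sequence is indexed from \<open>k = 1\<close>, the first index for which \<open>\<Delta>\<^sub>k\<^sub>-\<^sub>1\<close> exists. The quadratic
  form \<open>D\<^sub>k\<^sup>\<dagger> A\<^sup>-\<^sup>1 D\<^sub>k\<close> is the only entry of a \<open>1 \<times> 1\<close> matrix; it is real, and \<open>A\<close> is positive
  definite, so \<open>mat_inverse\<close> does yield the inverse.\<close>

definition coh_form :: "nat \<Rightarrow> (int \<Rightarrow> complex) \<Rightarrow> real \<Rightarrow> nat \<Rightarrow> real" where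
  "coh_form N \<rho> p k =
     (let D = Dcol \<rho> k;
          A = complex_of_real (real N * p) \<cdot>\<^sub>m (Delta \<rho> (k - 1) - D * mat_adjoint D) + 1\<^sub>m k
      in Re ((mat_adjoint D * the (mat_inverse A) * D) $$ (0, 0)))"

definition Tc :: "nat \<Rightarrow> (int \<Rightarrow> complex) \<Rightarrow> real \<Rightarrow> ereal" where
  "Tc N \<rho> p = 2 * ereal (real N) * lim (\<lambda>k. ereal (coh_form N \<rho> p (Suc k))) + ereal (real N)"

definition C_QPSK :: "real \<Rightarrow> real" where
  "C_QPSK snr = ln 4 - sqrt (2 / pi) *
     (\<integral>y. exp (- y\<^sup>2 / 2) * ln (1 + exp (- 2 * (snr + sqrt snr * y))) \<partial>lborel)"

text \<open>Evaluated in \<open>ereal\<close>: an infinite effective coherence time gives \<open>0\<close>, the limiting value.\<close>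

definition pred_err :: "nat \<Rightarrow> nat \<Rightarrow> (int \<Rightarrow> complex) \<Rightarrow> real \<Rightarrow> nat \<Rightarrow> real \<Rightarrow> real" where
  "pred_err N L \<rho> px r \<beta> = real_of_ereal
     (if r < N
      then 1 / (1 + ereal (\<beta> / real r * (px / 2)) * (Tc N \<rho> (\<beta> / real r * px) - ereal (real N)))
      else 1 / (1 + ereal (\<beta> / real L * (px / 2)) * (Tc N \<rho> (\<beta> * px) - ereal (real N))))"

definition LB_QPSK ::
  "'a measure \<Rightarrow> nat \<Rightarrow> nat \<Rightarrow> (int \<Rightarrow> complex) \<Rightarrow> (nat \<Rightarrow> 'a \<Rightarrow> nat \<Rightarrow> complex) \<Rightarrow> real \<Rightarrow> nat \<Rightarrow> real \<Rightarrow> real"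
where
  "LB_QPSK M N L \<rho> H px r \<beta> =
     (let e = pred_err N L \<rho> px r \<beta>;
          m = complex_of_real (sqrt (real N)) * mean M (\<lambda>\<omega>. freq_resp N (H 0 \<omega>) 0)
      in real r / (real N * \<beta>) *
         (\<integral>u. C_QPSK ((cmod (m + complex_of_real (sqrt (1 - e)) * u))\<^sup>2 /
                      (real r / real N * (1 / (\<beta> * px)) + e)) \<partial>std_CN))"

end

theory Submission
  imports Defs "HOL-Real_Asymp.Real_Asymp"
begin

text \<open>
  For an input law \<open>\<mu>\<close> and any positive \<open>\<phi>\<close> with \<open>\<integral> \<phi> x y d\<mu>(x) \<le> 1\<close>, Gibbs' inequality gives
  \<open>I(X; Y) \<ge> E[ln \<phi>(X, Y)]\<close>. The input consists of independent QPSK symbols on the first \<open>r\<close> carriers,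
  transmitted with probability \<open>1/\<beta>\<close>; otherwise the whole block is zero. For \<open>\<phi>\<close> take the product of the
  posterior-to-prior ratios of the symbols in a fictitious coherent channel, in which the gain at time
  \<open>k\<close> is an estimate computed from the past outputs and the past symbols: summing over the symbols from the
  last one backwards shows that \<open>\<phi>\<close> averages to \<open>1\<close>.

  The estimate is linear in the past, with coefficients solving the regularized Toeplitz system behind
  \<open>T\<^sub>c\<close>, and is dithered by an independent Gaussian variable \<open>\<theta>\<close> so that estimate and estimation error are
  independent with variances exactly \<open>1 - e\<^sub>k\<close> and \<open>e\<^sub>k\<close>; all past symbols having the same modulus, these do
  not depend on the data. Hence every symbol contributes exactly the QPSK information of a fading channel with
  known gain and error variance \<open>e\<^sub>k\<close>. Since \<open>e\<^sub>k\<close> decreases to \<open>e\<^bsub>r,\<beta>\<^esub>\<close>, the averages over \<open>k\<close> converge to the claimed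
  bound, and the limit defining the capacity exists because block information is superadditive.
\<close>

subsection \<open>Characteristic functions of complex random vectors\<close>

text \<open>For a past observed with noise variance 1 / s put q = D^H (s (Delta - D D^H) + I)^(-1)
  D. By Sherman-Morrison the least mean square error in predicting the present is 1 / (1 + s q);
  this is the shape of the prediction error in the bound. With r < N every carrier is predicted from
  its own past and s = N p. With r = N, interpolation through the L taps leaves noise of variance L
  / s, while the bound keeps the coefficients that are optimal for 1 / s. That estimator is
  mismatched: its variance may fall short of its covariance with the target. The dither fills
  exactly this gap and vanishes when the two noise levels agree. Independence of estimate and error
  is what makes the fictitious coherent channel the true one for a single symbol: error times symbol
  plus noise is then Gaussian and independent of the estimate. The dither is frozen when Gibbs'
  inequality is applied and averaged out afterwards. Finiteness is the other concern. All output
  laws are taken relative to white noise, and their densities lie between exponentials of minus and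
  plus energies, so that log-likelihoods are integrable as soon as the input has finite mean
  energy.\<close>

lemma char_distr:
  assumes "prob_space P" "X \<in> borel_measurable P"
  shows "char (distr P borel X) t = (\<integral>\<omega>. iexp (t * X \<omega>) \<partial>P)"
  unfolding char_def using assms by (subst integral_distr) auto

text \<open>Adding the constant 2 to a weight bounded by 1 makes it a density with values in [1, 3].
  Normalised, it yields tilted probability laws with equal characteristic functions, to which Levy's
  uniqueness theorem applies. Subtracting the case of the constant weight 2 recovers the signed
  weight.\<close>

lemma real_weighted_char_unique:
  fixes w :: "'a \<Rightarrow> real" and v :: "'b \<Rightarrow> real"
  assumes P: "prob_space P" and Q: "prob_space Q"
    and [measurable]: "X \<in> borel_measurable P" "Y \<in> borel_measurable Q"
      "w \<in> borel_measurable P" "v \<in> borel_measurable Q"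
    and w: "\<And>\<omega>. \<bar>w \<omega>\<bar> \<le> 1" and v: "\<And>\<omega>. \<bar>v \<omega>\<bar> \<le> 1"
    and base: "\<And>t. (\<integral>\<omega>. iexp (t * X \<omega>) \<partial>P) = (\<integral>\<omega>. iexp (t * Y \<omega>) \<partial>Q)"
    and wgt: "\<And>t. (\<integral>\<omega>. w \<omega> * iexp (t * X \<omega>) \<partial>P) = (\<integral>\<omega>. v \<omega> * iexp (t * Y \<omega>) \<partial>Q)"
    and [measurable]: "A \<in> sets borel"
  shows "(\<integral>\<omega>. w \<omega> * indicator A (X \<omega>) \<partial>P) = (\<integral>\<omega>. v \<omega> * indicator A (Y \<omega>) \<partial>Q)"
proof -
  interpret P: prob_space P by fact
  interpret Q: prob_space Q by fact
  have gen: "(\<integral>\<omega>. w \<omega> * indicator A (X \<omega>) \<partial>P) = (\<integral>\<omega>. v \<omega> * indicator A (Y \<omega>) \<partial>Q)"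
    if wm[measurable]: "w \<in> borel_measurable P" "v \<in> borel_measurable Q"
      and w: "\<And>\<omega>. 1 \<le> w \<omega>" "\<And>\<omega>. w \<omega> \<le> 3" and v: "\<And>\<omega>. 1 \<le> v \<omega>" "\<And>\<omega>. v \<omega> \<le> 3"
      and wgt: "\<And>t. (\<integral>\<omega>. w \<omega> * iexp (t * X \<omega>) \<partial>P) = (\<integral>\<omega>. v \<omega> * iexp (t * Y \<omega>) \<partial>Q)"
    for w :: "'a \<Rightarrow> real" and v :: "'b \<Rightarrow> real"
  proof -
    define Z where "Z = (\<integral>\<omega>. w \<omega> \<partial>P)"
    have "\<bar>w \<omega>\<bar> \<le> 3" for \<omega> using w[of \<omega>] by linarith
    then have wi: "integrable P w" by (intro P.integrable_const_bound[of _ 3]) auto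
    have "\<bar>v \<omega>\<bar> \<le> 3" for \<omega> using v[of \<omega>] by linarith
    then have vi: "integrable Q v" by (intro Q.integrable_const_bound[of _ 3]) auto
    \<comment> \<open>The weighted identity at t = 0 says that both tilts have the same normalising
      constant.\<close>
    have ZQ: "Z = (\<integral>\<omega>. v \<omega> \<partial>Q)"
    proof -
      have "complex_of_real Z = complex_of_real (\<integral>\<omega>. v \<omega> \<partial>Q)"
        using wgt[of 0] by (simp add: Z_def)
      then show ?thesis using of_real_eq_iff by blast
    qed
    have Z1: "1 \<le> Z"
    proof -
      have "(\<integral>\<omega>. 1 \<partial>P) \<le> Z" unfolding Z_def using w wi by (intro integral_mono) auto
      then show ?thesis by (simp add: P.prob_space)
    qed
    define P' where "P' = density P (\<lambda>\<omega>. ennreal (w \<omega> / Z))"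
    define Q' where "Q' = density Q (\<lambda>\<omega>. ennreal (v \<omega> / Z))"
    have w0: "0 \<le> w \<omega>" for \<omega> using w(1)[of \<omega>] by simp
    have v0: "0 \<le> v \<omega>" for \<omega> using v(1)[of \<omega>] by simp
    have P': "prob_space P'"
    proof
      have "emeasure P' (space P') = (\<integral>\<^sup>+\<omega>. ennreal (w \<omega> / Z) \<partial>P)"
        unfolding P'_def by (simp add: emeasure_density cong: nn_integral_cong)
      also have "\<dots> = ennreal (\<integral>\<omega>. w \<omega> / Z \<partial>P)"
        using wi w0 Z1 by (intro nn_integral_eq_integral) auto
      also have "(\<integral>\<omega>. w \<omega> / Z \<partial>P) = 1" using Z1 by (simp add: Z_def)
      finally show "emeasure P' (space P') = 1" by simp
    qed
    have Q': "prob_space Q'"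
    proof
      have "emeasure Q' (space Q') = (\<integral>\<^sup>+\<omega>. ennreal (v \<omega> / Z) \<partial>Q)"
        unfolding Q'_def by (simp add: emeasure_density cong: nn_integral_cong)
      also have "\<dots> = ennreal (\<integral>\<omega>. v \<omega> / Z \<partial>Q)"
        using vi v0 Z1 by (intro nn_integral_eq_integral) auto
      also have "(\<integral>\<omega>. v \<omega> / Z \<partial>Q) = 1" using Z1 by (simp add: ZQ)
      finally show "emeasure Q' (space Q') = 1" by simp
    qed
    interpret P': prob_space P' by fact
    interpret Q': prob_space Q' by fact
    have [measurable]: "X \<in> borel_measurable P'" "Y \<in> borel_measurable Q'"
      by (simp_all add: P'_def Q'_def)
    have IP: "(\<integral>\<omega>. h \<omega> \<partial>P') = (\<integral>\<omega>. (w \<omega> / Z) *\<^sub>R h \<omega> \<partial>P)"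
      if "h \<in> borel_measurable P" for h :: "'a \<Rightarrow> 'c::{banach, second_countable_topology}"
      unfolding P'_def using that w0 Z1 by (intro integral_density) auto
    have IQ: "(\<integral>\<omega>. h \<omega> \<partial>Q') = (\<integral>\<omega>. (v \<omega> / Z) *\<^sub>R h \<omega> \<partial>Q)"
      if "h \<in> borel_measurable Q" for h :: "'b \<Rightarrow> 'c::{banach, second_countable_topology}"
      unfolding Q'_def using that v0 Z1 by (intro integral_density) auto
    have "distr P' borel X = distr Q' borel Y"
    proof (rule Levy_uniqueness)
      show "real_distribution (distr P' borel X)" "real_distribution (distr Q' borel Y)" by auto
      show "char (distr P' borel X) = char (distr Q' borel Y)"
      proof
        fix t
        have "char (distr P' borel X) t = (\<integral>\<omega>. (1 / Z) *\<^sub>R (w \<omega> * iexp (t * X \<omega>)) \<partial>P)"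
          by (simp add: char_distr[OF P'] IP scaleR_conv_of_real)
        also have "\<dots> = (\<integral>\<omega>. (1 / Z) *\<^sub>R (v \<omega> * iexp (t * Y \<omega>)) \<partial>Q)"
          unfolding integral_scaleR_right wgt ..
        also have "\<dots> = char (distr Q' borel Y) t"
          by (simp add: char_distr[OF Q'] IQ scaleR_conv_of_real)
        finally show "char (distr P' borel X) t = char (distr Q' borel Y) t" .
      qed
    qed
    then have "(\<integral>x. indicator A x \<partial>distr P' borel X) = (\<integral>x. indicator A x \<partial>distr Q' borel Y :: real)" by simp
    then have "(\<integral>\<omega>. indicator A (X \<omega>) \<partial>P') = (\<integral>\<omega>. indicator A (Y \<omega>) \<partial>Q' :: real)"
      by (subst (asm) (1 2) integral_distr) auto
    then show ?thesis using Z1 by (simp add: IP IQ)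
  qed
  have ie: "integrable P (\<lambda>\<omega>. u \<omega> * iexp (t * X \<omega>))" if "u \<in> borel_measurable P" "\<And>\<omega>. \<bar>u \<omega>\<bar> \<le> 1" for u :: "'a \<Rightarrow> real" and t
    using that by (intro P.integrable_const_bound[of _ 1]) (auto intro!: AE_I2 simp: norm_mult)
  have ie': "integrable Q (\<lambda>\<omega>. u \<omega> * iexp (t * Y \<omega>))" if "u \<in> borel_measurable Q" "\<And>\<omega>. \<bar>u \<omega>\<bar> \<le> 1" for u :: "'b \<Rightarrow> real" and t
    using that by (intro Q.integrable_const_bound[of _ 1]) (auto intro!: AE_I2 simp: norm_mult)
  have i1: "integrable P (\<lambda>\<omega>. iexp (t * X \<omega>))" "integrable Q (\<lambda>\<omega>. iexp (t * Y \<omega>))" for t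
    by (auto intro!: P.integrable_const_bound[of _ 1] Q.integrable_const_bound[of _ 1])
  have b: "(\<integral>\<omega>. 2 * indicator A (X \<omega>) \<partial>P) = (\<integral>\<omega>. 2 * indicator A (Y \<omega>) \<partial>Q :: real)"
    using base by (intro gen) auto
  have c: "(\<integral>\<omega>. (2 + w \<omega>) * indicator A (X \<omega>) \<partial>P) = (\<integral>\<omega>. (2 + v \<omega>) * indicator A (Y \<omega>) \<partial>Q)"
  proof (rule gen)
    fix \<omega> show "1 \<le> 2 + w \<omega>" "2 + w \<omega> \<le> 3" using w[of \<omega>] by auto
  next
    fix \<omega> show "1 \<le> 2 + v \<omega>" "2 + v \<omega> \<le> 3" using v[of \<omega>] by auto
  next
    fix t
    show "(\<integral>\<omega>. complex_of_real (2 + w \<omega>) * iexp (t * X \<omega>) \<partial>P) = (\<integral>\<omega>. complex_of_real (2 + v \<omega>) * iexp (t * Y \<omega>) \<partial>Q)"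
      using i1 ie[of w, OF _ w] ie'[of v, OF _ v] by (simp add: ring_distribs wgt base del: of_real_mult)
  qed auto
  have k: "integrable P (\<lambda>\<omega>. u \<omega> * indicator A (X \<omega>))" if "u \<in> borel_measurable P" "\<And>\<omega>. \<bar>u \<omega>\<bar> \<le> 1" for u :: "'a \<Rightarrow> real"
    using that by (intro P.integrable_const_bound[of _ 1]) (auto intro!: AE_I2 simp: indicator_def)
  have k': "integrable Q (\<lambda>\<omega>. u \<omega> * indicator A (Y \<omega>))" if "u \<in> borel_measurable Q" "\<And>\<omega>. \<bar>u \<omega>\<bar> \<le> 1" for u :: "'b \<Rightarrow> real"
    using that by (intro Q.integrable_const_bound[of _ 1]) (auto intro!: AE_I2 simp: indicator_def)
  show ?thesis using b c k[OF _ w] k'[OF _ v] k[of "\<lambda>_. 1"] k'[of "\<lambda>_. 1"]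
    by (simp add: ring_distribs)
qed

text \<open>The real and imaginary parts of a weight are combinations of the weight and its
  conjugate; the identity for the conjugate weight at t is the conjugate of the given one at
  -t.\<close>

lemma complex_weighted_char_unique:
  fixes w :: "'a \<Rightarrow> complex" and v :: "'b \<Rightarrow> complex"
  assumes P: "prob_space P" and Q: "prob_space Q"
    and [measurable]: "X \<in> borel_measurable P" "Y \<in> borel_measurable Q"
      "w \<in> borel_measurable P" "v \<in> borel_measurable Q"
    and w: "\<And>\<omega>. cmod (w \<omega>) \<le> 1" and v: "\<And>\<omega>. cmod (v \<omega>) \<le> 1"
    and base: "\<And>t. (\<integral>\<omega>. iexp (t * X \<omega>) \<partial>P) = (\<integral>\<omega>. iexp (t * Y \<omega>) \<partial>Q)"
    and wgt: "\<And>t. (\<integral>\<omega>. w \<omega> * iexp (t * X \<omega>) \<partial>P) = (\<integral>\<omega>. v \<omega> * iexp (t * Y \<omega>) \<partial>Q)"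
    and [measurable]: "A \<in> sets borel"
  shows "(\<integral>\<omega>. w \<omega> * indicator A (X \<omega>) \<partial>P) = (\<integral>\<omega>. v \<omega> * indicator A (Y \<omega>) \<partial>Q)"
proof -
  interpret P: prob_space P by fact
  interpret Q: prob_space Q by fact
  have [measurable]: "(\<lambda>\<omega>. cnj (w \<omega>)) \<in> borel_measurable P" "(\<lambda>\<omega>. cnj (v \<omega>)) \<in> borel_measurable Q"
    by (auto intro!: borel_measurable_continuous_on[OF _ \<open>w \<in> _\<close>] borel_measurable_continuous_on[OF _ \<open>v \<in> _\<close>] continuous_intros)
  have i: "integrable P (\<lambda>\<omega>. w \<omega> * iexp (t * X \<omega>))" "integrable P (\<lambda>\<omega>. cnj (w \<omega>) * iexp (t * X \<omega>))" for t
    using w by (auto intro!: P.integrable_const_bound[of _ 1] simp: norm_mult)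
  have i': "integrable Q (\<lambda>\<omega>. v \<omega> * iexp (t * Y \<omega>))" "integrable Q (\<lambda>\<omega>. cnj (v \<omega>) * iexp (t * Y \<omega>))" for t
    using v by (auto intro!: Q.integrable_const_bound[of _ 1] simp: norm_mult)
  have cn: "(\<integral>\<omega>. cnj (w \<omega>) * iexp (t * X \<omega>) \<partial>P) = (\<integral>\<omega>. cnj (v \<omega>) * iexp (t * Y \<omega>) \<partial>Q)" for t
  proof -
    have "(\<integral>\<omega>. cnj (w \<omega>) * iexp (t * X \<omega>) \<partial>P) = (\<integral>\<omega>. cnj (w \<omega> * iexp ((- t) * X \<omega>)) \<partial>P)"
      by (simp add: exp_cnj)
    also have "\<dots> = (\<integral>\<omega>. cnj (v \<omega> * iexp ((- t) * Y \<omega>)) \<partial>Q)"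
      unfolding Bochner_Integration.integral_cnj wgt ..
    also have "\<dots> = (\<integral>\<omega>. cnj (v \<omega>) * iexp (t * Y \<omega>) \<partial>Q)" by (simp add: exp_cnj)
    finally show ?thesis .
  qed
  have re: "(\<integral>\<omega>. Re (w \<omega>) * indicator A (X \<omega>) \<partial>P) = (\<integral>\<omega>. Re (v \<omega>) * indicator A (Y \<omega>) \<partial>Q)"
  proof (rule real_weighted_char_unique[OF P Q])
    fix t
    have e: "complex_of_real (Re z) * u = (1/2) * (z * u + cnj z * u)" for z u
      using complex_add_cnj[of z] by (metis (no_types, opaque_lifting) distrib_right mult.assoc mult_1 nonzero_divide_eq_eq of_real_mult of_real_numeral times_divide_eq_left zero_neq_numeral mult.commute)
    show "(\<integral>\<omega>. complex_of_real (Re (w \<omega>)) * iexp (t * X \<omega>) \<partial>P) = (\<integral>\<omega>. complex_of_real (Re (v \<omega>)) * iexp (t * Y \<omega>) \<partial>Q)"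
      unfolding e integral_mult_right_zero using i i' by (simp add: wgt cn del: of_real_mult)
  qed (use w v base in \<open>auto intro: order_trans[OF abs_Re_le_cmod]\<close>)
  have im: "(\<integral>\<omega>. Im (w \<omega>) * indicator A (X \<omega>) \<partial>P) = (\<integral>\<omega>. Im (v \<omega>) * indicator A (Y \<omega>) \<partial>Q)"
  proof (rule real_weighted_char_unique[OF P Q])
    fix t
    have e: "complex_of_real (Im z) * u = (1/(2 * \<i>)) * (z * u - cnj z * u)" for z u
      proof -
      have "z * u - cnj z * u = 2 * \<i> * of_real (Im z) * u"
        by (simp add: left_diff_distrib[symmetric] complex_diff_cnj)
      then show ?thesis by simp
    qed
    show "(\<integral>\<omega>. complex_of_real (Im (w \<omega>)) * iexp (t * X \<omega>) \<partial>P) = (\<integral>\<omega>. complex_of_real (Im (v \<omega>)) * iexp (t * Y \<omega>) \<partial>Q)"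
      unfolding e integral_mult_right_zero using i i' by (simp add: wgt cn del: of_real_mult)
  qed (use w v base in \<open>auto intro: order_trans[OF abs_Im_le_cmod]\<close>)
  have j: "integrable P (\<lambda>\<omega>. w \<omega> * indicator A (X \<omega>))"
    using w by (auto intro!: P.integrable_const_bound[of _ 1] simp: norm_mult indicator_def)
  have j': "integrable Q (\<lambda>\<omega>. v \<omega> * indicator A (Y \<omega>))"
    using v by (auto intro!: Q.integrable_const_bound[of _ 1] simp: norm_mult indicator_def)
  have ri: "Re (z * indicator A x) = Re z * indicator A x" "Im (z * indicator A x) = Im z * indicator A x" for z x
    by (auto simp: indicator_def)
  show ?thesis
    by (intro complex_eqI)
       (simp_all only: integral_Re[OF j, symmetric] integral_Re[OF j', symmetric]
         integral_Im[OF j, symmetric] integral_Im[OF j', symmetric] ri re im)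
qed

text \<open>A Cramer-Wold argument by induction on the set \<open>K\<close> of coordinates already
  turned from exponentials into indicators. All other factors have modulus at most 1 and act as the
  complex weight while the next coordinate is converted; at \<open>K = J\<close> the integrals are
  probabilities of boxes.\<close>

lemma joint_char_unique:
  fixes X :: "'i \<Rightarrow> 'a \<Rightarrow> real" and Y :: "'i \<Rightarrow> 'b \<Rightarrow> real"
  assumes P: "prob_space P" and Q: "prob_space Q" and J: "finite J"
    and X: "\<And>j. j \<in> J \<Longrightarrow> X j \<in> borel_measurable P" and Y: "\<And>j. j \<in> J \<Longrightarrow> Y j \<in> borel_measurable Q"
    and eq: "\<And>t. (\<integral>\<omega>. iexp (\<Sum>j\<in>J. t j * X j \<omega>) \<partial>P) = (\<integral>\<omega>. iexp (\<Sum>j\<in>J. t j * Y j \<omega>) \<partial>Q)"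
  shows "distr P (\<Pi>\<^sub>M j\<in>J. borel) (\<lambda>\<omega>. \<lambda>j\<in>J. X j \<omega>) = distr Q (\<Pi>\<^sub>M j\<in>J. borel) (\<lambda>\<omega>. \<lambda>j\<in>J. Y j \<omega>)"
proof -
  interpret P: prob_space P by fact
  interpret Q: prob_space Q by fact
  have main: "(\<integral>\<omega>. (\<Prod>j\<in>K. indicator (A j) (X j \<omega>)) * iexp (\<Sum>j\<in>J - K. t j * X j \<omega>) \<partial>P) =
        (\<integral>\<omega>. (\<Prod>j\<in>K. indicator (A j) (Y j \<omega>)) * iexp (\<Sum>j\<in>J - K. t j * Y j \<omega>) \<partial>Q)"
    if "K \<subseteq> J" "\<And>j. j \<in> J \<Longrightarrow> A j \<in> sets borel" for K A t
  proof -
    have "finite K" using that J by (auto intro: finite_subset)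
    then show ?thesis using that(1)
    proof (induction K arbitrary: t rule: finite_induct)
      case empty then show ?case using eq by simp
    next
      case (insert k K)
      have k: "k \<in> J" and KJ: "K \<subseteq> J" using insert by auto
      have [measurable]: "X k \<in> borel_measurable P" "Y k \<in> borel_measurable Q" "A k \<in> sets borel"
        using X[OF k] Y[OF k] that(2)[OF k] by auto
      have J': "J - K = insert k (J - insert k K)" using k insert by auto
      have fin: "finite (J - insert k K)" using J by auto
      define w where "w \<omega> = (\<Prod>j\<in>K. indicator (A j) (X j \<omega>)) * iexp (\<Sum>j\<in>J - insert k K. t j * X j \<omega>)" for \<omega>
      define v where "v \<omega> = (\<Prod>j\<in>K. indicator (A j) (Y j \<omega>)) * iexp (\<Sum>j\<in>J - insert k K. t j * Y j \<omega>)" for \<omega>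
      have indm: "(\<lambda>\<omega>. indicator (A j) (X j \<omega>) :: complex) \<in> borel_measurable P"
         "(\<lambda>\<omega>. indicator (A j) (Y j \<omega>) :: complex) \<in> borel_measurable Q" if "j \<in> K" for j
      proof -
        have [measurable]: "X j \<in> borel_measurable P" "Y j \<in> borel_measurable Q" "A j \<in> sets borel"
          using that KJ X Y \<open>\<And>j. j \<in> J \<Longrightarrow> A j \<in> sets borel\<close> by auto
        show "(\<lambda>\<omega>. indicator (A j) (X j \<omega>) :: complex) \<in> borel_measurable P"
         "(\<lambda>\<omega>. indicator (A j) (Y j \<omega>) :: complex) \<in> borel_measurable Q" by measurable
      qed
      have wm: "w \<in> borel_measurable P" "v \<in> borel_measurable Q"
        unfolding w_def[abs_def] v_def[abs_def] using indm X Y by measurable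
      have pn: "cmod (\<Prod>j\<in>K. indicator (A j) (Z j)) \<le> 1" for Z :: "'i \<Rightarrow> real"
        unfolding prod_norm[symmetric] by (intro prod_le_1) (auto simp: indicator_def)
      have "(\<integral>\<omega>. w \<omega> * indicator (A k) (X k \<omega>) \<partial>P) = (\<integral>\<omega>. v \<omega> * indicator (A k) (Y k \<omega>) \<partial>Q)"
      proof (rule complex_weighted_char_unique[OF P Q])
        show "cmod (w \<omega>) \<le> 1" for \<omega> using pn by (simp add: w_def norm_mult)
        show "cmod (v \<omega>) \<le> 1" for \<omega> using pn by (simp add: v_def norm_mult)
      next
        fix s
        have "(\<Sum>j\<in>J. (if j = k then s else 0) * Z j) = s * Z k" for Z :: "'i \<Rightarrow> real"
          using k J by (simp add: if_distrib[of "\<lambda>x. x * _"] cong: if_cong)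
        then show "(\<integral>\<omega>. iexp (s * X k \<omega>) \<partial>P) = (\<integral>\<omega>. iexp (s * Y k \<omega>) \<partial>Q)"
          using eq[of "\<lambda>j. if j = k then s else 0"] by simp
      next
        fix s
        have sp: "(\<Sum>j\<in>J - K. (t(k := s)) j * Z j) = s * Z k + (\<Sum>j\<in>J - insert k K. t j * Z j)" for Z :: "'i \<Rightarrow> real"
          unfolding J' using fin by (subst sum.insert) (auto intro!: sum.cong)
        show "(\<integral>\<omega>. w \<omega> * iexp (s * X k \<omega>) \<partial>P) = (\<integral>\<omega>. v \<omega> * iexp (s * Y k \<omega>) \<partial>Q)"
          using insert.IH[OF KJ, of "t(k := s)"] unfolding sp w_def v_def
          by (simp add: exp_add ring_distribs mult_ac)
      qed (use wm in auto)
      then show ?case using insert(1,2) by (simp add: w_def v_def mult_ac)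
    qed
  qed
  have integral_indicator_complex: "(\<integral>x. indicator A x \<partial>M) = complex_of_real (measure M A)"
    if "prob_space M" "A \<in> sets M" for M :: "('i \<Rightarrow> real) measure" and A
  proof -
    have "(indicator A x :: complex) = complex_of_real (indicator A x)" for x by (simp add: indicator_def)
    then show ?thesis using that by (simp add: sets.sets_into_space Int_absorb1)
  qed
  let ?PM = "\<Pi>\<^sub>M j\<in>J. borel :: real measure"
  have Xm: "(\<lambda>\<omega>. \<lambda>j\<in>J. X j \<omega>) \<in> P \<rightarrow>\<^sub>M ?PM" using X by measurable
  have Ym: "(\<lambda>\<omega>. \<lambda>j\<in>J. Y j \<omega>) \<in> Q \<rightarrow>\<^sub>M ?PM" using Y by measurable
  interpret DP: prob_space "distr P ?PM (\<lambda>\<omega>. \<lambda>j\<in>J. X j \<omega>)" using Xm by (rule P.prob_space_distr)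
  interpret DQ: prob_space "distr Q ?PM (\<lambda>\<omega>. \<lambda>j\<in>J. Y j \<omega>)" using Ym by (rule Q.prob_space_distr)
  show ?thesis
  proof (rule measure_eqI_PiM_finite[OF J, of _ _ _ "\<lambda>_. space ?PM"])
    fix A :: "'i \<Rightarrow> real set" assume A: "\<And>j. j \<in> J \<Longrightarrow> A j \<in> sets borel"
    have pA: "Pi\<^sub>E J A \<in> sets ?PM" using A J by (intro sets_PiM_I_finite) auto
    have e: "(\<Prod>j\<in>J. indicator (A j) (Z j)) = (indicator (Pi\<^sub>E J A) (\<lambda>j\<in>J. Z j) :: complex)" for Z
      using J by (auto simp: indicator_def PiE_def Pi_def)
    have ei: "(\<integral>\<omega>. indicator (Pi\<^sub>E J A) (\<lambda>j\<in>J. X j \<omega>) \<partial>P) = (\<integral>\<omega>. indicator (Pi\<^sub>E J A) (\<lambda>j\<in>J. Y j \<omega>) \<partial>Q :: complex)"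
      using main[of J A "\<lambda>_. 0"] A by (simp add: e)
    have "complex_of_real (measure (distr P ?PM (\<lambda>\<omega>. \<lambda>j\<in>J. X j \<omega>)) (Pi\<^sub>E J A)) =
        (\<integral>x. indicator (Pi\<^sub>E J A) x \<partial>distr P ?PM (\<lambda>\<omega>. \<lambda>j\<in>J. X j \<omega>))"
      using pA by (simp add: integral_indicator_complex DP.prob_space_axioms DQ.prob_space_axioms)
    also have "\<dots> = (\<integral>\<omega>. indicator (Pi\<^sub>E J A) (\<lambda>j\<in>J. X j \<omega>) \<partial>P)"
      using pA Xm by (intro integral_distr) auto
    also have "\<dots> = (\<integral>x. indicator (Pi\<^sub>E J A) x \<partial>distr Q ?PM (\<lambda>\<omega>. \<lambda>j\<in>J. Y j \<omega>))"
      unfolding ei by (rule integral_distr[symmetric, OF Ym]) (use pA in auto)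
    also have "\<dots> = complex_of_real (measure (distr Q ?PM (\<lambda>\<omega>. \<lambda>j\<in>J. Y j \<omega>)) (Pi\<^sub>E J A))"
      using pA by (simp add: integral_indicator_complex DP.prob_space_axioms DQ.prob_space_axioms)
    finally show "emeasure (distr P ?PM (\<lambda>\<omega>. \<lambda>j\<in>J. X j \<omega>)) (Pi\<^sub>E J A) = emeasure (distr Q ?PM (\<lambda>\<omega>. \<lambda>j\<in>J. Y j \<omega>)) (Pi\<^sub>E J A)"
      by (simp add: DP.emeasure_eq_measure DQ.emeasure_eq_measure of_real_eq_iff)
  next
    show "range (\<lambda>_. space ?PM) \<subseteq> prod_algebra J (\<lambda>_. borel)"
      using prod_algebraI_finite[OF J, of "\<lambda>_. UNIV" "\<lambda>_. borel :: real measure"] by (auto simp: space_PiM)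
  qed (auto simp: DP.emeasure_eq_measure)
qed

text \<open>Real and imaginary parts become separate real coordinates, told apart by a Boolean
  index. A real functional with coefficients s and t is Re (c z) for c = s - i t, whence the minus
  sign in the coefficient.\<close>

lemma complex_joint_char_unique:
  fixes X :: "'i \<Rightarrow> 'a \<Rightarrow> complex" and Y :: "'i \<Rightarrow> 'b \<Rightarrow> complex"
  assumes P: "prob_space P" and Q: "prob_space Q" and J: "finite J"
    and X: "\<And>j. j \<in> J \<Longrightarrow> X j \<in> borel_measurable P" and Y: "\<And>j. j \<in> J \<Longrightarrow> Y j \<in> borel_measurable Q"
    and eq: "\<And>c. (\<integral>\<omega>. iexp (Re (\<Sum>j\<in>J. c j * X j \<omega>)) \<partial>P) = (\<integral>\<omega>. iexp (Re (\<Sum>j\<in>J. c j * Y j \<omega>)) \<partial>Q)"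
  shows "distr P (\<Pi>\<^sub>M j\<in>J. borel) (\<lambda>\<omega>. \<lambda>j\<in>J. X j \<omega>) = distr Q (\<Pi>\<^sub>M j\<in>J. borel) (\<lambda>\<omega>. \<lambda>j\<in>J. Y j \<omega>)"
proof -
  define r where "r = (\<lambda>(Z :: 'i \<Rightarrow> complex) (j, b). if b then Re (Z j) else Im (Z j))"
  define g where "g = (\<lambda>(z :: 'i \<times> bool \<Rightarrow> real). \<lambda>j\<in>J. Complex (z (j, True)) (z (j, False)))"
  let ?J = "J \<times> (UNIV :: bool set)"
  have Xr: "(\<lambda>\<omega>. r (\<lambda>i. X i \<omega>) j) \<in> borel_measurable P" if "j \<in> ?J" for j
    using that X by (cases j, cases "snd j") (auto simp: r_def)
  have Yr: "(\<lambda>\<omega>. r (\<lambda>i. Y i \<omega>) j) \<in> borel_measurable Q" if "j \<in> ?J" for j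
    using that Y by (cases j, cases "snd j") (auto simp: r_def)
  have "distr P (\<Pi>\<^sub>M j\<in>?J. borel) (\<lambda>\<omega>. \<lambda>j\<in>?J. r (\<lambda>i. X i \<omega>) j) = distr Q (\<Pi>\<^sub>M j\<in>?J. borel) (\<lambda>\<omega>. \<lambda>j\<in>?J. r (\<lambda>i. Y i \<omega>) j)"
  proof (rule joint_char_unique[OF P Q])
    fix t :: "'i \<times> bool \<Rightarrow> real"
    have s: "(\<Sum>j\<in>?J. t j * r Z j) = Re (\<Sum>j\<in>J. Complex (t (j, True)) (- t (j, False)) * Z j)" for Z
    proof -
      have "(\<Sum>j\<in>?J. t j * r Z j) = (\<Sum>i\<in>J. \<Sum>b\<in>UNIV. t (i, b) * r Z (i, b))"
        by (simp add: sum.cartesian_product case_prod_unfold)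
      then show ?thesis by (simp add: r_def UNIV_bool add.commute)
    qed
    show "(\<integral>\<omega>. iexp (\<Sum>j\<in>?J. t j * r (\<lambda>i. X i \<omega>) j) \<partial>P) = (\<integral>\<omega>. iexp (\<Sum>j\<in>?J. t j * r (\<lambda>i. Y i \<omega>) j) \<partial>Q)"
      unfolding s by (rule eq)
  qed (use J Xr Yr in auto)
  then have "distr (distr P (\<Pi>\<^sub>M j\<in>?J. borel) (\<lambda>\<omega>. \<lambda>j\<in>?J. r (\<lambda>i. X i \<omega>) j)) (\<Pi>\<^sub>M j\<in>J. borel) g =
     distr (distr Q (\<Pi>\<^sub>M j\<in>?J. borel) (\<lambda>\<omega>. \<lambda>j\<in>?J. r (\<lambda>i. Y i \<omega>) j)) (\<Pi>\<^sub>M j\<in>J. borel) g" by simp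
  moreover have gm: "g \<in> (\<Pi>\<^sub>M j\<in>?J. borel) \<rightarrow>\<^sub>M (\<Pi>\<^sub>M j\<in>J. borel)"
    unfolding g_def Complex_eq by measurable
  moreover have "(\<lambda>\<omega>. \<lambda>j\<in>?J. r (\<lambda>i. X i \<omega>) j) \<in> P \<rightarrow>\<^sub>M (\<Pi>\<^sub>M j\<in>?J. borel)" using Xr by (intro measurable_restrict)
  moreover have "(\<lambda>\<omega>. \<lambda>j\<in>?J. r (\<lambda>i. Y i \<omega>) j) \<in> Q \<rightarrow>\<^sub>M (\<Pi>\<^sub>M j\<in>?J. borel)" using Yr by (intro measurable_restrict)
  moreover have "g (\<lambda>j\<in>?J. r Z j) = (\<lambda>j\<in>J. Z j)" for Z
    by (auto simp: g_def r_def fun_eq_iff restrict_def)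
  ultimately show ?thesis by (simp add: distr_distr comp_def)
qed

subsection \<open>The real normal law\<close>

text \<open>One representation for all \<open>s\<close>, including the point mass at
  \<open>s = 0\<close>: moments and characteristic function then reduce to the standard normal law
  without a case distinction.\<close>

lemma normal_law_affine:
  assumes "0 \<le> s"
  shows "normal_law m s = distr std_normal_distribution borel (\<lambda>x. m + s * x)"
proof -
  interpret std: prob_space std_normal_distribution
    by (rule prob_space_normal_density) simp
  show ?thesis
  proof (cases "s = 0")
    case True
    have "distr std_normal_distribution borel (\<lambda>x. m) = return borel m"
      by (rule std.distr_const) simp
    then show ?thesis using True by (simp add: normal_law_def)
  next
    case False
    have "distributed std_normal_distribution lborel (\<lambda>x. x) (normal_density 0 1)"
      by (auto simp: distributed_def distr_id2 intro!: measure_eqI)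
    from std.normal_density_affine[OF this _ False, of m]
    have "distributed std_normal_distribution lborel (\<lambda>x. m + s * x) (normal_density m s)"
      using assms by (simp add: abs_of_nonneg)
    then have "distr std_normal_distribution lborel (\<lambda>x. m + s * x) = density lborel (normal_density m s)"
      by (rule distributed_distr_eq_density)
    then show ?thesis using False by (auto simp: normal_law_def cong: distr_cong)
  qed
qed

lemma normal_law_prob_space: "0 \<le> s \<Longrightarrow> prob_space (normal_law m s)"
  by (simp add: normal_law_affine prob_space.prob_space_distr[OF prob_space_normal_density])

lemma normal_law_moments:
  assumes "0 \<le> s"
  shows "integrable (normal_law m s) (\<lambda>x. x)" "(\<integral>x. x \<partial>normal_law m s) = m"
    "integrable (normal_law m s) (\<lambda>x. x\<^sup>2)" "(\<integral>x. x\<^sup>2 \<partial>normal_law m s) = m\<^sup>2 + s\<^sup>2"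
proof -
  interpret std: prob_space std_normal_distribution
    by (rule prob_space_normal_density) simp
  have i1: "integrable std_normal_distribution (\<lambda>x. x)"
    using integrable_std_normal_distribution_moment[of 1] by simp
  have i2: "integrable std_normal_distribution (\<lambda>x. x\<^sup>2)"
    using integrable_std_normal_distribution_moment[of 2] by simp
  have e1: "(\<integral>x. x \<partial>std_normal_distribution) = 0"
    using integral_std_normal_distribution_moment_odd[of 1] by simp
  have e2: "(\<integral>x. x\<^sup>2 \<partial>std_normal_distribution) = 1"
      proof -
    have "fact 2 = (2 :: real)" by (simp add: eval_nat_numeral)
    then show ?thesis using std_normal_distribution_even_moments(1)[of 1] by simp
  qed
  have I: "integrable (normal_law m s) g = integrable std_normal_distribution (\<lambda>x. g (m + s * x))"
    "(\<integral>x. g x \<partial>normal_law m s) = (\<integral>x. g (m + s * x) \<partial>std_normal_distribution)"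
    if "g \<in> borel_measurable borel" for g :: "real \<Rightarrow> real"
    unfolding normal_law_affine[OF assms] using that
    by (subst integrable_distr_eq, auto) (subst integral_distr, auto)
  have idm: "(\<lambda>x. x) \<in> borel_measurable (borel :: real measure)"
    and sqm: "(\<lambda>x. x\<^sup>2) \<in> borel_measurable (borel :: real measure)" by simp_all
  have p: "measure std_normal_distribution (space std_normal_distribution) = 1"
    by (rule std.prob_space)
  have i': "integrable std_normal_distribution (\<lambda>x. k + l * x)"
    "(\<integral>x. k + l * x \<partial>std_normal_distribution) = k" for k l
  proof -
    show "integrable std_normal_distribution (\<lambda>x. k + l * x)"
      using i1 by (intro Bochner_Integration.integrable_add integrable_mult_right std.integrable_const)
    have "(\<integral>x. k + l * x \<partial>std_normal_distribution) =
      (\<integral>x. k \<partial>std_normal_distribution) + (\<integral>x. l * x \<partial>std_normal_distribution)"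
      using i1 by (intro Bochner_Integration.integral_add integrable_mult_right std.integrable_const)
    also have "\<dots> = k" unfolding integral_mult_right_zero e1 lebesgue_integral_const p by simp
    finally show "(\<integral>x. k + l * x \<partial>std_normal_distribution) = k" .
  qed
  show "integrable (normal_law m s) (\<lambda>x. x)" "(\<integral>x. x \<partial>normal_law m s) = m"
    by (simp_all only: I[OF idm] i')
  have sq: "(m + s * x)\<^sup>2 = m\<^sup>2 + (2 * m * s) * x + s\<^sup>2 * x\<^sup>2" for x
    by (simp add: power2_eq_square algebra_simps)
  have i'': "integrable std_normal_distribution (\<lambda>x. s\<^sup>2 * x\<^sup>2)"
    using i2 by (rule integrable_mult_right)
  have "integrable std_normal_distribution (\<lambda>x. (m + s * x)\<^sup>2)"
    unfolding sq by (rule Bochner_Integration.integrable_add[OF i'(1) i''])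
  then show "integrable (normal_law m s) (\<lambda>x. x\<^sup>2)" by (simp only: I[OF sqm])
  have "(\<integral>x. (m + s * x)\<^sup>2 \<partial>std_normal_distribution) = m\<^sup>2 + s\<^sup>2"
    unfolding sq Bochner_Integration.integral_add[OF i'(1) i''] i'(2) integral_mult_right_zero e2 by simp
  then show "(\<integral>x. x\<^sup>2 \<partial>normal_law m s) = m\<^sup>2 + s\<^sup>2" by (simp only: I[OF sqm])
qed

lemma char_normal_law:
  assumes "0 \<le> s"
  shows "(\<integral>x. iexp (t * x) \<partial>normal_law m s) = iexp (t * m) * exp (- (s * t)\<^sup>2 / 2)"
proof -
  have "(\<integral>x. iexp (t * x) \<partial>normal_law m s) = (\<integral>x. iexp (t * m) * iexp ((t * s) * x) \<partial>std_normal_distribution)"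
  proof -
    have "iexp (t * (m + s * x)) = iexp (t * m) * iexp ((t * s) * x)" for x
      by (simp add: exp_add[symmetric] ring_distribs mult.assoc)
    then show ?thesis
      unfolding normal_law_affine[OF assms] by (subst integral_distr) simp_all
  qed
  also have "\<dots> = iexp (t * m) * char std_normal_distribution (t * s)"
    by (simp add: char_def)
  also have "\<dots> = iexp (t * m) * exp (- (s * t)\<^sup>2 / 2)"
    by (simp only: char_std_normal_distribution mult.commute)
  finally show ?thesis .
qed

subsection \<open>The standard proper complex normal law\<close>

text \<open>Lebesgue measure is determined by its values on open boxes, which are rectangles in the
  plane. This is what allows a density on the complex numbers to be split into real and imaginary
  parts.\<close>

lemma lborel_complex: "lborel = distr (lborel \<Otimes>\<^sub>M lborel) borel (\<lambda>p. Complex (fst p) (snd p))"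
proof (rule lborel_eqI)
  have cm: "(\<lambda>p. Complex (fst p) (snd p)) \<in> borel_measurable (lborel \<Otimes>\<^sub>M lborel)"
    unfolding Complex_eq by measurable
  fix l u :: complex assume lu: "\<And>b. b \<in> Basis \<Longrightarrow> l \<bullet> b \<le> u \<bullet> b"
  have "Re l \<le> Re u" "Im l \<le> Im u" using lu[of 1] lu[of \<i>] by (auto simp: Basis_complex_def)
  have v: "(\<lambda>p. Complex (fst p) (snd p)) -` box l u \<inter> space (lborel \<Otimes>\<^sub>M lborel) = {Re l<..<Re u} \<times> {Im l<..<Im u}"
    by (auto simp: box_def Basis_complex_def space_pair_measure)
  have "emeasure (distr (lborel \<Otimes>\<^sub>M lborel) borel (\<lambda>p. Complex (fst p) (snd p))) (box l u) =
     emeasure (lborel \<Otimes>\<^sub>M lborel) ({Re l<..<Re u} \<times> {Im l<..<Im u})"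
    using cm by (subst emeasure_distr) (auto simp: v)
  also have "\<dots> = ennreal (Re u - Re l) * ennreal (Im u - Im l)"
    using \<open>Re l \<le> Re u\<close> \<open>Im l \<le> Im u\<close> by (subst lborel.emeasure_pair_measure_Times) auto
  also have "\<dots> = ennreal (prod ((\<bullet>) (u - l)) Basis)"
    using \<open>Re l \<le> Re u\<close> \<open>Im l \<le> Im u\<close> by (simp add: Basis_complex_def ennreal_mult)
  finally show "emeasure (distr (lborel \<Otimes>\<^sub>M lborel) borel (\<lambda>p. Complex (fst p) (snd p))) (box l u)
     = ennreal (prod ((\<bullet>) (u - l)) Basis)" .
qed simp

lemma sets_std_CN[simp, measurable_cong]: "sets std_CN = sets borel"
  and space_std_CN[simp]: "space std_CN = UNIV"
  by (simp_all add: std_CN_def)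

text \<open>The standard deviation 1 / sqrt 2 of each part makes the product of the two densities
  equal to exp (- |z|^2) / pi.\<close>

lemma std_CN_pair:
  "std_CN = distr (normal_law 0 (1 / sqrt 2) \<Otimes>\<^sub>M normal_law 0 (1 / sqrt 2)) borel (\<lambda>p. Complex (fst p) (snd p))"
proof -
  let ?n = "\<lambda>x. ennreal (normal_density 0 (1 / sqrt 2) x)"
  have cm: "(\<lambda>p. Complex (fst p) (snd p)) \<in> lborel \<Otimes>\<^sub>M lborel \<rightarrow>\<^sub>M borel"
    unfolding Complex_eq by measurable
  have nl: "normal_law 0 (1 / sqrt 2) = density lborel ?n" by (simp add: normal_law_def)
  have "std_CN = density (distr (lborel \<Otimes>\<^sub>M lborel) borel (\<lambda>p. Complex (fst p) (snd p))) (\<lambda>z. ennreal (exp (- (cmod z)\<^sup>2) / pi))"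
    unfolding std_CN_def lborel_complex[symmetric] ..
  also have "\<dots> = distr (density (lborel \<Otimes>\<^sub>M lborel) (\<lambda>p. ennreal (exp (- (cmod (Complex (fst p) (snd p)))\<^sup>2) / pi))) borel (\<lambda>p. Complex (fst p) (snd p))"
    using cm by (subst density_distr) auto
  also have "density (lborel \<Otimes>\<^sub>M lborel) (\<lambda>p. ennreal (exp (- (cmod (Complex (fst p) (snd p)))\<^sup>2) / pi)) =
     density lborel ?n \<Otimes>\<^sub>M density lborel ?n"
  proof -
    have sf: "sigma_finite_measure (density lborel ?n)"
      using normal_law_prob_space[of "1 / sqrt 2" 0] unfolding nl
      by (simp add: prob_space_imp_sigma_finite)
    have n: "normal_density 0 (1 / sqrt 2) x = exp (- x\<^sup>2) / sqrt pi" for x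
      by (simp add: normal_density_def power_divide)
    have "density lborel ?n \<Otimes>\<^sub>M density lborel ?n = density (lborel \<Otimes>\<^sub>M lborel) (\<lambda>(x, y). ?n x * ?n y)"
      by (rule pair_measure_density[OF _ _ lborel.sigma_finite_measure_axioms sf]) auto
    also have "(\<lambda>(x, y). ?n x * ?n y) = (\<lambda>p. ennreal (exp (- (cmod (Complex (fst p) (snd p)))\<^sup>2) / pi))"
    proof
      fix p :: "real \<times> real"
      have "exp (- (cmod (Complex (fst p) (snd p)))\<^sup>2) / pi = normal_density 0 (1 / sqrt 2) (fst p) * normal_density 0 (1 / sqrt 2) (snd p)"
      proof -
        have "exp (- (a\<^sup>2 + b\<^sup>2)) / pi = exp (- a\<^sup>2) / sqrt pi * (exp (- b\<^sup>2) / sqrt pi)" for a b :: real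
          unfolding minus_add_distrib exp_add by simp
        then show ?thesis by (simp only: n cmod_power2 complex.sel)
      qed
      then show "(case p of (x, y) \<Rightarrow> ?n x * ?n y) = ennreal (exp (- (cmod (Complex (fst p) (snd p)))\<^sup>2) / pi)"
        by (simp add: ennreal_mult case_prod_unfold)
    qed
    finally show ?thesis by simp
  qed
  finally show ?thesis by (simp add: nl)
qed

lemma prob_space_std_CN: "prob_space std_CN"
proof -
  interpret n: prob_space "normal_law 0 (1 / sqrt 2)" by (rule normal_law_prob_space) simp
  interpret pair_prob_space "normal_law 0 (1 / sqrt 2)" "normal_law 0 (1 / sqrt 2)" ..
  have "(\<lambda>p. Complex (fst p) (snd p)) \<in> borel_measurable (normal_law 0 (1 / sqrt 2) \<Otimes>\<^sub>M normal_law 0 (1 / sqrt 2))"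
    unfolding Complex_eq normal_law_def by simp
  then show ?thesis unfolding std_CN_pair by (rule prob_space_distr)
qed

interpretation std_CN: prob_space std_CN by (rule prob_space_std_CN)

lemma char_std_CN: "(\<integral>z. iexp (Re (c * z)) \<partial>std_CN) = exp (- (cmod c)\<^sup>2 / 4)"
proof -
  let ?N = "normal_law 0 (1 / sqrt 2)"
  interpret n: prob_space ?N by (rule normal_law_prob_space) simp
  interpret nn: pair_prob_space ?N ?N ..
  have cm: "(\<lambda>p. Complex (fst p) (snd p)) \<in> borel_measurable (?N \<Otimes>\<^sub>M ?N)"
    unfolding Complex_eq normal_law_def by simp
  have [measurable_cong]: "sets ?N = sets borel" by (simp add: normal_law_def)
  have "(\<integral>z. iexp (Re (c * z)) \<partial>std_CN) = (\<integral>p. iexp (Re (c * Complex (fst p) (snd p))) \<partial>(?N \<Otimes>\<^sub>M ?N))"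
    unfolding std_CN_pair using cm by (subst integral_distr) auto
  also have "\<dots> = (\<integral>p. iexp (Re c * fst p) * iexp (- Im c * snd p) \<partial>(?N \<Otimes>\<^sub>M ?N))"
    by (simp add: right_diff_distrib exp_diff exp_minus field_simps)
  also have "\<dots> = (\<integral>y. \<integral>x. iexp (Re c * x) * iexp (- Im c * y) \<partial>?N \<partial>?N)"
    by (subst nn.integral_snd[of "\<lambda>x y. iexp (Re c * x) * iexp (- Im c * y)"])
       (auto simp: case_prod_unfold norm_mult intro!: nn.integrable_const_bound[of _ 1])
  also have "\<dots> = (\<integral>x. iexp (Re c * x) \<partial>?N) * (\<integral>y. iexp (- Im c * y) \<partial>?N)"
    by (simp only: integral_mult_left_zero integral_mult_right_zero)
  also have "\<dots> = exp (- (cmod c)\<^sup>2 / 4)"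
  proof -
    have "(\<integral>x. iexp (t * x) \<partial>?N) = complex_of_real (exp (- t\<^sup>2 / 4))" for t
      using char_normal_law[of "1 / sqrt 2" 0 t] by (simp add: power_divide)
    moreover have "exp (- (Re c)\<^sup>2 / 4) * exp (- (- Im c)\<^sup>2 / 4) = exp (- (cmod c)\<^sup>2 / 4)"
      unfolding exp_add[symmetric] cmod_power2 by (simp add: add_divide_distrib)
    ultimately show ?thesis by (simp only: of_real_mult[symmetric])
  qed
  finally show ?thesis .
qed

text \<open>Rotation invariance: the characteristic function depends on the modulus of the
  coefficient only. The factor sqrt 2 undoes the variance 1/2 of a real component.\<close>

lemma distr_Re_std_CN:
  assumes "cmod c = 1"
  shows "distr std_CN borel (\<lambda>z. sqrt 2 * Re (c * z)) = std_normal_distribution"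
proof (rule Levy_uniqueness)
  show "real_distribution (distr std_CN borel (\<lambda>z. sqrt 2 * Re (c * z)))" by simp
  show "char (distr std_CN borel (\<lambda>z. sqrt 2 * Re (c * z))) = char std_normal_distribution"
  proof
    fix t
    have "char (distr std_CN borel (\<lambda>z. sqrt 2 * Re (c * z))) t = (\<integral>z. iexp (Re ((t * sqrt 2 * c) * z)) \<partial>std_CN)"
      by (subst char_distr[OF prob_space_std_CN]) (auto simp: mult.assoc)
    also have "\<dots> = exp (- (t\<^sup>2) / 2)"
      unfolding char_std_CN using assms by (simp add: norm_mult power_mult_distrib)
    finally show "char (distr std_CN borel (\<lambda>z. sqrt 2 * Re (c * z))) t = char std_normal_distribution t"
      by (simp add: char_std_normal_distribution)
  qed
qed (rule real_dist_normal_dist)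

lemma integrable_std_CN_cmod2: "integrable std_CN (\<lambda>z. (cmod z)\<^sup>2)"
proof -
  have i2: "integrable std_normal_distribution (\<lambda>x. x\<^sup>2)"
    using integrable_std_normal_distribution_moment[of 2] by simp
  have "integrable std_CN (\<lambda>z. (sqrt 2 * Re (c * z))\<^sup>2)" if "cmod c = 1" for c
    using i2 unfolding distr_Re_std_CN[OF that, symmetric]
    by (subst (asm) integrable_distr_eq) auto
  from Bochner_Integration.integrable_add[OF this[of 1] this[of "- \<i>"]]
  have "integrable std_CN (\<lambda>z. 2 * (cmod z)\<^sup>2)"
    by (simp add: power_mult_distrib cmod_power2)
  then show ?thesis by simp
qed

text \<open>Cameron-Martin formula in the plane, from |z - a|^2 = |z|^2 - (2 Re (z cnj a) - |a|^2).
  Every likelihood below is built from this density.\<close>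

lemma std_CN_translate:
  "distr std_CN borel (\<lambda>z. z + a) = density std_CN (\<lambda>z. ennreal (exp (2 * Re (z * cnj a) - (cmod a)\<^sup>2)))"
proof -
  let ?g = "\<lambda>z. ennreal (exp (- (cmod z)\<^sup>2) / pi)"
  have "(\<lambda>z. z + a) = (+) a" by (auto simp: add.commute)
  then have l: "distr lborel borel (\<lambda>z. z + a) = lborel"
    using lborel_distr_plus[of a] by metis
  have "density std_CN (\<lambda>z. ennreal (exp (2 * Re (z * cnj a) - (cmod a)\<^sup>2))) =
      density lborel (\<lambda>z. ?g z * ennreal (exp (2 * Re (z * cnj a) - (cmod a)\<^sup>2)))"
    unfolding std_CN_def by (subst density_density_eq) auto
  also have "\<dots> = density lborel (\<lambda>z. ?g (z - a))"
  proof (intro arg_cong[where f = "density _"] ext)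
    fix z
    have c: "(cmod (z - a))\<^sup>2 = (cmod z)\<^sup>2 - (2 * Re (z * cnj a) - (cmod a)\<^sup>2)"
      unfolding cmod_power2 by (simp add: power2_eq_square algebra_simps)
    have "exp (- (cmod z)\<^sup>2) / pi * exp (2 * Re (z * cnj a) - (cmod a)\<^sup>2) = exp (- (cmod (z - a))\<^sup>2) / pi"
      unfolding c minus_diff_eq times_divide_eq_left exp_add[symmetric] by (simp add: algebra_simps)
    then show "?g z * ennreal (exp (2 * Re (z * cnj a) - (cmod a)\<^sup>2)) = ?g (z - a)"
      by (simp only: ennreal_mult[symmetric] divide_nonneg_pos exp_ge_zero pi_gt_zero)
  qed
  also have "\<dots> = density (distr lborel borel (\<lambda>z. z + a)) (\<lambda>z. ?g (z - a))"
    unfolding l ..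
  also have "\<dots> = distr (density lborel (\<lambda>z. ?g z)) borel (\<lambda>z. z + a)"
    by (subst density_distr) auto
  finally show ?thesis unfolding std_CN_def by (rule sym)
qed

subsection \<open>A variational lower bound on mutual information\<close>

text \<open>Abstract form of the channel: for every input the output law has a positive density
  \<open>f\<close> relative to one fixed probability law \<open>G\<close>, and \<open>fbar\<close>
  is the output density for a random input. \<open>S\<close> and \<open>T\<close> carry only the
  measurable structures to which mutual information refers.\<close>

locale dominated_channel = noise: prob_space P + reference: prob_space G + input: prob_space \<mu>
  for P :: "'w measure" and G :: "'y measure" and \<mu> :: "'x measure" +
  fixes S :: "'x measure" and T :: "'y measure"
    and out :: "'x \<Rightarrow> 'w \<Rightarrow> 'y" and f :: "'x \<Rightarrow> 'y \<Rightarrow> real" and fbar :: "'y \<Rightarrow> real"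
  assumes sets_input: "sets \<mu> = sets S" and sets_reference: "sets G = sets T"
    and out_measurable: "(\<lambda>(x, \<omega>). out x \<omega>) \<in> S \<Otimes>\<^sub>M P \<rightarrow>\<^sub>M T"
    and f_measurable: "(\<lambda>(x, y). f x y) \<in> borel_measurable (S \<Otimes>\<^sub>M T)"
    and f_pos: "\<And>x y. x \<in> space S \<Longrightarrow> y \<in> space T \<Longrightarrow> 0 < f x y"
    and out_law: "\<And>x. x \<in> space S \<Longrightarrow> distr P T (out x) = density G (\<lambda>y. ennreal (f x y))"
    and fbar_measurable: "fbar \<in> borel_measurable T"
    and fbar_pos: "\<And>y. y \<in> space T \<Longrightarrow> 0 < fbar y"
    and fbar_eq: "\<And>y. y \<in> space T \<Longrightarrow> (\<integral>\<^sup>+x. ennreal (f x y) \<partial>\<mu>) = ennreal (fbar y)"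
begin

sublocale joint: pair_prob_space \<mu> P ..
sublocale refpair: pair_prob_space \<mu> G ..

lemma space_input: "space \<mu> = space S" and space_reference: "space G = space T"
  using sets_eq_imp_space_eq[OF sets_input] sets_eq_imp_space_eq[OF sets_reference] by auto

lemma meas_eqs:
  "sets (\<mu> \<Otimes>\<^sub>M P) = sets (S \<Otimes>\<^sub>M P)" "sets (\<mu> \<Otimes>\<^sub>M G) = sets (S \<Otimes>\<^sub>M T)"
  using sets_input sets_reference by (auto intro!: sets_pair_measure_cong)

lemma out_meas[measurable]: "(\<lambda>p. out (fst p) (snd p)) \<in> \<mu> \<Otimes>\<^sub>M P \<rightarrow>\<^sub>M T"
  using out_measurable by (simp add: case_prod_unfold measurable_cong_sets[OF meas_eqs(1) refl])

lemma f_meas[measurable]: "(\<lambda>p. f (fst p) (snd p)) \<in> borel_measurable (\<mu> \<Otimes>\<^sub>M G)"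
  using f_measurable by (simp add: case_prod_unfold measurable_cong_sets[OF meas_eqs(2) refl])

lemma fbar_meas[measurable]: "fbar \<in> borel_measurable G"
  using fbar_measurable by (simp add: measurable_cong_sets[OF sets_reference refl])

lemma pair_meas: "(\<lambda>p. (fst p, out (fst p) (snd p))) \<in> \<mu> \<Otimes>\<^sub>M P \<rightarrow>\<^sub>M S \<Otimes>\<^sub>M T"
proof -
  have "fst \<in> \<mu> \<Otimes>\<^sub>M P \<rightarrow>\<^sub>M S" using measurable_fst[of \<mu> P] by (simp add: measurable_cong_sets[OF refl sets_input])
  then show ?thesis by measurable
qed

text \<open>Change of measure: expectations under the joint law become expectations under
  independent input and output, at the price of the factor \<open>f\<close>. The joint law, the
  output law and the normalisation in Gibbs' inequality are all read off from it.\<close>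

lemma nn_integral_joint:
  assumes [measurable]: "h \<in> borel_measurable (S \<Otimes>\<^sub>M T)"
  shows "(\<integral>\<^sup>+p. h (fst p, out (fst p) (snd p)) \<partial>(\<mu> \<Otimes>\<^sub>M P)) =
         (\<integral>\<^sup>+p. ennreal (f (fst p) (snd p)) * h p \<partial>(\<mu> \<Otimes>\<^sub>M G))"
proof -
  have hm[measurable]: "h \<in> borel_measurable (\<mu> \<Otimes>\<^sub>M G)"
    using assms by (simp add: measurable_cong_sets[OF meas_eqs(2) refl])
  have hc: "(\<lambda>p. h (fst p, out (fst p) (snd p))) \<in> borel_measurable (\<mu> \<Otimes>\<^sub>M P)"
    using measurable_compose[OF pair_meas assms] .
  have "(\<integral>\<^sup>+p. h (fst p, out (fst p) (snd p)) \<partial>(\<mu> \<Otimes>\<^sub>M P)) = (\<integral>\<^sup>+x. \<integral>\<^sup>+\<omega>. h (x, out x \<omega>) \<partial>P \<partial>\<mu>)"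
    using noise.nn_integral_fst[OF hc] by simp
  also have "\<dots> = (\<integral>\<^sup>+x. \<integral>\<^sup>+y. ennreal (f x y) * h (x, y) \<partial>G \<partial>\<mu>)"
  proof (rule nn_integral_cong)
    fix x assume x: "x \<in> space \<mu>"
    then have xS: "x \<in> space S" by (simp add: space_input)
    have o: "out x \<in> P \<rightarrow>\<^sub>M T"
      using measurable_compose[OF measurable_Pair1'[OF x] out_meas] by simp
    have hx: "(\<lambda>y. h (x, y)) \<in> borel_measurable T"
      using measurable_compose[OF measurable_Pair1'[OF xS] assms] by simp
    have fx: "f x \<in> borel_measurable G"
      using measurable_compose[OF measurable_Pair1'[OF x] f_meas] by simp
    have hx': "(\<lambda>y. h (x, y)) \<in> borel_measurable G"
      using hx by (simp add: measurable_cong_sets[OF sets_reference refl])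
    have "(\<integral>\<^sup>+\<omega>. h (x, out x \<omega>) \<partial>P) = (\<integral>\<^sup>+y. h (x, y) \<partial>distr P T (out x))"
      using o hx by (simp add: nn_integral_distr)
    also have "\<dots> = (\<integral>\<^sup>+y. ennreal (f x y) * h (x, y) \<partial>G)"
      unfolding out_law[OF xS] using fx hx' by (subst nn_integral_density) auto
    finally show "(\<integral>\<^sup>+\<omega>. h (x, out x \<omega>) \<partial>P) = (\<integral>\<^sup>+y. ennreal (f x y) * h (x, y) \<partial>G)" .
  qed
  also have "\<dots> = (\<integral>\<^sup>+p. ennreal (f (fst p) (snd p)) * h p \<partial>(\<mu> \<Otimes>\<^sub>M G))"
    by (subst reference.nn_integral_fst[symmetric]) auto
  finally show ?thesis .
qed

lemma distr_joint:
  "distr (\<mu> \<Otimes>\<^sub>M P) (S \<Otimes>\<^sub>M T) (\<lambda>p. (fst p, out (fst p) (snd p))) =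
   density (\<mu> \<Otimes>\<^sub>M G) (\<lambda>p. ennreal (f (fst p) (snd p)))" (is "?L = ?R")
proof (rule measure_eqI)
  show "sets ?L = sets ?R" using meas_eqs(2) by simp
  fix A assume "A \<in> sets ?L"
  then have A: "A \<in> sets (S \<Otimes>\<^sub>M T)" and A': "A \<in> sets (\<mu> \<Otimes>\<^sub>M G)" using meas_eqs(2) by auto
  have "emeasure ?L A = (\<integral>\<^sup>+p. indicator A p \<partial>?L)" using A by simp
  also have "\<dots> = (\<integral>\<^sup>+p. indicator A (fst p, out (fst p) (snd p)) \<partial>(\<mu> \<Otimes>\<^sub>M P))"
    using pair_meas A by (subst nn_integral_distr) auto
  also have "\<dots> = (\<integral>\<^sup>+p. ennreal (f (fst p) (snd p)) * indicator A p \<partial>(\<mu> \<Otimes>\<^sub>M G))"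
    using A by (subst nn_integral_joint) auto
  also have "\<dots> = emeasure ?R A" using A' by (subst emeasure_density) auto
  finally show "emeasure ?L A = emeasure ?R A" .
qed

lemma distr_out: "distr (\<mu> \<Otimes>\<^sub>M P) T (\<lambda>p. out (fst p) (snd p)) = density G (\<lambda>y. ennreal (fbar y))"
  (is "?L = ?R")
proof (rule measure_eqI)
  show "sets ?L = sets ?R" using sets_reference by simp
  fix A assume "A \<in> sets ?L"
  then have A: "A \<in> sets T" and A': "A \<in> sets G" using sets_reference by auto
  have "emeasure ?L A = (\<integral>\<^sup>+p. indicator A p \<partial>?L)" using A by simp
  also have "\<dots> = (\<integral>\<^sup>+p. indicator A (out (fst p) (snd p)) \<partial>(\<mu> \<Otimes>\<^sub>M P))"
    using A by (subst nn_integral_distr) auto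
  also have "\<dots> = (\<integral>\<^sup>+p. ennreal (f (fst p) (snd p)) * indicator A (snd p) \<partial>(\<mu> \<Otimes>\<^sub>M G))"
    using A nn_integral_joint[of "\<lambda>p. indicator A (snd p)"] by simp
  also have "\<dots> = (\<integral>\<^sup>+y. \<integral>\<^sup>+x. ennreal (f x y) * indicator A y \<partial>\<mu> \<partial>G)"
    using A' by (subst refpair.nn_integral_snd[symmetric]) (auto simp: case_prod_unfold)
  also have "\<dots> = (\<integral>\<^sup>+y. ennreal (fbar y) * indicator A y \<partial>G)"
  proof (rule nn_integral_cong)
    fix y assume y: "y \<in> space G"
    have "(\<lambda>x. f x y) \<in> borel_measurable \<mu>"
      using measurable_compose[OF measurable_Pair2'[OF y] f_meas] by simp
    then show "(\<integral>\<^sup>+x. ennreal (f x y) * indicator A y \<partial>\<mu>) = ennreal (fbar y) * indicator A y"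
      using y by (subst nn_integral_multc) (auto simp: fbar_eq space_reference)
  qed
  also have "\<dots> = emeasure ?R A" using A' by (subst emeasure_density) auto
  finally show "emeasure ?L A = emeasure ?R A" .
qed

lemma nn_integral_fbar: "(\<integral>\<^sup>+y. ennreal (fbar y) \<partial>G) = 1"
proof -
  have "emeasure (distr (\<mu> \<Otimes>\<^sub>M P) T (\<lambda>p. out (fst p) (snd p))) (space T) = 1"
    using prob_space.emeasure_space_1[OF joint.prob_space_distr[OF out_meas]] by simp
  then show ?thesis unfolding distr_out
    by (subst (asm) emeasure_density) (auto simp: space_reference[symmetric])
qed

text \<open>The joint law and the product of the marginals both have densities relative to
  \<open>\<mu> \<Otimes>\<^sub>M G\<close>, so the divergence is the mean logarithm of their ratio;
  the base \<open>exp 1\<close> gives nats.\<close>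

lemma mutual_information_eq:
  "prob_space.mutual_information (\<mu> \<Otimes>\<^sub>M P) (exp 1) S T fst (\<lambda>(x, \<omega>). out x \<omega>) =
   (\<integral>p. ln (f (fst p) (out (fst p) (snd p)) / fbar (out (fst p) (snd p))) \<partial>(\<mu> \<Otimes>\<^sub>M P))"
proof -
  let ?Q = "density G (\<lambda>y. ennreal (fbar y))"
  have q: "prob_space ?Q"
    unfolding distr_out[symmetric] by (rule joint.prob_space_distr) simp
  interpret Q: prob_space ?Q by fact
  have d1: "distr (\<mu> \<Otimes>\<^sub>M P) S fst = \<mu>"
  proof -
    have "distr (\<mu> \<Otimes>\<^sub>M P) S fst = distr (\<mu> \<Otimes>\<^sub>M P) \<mu> fst" by (rule distr_cong) (auto simp: sets_input)
    then show ?thesis by (simp add: noise.distr_pair_fst)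
  qed
  have d2: "\<mu> \<Otimes>\<^sub>M ?Q = density (\<mu> \<Otimes>\<^sub>M G) (\<lambda>p. ennreal (fbar (snd p)))"
  proof -
    have "density \<mu> (\<lambda>_. 1) \<Otimes>\<^sub>M ?Q = density (\<mu> \<Otimes>\<^sub>M G) (\<lambda>(x,y). 1 * ennreal (fbar y))"
      by (rule pair_measure_density) (auto simp: Q.sigma_finite_measure_axioms reference.sigma_finite_measure_axioms)
    then show ?thesis by (simp add: density_1 case_prod_unfold)
  qed
  have "prob_space.mutual_information (\<mu> \<Otimes>\<^sub>M P) (exp 1) S T fst (\<lambda>(x, \<omega>). out x \<omega>) =
    KL_divergence (exp 1) (density (\<mu> \<Otimes>\<^sub>M G) (\<lambda>p. ennreal (fbar (snd p))))
       (density (\<mu> \<Otimes>\<^sub>M G) (\<lambda>p. ennreal (f (fst p) (snd p))))"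
    unfolding joint.mutual_information_def
    by (simp only: d1 d2[symmetric] distr_out distr_joint case_prod_unfold)
  also have "\<dots> = (\<integral>p. f (fst p) (snd p) * log (exp 1) (f (fst p) (snd p) / fbar (snd p)) \<partial>(\<mu> \<Otimes>\<^sub>M G))"
    by (rule refpair.KL_density_density)
       (auto intro!: AE_I2 simp: space_pair_measure space_input space_reference
          less_imp_le f_pos fbar_pos less_imp_neq[OF fbar_pos, symmetric])
  also have "\<dots> = (\<integral>p. ln (f (fst p) (snd p) / fbar (snd p)) \<partial>density (\<mu> \<Otimes>\<^sub>M G) (\<lambda>p. ennreal (f (fst p) (snd p))))"
    by (subst integral_density)
       (auto intro!: AE_I2 simp: space_pair_measure space_input space_reference less_imp_le f_pos log_def)
  also have "\<dots> = (\<integral>p. ln (f (fst p) (out (fst p) (snd p)) / fbar (out (fst p) (snd p))) \<partial>(\<mu> \<Otimes>\<^sub>M P))"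
    unfolding distr_joint[symmetric]
    by (subst integral_distr[OF pair_meas])
       (use f_measurable fbar_measurable in \<open>auto simp: case_prod_unfold\<close>)
  finally show ?thesis .
qed

text \<open>Gibbs' inequality: every positive \<open>\<phi>\<close> of input average at most \<open>1\<close> is admissible as a guess for the
  likelihood ratio.\<close>

lemma mutual_information_ge:
  assumes \<phi>_meas: "(\<lambda>p. \<phi> (fst p) (snd p)) \<in> borel_measurable (S \<Otimes>\<^sub>M T)"
    and \<phi>_pos: "\<And>x y. x \<in> space S \<Longrightarrow> y \<in> space T \<Longrightarrow> 0 < \<phi> x y"
    and \<phi>_le: "\<And>y. y \<in> space T \<Longrightarrow> (\<integral>\<^sup>+x. ennreal (\<phi> x y) \<partial>\<mu>) \<le> 1"
    and int_f: "integrable (\<mu> \<Otimes>\<^sub>M P) (\<lambda>p. ln (f (fst p) (out (fst p) (snd p)) / fbar (out (fst p) (snd p))))"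
    and int_\<phi>: "integrable (\<mu> \<Otimes>\<^sub>M P) (\<lambda>p. ln (\<phi> (fst p) (out (fst p) (snd p))))"
  shows "(\<integral>p. ln (\<phi> (fst p) (out (fst p) (snd p))) \<partial>(\<mu> \<Otimes>\<^sub>M P)) \<le>
     prob_space.mutual_information (\<mu> \<Otimes>\<^sub>M P) (exp 1) S T fst (\<lambda>(x, \<omega>). out x \<omega>)"
proof -
  \<comment> \<open>\<open>R\<close> compares the guess with the true likelihood ratio. Its mean
    under the joint law is at most 1, because the true density cancels and what remains is
    \<open>fbar\<close> integrated against the input average of \<open>\<phi>\<close>.\<close>
  define R where "R p = \<phi> (fst p) (snd p) / (f (fst p) (snd p) / fbar (snd p))" for p
  define j where "j p = (fst p, out (fst p) (snd p))" for p
  have jm: "j \<in> \<mu> \<Otimes>\<^sub>M P \<rightarrow>\<^sub>M S \<Otimes>\<^sub>M T" using pair_meas by (simp add: j_def[abs_def])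
  have Rm: "R \<in> borel_measurable (S \<Otimes>\<^sub>M T)"
    using \<phi>_meas f_measurable fbar_measurable unfolding R_def[abs_def] case_prod_unfold by measurable
  have jsp: "fst (j p) \<in> space S" "snd (j p) \<in> space T" if "p \<in> space (\<mu> \<Otimes>\<^sub>M P)" for p
    using measurable_space[OF jm that] by (auto simp: space_pair_measure)
  have Rpos: "0 < R (j p)" if "p \<in> space (\<mu> \<Otimes>\<^sub>M P)" for p
    using jsp[OF that] by (simp add: R_def \<phi>_pos f_pos fbar_pos)
  have "(\<integral>\<^sup>+p. ennreal (R (j p)) \<partial>(\<mu> \<Otimes>\<^sub>M P)) =
     (\<integral>\<^sup>+p. ennreal (f (fst p) (snd p)) * ennreal (R p) \<partial>(\<mu> \<Otimes>\<^sub>M G))"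
    unfolding j_def using Rm by (subst nn_integral_joint) auto
  also have "\<dots> = (\<integral>\<^sup>+p. ennreal (fbar (snd p)) * ennreal (\<phi> (fst p) (snd p)) \<partial>(\<mu> \<Otimes>\<^sub>M G))"
  proof (rule nn_integral_cong)
    fix p assume "p \<in> space (\<mu> \<Otimes>\<^sub>M G)"
    then have p: "fst p \<in> space S" "snd p \<in> space T"
      by (auto simp: space_pair_measure space_input space_reference)
    have "f (fst p) (snd p) * R p = fbar (snd p) * \<phi> (fst p) (snd p)"
      using f_pos[OF p] fbar_pos[OF p(2)] by (simp add: R_def)
    then show "ennreal (f (fst p) (snd p)) * ennreal (R p) = ennreal (fbar (snd p)) * ennreal (\<phi> (fst p) (snd p))"
      using f_pos[OF p] fbar_pos[OF p(2)] \<phi>_pos[OF p]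
      by (simp add: R_def ennreal_mult[symmetric] less_imp_le)
  qed
  also have "\<dots> = (\<integral>\<^sup>+y. \<integral>\<^sup>+x. ennreal (fbar y) * ennreal (\<phi> x y) \<partial>\<mu> \<partial>G)"
    using \<phi>_meas fbar_measurable by (subst refpair.nn_integral_snd[symmetric])
      (auto simp: case_prod_unfold measurable_cong_sets[OF meas_eqs(2) refl])
  also have "\<dots> \<le> (\<integral>\<^sup>+y. ennreal (fbar y) \<partial>G)"
  proof (rule nn_integral_mono)
    fix y assume y: "y \<in> space G"
    then have y': "y \<in> space T" by (simp add: space_reference)
    have "(\<lambda>x. \<phi> x y) \<in> borel_measurable S"
      using measurable_compose[OF measurable_Pair2'[OF y'] \<phi>_meas] by simp
    then have "(\<integral>\<^sup>+x. ennreal (fbar y) * ennreal (\<phi> x y) \<partial>\<mu>) = ennreal (fbar y) * (\<integral>\<^sup>+x. ennreal (\<phi> x y) \<partial>\<mu>)"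
      by (intro nn_integral_cmult) (simp add: measurable_cong_sets[OF sets_input refl])
    also have "\<dots> \<le> ennreal (fbar y) * 1" by (intro mult_left_mono \<phi>_le y') simp
    finally show "(\<integral>\<^sup>+x. ennreal (fbar y) * ennreal (\<phi> x y) \<partial>\<mu>) \<le> ennreal (fbar y)" by simp
  qed
  also have "\<dots> = 1" by (rule nn_integral_fbar)
  finally have R1: "(\<integral>\<^sup>+p. ennreal (R (j p)) \<partial>(\<mu> \<Otimes>\<^sub>M P)) \<le> 1" .
  have Rjm: "(\<lambda>p. R (j p)) \<in> borel_measurable (\<mu> \<Otimes>\<^sub>M P)" using jm Rm by (rule measurable_compose)
  have Rint: "integrable (\<mu> \<Otimes>\<^sub>M P) (\<lambda>p. R (j p))"
    using Rjm R1 Rpos by (intro integrableI_nonneg) (auto intro!: AE_I2 less_imp_le simp: le_less_trans[OF _ ennreal_one_less_top])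
  have RI: "(\<integral>p. R (j p) \<partial>(\<mu> \<Otimes>\<^sub>M P)) \<le> 1"
  proof -
    have "ennreal (\<integral>p. R (j p) \<partial>(\<mu> \<Otimes>\<^sub>M P)) \<le> 1"
      using R1 Rint Rpos by (subst nn_integral_eq_integral[symmetric]) (auto intro!: AE_I2 less_imp_le)
    then show ?thesis by (simp add: ennreal_le_1)
  qed
  \<comment> \<open>The difference of the two logarithms is ln R, and ln R \<le> R - 1.\<close>
  have "(\<integral>p. ln (\<phi> (fst p) (out (fst p) (snd p))) - ln (f (fst p) (out (fst p) (snd p)) / fbar (out (fst p) (snd p))) \<partial>(\<mu> \<Otimes>\<^sub>M P))
     \<le> (\<integral>p. R (j p) - 1 \<partial>(\<mu> \<Otimes>\<^sub>M P))"
  proof (rule integral_mono)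
    show "integrable (\<mu> \<Otimes>\<^sub>M P) (\<lambda>p. R (j p) - 1)" using Rint by simp
    fix p assume p: "p \<in> space (\<mu> \<Otimes>\<^sub>M P)"
    note s = jsp[OF p, unfolded j_def fst_conv snd_conv]
    have "ln (\<phi> (fst p) (out (fst p) (snd p))) - ln (f (fst p) (out (fst p) (snd p)) / fbar (out (fst p) (snd p))) = ln (R (j p))"
      using \<phi>_pos[OF s] f_pos[OF s] fbar_pos[OF s(2)] by (simp add: R_def j_def ln_div ln_mult)
    then show "ln (\<phi> (fst p) (out (fst p) (snd p))) - ln (f (fst p) (out (fst p) (snd p)) / fbar (out (fst p) (snd p))) \<le> R (j p) - 1"
      using ln_le_minus_one[OF Rpos[OF p]] by simp
  qed (use int_f int_\<phi> in auto)
  also have "\<dots> \<le> 0" using RI Rint by (simp add: joint.prob_space)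
  finally show ?thesis unfolding mutual_information_eq using int_f int_\<phi> by simp
qed

end

subsection \<open>Characteristic function of a proper complex Gaussian family\<close>

lemma normal_law_moments':
  assumes M: "prob_space M" and X[measurable]: "X \<in> borel_measurable M"
    and s: "0 \<le> s" and d: "distr M borel X = normal_law m s"
  shows "integrable M X" "(\<integral>\<omega>. X \<omega> \<partial>M) = m" "integrable M (\<lambda>\<omega>. (X \<omega>)\<^sup>2)"
    "(\<integral>\<omega>. (X \<omega>)\<^sup>2 \<partial>M) = m\<^sup>2 + s\<^sup>2" "(\<integral>\<omega>. iexp (X \<omega>) \<partial>M) = iexp m * exp (- s\<^sup>2 / 2)"
proof -
  note mom = normal_law_moments[OF s, of m, folded d]
  show "integrable M X" using mom(1) by (subst (asm) integrable_distr_eq) auto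
  show "(\<integral>\<omega>. X \<omega> \<partial>M) = m" using mom(2) by (subst (asm) integral_distr) auto
  show "integrable M (\<lambda>\<omega>. (X \<omega>)\<^sup>2)" using mom(3) by (subst (asm) integrable_distr_eq) auto
  show "(\<integral>\<omega>. (X \<omega>)\<^sup>2 \<partial>M) = m\<^sup>2 + s\<^sup>2" using mom(4) by (subst (asm) integral_distr) auto
  show "(\<integral>\<omega>. iexp (X \<omega>) \<partial>M) = iexp m * exp (- s\<^sup>2 / 2)"
    using char_normal_law[OF s, of m 1, folded d] by (subst (asm) integral_distr) auto
qed

lemma integrable_mult_square_integrable:
  fixes f g :: "'a \<Rightarrow> complex"
  assumes [measurable]: "f \<in> borel_measurable M" "g \<in> borel_measurable M"
    and "integrable M (\<lambda>x. (cmod (f x))\<^sup>2)" "integrable M (\<lambda>x. (cmod (g x))\<^sup>2)"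
  shows "integrable M (\<lambda>x. f x * g x)"
proof (rule Bochner_Integration.integrable_bound)
  show "integrable M (\<lambda>x. (cmod (f x))\<^sup>2 + (cmod (g x))\<^sup>2)" using assms by simp
  show "AE x in M. norm (f x * g x) \<le> norm ((cmod (f x))\<^sup>2 + (cmod (g x))\<^sup>2)"
  proof (rule AE_I2)
    fix x
    have "2 * (cmod (f x) * cmod (g x)) \<le> (cmod (f x))\<^sup>2 + (cmod (g x))\<^sup>2"
      using sum_squares_bound[of "cmod (f x)" "cmod (g x)"] by (simp add: mult.assoc)
    moreover have "0 \<le> cmod (f x) * cmod (g x)" by simp
    ultimately show "norm (f x * g x) \<le> norm ((cmod (f x))\<^sup>2 + (cmod (g x))\<^sup>2)"
      by (simp add: norm_mult del: norm_ge_zero)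
  qed
qed simp

lemma borel_measurable_cnj[measurable]:
  "f \<in> borel_measurable M \<Longrightarrow> (\<lambda>x. cnj (f x)) \<in> borel_measurable M"
  by (rule borel_measurable_continuous_on[where f = cnj]) (auto intro: continuous_intros)

lemma jointly_gaussian_square_integrable:
  assumes M: "prob_space M" and g: "jointly_gaussian M I Z" and i: "i \<in> I"
  shows "integrable M (\<lambda>\<omega>. (cmod (Z i \<omega>))\<^sup>2)"
proof -
  have [measurable]: "Z i \<in> borel_measurable M" using g i by (auto simp: jointly_gaussian_def)
  have *: "\<exists>m s. s \<ge> 0 \<and> distr M borel (\<lambda>\<omega>. \<Sum>i\<in>J. c i * Re (Z i \<omega>) + d i * Im (Z i \<omega>)) = normal_law m s"
    if "finite J" "J \<subseteq> I" for J c d using g that unfolding jointly_gaussian_def by blast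
  have "integrable M (\<lambda>\<omega>. (Re (Z i \<omega>))\<^sup>2)"
    using *[of "{i}" "\<lambda>_. 1" "\<lambda>_. 0"] i normal_law_moments'(3)[OF M, of "\<lambda>\<omega>. Re (Z i \<omega>)"] by auto
  moreover have "integrable M (\<lambda>\<omega>. (Im (Z i \<omega>))\<^sup>2)"
    using *[of "{i}" "\<lambda>_. 0" "\<lambda>_. 1"] i normal_law_moments'(3)[OF M, of "\<lambda>\<omega>. Im (Z i \<omega>)"] by auto
  ultimately show ?thesis by (simp add: cmod_power2)
qed

lemma cmod_square_integrable_imp_integrable:
  fixes f :: "'a \<Rightarrow> complex"
  assumes "prob_space M" "f \<in> borel_measurable M" "integrable M (\<lambda>x. (cmod (f x))\<^sup>2)"
  shows "integrable M f"
proof -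
  interpret prob_space M by fact
  show ?thesis using integrable_mult_square_integrable[of f M "\<lambda>_. 1"] assms by simp
qed

lemma square_integrable_diff_const:
  fixes f :: "'a \<Rightarrow> complex"
  assumes "prob_space M" and [measurable]: "f \<in> borel_measurable M" and i: "integrable M (\<lambda>x. (cmod (f x))\<^sup>2)"
  shows "integrable M (\<lambda>x. (cmod (f x - a))\<^sup>2)"
proof -
  interpret prob_space M by fact
  show ?thesis
  proof (rule Bochner_Integration.integrable_bound)
    show "integrable M (\<lambda>x. 2 * (cmod (f x))\<^sup>2 + 2 * (cmod a)\<^sup>2)" using i by simp
    show "AE x in M. norm ((cmod (f x - a))\<^sup>2) \<le> norm (2 * (cmod (f x))\<^sup>2 + 2 * (cmod a)\<^sup>2)"
    proof (rule AE_I2)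
      fix x
      have "(cmod (f x - a))\<^sup>2 \<le> (cmod (f x) + cmod a)\<^sup>2"
        by (intro power_mono norm_triangle_ineq4) auto
      also have "\<dots> \<le> 2 * (cmod (f x))\<^sup>2 + 2 * (cmod a)\<^sup>2"
        using sum_squares_bound[of "cmod (f x)" "cmod a"] by (simp add: power2_sum)
      finally show "norm ((cmod (f x - a))\<^sup>2) \<le> norm (2 * (cmod (f x))\<^sup>2 + 2 * (cmod a)\<^sup>2)" by simp
    qed
  qed simp
qed

text \<open>Every real functional of the family is normal, so only mean and variance matter. The
  vanishing pseudo-covariance makes the variance of the real part half of the mean square modulus,
  whence the factor 1/4 in the exponent.\<close>

lemma proper_gaussian_char:
  assumes M: "prob_space M" and g: "proper_gaussian M I Z" and J: "finite J" "J \<subseteq> I"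
  shows "(\<integral>\<omega>. iexp (Re (\<Sum>j\<in>J. c j * (Z j \<omega> - mean M (Z j)))) \<partial>M) =
     exp (- Re (\<Sum>j\<in>J. \<Sum>k\<in>J. c j * cnj (c k) * covar M (Z j) (Z k)) / 4)"
proof -
  interpret prob_space M by fact
  have jg: "jointly_gaussian M I Z" and pc: "\<And>i j. i \<in> I \<Longrightarrow> j \<in> I \<Longrightarrow> pseudo_covar M (Z i) (Z j) = 0"
    using g by (auto simp: proper_gaussian_def)
  have Zm[measurable]: "Z j \<in> borel_measurable M" if "j \<in> J" for j
    using jg J(2) that by (auto simp: jointly_gaussian_def)
  define A where "A j \<omega> = Z j \<omega> - mean M (Z j)" for j \<omega>
  have Am[measurable]: "A j \<in> borel_measurable M" if "j \<in> J" for j using Zm[OF that] unfolding A_def[abs_def] by simp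
  have Ai: "integrable M (\<lambda>\<omega>. (cmod (A j \<omega>))\<^sup>2)" if "j \<in> J" for j
    unfolding A_def
    by (rule square_integrable_diff_const[OF M Zm[OF that] jointly_gaussian_square_integrable[OF M jg subsetD[OF J(2) that]]])
  have AAi: "integrable M (\<lambda>\<omega>. A j \<omega> * cnj (A k \<omega>))" "integrable M (\<lambda>\<omega>. A j \<omega> * A k \<omega>)"
    if "j \<in> J" "k \<in> J" for j k
    using Ai[OF that(1)] Ai[OF that(2)] Am[OF that(1)] Am[OF that(2)]
    by (auto intro!: integrable_mult_square_integrable)
  have Zi: "integrable M (Z j)" if "j \<in> J" for j
    by (rule cmod_square_integrable_imp_integrable[OF M Zm[OF that] jointly_gaussian_square_integrable[OF M jg subsetD[OF J(2) that]]])
  define G where "G \<omega> = (\<Sum>j\<in>J. c j * A j \<omega>)" for \<omega>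
  define X where "X \<omega> = (\<Sum>j\<in>J. Re (c j) * Re (Z j \<omega>) + (- Im (c j)) * Im (Z j \<omega>))" for \<omega>
  have "\<exists>m s. s \<ge> 0 \<and> distr M borel X = normal_law m s"
    using jg[unfolded jointly_gaussian_def, THEN conjunct2, rule_format, OF J, of "\<lambda>j. Re (c j)" "\<lambda>j. - Im (c j)"]
    unfolding X_def[abs_def] .
  then obtain m s where s: "0 \<le> s" and d: "distr M borel X = normal_law m s" by blast
  have Xm[measurable]: "X \<in> borel_measurable M" unfolding X_def[abs_def] using Zm by simp
  note mom = normal_law_moments'[OF M Xm s d]
  have XR: "X \<omega> = Re (\<Sum>j\<in>J. c j * Z j \<omega>)" for \<omega> by (simp add: X_def)
  have m: "m = Re (\<Sum>j\<in>J. c j * mean M (Z j))"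
  proof -
    have "m = (\<integral>\<omega>. X \<omega> \<partial>M)" by (rule mom(2)[symmetric])
    also have "\<dots> = Re (\<integral>\<omega>. (\<Sum>j\<in>J. c j * Z j \<omega>) \<partial>M)"
      unfolding XR using Zi by (intro integral_Re) auto
    also have "(\<integral>\<omega>. (\<Sum>j\<in>J. c j * Z j \<omega>) \<partial>M) = (\<Sum>j\<in>J. c j * mean M (Z j))"
      using Zi by (simp add: mean_def)
    finally show ?thesis .
  qed
  have RG: "Re (G \<omega>) = X \<omega> - m" for \<omega>
    unfolding G_def A_def XR m right_diff_distrib sum_subtractf by simp
  have "(\<integral>\<omega>. (X \<omega> - m)\<^sup>2 \<partial>M) = (\<integral>\<omega>. (X \<omega>)\<^sup>2 - 2 * m * X \<omega> + m\<^sup>2 \<partial>M)"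
    by (intro Bochner_Integration.integral_cong refl) (simp add: power2_eq_square algebra_simps)
  also have "\<dots> = s\<^sup>2"
    using mom by (simp add: prob_space power2_eq_square)
  finally have s2: "s\<^sup>2 = (\<integral>\<omega>. (Re (G \<omega>))\<^sup>2 \<partial>M)" by (simp add: RG)
  have GG: "G \<omega> * cnj (G \<omega>) = (\<Sum>j\<in>J. \<Sum>k\<in>J. c j * cnj (c k) * (A j \<omega> * cnj (A k \<omega>)))" for \<omega>
    unfolding G_def cnj_sum sum_product by (intro sum.cong refl) simp
  have GP: "G \<omega> * G \<omega> = (\<Sum>j\<in>J. \<Sum>k\<in>J. c j * c k * (A j \<omega> * A k \<omega>))" for \<omega>
    unfolding G_def sum_product by (intro sum.cong refl) simp
  have i1: "integrable M (\<lambda>\<omega>. G \<omega> * cnj (G \<omega>))" unfolding GG using AAi by auto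
  have i2: "integrable M (\<lambda>\<omega>. G \<omega> * G \<omega>)" unfolding GP using AAi by auto
  have I1: "(\<integral>\<omega>. G \<omega> * cnj (G \<omega>) \<partial>M) = (\<Sum>j\<in>J. \<Sum>k\<in>J. c j * cnj (c k) * covar M (Z j) (Z k))"
    unfolding GG covar_def A_def[symmetric] using AAi by simp
  have I2: "(\<integral>\<omega>. G \<omega> * G \<omega> \<partial>M) = 0"
  proof -
    have "(\<integral>\<omega>. G \<omega> * G \<omega> \<partial>M) = (\<Sum>j\<in>J. \<Sum>k\<in>J. c j * c k * pseudo_covar M (Z j) (Z k))"
      unfolding GP pseudo_covar_def A_def[symmetric] using AAi by simp
    also have "\<dots> = 0" using pc J(2) by (intro sum.neutral ballI) auto
    finally show ?thesis .
  qed
  \<comment> \<open>(Re G)^2 = (|G|^2 + Re (G^2)) / 2, and the mean of G^2 is a combination of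
    pseudo-covariances, hence 0.\<close>
  have "(Re (G \<omega>))\<^sup>2 = (1 / 2) * Re (G \<omega> * cnj (G \<omega>) + G \<omega> * G \<omega>)" for \<omega>
    by (simp add: power2_eq_square)
  then have "s\<^sup>2 = (\<integral>\<omega>. (1 / 2) * Re (G \<omega> * cnj (G \<omega>) + G \<omega> * G \<omega>) \<partial>M)" using s2 by simp
  also have "\<dots> = (1 / 2) * Re (\<integral>\<omega>. G \<omega> * cnj (G \<omega>) + G \<omega> * G \<omega> \<partial>M)"
    unfolding integral_mult_right_zero using i1 i2 by (subst integral_Re) auto
  also have "\<dots> = (1 / 2) * Re (\<Sum>j\<in>J. \<Sum>k\<in>J. c j * cnj (c k) * covar M (Z j) (Z k))"
    using i1 i2 I1 I2 by (subst Bochner_Integration.integral_add) auto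
  finally have s2': "s\<^sup>2 = (1 / 2) * Re (\<Sum>j\<in>J. \<Sum>k\<in>J. c j * cnj (c k) * covar M (Z j) (Z k))" .
  have "(\<integral>\<omega>. iexp (Re (G \<omega>)) \<partial>M) = (\<integral>\<omega>. iexp (- m) * iexp (X \<omega>) \<partial>M)"
    unfolding RG by (intro Bochner_Integration.integral_cong refl) (simp add: exp_add[symmetric] right_diff_distrib)
  also have "\<dots> = iexp (- m) * (iexp m * exp (- s\<^sup>2 / 2))"
    unfolding integral_mult_right_zero mom(5) ..
  also have "\<dots> = exp (- s\<^sup>2 / 2)"
    by (simp add: mult.assoc[symmetric] exp_add[symmetric])
  finally show ?thesis unfolding G_def A_def s2' by simp
qed

subsection \<open>Vector and block spaces\<close>

lemma vec_component: "m < N \<Longrightarrow> (\<lambda>v. v m) \<in> borel_measurable (vec_space N)"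
  unfolding vec_space_def by (rule measurable_component_singleton) simp

lemma block_row: "k \<le> n \<Longrightarrow> (\<lambda>x. x k) \<in> block_space N n \<rightarrow>\<^sub>M vec_space N"
  unfolding block_space_def by (rule measurable_component_singleton) simp

lemma block_component: "k \<le> n \<Longrightarrow> m < N \<Longrightarrow> (\<lambda>x. x k m) \<in> borel_measurable (block_space N n)"
  using measurable_compose[OF block_row vec_component] by simp

lemma space_vec_space: "space (vec_space N) = {..<N} \<rightarrow>\<^sub>E UNIV"
  by (simp add: vec_space_def space_PiM)

lemma space_block_space: "space (block_space N n) = {..n} \<rightarrow>\<^sub>E ({..<N} \<rightarrow>\<^sub>E UNIV)"
  by (simp add: block_space_def space_PiM space_vec_space)

lemma measurable_block_spaceI:
  assumes "\<And>k m. k \<le> n \<Longrightarrow> m < N \<Longrightarrow> (\<lambda>x. f x k m) \<in> borel_measurable A"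
  shows "(\<lambda>x. \<lambda>k\<in>{..n}. \<lambda>m\<in>{..<N}. f x k m) \<in> A \<rightarrow>\<^sub>M block_space N n"
  unfolding block_space_def vec_space_def
  by (intro measurable_restrict) (use assms in auto)

definition block_energy :: "nat \<Rightarrow> nat \<Rightarrow> (nat \<Rightarrow> nat \<Rightarrow> complex) \<Rightarrow> real" where
  "block_energy N n x = (\<Sum>k\<le>n. \<Sum>m<N. (cmod (x k m))\<^sup>2)"

lemma block_energy_measurable[measurable]: "block_energy N n \<in> borel_measurable (block_space N n)"
  unfolding block_energy_def[abs_def]
  by (intro borel_measurable_sum borel_measurable_power measurable_compose[OF _ borel_measurable_norm] block_component) auto

lemma block_energy_nonneg: "0 \<le> block_energy N n x"
  unfolding block_energy_def by (intro sum_nonneg) auto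

subsection \<open>White noise blocks\<close>

text \<open>Densities multiply over independent coordinates: it suffices to compare both sides on
  boxes, where they factor.\<close>

lemma distr_PiM_density:
  assumes I: "finite I"
    and P: "\<And>i. i \<in> I \<Longrightarrow> prob_space (M i)"
    and t: "\<And>i. i \<in> I \<Longrightarrow> t i \<in> M i \<rightarrow>\<^sub>M M i"
    and g: "\<And>i. i \<in> I \<Longrightarrow> g i \<in> borel_measurable (M i)" and g0: "\<And>i x. i \<in> I \<Longrightarrow> 0 \<le> g i x"
    and d: "\<And>i. i \<in> I \<Longrightarrow> distr (M i) (M i) (t i) = density (M i) (\<lambda>x. ennreal (g i x))"
  shows "distr (Pi\<^sub>M I M) (Pi\<^sub>M I M) (\<lambda>x. \<lambda>i\<in>I. t i (x i)) =
    density (Pi\<^sub>M I M) (\<lambda>x. ennreal (\<Prod>i\<in>I. g i (x i)))"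
proof -
  \<comment> \<open>The family is extended by a point mass outside \<open>I\<close>, since the
    product locale asks for a probability law at every index.\<close>
  define M' where "M' i = (if i \<in> I then M i else return (count_space UNIV) undefined)" for i
  have MM': "Pi\<^sub>M I M = Pi\<^sub>M I M'" by (rule PiM_cong) (auto simp: M'_def)
  have P': "prob_space (M' i)" for i using P by (auto simp: M'_def intro: prob_space_return)
  interpret product_prob_space M' by (rule product_prob_spaceI[OF P'])
  interpret finite_product_sigma_finite M' I by standard (rule I)
  have gm: "(\<lambda>x. g i (x i)) \<in> borel_measurable (Pi\<^sub>M I M')" if "i \<in> I" for i
    using g[OF that] that by (intro measurable_compose[OF measurable_component_singleton[OF that]]) (simp add: M'_def)
  have tm: "(\<lambda>x. \<lambda>i\<in>I. t i (x i)) \<in> Pi\<^sub>M I M' \<rightarrow>\<^sub>M Pi\<^sub>M I M'"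
    using t by (intro measurable_restrict measurable_compose[OF measurable_component_singleton]) (auto simp: M'_def)
  have pm: "(\<lambda>x. ennreal (\<Prod>i\<in>I. g i (x i))) \<in> borel_measurable (Pi\<^sub>M I M')"
    using gm by (intro measurable_compose[OF _ measurable_ennreal] borel_measurable_prod) auto
  interpret D: prob_space "distr (Pi\<^sub>M I M') (Pi\<^sub>M I M') (\<lambda>x. \<lambda>i\<in>I. t i (x i))"
    using tm by (rule P.prob_space_distr)
  show ?thesis unfolding MM'
  proof (rule measure_eqI_PiM_finite[OF I, of _ M' _ "\<lambda>_. space (Pi\<^sub>M I M')"])
    fix A assume A: "\<And>i. i \<in> I \<Longrightarrow> A i \<in> sets (M' i)"
    have bA: "Pi\<^sub>E I A \<in> sets (Pi\<^sub>M I M')" using A I by (intro sets_PiM_I_finite) auto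
    have tA: "t i -` A i \<inter> space (M' i) \<in> sets (M' i)" if "i \<in> I" for i
      using t[OF that] A[OF that] that by (auto simp: M'_def intro: measurable_sets)
    have "(\<lambda>x. \<lambda>i\<in>I. t i (x i)) -` Pi\<^sub>E I A \<inter> space (Pi\<^sub>M I M') = (\<Pi>\<^sub>E i\<in>I. t i -` A i \<inter> space (M' i))"
      by (auto simp: space_PiM PiE_iff)
    then have "emeasure (distr (Pi\<^sub>M I M') (Pi\<^sub>M I M') (\<lambda>x. \<lambda>i\<in>I. t i (x i))) (Pi\<^sub>E I A) =
      (\<Prod>i\<in>I. emeasure (M' i) (t i -` A i \<inter> space (M' i)))"
      using tm bA tA by (simp add: emeasure_distr emeasure_PiM I)
    also have "\<dots> = (\<Prod>i\<in>I. \<integral>\<^sup>+x. ennreal (g i x) * indicator (A i) x \<partial>M' i)"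
    proof (rule prod.cong[OF refl])
      fix i assume i: "i \<in> I"
      then have Mi: "M' i = M i" by (simp add: M'_def)
      have "emeasure (M' i) (t i -` A i \<inter> space (M' i)) = emeasure (distr (M i) (M i) (t i)) (A i)"
        using t[OF i] A[OF i] by (simp add: Mi emeasure_distr)
      also have "\<dots> = (\<integral>\<^sup>+x. ennreal (g i x) * indicator (A i) x \<partial>M i)"
        unfolding d[OF i] using g[OF i] A[OF i] by (subst emeasure_density) (auto simp: Mi)
      finally show "emeasure (M' i) (t i -` A i \<inter> space (M' i)) = (\<integral>\<^sup>+x. ennreal (g i x) * indicator (A i) x \<partial>M' i)"
        by (simp add: Mi)
    qed
    also have "\<dots> = (\<integral>\<^sup>+x. (\<Prod>i\<in>I. ennreal (g i (x i)) * indicator (A i) (x i)) \<partial>Pi\<^sub>M I M')"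
      using g A by (intro product_nn_integral_prod[symmetric] I) (auto simp: M'_def intro!: borel_measurable_times_ennreal measurable_compose[OF _ measurable_ennreal])
    also have "\<dots> = (\<integral>\<^sup>+x. ennreal (\<Prod>i\<in>I. g i (x i)) * indicator (Pi\<^sub>E I A) x \<partial>Pi\<^sub>M I M')"
    proof (rule nn_integral_cong)
      fix x assume x: "x \<in> space (Pi\<^sub>M I M')"
      have "(\<Prod>i\<in>I. indicator (A i) (x i)) = (indicator (Pi\<^sub>E I A) x :: ennreal)"
        using x I by (auto simp: indicator_def space_PiM PiE_iff)
      then show "(\<Prod>i\<in>I. ennreal (g i (x i)) * indicator (A i) (x i)) = ennreal (\<Prod>i\<in>I. g i (x i)) * indicator (Pi\<^sub>E I A) x"
        using g0 by (simp add: prod.distrib prod_ennreal)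
    qed
    also have "\<dots> = emeasure (density (Pi\<^sub>M I M') (\<lambda>x. ennreal (\<Prod>i\<in>I. g i (x i)))) (Pi\<^sub>E I A)"
      using pm bA by (simp add: emeasure_density)
    finally show "emeasure (distr (Pi\<^sub>M I M') (Pi\<^sub>M I M') (\<lambda>x. \<lambda>i\<in>I. t i (x i))) (Pi\<^sub>E I A) =
       emeasure (density (Pi\<^sub>M I M') (\<lambda>x. ennreal (\<Prod>i\<in>I. g i (x i)))) (Pi\<^sub>E I A)" .
  next
    show "range (\<lambda>_. space (Pi\<^sub>M I M')) \<subseteq> prod_algebra I M'"
      using prod_algebraI_finite[OF I, of "\<lambda>i. space (M' i)" M'] by (auto simp: space_PiM)
    show "emeasure (distr (Pi\<^sub>M I M') (Pi\<^sub>M I M') (\<lambda>x. \<lambda>i\<in>I. t i (x i))) (space (Pi\<^sub>M I M')) \<noteq> \<infinity>"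
      using D.emeasure_finite by simp
  qed auto
qed

definition white_vec :: "nat \<Rightarrow> (nat \<Rightarrow> complex) measure" where
  "white_vec N = (\<Pi>\<^sub>M m\<in>{..<N}. std_CN)"

definition white_block :: "nat \<Rightarrow> nat \<Rightarrow> (nat \<Rightarrow> nat \<Rightarrow> complex) measure" where
  "white_block N n = (\<Pi>\<^sub>M k\<in>{..n}. white_vec N)"

lemma sets_white_vec: "sets (white_vec N) = sets (vec_space N)"
  unfolding white_vec_def vec_space_def by (intro sets_PiM_cong) auto

lemma sets_white_block: "sets (white_block N n) = sets (block_space N n)"
  unfolding white_block_def block_space_def by (intro sets_PiM_cong sets_white_vec) auto

lemma prob_space_white_vec: "prob_space (white_vec N)"
  unfolding white_vec_def by (intro prob_space_PiM prob_space_std_CN)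

lemma prob_space_white_block: "prob_space (white_block N n)"
  unfolding white_block_def by (intro prob_space_PiM prob_space_white_vec)

text \<open>The product rule is used once over the carriers and once over the times. The density is
  the likelihood ratio of the known signal \<open>a\<close> in white noise against noise
  alone.\<close>

lemma white_block_translate:
  "distr (white_block N n) (block_space N n) (\<lambda>w. \<lambda>k\<in>{..n}. \<lambda>m\<in>{..<N}. w k m + a k m) =
   density (white_block N n) (\<lambda>y. ennreal (exp (\<Sum>k\<le>n. \<Sum>m<N. 2 * Re (y k m * cnj (a k m)) - (cmod (a k m))\<^sup>2)))"
proof -
  have row: "distr (white_vec N) (white_vec N) (\<lambda>v. \<lambda>m\<in>{..<N}. v m + a k m) =
     density (white_vec N) (\<lambda>v. ennreal (exp (\<Sum>m<N. 2 * Re (v m * cnj (a k m)) - (cmod (a k m))\<^sup>2)))" for k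
  proof -
    have d: "distr std_CN std_CN (\<lambda>z. z + b) = density std_CN (\<lambda>z. ennreal (exp (2 * Re (z * cnj b) - (cmod b)\<^sup>2)))" for b
      unfolding std_CN_translate[symmetric] by (rule distr_cong) auto
    have tm: "(\<lambda>z. z + b) \<in> std_CN \<rightarrow>\<^sub>M std_CN" for b :: complex
      unfolding measurable_cong_sets[OF sets_std_CN sets_std_CN] by simp
    have gm: "(\<lambda>z. exp (2 * Re (z * cnj b) - (cmod b)\<^sup>2)) \<in> borel_measurable std_CN" for b
      unfolding measurable_cong_sets[OF sets_std_CN refl] by simp
    show ?thesis unfolding white_vec_def exp_sum[OF finite_lessThan]
      by (rule distr_PiM_density[where t = "\<lambda>m z. z + a k m" and M = "\<lambda>_. std_CN"
            and g = "\<lambda>m z. exp (2 * Re (z * cnj (a k m)) - (cmod (a k m))\<^sup>2)"])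
         (rule finite_lessThan prob_space_std_CN tm gm d exp_ge_zero)+
  qed
  have rm: "(\<lambda>v. v m) \<in> borel_measurable (white_vec N)" if "m < N" for m
    using vec_component[OF that] by (simp add: measurable_cong_sets[OF sets_white_vec refl])
  have "distr (white_block N n) (white_block N n) (\<lambda>w. \<lambda>k\<in>{..n}. (\<lambda>m\<in>{..<N}. w k m + a k m)) =
    density (white_block N n) (\<lambda>y. ennreal (\<Prod>k\<le>n. exp (\<Sum>m<N. 2 * Re (y k m * cnj (a k m)) - (cmod (a k m))\<^sup>2)))"
    unfolding white_block_def
  proof (rule distr_PiM_density[where t = "\<lambda>k v. \<lambda>m\<in>{..<N}. v m + a k m" and M = "\<lambda>_. white_vec N"
            and g = "\<lambda>k v. exp (\<Sum>m<N. 2 * Re (v m * cnj (a k m)) - (cmod (a k m))\<^sup>2)"])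
    fix k
    show "(\<lambda>v. \<lambda>m\<in>{..<N}. v m + a k m) \<in> white_vec N \<rightarrow>\<^sub>M white_vec N"
      unfolding measurable_cong_sets[OF refl sets_white_vec] unfolding vec_space_def
      by (intro measurable_restrict borel_measurable_add rm) auto
    show "(\<lambda>v. exp (\<Sum>m<N. 2 * Re (v m * cnj (a k m)) - (cmod (a k m))\<^sup>2)) \<in> borel_measurable (white_vec N)"
      by (intro measurable_compose[OF _ borel_measurable_exp] borel_measurable_sum borel_measurable_diff borel_measurable_times
            measurable_compose[OF _ borel_measurable_Re] rm) auto
  qed (rule finite_atMost prob_space_white_vec row exp_ge_zero)+
  moreover have "distr (white_block N n) (white_block N n) f = distr (white_block N n) (block_space N n) f" for f
    by (rule distr_cong) (auto simp: sets_white_block)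
  ultimately show ?thesis by (simp add: exp_sum)
qed

lemma char_white_vec:
  "(\<integral>z. iexp (Re (\<Sum>m<N. c m * z m)) \<partial>white_vec N) = exp (- (\<Sum>m<N. (cmod (c m))\<^sup>2) / 4)"
proof -
  interpret product_prob_space "\<lambda>_. std_CN" "{..<N}" by (rule product_prob_spaceI[OF prob_space_std_CN])
  interpret finite_product_sigma_finite "\<lambda>_. std_CN" "{..<N}" by standard simp
  have "(\<integral>z. iexp (Re (\<Sum>m<N. c m * z m)) \<partial>white_vec N) = (\<integral>z. (\<Prod>m<N. iexp (Re (c m * z m))) \<partial>(\<Pi>\<^sub>M m\<in>{..<N}. std_CN))"
    unfolding white_vec_def Re_sum of_real_sum sum_distrib_left exp_sum[OF finite_lessThan] ..
  also have "\<dots> = (\<Prod>m<N. (\<integral>z. iexp (Re (c m * z)) \<partial>std_CN))"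
    by (rule product_integral_prod) (auto intro!: std_CN.integrable_const_bound[of _ 1])
  also have "\<dots> = (\<Prod>m<N. complex_of_real (exp (- (cmod (c m))\<^sup>2 / 4)))"
    unfolding char_std_CN ..
  also have "\<dots> = exp (- (\<Sum>m<N. (cmod (c m))\<^sup>2) / 4)"
    unfolding of_real_prod[symmetric] exp_sum[OF finite_lessThan, symmetric]
    by (simp add: sum_negf sum_divide_distrib)
  finally show ?thesis .
qed

subsection \<open>The channel law\<close>

text \<open>Jensen's inequality, from the tangent of the exponential at the mean
  \<open>c\<close>.\<close>

lemma (in prob_space) exp_integral_le:
  fixes h :: "'a \<Rightarrow> real"
  assumes "integrable M h" "integrable M (\<lambda>x. exp (h x))"
  shows "exp (\<integral>x. h x \<partial>M) \<le> (\<integral>x. exp (h x) \<partial>M)"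
proof -
  define c where "c = (\<integral>x. h x \<partial>M)"
  have "exp c = (\<integral>x. exp c * (1 + (h x - c)) \<partial>M)"
    using assms(1) by (simp add: prob_space c_def)
  also have "\<dots> \<le> (\<integral>x. exp (h x) \<partial>M)"
  proof (rule integral_mono)
    fix x
    have "exp c * (1 + (h x - c)) \<le> exp c * exp (h x - c)"
      by (intro mult_left_mono exp_ge_add_one_self) auto
    then show "exp c * (1 + (h x - c)) \<le> exp (h x)" by (simp add: exp_diff)
  qed (use assms in auto)
  finally show ?thesis by (simp add: c_def)
qed

definition gain :: "nat \<Rightarrow> (nat \<Rightarrow> complex) \<Rightarrow> nat \<Rightarrow> complex" where
  "gain N h m = complex_of_real (sqrt (real N)) * freq_resp N h m"

text \<open>Log-likelihood of the output when input and fading are both known, relative to noise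
  alone.\<close>

definition log_lik :: "nat \<Rightarrow> nat \<Rightarrow> (nat \<Rightarrow> nat \<Rightarrow> complex) \<Rightarrow> (nat \<Rightarrow> nat \<Rightarrow> complex) \<Rightarrow> (nat \<Rightarrow> nat \<Rightarrow> complex) \<Rightarrow> real" where
  "log_lik N n h x y = (\<Sum>k\<le>n. \<Sum>m<N. 2 * Re (y k m * cnj (gain N (h k) m * x k m)) - (cmod (gain N (h k) m * x k m))\<^sup>2)"

definition rx_energy :: "nat \<Rightarrow> nat \<Rightarrow> (nat \<Rightarrow> nat \<Rightarrow> complex) \<Rightarrow> (nat \<Rightarrow> nat \<Rightarrow> complex) \<Rightarrow> real" where
  "rx_energy N n h x = (\<Sum>k\<le>n. \<Sum>m<N. (cmod (gain N (h k) m * x k m))\<^sup>2)"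

text \<open>|y - a|^2 \<ge> 0 in every entry. The bound involves neither input nor fading, so the
  exponential can always be averaged over the fading.\<close>

lemma log_lik_le: "log_lik N n h x y \<le> block_energy N n y"
  unfolding log_lik_def block_energy_def
proof (intro sum_mono)
  fix k m
  let ?a = "gain N (h k) m * x k m"
  have "(cmod (y k m - ?a))\<^sup>2 = (cmod (y k m))\<^sup>2 - (2 * Re (y k m * cnj ?a) - (cmod ?a)\<^sup>2)"
    unfolding cmod_power2 by (simp add: power2_eq_square algebra_simps)
  then show "2 * Re (y k m * cnj ?a) - (cmod ?a)\<^sup>2 \<le> (cmod (y k m))\<^sup>2"
    using zero_le_power2[of "cmod (y k m - ?a)"] by linarith
qed

text \<open>|y + a|^2 \<ge> 0 in every entry. With the upper bound it confines log-likelihoods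
  between energies.\<close>

lemma log_lik_ge: "- block_energy N n y - 2 * rx_energy N n h x \<le> log_lik N n h x y"
proof -
  have "- (\<Sum>k\<le>n. \<Sum>m<N. (cmod (y k m))\<^sup>2 + 2 * (cmod (gain N (h k) m * x k m))\<^sup>2) \<le> log_lik N n h x y"
    unfolding log_lik_def sum_negf[symmetric]
  proof (intro sum_mono)
    fix k m
    let ?a = "gain N (h k) m * x k m"
    have "(cmod (y k m + ?a))\<^sup>2 = (cmod (y k m))\<^sup>2 + 2 * Re (y k m * cnj ?a) + (cmod ?a)\<^sup>2"
      unfolding cmod_power2 by (simp add: power2_eq_square algebra_simps)
    then show "- ((cmod (y k m))\<^sup>2 + 2 * (cmod ?a)\<^sup>2) \<le> 2 * Re (y k m * cnj ?a) - (cmod ?a)\<^sup>2"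
      using zero_le_power2[of "cmod (y k m + ?a)"] by linarith
  qed
  then show ?thesis
    by (simp add: block_energy_def rx_energy_def sum.distrib sum_distrib_left)
qed

lemma gain_measurable: "m < N \<Longrightarrow> (\<lambda>h. gain N h m) \<in> borel_measurable (vec_space N)"
  unfolding gain_def freq_resp_def
  by (intro borel_measurable_times borel_measurable_sum borel_measurable_const vec_component) auto

lemma block_gain_measurable:
  "k \<le> n \<Longrightarrow> m < N \<Longrightarrow> (\<lambda>h. gain N (h k) m) \<in> borel_measurable (block_space N n)"
  using measurable_compose[OF block_row gain_measurable] by simp

lemma (in finite_measure) integrable_exp_le:
  assumes "h \<in> borel_measurable M" "\<And>x. h x \<le> B"
  shows "integrable M (\<lambda>x. exp (h x) :: real)"
  using assms by (intro integrable_const_bound[of _ "exp B"]) auto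

section \<open>Likelihood of the noncoherent channel\<close>

context ofdm_channel
begin

lemma H_component: "m < N \<Longrightarrow> (\<lambda>\<omega>. H k \<omega> m) \<in> borel_measurable M"
  using measurable_compose[OF H_meas vec_component] by simp

lemma W_component: "m < N \<Longrightarrow> (\<lambda>\<omega>. W k \<omega> m) \<in> borel_measurable M"
  using measurable_compose[OF W_meas vec_component] by simp

definition "Hb n \<omega> = (\<lambda>k\<in>{..n}. H k \<omega>)" for n :: nat
definition "Wb n \<omega> = (\<lambda>k\<in>{..n}. W k \<omega>)" for n :: nat

lemma Hb_measurable[measurable]: "Hb n \<in> M \<rightarrow>\<^sub>M block_space N n"
  unfolding Hb_def[abs_def] block_space_def by (intro measurable_restrict H_meas)

lemma Wb_measurable[measurable]: "Wb n \<in> M \<rightarrow>\<^sub>M block_space N n"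
  unfolding Wb_def[abs_def] block_space_def by (intro measurable_restrict W_meas)

text \<open>Uncorrelated proper Gaussian components of unit variance have the characteristic
  function of a product law; independence across the carriers is thus a consequence of the
  covariance.\<close>

lemma W_law: "distr M (vec_space N) (W k) = white_vec N"
proof -
  interpret wv: prob_space "white_vec N" by (rule prob_space_white_vec)
  have "distr M (\<Pi>\<^sub>M m\<in>{..<N}. borel) (\<lambda>\<omega>. \<lambda>m\<in>{..<N}. W k \<omega> m) =
     distr (white_vec N) (\<Pi>\<^sub>M m\<in>{..<N}. borel) (\<lambda>z. \<lambda>m\<in>{..<N}. z m)"
  proof (rule complex_joint_char_unique[OF prob_space_axioms prob_space_white_vec finite_lessThan])
    fix c
    have "(\<integral>\<omega>. iexp (Re (\<Sum>m<N. c m * W k \<omega> m)) \<partial>M) =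
        (\<integral>\<omega>. iexp (Re (\<Sum>m<N. c m * (W k \<omega> m - mean M (\<lambda>\<omega>. W k \<omega> m)))) \<partial>M)"
      by (simp add: W_mean)
    also have "\<dots> = exp (- Re (\<Sum>j<N. \<Sum>m<N. c j * cnj (c m) * covar M (\<lambda>\<omega>. W k \<omega> j) (\<lambda>\<omega>. W k \<omega> m)) / 4)"
      by (rule proper_gaussian_char[OF prob_space_axioms W_gaussian]) auto
    also have "Re (\<Sum>j<N. \<Sum>m<N. c j * cnj (c m) * covar M (\<lambda>\<omega>. W k \<omega> j) (\<lambda>\<omega>. W k \<omega> m)) = (\<Sum>m<N. (cmod (c m))\<^sup>2)"
    proof -
      have "(\<Sum>m<N. c j * cnj (c m) * covar M (\<lambda>\<omega>. W k \<omega> j) (\<lambda>\<omega>. W k \<omega> m)) = complex_of_real ((cmod (c j))\<^sup>2)"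
        if "j < N" for j
      proof -
        have "(\<Sum>m<N. c j * cnj (c m) * covar M (\<lambda>\<omega>. W k \<omega> j) (\<lambda>\<omega>. W k \<omega> m)) =
          (\<Sum>m<N. if j = m then c j * cnj (c m) else 0)"
          using that by (intro sum.cong) (auto simp: W_cov)
        also have "\<dots> = c j * cnj (c j)" using that by simp
        also have "\<dots> = complex_of_real ((cmod (c j))\<^sup>2)" by (rule complex_norm_square[symmetric])
        finally show ?thesis .
      qed
      then show ?thesis by (simp add: Re_sum)
    qed
    also have "complex_of_real (exp (- (\<Sum>m<N. (cmod (c m))\<^sup>2) / 4)) = (\<integral>z. iexp (Re (\<Sum>m<N. c m * z m)) \<partial>white_vec N)"
      by (rule char_white_vec[symmetric])
    finally show "(\<integral>\<omega>. iexp (Re (\<Sum>m<N. c m * W k \<omega> m)) \<partial>M) = (\<integral>z. iexp (Re (\<Sum>m<N. c m * z m)) \<partial>white_vec N)" .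
  next
    fix m assume "m \<in> {..<N}"
    then show "(\<lambda>\<omega>. W k \<omega> m) \<in> borel_measurable M" by (intro W_component) auto
    show "(\<lambda>z. z m) \<in> borel_measurable (white_vec N)"
      using \<open>m \<in> {..<N}\<close> vec_component[of m N] by (simp add: measurable_cong_sets[OF sets_white_vec refl])
  qed
  moreover have "distr M (\<Pi>\<^sub>M m\<in>{..<N}. borel) (\<lambda>\<omega>. \<lambda>m\<in>{..<N}. W k \<omega> m) = distr M (vec_space N) (W k)"
  proof (rule distr_cong)
    fix \<omega> assume "\<omega> \<in> space M"
    then have "W k \<omega> \<in> space (vec_space N)" using W_meas by (auto dest: measurable_space)
    then show "(\<lambda>m\<in>{..<N}. W k \<omega> m) = W k \<omega>" by (auto simp: space_vec_space)
  qed (auto simp: vec_space_def)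
  moreover have "distr (white_vec N) (\<Pi>\<^sub>M m\<in>{..<N}. borel) (\<lambda>z. \<lambda>m\<in>{..<N}. z m) = white_vec N"
  proof -
    have "distr (white_vec N) (\<Pi>\<^sub>M m\<in>{..<N}. borel) (\<lambda>z. \<lambda>m\<in>{..<N}. z m) = distr (white_vec N) (white_vec N) (\<lambda>z. z)"
    proof (rule distr_cong)
      show "sets (\<Pi>\<^sub>M m\<in>{..<N}. borel) = sets (white_vec N)" by (simp add: sets_white_vec vec_space_def)
      fix z assume "z \<in> space (white_vec N)"
      then have "z \<in> space (vec_space N)" using sets_eq_imp_space_eq[OF sets_white_vec] by auto
      then show "(\<lambda>m\<in>{..<N}. z m) = z" by (auto simp: space_vec_space)
    qed simp
    then show ?thesis by simp
  qed
  ultimately show ?thesis by simp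
qed

lemma Wb_law: "distr M (block_space N n) (Wb n) = white_block N n"
proof -
  have "indep_vars (\<lambda>_. vec_space N) W {..n}"
    by (rule indep_vars_subset[OF W_indep]) auto
  then have "distr M (\<Pi>\<^sub>M k\<in>{..n}. vec_space N) (\<lambda>\<omega>. \<lambda>k\<in>{..n}. W k \<omega>) = (\<Pi>\<^sub>M k\<in>{..n}. distr M (vec_space N) (W k))"
    by (subst (asm) indep_vars_iff_distr_eq_PiM') (auto intro: W_meas)
  then show ?thesis
    unfolding block_space_def Wb_def[abs_def] white_block_def W_law .
qed

text \<open>Independence of the two infinite sequences passes to their restrictions to the times up
  to \<open>n\<close>.\<close>

lemma Hb_Wb_law:
  "distr M (block_space N n \<Otimes>\<^sub>M block_space N n) (\<lambda>\<omega>. (Hb n \<omega>, Wb n \<omega>)) =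
   distr M (block_space N n) (Hb n) \<Otimes>\<^sub>M white_block N n"
proof -
  let ?r = "\<lambda>(f :: nat \<Rightarrow> nat \<Rightarrow> complex). restrict f {..n}"
  have "?r \<in> seq_space N \<rightarrow>\<^sub>M block_space N n"
    unfolding seq_space_def block_space_def by (rule measurable_restrict_subset) simp
  then have "indep_var (block_space N n) (?r \<circ> (\<lambda>\<omega> k. H k \<omega>)) (block_space N n) (?r \<circ> (\<lambda>\<omega> k. W k \<omega>))"
    by (intro indep_var_compose[OF H_W_indep])
  then have "indep_var (block_space N n) (Hb n) (block_space N n) (Wb n)"
    by (simp add: comp_def Hb_def[abs_def] Wb_def[abs_def])
  then show ?thesis by (subst (asm) indep_var_distribution_eq) (auto simp: Wb_law)
qed

lemma nn_integral_Hb_Wb: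
  assumes g: "g \<in> borel_measurable (block_space N n \<Otimes>\<^sub>M block_space N n)"
  shows "(\<integral>\<^sup>+\<omega>. g (Hb n \<omega>, Wb n \<omega>) \<partial>M) = (\<integral>\<^sup>+\<omega>. \<integral>\<^sup>+w. g (Hb n \<omega>, w) \<partial>white_block N n \<partial>M)"
proof -
  interpret wb: prob_space "white_block N n" by (rule prob_space_white_block)
  let ?D = "distr M (block_space N n) (Hb n)"
  have g': "g \<in> borel_measurable (?D \<Otimes>\<^sub>M white_block N n)"
    using g by (subst measurable_cong_sets[OF sets_pair_measure_cong[OF sets_distr sets_white_block] refl])
  have "(\<integral>\<^sup>+\<omega>. g (Hb n \<omega>, Wb n \<omega>) \<partial>M) = (\<integral>\<^sup>+p. g p \<partial>distr M (block_space N n \<Otimes>\<^sub>M block_space N n) (\<lambda>\<omega>. (Hb n \<omega>, Wb n \<omega>)))"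
    using g by (subst nn_integral_distr) auto
  also have "\<dots> = (\<integral>\<^sup>+h. \<integral>\<^sup>+w. g (h, w) \<partial>white_block N n \<partial>?D)"
    unfolding Hb_Wb_law by (rule wb.nn_integral_fst[OF g', symmetric])
  also have "\<dots> = (\<integral>\<^sup>+\<omega>. \<integral>\<^sup>+w. g (Hb n \<omega>, w) \<partial>white_block N n \<partial>M)"
    using wb.borel_measurable_nn_integral_fst[OF g']
    by (subst nn_integral_distr) auto
  finally show ?thesis .
qed

lemma cmod_gain_square_integrable: "m < N \<Longrightarrow> integrable M (\<lambda>\<omega>. (cmod (gain N (H k \<omega>) m))\<^sup>2)"
proof -
  assume m: "m < N"
  have jg: "jointly_gaussian M (UNIV \<times> {..<N}) (\<lambda>(k, l) \<omega>. H k \<omega> l)"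
    using H_gaussian by (simp add: proper_gaussian_def)
  have i: "integrable M (\<lambda>\<omega>. (cmod (H k \<omega> l))\<^sup>2)" if "l < N" for l
    using jointly_gaussian_square_integrable[OF prob_space_axioms jg, of "(k, l)"] that by simp
  have "integrable M (\<lambda>\<omega>. \<Sum>l<N. \<Sum>l'<N. c l * cnj (c l') * (H k \<omega> l * cnj (H k \<omega> l')))" for c
    using i by (intro Bochner_Integration.integrable_sum integrable_mult_right integrable_mult_square_integrable
       borel_measurable_cnj H_component) (auto simp: complex_mod_cnj)
  note * = this
  define c where "c l = complex_of_real (sqrt (real N)) * cnj (dft N l m)" for l
  have g: "gain N (H k \<omega>) m = (\<Sum>l<N. c l * H k \<omega> l)" for \<omega>
    by (simp only: gain_def freq_resp_def sum_distrib_left c_def mult.assoc)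
  have "gain N (H k \<omega>) m * cnj (gain N (H k \<omega>) m) = (\<Sum>l<N. \<Sum>l'<N. c l * cnj (c l') * (H k \<omega> l * cnj (H k \<omega> l')))" for \<omega>
    unfolding g cnj_sum sum_product by (intro sum.cong refl) simp
  then have "integrable M (\<lambda>\<omega>. gain N (H k \<omega>) m * cnj (gain N (H k \<omega>) m))"
    using *[of c] by simp
  then have "integrable M (\<lambda>\<omega>. Re (gain N (H k \<omega>) m * cnj (gain N (H k \<omega>) m)))" by (rule integrable_Re)
  then show "integrable M (\<lambda>\<omega>. (cmod (gain N (H k \<omega>) m))\<^sup>2)"
    by (simp only: complex_norm_square[symmetric] Re_complex_of_real)
qed

lemma W_square_integrable: "m < N \<Longrightarrow> integrable M (\<lambda>\<omega>. (cmod (W k \<omega> m))\<^sup>2)"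
  using jointly_gaussian_square_integrable[OF prob_space_axioms, of "{..<N}" "\<lambda>m \<omega>. W k \<omega> m" m] W_gaussian[of k]
  by (simp add: proper_gaussian_def)

text \<open>A deliberately crude constant: the mean energy of all gains in the block dominates each
  single one, so one factor serves for every entry of the input.\<close>

definition "gain_energy n = (\<Sum>k\<le>n. \<Sum>m<N. \<integral>\<omega>. (cmod (gain N (H k \<omega>) m))\<^sup>2 \<partial>M)" for n :: nat
lemma rx_energy_integrable: "integrable M (\<lambda>\<omega>. rx_energy N n (\<lambda>k. H k \<omega>) x)"
  and rx_energy_le: "(\<integral>\<omega>. rx_energy N n (\<lambda>k. H k \<omega>) x \<partial>M) \<le> gain_energy n * block_energy N n x"
proof -
  have i: "integrable M (\<lambda>\<omega>. (cmod (gain N (H k \<omega>) m * x k m))\<^sup>2)" if "m < N" for k m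
    unfolding norm_mult power_mult_distrib using cmod_gain_square_integrable[OF that] by simp
  show "integrable M (\<lambda>\<omega>. rx_energy N n (\<lambda>k. H k \<omega>) x)"
    unfolding rx_energy_def using i by (intro Bochner_Integration.integrable_sum) auto
  have "(\<integral>\<omega>. rx_energy N n (\<lambda>k. H k \<omega>) x \<partial>M) = (\<Sum>k\<le>n. \<Sum>m<N. (\<integral>\<omega>. (cmod (gain N (H k \<omega>) m))\<^sup>2 \<partial>M) * (cmod (x k m))\<^sup>2)"
    unfolding rx_energy_def using i
    by (subst Bochner_Integration.integral_sum)
       (auto simp: norm_mult power_mult_distrib intro!: sum.cong)
  also have "\<dots> \<le> (\<Sum>k\<le>n. \<Sum>m<N. gain_energy n * (cmod (x k m))\<^sup>2)"
  proof (intro sum_mono mult_right_mono)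
    fix k m assume km: "k \<in> {..n}" "m \<in> {..<N}"
    have "(\<integral>\<omega>. (cmod (gain N (H k \<omega>) m))\<^sup>2 \<partial>M) \<le> (\<Sum>m<N. \<integral>\<omega>. (cmod (gain N (H k \<omega>) m))\<^sup>2 \<partial>M)"
      by (rule member_le_sum[OF km(2)]) auto
    also have "\<dots> \<le> gain_energy n"
      unfolding gain_energy_def by (rule member_le_sum[OF km(1)]) (auto intro!: sum_nonneg)
    finally show "(\<integral>\<omega>. (cmod (gain N (H k \<omega>) m))\<^sup>2 \<partial>M) \<le> gain_energy n" .
  qed auto
  also have "\<dots> = gain_energy n * block_energy N n x"
    by (simp add: block_energy_def sum_distrib_left)
  finally show "(\<integral>\<omega>. rx_energy N n (\<lambda>k. H k \<omega>) x \<partial>M) \<le> gain_energy n * block_energy N n x" .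
qed

lemma gain_energy_nonneg: "0 \<le> gain_energy n" unfolding gain_energy_def by (intro sum_nonneg) auto

text \<open>The fading averaged out: density of the output given the input alone, relative to white
  noise.\<close>

definition "lik n x y = (\<integral>\<omega>. exp (log_lik N n (\<lambda>k. H k \<omega>) x y) \<partial>M)" for n :: nat

lemma log_lik_Hb: "log_lik N n (\<lambda>k. H k \<omega>) x y = log_lik N n (Hb n \<omega>) x y"
  by (simp add: log_lik_def Hb_def)

lemma log_lik_measurable3:
  "(\<lambda>((h, x), y). log_lik N n h x y) \<in> borel_measurable ((block_space N n \<Otimes>\<^sub>M block_space N n) \<Otimes>\<^sub>M block_space N n)"
  unfolding log_lik_def case_prod_unfold
  by (intro borel_measurable_sum borel_measurable_diff borel_measurable_times borel_measurable_const
      borel_measurable_power measurable_compose[OF _ borel_measurable_norm] measurable_compose[OF _ borel_measurable_Re]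
      borel_measurable_cnj measurable_compose[OF _ block_gain_measurable, of "\<lambda>p. fst (fst p)"]
      measurable_compose[OF _ block_component, of "\<lambda>p. snd (fst p)"] measurable_compose[OF _ block_component, of "snd"]) auto

lemma log_lik_measurable_omega:
  assumes "x \<in> space (block_space N n)" "y \<in> space (block_space N n)"
  shows "(\<lambda>\<omega>. log_lik N n (\<lambda>k. H k \<omega>) x y) \<in> borel_measurable M"
proof -
  have "(\<lambda>\<omega>. ((Hb n \<omega>, x), y)) \<in> M \<rightarrow>\<^sub>M (block_space N n \<Otimes>\<^sub>M block_space N n) \<Otimes>\<^sub>M block_space N n"
    using assms by measurable
  from measurable_compose[OF this log_lik_measurable3] show ?thesis by (simp add: log_lik_Hb)
qed

lemma exp_log_lik_integrable:
  assumes "x \<in> space (block_space N n)" "y \<in> space (block_space N n)"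
  shows "integrable M (\<lambda>\<omega>. exp (log_lik N n (\<lambda>k. H k \<omega>) x y))"
  by (rule integrable_exp_le[OF log_lik_measurable_omega[OF assms] log_lik_le])

lemma lik_measurable: "(\<lambda>(x, y). lik n x y) \<in> borel_measurable (block_space N n \<Otimes>\<^sub>M block_space N n)"
proof -
  have "(\<lambda>q. ((Hb n (snd q), fst (fst q)), snd (fst q))) \<in>
     (block_space N n \<Otimes>\<^sub>M block_space N n) \<Otimes>\<^sub>M M \<rightarrow>\<^sub>M (block_space N n \<Otimes>\<^sub>M block_space N n) \<Otimes>\<^sub>M block_space N n"
    by measurable
  from measurable_compose[OF measurable_compose[OF this log_lik_measurable3] borel_measurable_exp]
  have "(\<lambda>(p, \<omega>). exp (log_lik N n (\<lambda>k. H k \<omega>) (fst p) (snd p))) \<in> borel_measurable ((block_space N n \<Otimes>\<^sub>M block_space N n) \<Otimes>\<^sub>M M)"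
    by (simp add: log_lik_Hb case_prod_unfold)
  from borel_measurable_lebesgue_integral[OF this] show ?thesis
    by (simp add: lik_def case_prod_unfold)
qed

lemma lik_le: "x \<in> space (block_space N n) \<Longrightarrow> y \<in> space (block_space N n) \<Longrightarrow> lik n x y \<le> exp (block_energy N n y)"
proof -
  assume xy: "x \<in> space (block_space N n)" "y \<in> space (block_space N n)"
  have "lik n x y \<le> (\<integral>\<omega>. exp (block_energy N n y) \<partial>M)"
    unfolding lik_def using exp_log_lik_integrable[OF xy] log_lik_le by (intro integral_mono) auto
  then show ?thesis by (simp add: prob_space)
qed

text \<open>Jensen moves the average over the fading into the exponent, where the mean received
  energy is at most a constant times the input energy.\<close>

lemma lik_ge:
  assumes xy: "x \<in> space (block_space N n)" "y \<in> space (block_space N n)"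
  shows "exp (- block_energy N n y - 2 * gain_energy n * block_energy N n x) \<le> lik n x y"
proof -
  have "integrable M (\<lambda>\<omega>. log_lik N n (\<lambda>k. H k \<omega>) x y)"
  proof (rule Bochner_Integration.integrable_bound)
    show "integrable M (\<lambda>\<omega>. block_energy N n y + 2 * rx_energy N n (\<lambda>k. H k \<omega>) x)"
      using rx_energy_integrable by simp
    show "AE \<omega> in M. norm (log_lik N n (\<lambda>k. H k \<omega>) x y) \<le> norm (block_energy N n y + 2 * rx_energy N n (\<lambda>k. H k \<omega>) x)"
    proof (rule AE_I2)
      fix \<omega>
      have "0 \<le> rx_energy N n (\<lambda>k. H k \<omega>) x" unfolding rx_energy_def by (intro sum_nonneg) auto
      then show "norm (log_lik N n (\<lambda>k. H k \<omega>) x y) \<le> norm (block_energy N n y + 2 * rx_energy N n (\<lambda>k. H k \<omega>) x)"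
        using log_lik_le[of N n "\<lambda>k. H k \<omega>" x y] log_lik_ge[of N n y "\<lambda>k. H k \<omega>" x] block_energy_nonneg[of N n y]
        unfolding real_norm_def by linarith
    qed
  qed (rule log_lik_measurable_omega[OF xy])
  note i = this
  have "- block_energy N n y - 2 * (gain_energy n * block_energy N n x) \<le> - block_energy N n y - 2 * (\<integral>\<omega>. rx_energy N n (\<lambda>k. H k \<omega>) x \<partial>M)"
    using rx_energy_le[of n x] by simp
  also have "\<dots> = (\<integral>\<omega>. - block_energy N n y - 2 * rx_energy N n (\<lambda>k. H k \<omega>) x \<partial>M)"
    using rx_energy_integrable by (simp add: prob_space)
  also have "\<dots> \<le> (\<integral>\<omega>. log_lik N n (\<lambda>k. H k \<omega>) x y \<partial>M)"
    using i rx_energy_integrable log_lik_ge by (intro integral_mono) auto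
  finally have "exp (- block_energy N n y - 2 * (gain_energy n * block_energy N n x)) \<le> exp (\<integral>\<omega>. log_lik N n (\<lambda>k. H k \<omega>) x y \<partial>M)"
    by simp
  also have "\<dots> \<le> lik n x y"
    unfolding lik_def by (rule exp_integral_le[OF i exp_log_lik_integrable[OF xy]])
  finally show ?thesis by (simp add: mult.assoc)
qed

lemma lik_pos: "x \<in> space (block_space N n) \<Longrightarrow> y \<in> space (block_space N n) \<Longrightarrow> 0 < lik n x y"
  by (rule less_le_trans[OF exp_gt_zero lik_ge])

lemma channel_output_eq:
  "channel_output N H W n x \<omega> = (\<lambda>k\<in>{..n}. \<lambda>m\<in>{..<N}. Wb n \<omega> k m + gain N (Hb n \<omega> k) m * x k m)"
  by (auto simp: channel_output_def gain_def Wb_def Hb_def fun_eq_iff restrict_def)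

lemma add_signal_measurable:
  "(\<lambda>((h, x), w). \<lambda>k\<in>{..n}. \<lambda>m\<in>{..<N}. w k m + gain N (h k) m * x k m) \<in>
     (block_space N n \<Otimes>\<^sub>M block_space N n) \<Otimes>\<^sub>M block_space N n \<rightarrow>\<^sub>M block_space N n"
  unfolding case_prod_unfold
  by (intro measurable_block_spaceI borel_measurable_add borel_measurable_times
      measurable_compose[OF _ block_gain_measurable, of "\<lambda>p. fst (fst p)"]
      measurable_compose[OF _ block_component, of "\<lambda>p. snd (fst p)"] measurable_compose[OF _ block_component, of "snd"]) auto

lemma channel_output_measurable:
  "(\<lambda>(x, \<omega>). channel_output N H W n x \<omega>) \<in> block_space N n \<Otimes>\<^sub>M M \<rightarrow>\<^sub>M block_space N n"
proof -
  have "(\<lambda>q. ((Hb n (snd q), fst q), Wb n (snd q))) \<in>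
     block_space N n \<Otimes>\<^sub>M M \<rightarrow>\<^sub>M (block_space N n \<Otimes>\<^sub>M block_space N n) \<Otimes>\<^sub>M block_space N n"
    by measurable
  from measurable_compose[OF this add_signal_measurable] show ?thesis
    by (simp add: channel_output_eq case_prod_unfold)
qed

text \<open>Given the fading, the output is white noise translated by a fixed signal; integrations
  over noise and fading are then exchanged.\<close>

lemma channel_output_law:
  assumes x: "x \<in> space (block_space N n)"
  shows "distr M (block_space N n) (channel_output N H W n x) = density (white_block N n) (\<lambda>y. ennreal (lik n x y))"
    (is "?L = ?R")
proof (rule measure_eqI)
  interpret wb: prob_space "white_block N n" by (rule prob_space_white_block)
  interpret pr: pair_sigma_finite "white_block N n" M ..
  show "sets ?L = sets ?R" by (simp add: sets_white_block)
  have om: "channel_output N H W n x \<in> M \<rightarrow>\<^sub>M block_space N n"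
    using measurable_compose[OF measurable_Pair1'[OF x] channel_output_measurable] by simp
  fix A assume "A \<in> sets ?L"
  then have A: "A \<in> sets (block_space N n)" and A': "A \<in> sets (white_block N n)" by (auto simp: sets_white_block)
  let ?T = "\<lambda>h w. \<lambda>k\<in>{..n}. \<lambda>m\<in>{..<N}. w k m + gain N (h k) m * x k m"
  have T2: "(\<lambda>(h, w). ?T h w) \<in> block_space N n \<Otimes>\<^sub>M block_space N n \<rightarrow>\<^sub>M block_space N n"
  proof -
    have "(\<lambda>q. ((fst q, x), snd q)) \<in> block_space N n \<Otimes>\<^sub>M block_space N n \<rightarrow>\<^sub>M (block_space N n \<Otimes>\<^sub>M block_space N n) \<Otimes>\<^sub>M block_space N n"
      using x by measurable
    from measurable_compose[OF this add_signal_measurable] show ?thesis by (simp add: case_prod_unfold)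
  qed
  have gm: "(\<lambda>(h, w). indicator A (?T h w) :: ennreal) \<in> borel_measurable (block_space N n \<Otimes>\<^sub>M block_space N n)"
    using measurable_compose[OF T2 borel_measurable_indicator[OF A]] by (simp add: case_prod_unfold)
  have lm: "(\<lambda>(y, \<omega>). ennreal (exp (log_lik N n (\<lambda>k. H k \<omega>) x y)) * indicator A y) \<in> borel_measurable (white_block N n \<Otimes>\<^sub>M M)"
  proof -
    have "(\<lambda>q. ((Hb n (snd q), x), fst q)) \<in> block_space N n \<Otimes>\<^sub>M M \<rightarrow>\<^sub>M (block_space N n \<Otimes>\<^sub>M block_space N n) \<Otimes>\<^sub>M block_space N n"
      using x by measurable
    from measurable_compose[OF measurable_compose[OF measurable_compose[OF this log_lik_measurable3] borel_measurable_exp] measurable_ennreal]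
    have 1: "(\<lambda>q. ennreal (exp (log_lik N n (\<lambda>k. H k (snd q)) x (fst q)))) \<in> borel_measurable (block_space N n \<Otimes>\<^sub>M M)"
      by (simp add: log_lik_Hb)
    have 2: "(\<lambda>q. indicator A (fst q) :: ennreal) \<in> borel_measurable (block_space N n \<Otimes>\<^sub>M M)"
      by (rule measurable_compose[OF measurable_fst borel_measurable_indicator[OF A]])
    show ?thesis unfolding case_prod_unfold measurable_cong_sets[OF sets_pair_measure_cong[OF sets_white_block refl] refl]
      using 1 2 by (rule borel_measurable_times_ennreal)
  qed
  have "emeasure ?L A = (\<integral>\<^sup>+\<omega>. indicator A (channel_output N H W n x \<omega>) \<partial>M)"
    using om A by (subst nn_integral_indicator[symmetric], simp, subst nn_integral_distr) auto
  also have "\<dots> = (\<integral>\<^sup>+\<omega>. (\<lambda>(h, w). indicator A (?T h w)) (Hb n \<omega>, Wb n \<omega>) \<partial>M)"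
    by (simp add: channel_output_eq)
  also have "\<dots> = (\<integral>\<^sup>+\<omega>. \<integral>\<^sup>+w. indicator A (?T (Hb n \<omega>) w) \<partial>white_block N n \<partial>M)"
    by (subst nn_integral_Hb_Wb[OF gm]) simp
  also have "\<dots> = (\<integral>\<^sup>+\<omega>. \<integral>\<^sup>+y. ennreal (exp (log_lik N n (\<lambda>k. H k \<omega>) x y)) * indicator A y \<partial>white_block N n \<partial>M)"
  proof (rule nn_integral_cong)
    fix \<omega> assume \<omega>: "\<omega> \<in> space M"
    let ?a = "\<lambda>k m. gain N (Hb n \<omega> k) m * x k m"
    have "Hb n \<omega> \<in> space (block_space N n)" by (rule measurable_space[OF Hb_measurable \<omega>])
    from measurable_compose[OF measurable_Pair1'[OF this] T2]
    have Tm: "?T (Hb n \<omega>) \<in> white_block N n \<rightarrow>\<^sub>M block_space N n"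
      by (simp add: measurable_cong_sets[OF sets_white_block refl])
    have em: "(\<lambda>y. ennreal (exp (log_lik N n (\<lambda>k. H k \<omega>) x y))) \<in> borel_measurable (white_block N n)"
    proof -
      have "(\<lambda>y. ((Hb n \<omega>, x), y)) \<in> block_space N n \<rightarrow>\<^sub>M (block_space N n \<Otimes>\<^sub>M block_space N n) \<Otimes>\<^sub>M block_space N n"
        using x \<open>Hb n \<omega> \<in> space (block_space N n)\<close> by measurable
      from measurable_compose[OF measurable_compose[OF measurable_compose[OF this log_lik_measurable3] borel_measurable_exp] measurable_ennreal]
      show ?thesis by (simp add: log_lik_Hb measurable_cong_sets[OF sets_white_block refl])
    qed
    have "(\<integral>\<^sup>+w. indicator A (?T (Hb n \<omega>) w) \<partial>white_block N n) =
      (\<integral>\<^sup>+y. indicator A y \<partial>distr (white_block N n) (block_space N n) (?T (Hb n \<omega>)))"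
      using Tm A by (subst nn_integral_distr) auto
    also have "\<dots> = (\<integral>\<^sup>+y. indicator A y \<partial>density (white_block N n) (\<lambda>y. ennreal (exp (log_lik N n (\<lambda>k. H k \<omega>) x y))))"
    proof -
      have "distr (white_block N n) (block_space N n) (?T (Hb n \<omega>)) =
        density (white_block N n) (\<lambda>y. ennreal (exp (log_lik N n (Hb n \<omega>) x y)))"
        unfolding white_block_translate[of N n ?a] log_lik_def ..
      then show ?thesis by (simp only: log_lik_Hb)
    qed
    also have "\<dots> = (\<integral>\<^sup>+y. ennreal (exp (log_lik N n (\<lambda>k. H k \<omega>) x y)) * indicator A y \<partial>white_block N n)"
      using em A' by (subst nn_integral_density) auto
    finally show "(\<integral>\<^sup>+w. indicator A (?T (Hb n \<omega>) w) \<partial>white_block N n) =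
       (\<integral>\<^sup>+y. ennreal (exp (log_lik N n (\<lambda>k. H k \<omega>) x y)) * indicator A y \<partial>white_block N n)" .
  qed
  also have "\<dots> = (\<integral>\<^sup>+y. \<integral>\<^sup>+\<omega>. ennreal (exp (log_lik N n (\<lambda>k. H k \<omega>) x y)) * indicator A y \<partial>M \<partial>white_block N n)"
    using pr.Fubini'[OF lm] by simp
  also have "\<dots> = (\<integral>\<^sup>+y. ennreal (lik n x y) * indicator A y \<partial>white_block N n)"
  proof (rule nn_integral_cong)
    fix y assume "y \<in> space (white_block N n)"
    then have y: "y \<in> space (block_space N n)" using sets_eq_imp_space_eq[OF sets_white_block] by auto
    have "(\<integral>\<^sup>+\<omega>. ennreal (exp (log_lik N n (\<lambda>k. H k \<omega>) x y)) \<partial>M) = ennreal (lik n x y)"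
      unfolding lik_def by (rule nn_integral_eq_integral[OF exp_log_lik_integrable[OF x y]]) auto
    then show "(\<integral>\<^sup>+\<omega>. ennreal (exp (log_lik N n (\<lambda>k. H k \<omega>) x y)) * indicator A y \<partial>M) = ennreal (lik n x y) * indicator A y"
      using log_lik_measurable_omega[OF x y] by (subst nn_integral_multc) auto
  qed
  also have "\<dots> = emeasure ?R A"
  proof -
    have "(\<lambda>y. ennreal (lik n x y)) \<in> borel_measurable (block_space N n)"
      using measurable_compose[OF measurable_compose[OF measurable_Pair1'[OF x] lik_measurable] measurable_ennreal] by simp
    then show ?thesis using A' by (subst emeasure_density) (auto simp: measurable_cong_sets[OF sets_white_block refl])
  qed
  finally show "emeasure ?L A = emeasure ?R A" .
qed

end

text \<open>A common superclass of both power constraints: finite mean energy suffices for the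
  log-likelihood ratios to be integrable.\<close>

definition energy_inputs :: "nat \<Rightarrow> nat \<Rightarrow> (nat \<Rightarrow> nat \<Rightarrow> complex) measure set" where
  "energy_inputs N n = {\<mu> \<in> input_laws N n. integrable \<mu> (block_energy N n)}"

section \<open>Time invariance of the channel and finiteness of the information\<close>

context ofdm_channel
begin

text \<open>A window beginning at time \<open>s\<close>, re-indexed from 0, so that late and early
  blocks live on the same space.\<close>

definition "Hs s n \<omega> = (\<lambda>k\<in>{..n}. H (k + s) \<omega>)" for s n :: nat
definition "Ws s n \<omega> = (\<lambda>k\<in>{..n}. W (k + s) \<omega>)" for s n :: nat

lemma Hs_measurable[measurable]: "Hs s n \<in> M \<rightarrow>\<^sub>M block_space N n"
  unfolding Hs_def[abs_def] block_space_def by (intro measurable_restrict H_meas)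

lemma Ws_measurable[measurable]: "Ws s n \<in> M \<rightarrow>\<^sub>M block_space N n"
  unfolding Ws_def[abs_def] block_space_def by (intro measurable_restrict W_meas)

text \<open>Stationarity is invariance under a single shift; induction on \<open>s\<close> gives all
  of them.\<close>

lemma Hs_law: "distr M (block_space N n) (Hs s n) = distr M (block_space N n) (Hb n)"
proof -
  have Hm: "(\<lambda>\<omega> k. H k \<omega>) \<in> M \<rightarrow>\<^sub>M seq_space N"
    unfolding seq_space_def by (rule measurable_PiM_single') (auto intro: H_meas dest: measurable_space[OF H_meas])
  have sh: "shift \<in> seq_space N \<rightarrow>\<^sub>M seq_space N"
    unfolding seq_space_def shift_def[abs_def]
    by (rule measurable_PiM_single') (auto simp: space_PiM)
  have fm: "(\<lambda>f. \<lambda>k\<in>{..n}. f (k + s)) \<in> seq_space N \<rightarrow>\<^sub>M block_space N n" for s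
    unfolding seq_space_def block_space_def by (intro measurable_restrict) simp
  have e: "distr M (block_space N n) (Hs s n) = distr (process_law N M H) (block_space N n) (\<lambda>f. \<lambda>k\<in>{..n}. f (k + s))" for s
    unfolding process_law_def using Hm fm by (subst distr_distr) (auto simp: comp_def Hs_def[abs_def])
  have Hs0: "Hs 0 n = Hb n" by (simp add: Hs_def[abs_def] Hb_def[abs_def])
  have "distr M (block_space N n) (Hs (Suc s) n) = distr M (block_space N n) (Hs s n)" for s
  proof -
    have pm: "sets (process_law N M H) = sets (seq_space N)" by (simp add: process_law_def)
    have "distr M (block_space N n) (Hs s n) = distr (distr (process_law N M H) (seq_space N) shift) (block_space N n) (\<lambda>f. \<lambda>k\<in>{..n}. f (k + s))"
      using H_stationary by (simp add: e stationary_def)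
    also have "\<dots> = distr M (block_space N n) (Hs (Suc s) n)"
      unfolding e using sh fm by (subst distr_distr) (auto simp: comp_def shift_def measurable_cong_sets[OF pm refl])
    finally show ?thesis by simp
  qed
  then show ?thesis by (induction s) (auto simp: Hs0)
qed

text \<open>The longer block up to time \<open>n + s\<close> has a product law with equal factors,
  and pulling such a law back along an injection of the index sets gives a product law
  again.\<close>

lemma Ws_law: "distr M (block_space N n) (Ws s n) = white_block N n"
proof -
  let ?K = "{..n + s}"
  let ?r = "\<lambda>\<omega>. \<lambda>k\<in>{..n}. \<omega> (k + s)"
  have rm: "?r \<in> block_space N (n + s) \<rightarrow>\<^sub>M block_space N n"
    unfolding block_space_def by (intro measurable_restrict measurable_component_singleton) auto
  have "distr M (block_space N n) (Ws s n) = distr (distr M (block_space N (n + s)) (Wb (n + s))) (block_space N n) ?r"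
  proof -
    have "?r (Wb (n + s) \<omega>) = Ws s n \<omega>" for \<omega>
      by (auto simp: Wb_def Ws_def restrict_def fun_eq_iff)
    then show ?thesis using rm by (simp add: distr_distr comp_def)
  qed
  also have "\<dots> = distr (\<Pi>\<^sub>M k\<in>?K. white_vec N) (\<Pi>\<^sub>M k\<in>{..n}. white_vec N) ?r"
    unfolding Wb_law by (rule distr_cong) (auto simp: white_block_def sets_white_block[symmetric])
  also have "\<dots> = white_block N n"
    unfolding white_block_def
    by (rule distr_PiM_reindex) (auto simp: prob_space_white_vec inj_on_def)
  finally show ?thesis .
qed

lemma Hs_Ws_law:
  "distr M (block_space N n \<Otimes>\<^sub>M block_space N n) (\<lambda>\<omega>. (Hs s n \<omega>, Ws s n \<omega>)) =
   distr M (block_space N n \<Otimes>\<^sub>M block_space N n) (\<lambda>\<omega>. (Hb n \<omega>, Wb n \<omega>))"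
proof -
  let ?r = "\<lambda>(f :: nat \<Rightarrow> nat \<Rightarrow> complex). \<lambda>k\<in>{..n}. f (k + s)"
  have "?r \<in> seq_space N \<rightarrow>\<^sub>M block_space N n"
    unfolding seq_space_def block_space_def by (intro measurable_restrict) simp
  then have "indep_var (block_space N n) (?r \<circ> (\<lambda>\<omega> k. H k \<omega>)) (block_space N n) (?r \<circ> (\<lambda>\<omega> k. W k \<omega>))"
    by (intro indep_var_compose[OF H_W_indep])
  then have "indep_var (block_space N n) (Hs s n) (block_space N n) (Ws s n)"
    by (simp add: comp_def Hs_def[abs_def] Ws_def[abs_def])
  then have "distr M (block_space N n) (Hs s n) \<Otimes>\<^sub>M distr M (block_space N n) (Ws s n) =
     distr M (block_space N n \<Otimes>\<^sub>M block_space N n) (\<lambda>\<omega>. (Hs s n \<omega>, Ws s n \<omega>))"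
    by (subst (asm) indep_var_distribution_eq) simp
  then show ?thesis unfolding Hb_Wb_law Hs_law Ws_law by simp
qed

definition "outs s n = channel_output N (\<lambda>k. H (k + s)) (\<lambda>k. W (k + s)) n" for s n :: nat

lemma outs_0: "outs 0 n = channel_output N H W n" by (simp add: outs_def)

lemma outs_eq:
  "outs s n x \<omega> = (\<lambda>k\<in>{..n}. \<lambda>m\<in>{..<N}. Ws s n \<omega> k m + gain N (Hs s n \<omega> k) m * x k m)"
  by (auto simp: outs_def channel_output_def gain_def Ws_def Hs_def fun_eq_iff restrict_def)

lemma outs_measurable:
  "(\<lambda>(x, \<omega>). outs s n x \<omega>) \<in> block_space N n \<Otimes>\<^sub>M M \<rightarrow>\<^sub>M block_space N n"
proof -
  have "(\<lambda>q. ((Hs s n (snd q), fst q), Ws s n (snd q))) \<in>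
     block_space N n \<Otimes>\<^sub>M M \<rightarrow>\<^sub>M (block_space N n \<Otimes>\<^sub>M block_space N n) \<Otimes>\<^sub>M block_space N n"
    by measurable
  from measurable_compose[OF this add_signal_measurable] show ?thesis
    by (simp add: outs_eq case_prod_unfold)
qed

text \<open>Fading and noise windows have the same joint law at every starting time, so the one
  density \<open>lik n\<close> serves for all \<open>s\<close>.\<close>

lemma outs_law:
  assumes x: "x \<in> space (block_space N n)"
  shows "distr M (block_space N n) (outs s n x) = density (white_block N n) (\<lambda>y. ennreal (lik n x y))"
proof -
  let ?T = "\<lambda>(h, w). \<lambda>k\<in>{..n}. \<lambda>m\<in>{..<N}. w k m + gain N (h k) m * x k m"
  have T2: "?T \<in> block_space N n \<Otimes>\<^sub>M block_space N n \<rightarrow>\<^sub>M block_space N n"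
  proof -
    have "(\<lambda>q. ((fst q, x), snd q)) \<in> block_space N n \<Otimes>\<^sub>M block_space N n \<rightarrow>\<^sub>M (block_space N n \<Otimes>\<^sub>M block_space N n) \<Otimes>\<^sub>M block_space N n"
      using x by measurable
    from measurable_compose[OF this add_signal_measurable] show ?thesis by (simp add: case_prod_unfold)
  qed
  have "distr M (block_space N n) (outs s n x) = distr (distr M (block_space N n \<Otimes>\<^sub>M block_space N n) (\<lambda>\<omega>. (Hs s n \<omega>, Ws s n \<omega>))) (block_space N n) ?T"
  proof -
    have "outs s n x = (\<lambda>\<omega>. ?T (Hs s n \<omega>, Ws s n \<omega>))" by (simp add: outs_eq[abs_def] fun_eq_iff outs_eq)
    then show ?thesis using T2 by (simp add: distr_distr comp_def)
  qed
  also have "\<dots> = distr M (block_space N n) (channel_output N H W n x)"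
  proof -
    have "channel_output N H W n x = (\<lambda>\<omega>. ?T (Hb n \<omega>, Wb n \<omega>))" by (simp add: fun_eq_iff channel_output_eq)
    then show ?thesis unfolding Hs_Ws_law using T2 by (simp add: distr_distr comp_def)
  qed
  finally show ?thesis by (simp add: channel_output_law[OF x])
qed

definition "likbar n \<mu> y = (\<integral>x. lik n x y \<partial>\<mu>)" for n :: nat

text \<open>The two-sided bounds on \<open>lik\<close> survive averaging over the input; the lower
  one needs Jensen a second time, and this is where finite mean energy of the input enters.\<close>

lemma dominated:
  assumes \<mu>: "\<mu> \<in> energy_inputs N n"
  shows "dominated_channel M (white_block N n) \<mu> (block_space N n) (block_space N n) (outs s n) (lik n) (likbar n \<mu>)"
    and "\<And>y. y \<in> space (block_space N n) \<Longrightarrow> likbar n \<mu> y \<le> exp (block_energy N n y)"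
    and "\<And>y. y \<in> space (block_space N n) \<Longrightarrow>
      exp (- block_energy N n y - 2 * gain_energy n * (\<integral>x. block_energy N n x \<partial>\<mu>)) \<le> likbar n \<mu> y"
proof -
  have p: "prob_space \<mu>" and st: "sets \<mu> = sets (block_space N n)" and ie: "integrable \<mu> (block_energy N n)"
    using \<mu> by (auto simp: energy_inputs_def input_laws_def)
  interpret \<mu>: prob_space \<mu> by (rule p)
  have sp: "space \<mu> = space (block_space N n)" by (rule sets_eq_imp_space_eq[OF st])
  have lm: "(\<lambda>x. lik n x y) \<in> borel_measurable \<mu>" if "y \<in> space (block_space N n)" for y
    using measurable_compose[OF measurable_Pair2'[OF that] lik_measurable] by (simp add: measurable_cong_sets[OF st refl])
  have li: "integrable \<mu> (\<lambda>x. lik n x y)" if y: "y \<in> space (block_space N n)" for y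
    using lik_le[OF _ y] lik_pos[OF _ y] lm[OF y]
    by (intro \<mu>.integrable_const_bound[of _ "exp (block_energy N n y)"] AE_I2) (auto simp: sp abs_of_pos)
  show up: "likbar n \<mu> y \<le> exp (block_energy N n y)" if y: "y \<in> space (block_space N n)" for y
  proof -
    have "likbar n \<mu> y \<le> (\<integral>x. exp (block_energy N n y) \<partial>\<mu>)"
      unfolding likbar_def using lik_le[OF _ y] li[OF y] by (intro integral_mono) (auto simp: sp)
    then show ?thesis by (simp add: \<mu>.prob_space)
  qed
  show lo: "exp (- block_energy N n y - 2 * gain_energy n * (\<integral>x. block_energy N n x \<partial>\<mu>)) \<le> likbar n \<mu> y"
    if y: "y \<in> space (block_space N n)" for y
  proof -
    let ?h = "\<lambda>x. - block_energy N n y - 2 * gain_energy n * block_energy N n x"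
    have hi: "integrable \<mu> ?h" using ie by simp
    have ei: "integrable \<mu> (\<lambda>x. exp (?h x))"
      using hi gain_energy_nonneg block_energy_nonneg
      by (intro \<mu>.integrable_exp_le[of _ "- block_energy N n y"]) (auto intro: borel_measurable_integrable)
    have "exp (- block_energy N n y - 2 * gain_energy n * (\<integral>x. block_energy N n x \<partial>\<mu>)) = exp (\<integral>x. ?h x \<partial>\<mu>)"
      using ie by (simp add: \<mu>.prob_space)
    also have "\<dots> \<le> (\<integral>x. exp (?h x) \<partial>\<mu>)" by (rule \<mu>.exp_integral_le[OF hi ei])
    also have "\<dots> \<le> likbar n \<mu> y"
      unfolding likbar_def using ei li[OF y] lik_ge[OF _ y] by (intro integral_mono) (auto simp: sp)
    finally show ?thesis .
  qed
  interpret wb: prob_space "white_block N n" by (rule prob_space_white_block)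
  show "dominated_channel M (white_block N n) \<mu> (block_space N n) (block_space N n) (outs s n) (lik n) (likbar n \<mu>)"
  proof
    show "likbar n \<mu> \<in> borel_measurable (block_space N n)"
    proof -
      have "(\<lambda>(y, x). lik n x y) \<in> borel_measurable (block_space N n \<Otimes>\<^sub>M block_space N n)"
        using measurable_compose[OF measurable_pair_swap' lik_measurable] by (simp add: case_prod_unfold)
      then have "(\<lambda>(y, x). lik n x y) \<in> borel_measurable (block_space N n \<Otimes>\<^sub>M \<mu>)"
        by (simp add: measurable_cong_sets[OF sets_pair_measure_cong[OF refl st] refl])
      from \<mu>.borel_measurable_lebesgue_integral[OF this] show ?thesis by (simp add: likbar_def[abs_def])
    qed
    show "0 < likbar n \<mu> y" if "y \<in> space (block_space N n)" for y
      by (rule less_le_trans[OF exp_gt_zero lo[OF that]])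
    show "(\<integral>\<^sup>+x. ennreal (lik n x y) \<partial>\<mu>) = ennreal (likbar n \<mu> y)" if y: "y \<in> space (block_space N n)" for y
      unfolding likbar_def using li[OF y] lik_pos[OF _ y]
      by (intro nn_integral_eq_integral) (auto intro!: AE_I2 less_imp_le simp: sp)
  qed (use st outs_measurable lik_measurable lik_pos outs_law in \<open>auto simp: sets_white_block\<close>)
qed

lemma block_information_eq_mi:
  "block_information M N H W n \<mu> = prob_space.mutual_information (\<mu> \<Otimes>\<^sub>M M) (exp 1) (block_space N n) (block_space N n)
       fst (\<lambda>(x, \<omega>). outs 0 n x \<omega>)"
  by (simp add: block_information_def outs_0)

lemma Ws_energy: "integrable M (\<lambda>\<omega>. block_energy N n (Ws 0 n \<omega>))"
proof -
  have "block_energy N n (Ws 0 n \<omega>) = (\<Sum>k\<le>n. \<Sum>m<N. (cmod (W k \<omega> m))\<^sup>2)" for \<omega>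
    by (simp add: block_energy_def Ws_def)
  then show ?thesis by (simp only:) (rule Bochner_Integration.integrable_sum, rule Bochner_Integration.integrable_sum, rule W_square_integrable, simp)
qed

lemma rx_energy_nonneg: "0 \<le> rx_energy N n h x"
  unfolding rx_energy_def by (intro sum_nonneg) auto

text \<open>|a + w|^2 \<le> 2 |a|^2 + 2 |w|^2 separates signal and noise; for a fixed input the mean
  energy of the signal part is at most a constant times the input energy, which is then averaged
  over the input.\<close>

lemma out_energy_integrable:
  assumes \<mu>: "\<mu> \<in> energy_inputs N n"
  shows "integrable (\<mu> \<Otimes>\<^sub>M M) (\<lambda>p. block_energy N n (outs 0 n (fst p) (snd p)))"
proof -
  interpret dominated_channel M "white_block N n" \<mu> "block_space N n" "block_space N n" "outs 0 n" "lik n" "likbar n \<mu>"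
    by (rule dominated(1)[OF \<mu>])
  have ie: "integrable \<mu> (block_energy N n)" using \<mu> by (simp add: energy_inputs_def)
  define K where "K = (\<integral>\<omega>. block_energy N n (Ws 0 n \<omega>) \<partial>M)"
  have K0: "0 \<le> K" unfolding K_def by (intro integral_nonneg_AE AE_I2 block_energy_nonneg)
  have m: "(\<lambda>p. block_energy N n (outs 0 n (fst p) (snd p))) \<in> borel_measurable (\<mu> \<Otimes>\<^sub>M M)"
    by (rule measurable_compose[OF out_meas block_energy_measurable])
  have "(\<integral>\<^sup>+p. ennreal (block_energy N n (outs 0 n (fst p) (snd p))) \<partial>(\<mu> \<Otimes>\<^sub>M M)) =
     (\<integral>\<^sup>+x. \<integral>\<^sup>+\<omega>. ennreal (block_energy N n (outs 0 n x \<omega>)) \<partial>M \<partial>\<mu>)"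
    using m by (subst nn_integral_fst[symmetric]) auto
  also have "\<dots> \<le> (\<integral>\<^sup>+x. ennreal (2 * (gain_energy n * block_energy N n x) + 2 * K) \<partial>\<mu>)"
  proof (rule nn_integral_mono)
    fix x
    have "(\<integral>\<^sup>+\<omega>. ennreal (block_energy N n (outs 0 n x \<omega>)) \<partial>M) \<le>
       (\<integral>\<^sup>+\<omega>. ennreal (2 * rx_energy N n (\<lambda>k. H k \<omega>) x + 2 * block_energy N n (Ws 0 n \<omega>)) \<partial>M)"
    proof (intro nn_integral_mono ennreal_leI)
      fix \<omega>
      have "block_energy N n (outs 0 n x \<omega>) = (\<Sum>k\<le>n. \<Sum>m<N. (cmod (Ws 0 n \<omega> k m + gain N (H k \<omega>) m * x k m))\<^sup>2)"
        unfolding block_energy_def by (intro sum.cong refl) (auto simp: outs_eq Hs_def)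
      also have "\<dots> \<le> (\<Sum>k\<le>n. \<Sum>m<N. 2 * (cmod (gain N (H k \<omega>) m * x k m))\<^sup>2 + 2 * (cmod (Ws 0 n \<omega> k m))\<^sup>2)"
      proof (intro sum_mono)
        fix k m
        let ?a = "gain N (H k \<omega>) m * x k m" and ?w = "Ws 0 n \<omega> k m"
        have "(cmod (?w + ?a))\<^sup>2 \<le> (cmod ?w + cmod ?a)\<^sup>2" by (intro power_mono norm_triangle_ineq) auto
        also have "\<dots> \<le> 2 * (cmod ?a)\<^sup>2 + 2 * (cmod ?w)\<^sup>2"
          using sum_squares_bound[of "cmod ?w" "cmod ?a"] by (simp add: power2_sum)
        finally show "(cmod (?w + ?a))\<^sup>2 \<le> 2 * (cmod ?a)\<^sup>2 + 2 * (cmod ?w)\<^sup>2" .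
      qed
      also have "\<dots> = 2 * rx_energy N n (\<lambda>k. H k \<omega>) x + 2 * block_energy N n (Ws 0 n \<omega>)"
        by (simp add: rx_energy_def block_energy_def sum.distrib sum_distrib_left)
      finally show "block_energy N n (outs 0 n x \<omega>) \<le> 2 * rx_energy N n (\<lambda>k. H k \<omega>) x + 2 * block_energy N n (Ws 0 n \<omega>)" .
    qed
    also have "\<dots> = ennreal (\<integral>\<omega>. 2 * rx_energy N n (\<lambda>k. H k \<omega>) x + 2 * block_energy N n (Ws 0 n \<omega>) \<partial>M)"
    proof (rule nn_integral_eq_integral)
      show "integrable M (\<lambda>\<omega>. 2 * rx_energy N n (\<lambda>k. H k \<omega>) x + 2 * block_energy N n (Ws 0 n \<omega>))"
        by (intro Bochner_Integration.integrable_add integrable_mult_right rx_energy_integrable Ws_energy)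
      show "AE \<omega> in M. 0 \<le> 2 * rx_energy N n (\<lambda>k. H k \<omega>) x + 2 * block_energy N n (Ws 0 n \<omega>)"
        by (intro AE_I2 add_nonneg_nonneg mult_nonneg_nonneg rx_energy_nonneg block_energy_nonneg) simp_all
    qed
    also have "\<dots> \<le> ennreal (2 * (gain_energy n * block_energy N n x) + 2 * K)"
    proof (rule ennreal_leI)
      have "(\<integral>\<omega>. 2 * rx_energy N n (\<lambda>k. H k \<omega>) x + 2 * block_energy N n (Ws 0 n \<omega>) \<partial>M) =
        2 * (\<integral>\<omega>. rx_energy N n (\<lambda>k. H k \<omega>) x \<partial>M) + 2 * K"
        unfolding K_def using rx_energy_integrable[of n x] Ws_energy[of n]
        by (subst Bochner_Integration.integral_add) simp_all
      then show "(\<integral>\<omega>. 2 * rx_energy N n (\<lambda>k. H k \<omega>) x + 2 * block_energy N n (Ws 0 n \<omega>) \<partial>M) \<le>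
        2 * (gain_energy n * block_energy N n x) + 2 * K" using rx_energy_le[of n x] by simp
    qed
    finally show "(\<integral>\<^sup>+\<omega>. ennreal (block_energy N n (outs 0 n x \<omega>)) \<partial>M) \<le> ennreal (2 * (gain_energy n * block_energy N n x) + 2 * K)" .
  qed
  also have "\<dots> = ennreal (\<integral>x. 2 * (gain_energy n * block_energy N n x) + 2 * K \<partial>\<mu>)"
  proof (rule nn_integral_eq_integral)
    show "integrable \<mu> (\<lambda>x. 2 * (gain_energy n * block_energy N n x) + 2 * K)" using ie by simp
    show "AE x in \<mu>. 0 \<le> 2 * (gain_energy n * block_energy N n x) + 2 * K"
      using K0 by (intro AE_I2 add_nonneg_nonneg mult_nonneg_nonneg gain_energy_nonneg block_energy_nonneg) simp_all
  qed
  finally have "(\<integral>\<^sup>+p. ennreal (block_energy N n (outs 0 n (fst p) (snd p))) \<partial>(\<mu> \<Otimes>\<^sub>M M)) < \<infinity>"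
    by (rule le_less_trans) simp
  then show ?thesis using m block_energy_nonneg by (intro integrableI_nonneg) auto
qed

text \<open>The logarithms of \<open>lik\<close> and \<open>likbar\<close> both lie between minus
  the output energy, less a multiple of the input energy or of its mean, and plus the output energy.
  The majorant adds these bounds up.\<close>

lemma llr_integrable:
  assumes \<mu>: "\<mu> \<in> energy_inputs N n"
  shows "integrable (\<mu> \<Otimes>\<^sub>M M) (\<lambda>p. ln (lik n (fst p) (outs 0 n (fst p) (snd p)) / likbar n \<mu> (outs 0 n (fst p) (snd p))))"
proof -
  interpret dominated_channel M "white_block N n" \<mu> "block_space N n" "block_space N n" "outs 0 n" "lik n" "likbar n \<mu>"
    by (rule dominated(1)[OF \<mu>])
  have ie: "integrable \<mu> (block_energy N n)" using \<mu> by (simp add: energy_inputs_def)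
  have ie': "integrable (\<mu> \<Otimes>\<^sub>M M) (\<lambda>p. block_energy N n (fst p))"
    using ie by (intro integrable_distr[of fst _ \<mu>]) (simp_all add: distr_pair_fst)
  let ?y = "\<lambda>p. outs 0 n (fst p) (snd p)"
  let ?e = "\<integral>x. block_energy N n x \<partial>\<mu>"
  show ?thesis
  proof (rule Bochner_Integration.integrable_bound)
    show "integrable (\<mu> \<Otimes>\<^sub>M M) (\<lambda>p. 2 * block_energy N n (?y p) + 2 * gain_energy n * block_energy N n (fst p) + 2 * gain_energy n * ?e)"
      using out_energy_integrable[OF \<mu>] ie' by simp
    have jm: "(\<lambda>p. (fst p, ?y p)) \<in> \<mu> \<Otimes>\<^sub>M M \<rightarrow>\<^sub>M block_space N n \<Otimes>\<^sub>M block_space N n" by (rule pair_meas)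
    have "(\<lambda>p. ln (lik n (fst p) (snd p) / likbar n \<mu> (snd p))) \<in> borel_measurable (block_space N n \<Otimes>\<^sub>M block_space N n)"
      using f_measurable fbar_measurable unfolding case_prod_unfold by measurable
    from measurable_compose[OF jm this]
    show "(\<lambda>p. ln (lik n (fst p) (?y p) / likbar n \<mu> (?y p))) \<in> borel_measurable (\<mu> \<Otimes>\<^sub>M M)" by simp
    show "AE p in \<mu> \<Otimes>\<^sub>M M. norm (ln (lik n (fst p) (?y p) / likbar n \<mu> (?y p))) \<le>
       norm (2 * block_energy N n (?y p) + 2 * gain_energy n * block_energy N n (fst p) + 2 * gain_energy n * ?e)"
    proof (rule AE_I2)
      fix p assume "p \<in> space (\<mu> \<Otimes>\<^sub>M M)"
      from measurable_space[OF jm this]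
      have x: "fst p \<in> space (block_space N n)" and y: "?y p \<in> space (block_space N n)" by (auto simp: space_pair_measure)
      note a1 = lik_le[OF x y] and a2 = lik_ge[OF x y] and a3 = dominated(2)[OF \<mu> y] and a4 = dominated(3)[OF \<mu> y]
      have p1: "0 < lik n (fst p) (?y p)" "0 < likbar n \<mu> (?y p)" using lik_pos[OF x y] fbar_pos[OF y] by auto
      have b: "ln (lik n (fst p) (?y p)) \<le> block_energy N n (?y p)" "ln (likbar n \<mu> (?y p)) \<le> block_energy N n (?y p)"
        using a1 a3 p1 by (metis exp_gt_zero ln_exp ln_le_cancel_iff)+
      have c: "- block_energy N n (?y p) - 2 * gain_energy n * block_energy N n (fst p) \<le> ln (lik n (fst p) (?y p))"
         "- block_energy N n (?y p) - 2 * gain_energy n * ?e \<le> ln (likbar n \<mu> (?y p))"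
        using a2 a4 p1 by (metis exp_gt_zero ln_exp ln_le_cancel_iff)+
      have z: "0 \<le> 2 * gain_energy n * block_energy N n (fst p)" "0 \<le> 2 * gain_energy n * ?e" "0 \<le> block_energy N n (?y p)"
        using gain_energy_nonneg[of n] block_energy_nonneg by (auto intro!: mult_nonneg_nonneg integral_nonneg_AE)
      show "norm (ln (lik n (fst p) (?y p) / likbar n \<mu> (?y p))) \<le>
       norm (2 * block_energy N n (?y p) + 2 * gain_energy n * block_energy N n (fst p) + 2 * gain_energy n * ?e)"
      proof -
        have "ln (lik n (fst p) (?y p) / likbar n \<mu> (?y p)) = ln (lik n (fst p) (?y p)) - ln (likbar n \<mu> (?y p))"
          using p1 by (simp add: ln_div)
        then show ?thesis unfolding real_norm_def using b c z by linarith
      qed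
    qed
  qed
qed

lemma block_information_eq:
  assumes \<mu>: "\<mu> \<in> energy_inputs N n"
  shows "block_information M N H W n \<mu> =
    (\<integral>p. ln (lik n (fst p) (outs 0 n (fst p) (snd p)) / likbar n \<mu> (outs 0 n (fst p) (snd p))) \<partial>(\<mu> \<Otimes>\<^sub>M M))"
  unfolding block_information_eq_mi by (rule dominated_channel.mutual_information_eq[OF dominated(1)[OF \<mu>]])

lemma block_information_ge:
  assumes \<mu>: "\<mu> \<in> energy_inputs N n"
    and "(\<lambda>p. \<phi> (fst p) (snd p)) \<in> borel_measurable (block_space N n \<Otimes>\<^sub>M block_space N n)"
    and "\<And>x y. x \<in> space (block_space N n) \<Longrightarrow> y \<in> space (block_space N n) \<Longrightarrow> 0 < \<phi> x y"
    and "\<And>y. y \<in> space (block_space N n) \<Longrightarrow> (\<integral>\<^sup>+x. ennreal (\<phi> x y) \<partial>\<mu>) \<le> 1"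
    and "integrable (\<mu> \<Otimes>\<^sub>M M) (\<lambda>p. ln (\<phi> (fst p) (outs 0 n (fst p) (snd p))))"
  shows "(\<integral>p. ln (\<phi> (fst p) (outs 0 n (fst p) (snd p))) \<partial>(\<mu> \<Otimes>\<^sub>M M)) \<le> block_information M N H W n \<mu>"
  unfolding block_information_eq_mi
  by (rule dominated_channel.mutual_information_ge[OF dominated(1)[OF \<mu>, of 0], where \<phi> = \<phi>])
     (fact assms(2) assms(3) assms(4) llr_integrable[OF \<mu>] assms(5))+

text \<open>The constant guess 1 in Gibbs' inequality.\<close>

lemma block_information_nonneg:
  assumes \<mu>: "\<mu> \<in> energy_inputs N n"
  shows "0 \<le> block_information M N H W n \<mu>"
proof -
  have "prob_space \<mu>" using \<mu> by (simp add: energy_inputs_def input_laws_def)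
  then show ?thesis using block_information_ge[OF \<mu>, of "\<lambda>_ _. 1"] by (simp add: prob_space.emeasure_space_1)
qed

end

subsection \<open>Superadditivity of the block information\<close>

text \<open>Fekete's lemma for sets of attainable values. A block with last index \<open>n\<close>
  has \<open>n + 1\<close> times, so that joining blocks gives the last index
  \<open>m + n + 1\<close>. The limit may be infinite, hence \<open>ereal\<close>.\<close>

lemma superadditive_limit:
  fixes A :: "nat \<Rightarrow> real set" and c :: real
  assumes c: "0 < c"
    and sup: "\<And>m n u v. u \<in> A m \<Longrightarrow> v \<in> A n \<Longrightarrow> \<exists>w\<in>A (m + n + 1). u + v \<le> w"
    and ne: "\<And>n. \<exists>v\<in>A n. 0 \<le> v"
  shows "(\<lambda>n. SUP v\<in>A n. ereal (v / (c * real (n + 1)))) \<longlonglongrightarrow> (SUP n. SUP v\<in>A n. ereal (v / (c * real (n + 1))))"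
    (is "?u \<longlonglongrightarrow> ?S")
proof (rule order_tendstoI)
  fix a :: ereal assume "?S < a"
  then show "\<forall>\<^sub>F n in sequentially. ?u n < a"
    by (intro always_eventually allI) (meson SUP_upper UNIV_I le_less_trans)
next
  fix a :: ereal assume a: "a < ?S"
  then obtain n0 v0 where v0: "v0 \<in> A n0" and av: "a < ereal (v0 / (c * real (n0 + 1)))"
    by (auto simp: less_SUP_iff)
  \<comment> \<open>Length of a block whose rate exceeds \<open>a\<close>.\<close>
  define T where "T = n0 + 1"
  \<comment> \<open>\<open>q\<close> copies of the good block after a remainder with
    \<open>t + 1\<close> times, of which only a nonnegative value is demanded; the last index of the
    whole is \<open>q * T + t\<close>.\<close>
  have rep: "\<exists>v\<in>A (q * T + t). real q * v0 \<le> v" for q t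
  proof (induction q)
    case 0
    show ?case using ne[of t] by simp
  next
    case (Suc q)
    then obtain v where v: "v \<in> A (q * T + t)" "real q * v0 \<le> v" by auto
    from sup[OF v(1) v0] obtain w where w: "w \<in> A (q * T + t + n0 + 1)" "v + v0 \<le> w" by auto
    have e: "q * T + t + n0 + 1 = Suc q * T + t" by (simp add: T_def)
    from w v(2) show ?case unfolding e by (intro bexI[of _ w]) (auto simp: ring_distribs)
  qed
  have lb: "ereal (real (n div T) * v0 / (c * real (n + 1))) \<le> ?u n" for n
  proof -
    obtain v where v: "v \<in> A n" "real (n div T) * v0 \<le> v"
      using rep[of "n div T" "n mod T"] by auto
    have "real (n div T) * v0 / (c * real (n + 1)) \<le> v / (c * real (n + 1))"
      using v(2) c by (intro divide_right_mono) auto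
    also have "ereal (v / (c * real (n + 1))) \<le> ?u n" using v(1) by (rule SUP_upper)
    finally show ?thesis by simp
  qed
  have lim: "(\<lambda>n. real (n div T) * v0 / (c * real (n + 1))) \<longlonglongrightarrow> v0 / (c * real T)"
  proof -
    have d: "(\<lambda>n. real (n div T) / real (n + 1)) \<longlonglongrightarrow> 1 / real T"
    proof (rule tendsto_sandwich)
      have T: "0 < real T" by (simp add: T_def)
      have b: "real n / real T - 1 \<le> real (n div T)" "real (n div T) \<le> real n / real T" for n
      proof -
        have "real n = real (n div T) * real T + real (n mod T)"
          unfolding of_nat_mult[symmetric] of_nat_add[symmetric] by simp
        moreover have "real (n mod T) \<le> real T" using T by (simp add: less_imp_le)
        ultimately show "real n / real T - 1 \<le> real (n div T)" "real (n div T) \<le> real n / real T"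
          using T by (simp_all add: field_simps)
      qed
      show "\<forall>\<^sub>F n in sequentially. (real n / real T - 1) / real (n + 1) \<le> real (n div T) / real (n + 1)"
        using b(1) by (intro always_eventually allI divide_right_mono) auto
      show "\<forall>\<^sub>F n in sequentially. real (n div T) / real (n + 1) \<le> (real n / real T) / real (n + 1)"
        using b(2) by (intro always_eventually allI divide_right_mono) auto
      show "(\<lambda>n. (real n / real T - 1) / real (n + 1)) \<longlonglongrightarrow> 1 / real T"
        using T unfolding inverse_eq_divide[symmetric] by real_asymp
      show "(\<lambda>n. (real n / real T) / real (n + 1)) \<longlonglongrightarrow> 1 / real T"
        using T unfolding inverse_eq_divide[symmetric] by real_asymp
    qed
    have "(\<lambda>n. (v0 / c) * (real (n div T) / real (n + 1))) \<longlonglongrightarrow> (v0 / c) * (1 / real T)"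
      by (intro tendsto_mult d tendsto_const)
    then show ?thesis by (simp add: mult_ac)
  qed
  have "(\<lambda>n. ereal (real (n div T) * v0 / (c * real (n + 1)))) \<longlonglongrightarrow> ereal (v0 / (c * real T))"
    using lim by simp
  moreover have "a < ereal (v0 / (c * real T))" using av by (simp add: T_def)
  ultimately have "\<forall>\<^sub>F n in sequentially. a < ereal (real (n div T) * v0 / (c * real (n + 1)))"
    by (rule order_tendstoD)
  then show "\<forall>\<^sub>F n in sequentially. a < ?u n"
    by (rule eventually_mono) (rule less_le_trans[OF _ lb])
qed

lemma distr_pair_snd':
  assumes "prob_space A" "prob_space B"
  shows "distr (A \<Otimes>\<^sub>M B) B snd = B"
proof (rule measure_eqI)
  interpret A: prob_space A by fact
  interpret B: prob_space B by fact
  fix X assume "X \<in> sets (distr (A \<Otimes>\<^sub>M B) B snd)"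
  then have X: "X \<in> sets B" by simp
  have "snd -` X \<inter> space (A \<Otimes>\<^sub>M B) = space A \<times> X"
    using sets.sets_into_space[OF X] by (auto simp: space_pair_measure)
  then show "emeasure (distr (A \<Otimes>\<^sub>M B) B snd) X = emeasure B X"
    using X by (simp add: emeasure_distr B.emeasure_pair_measure_Times A.emeasure_space_1)
qed simp

definition block_join :: "nat \<Rightarrow> nat \<Rightarrow> (nat \<Rightarrow> nat \<Rightarrow> complex) \<times> (nat \<Rightarrow> nat \<Rightarrow> complex) \<Rightarrow> nat \<Rightarrow> nat \<Rightarrow> complex" where
  "block_join n1 n2 p = (\<lambda>k\<in>{..n1 + n2 + 1}. if k \<le> n1 then fst p k else snd p (k - (n1 + 1)))"

definition block_part :: "nat \<Rightarrow> nat \<Rightarrow> (nat \<Rightarrow> nat \<Rightarrow> complex) \<Rightarrow> nat \<Rightarrow> nat \<Rightarrow> complex" where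
  "block_part s n x = (\<lambda>k\<in>{..n}. x (k + s))"

lemma block_part_measurable: "n + s \<le> n' \<Longrightarrow> block_part s n \<in> block_space N n' \<rightarrow>\<^sub>M block_space N n"
  unfolding block_part_def[abs_def] block_space_def by (intro measurable_restrict measurable_component_singleton) auto

lemma block_join_measurable:
  "block_join n1 n2 \<in> block_space N n1 \<Otimes>\<^sub>M block_space N n2 \<rightarrow>\<^sub>M block_space N (n1 + n2 + 1)"
proof -
  have "(\<lambda>p. if k \<le> n1 then fst p k else snd p (k - (n1 + 1))) \<in> block_space N n1 \<Otimes>\<^sub>M block_space N n2 \<rightarrow>\<^sub>M vec_space N"
    if "k \<le> n1 + n2 + 1" for k
  proof (cases "k \<le> n1")
    case True
    then show ?thesis using measurable_compose[OF measurable_fst block_row[OF True, of N]] by simp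
  next
    case False
    then have "k - (n1 + 1) \<le> n2" using that by auto
    from measurable_compose[OF measurable_snd block_row[OF this, of N]] False show ?thesis by simp
  qed
  then show ?thesis unfolding block_join_def[abs_def] block_space_def[of N "n1 + n2 + 1"]
    by (intro measurable_restrict) simp
qed

lemma block_part_join:
  assumes "x1 \<in> space (block_space N n1)" "x2 \<in> space (block_space N n2)"
  shows "block_part 0 n1 (block_join n1 n2 (x1, x2)) = x1"
    "block_part (n1 + 1) n2 (block_join n1 n2 (x1, x2)) = x2"
  using assms by (auto simp: block_part_def block_join_def space_block_space PiE_iff extensional_def fun_eq_iff restrict_def)

context ofdm_channel
begin

text \<open>The channel acts on each time separately, so a part of the output is the output for the
  same part of the input, with fading and noise from the shifted window.\<close>

lemma outs_part:
  assumes "n + s \<le> n'"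
  shows "block_part s n (outs 0 n' x \<omega>) = outs s n (block_part s n x) \<omega>"
  using assms by (auto simp: block_part_def outs_def channel_output_def fun_eq_iff restrict_def)

text \<open>The joint law of input and output window has the density \<open>lik n\<close> whatever
  the starting time, so a block sent later yields the same expected log-likelihoods.\<close>

lemma expectation_outs:
  assumes \<mu>: "\<mu> \<in> energy_inputs N n"
    and g: "g \<in> borel_measurable (block_space N n \<Otimes>\<^sub>M block_space N n)"
  shows "(\<integral>p. g (fst p, outs s n (fst p) (snd p)) \<partial>(\<mu> \<Otimes>\<^sub>M M)) = (\<integral>p. g (fst p, outs 0 n (fst p) (snd p)) \<partial>(\<mu> \<Otimes>\<^sub>M M) :: real)"
    "integrable (\<mu> \<Otimes>\<^sub>M M) (\<lambda>p. g (fst p, outs s n (fst p) (snd p))) = integrable (\<mu> \<Otimes>\<^sub>M M) (\<lambda>p. g (fst p, outs 0 n (fst p) (snd p)))"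
proof -
  have d: "distr (\<mu> \<Otimes>\<^sub>M M) (block_space N n \<Otimes>\<^sub>M block_space N n) (\<lambda>p. (fst p, outs s n (fst p) (snd p))) =
     density (\<mu> \<Otimes>\<^sub>M white_block N n) (\<lambda>p. ennreal (lik n (fst p) (snd p)))" for s
    by (rule dominated_channel.distr_joint[OF dominated(1)[OF \<mu>]])
  have m: "(\<lambda>p. (fst p, outs s n (fst p) (snd p))) \<in> \<mu> \<Otimes>\<^sub>M M \<rightarrow>\<^sub>M block_space N n \<Otimes>\<^sub>M block_space N n" for s
    by (rule dominated_channel.pair_meas[OF dominated(1)[OF \<mu>]])
  show "(\<integral>p. g (fst p, outs s n (fst p) (snd p)) \<partial>(\<mu> \<Otimes>\<^sub>M M)) = (\<integral>p. g (fst p, outs 0 n (fst p) (snd p)) \<partial>(\<mu> \<Otimes>\<^sub>M M))"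
    using integral_distr[OF m g, of s] integral_distr[OF m g, of 0] by (simp add: d)
  show "integrable (\<mu> \<Otimes>\<^sub>M M) (\<lambda>p. g (fst p, outs s n (fst p) (snd p))) = integrable (\<mu> \<Otimes>\<^sub>M M) (\<lambda>p. g (fst p, outs 0 n (fst p) (snd p)))"
    using integrable_distr_eq[OF m g, of s] integrable_distr_eq[OF m g, of 0] by (simp add: d)
qed

text \<open>Gibbs' inequality with the product of the likelihood ratios of the two halves as the
  guess. This guess ignores the correlation of the fading across the halves, which is why only an
  inequality results.\<close>

lemma block_information_join:
  assumes \<mu>1: "\<mu>1 \<in> energy_inputs N n1" and \<mu>2: "\<mu>2 \<in> energy_inputs N n2"
  defines "\<mu> \<equiv> distr (\<mu>1 \<Otimes>\<^sub>M \<mu>2) (block_space N (n1 + n2 + 1)) (block_join n1 n2)"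
  assumes \<mu>: "\<mu> \<in> energy_inputs N (n1 + n2 + 1)"
  shows "block_information M N H W n1 \<mu>1 + block_information M N H W n2 \<mu>2 \<le> block_information M N H W (n1 + n2 + 1) \<mu>"
proof -
  define n where "n = n1 + n2 + 1"
  note \<mu>' = \<mu>[folded n_def] and \<mu>d = \<mu>_def[folded n_def]
  define t where "t = n1 + 1"
  interpret d1: dominated_channel M "white_block N n1" \<mu>1 "block_space N n1" "block_space N n1" "outs 0 n1" "lik n1" "likbar n1 \<mu>1"
    by (rule dominated(1)[OF \<mu>1])
  interpret d2: dominated_channel M "white_block N n2" \<mu>2 "block_space N n2" "block_space N n2" "outs 0 n2" "lik n2" "likbar n2 \<mu>2"
    by (rule dominated(1)[OF \<mu>2])
  interpret p12: pair_prob_space \<mu>1 \<mu>2 ..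
  interpret \<mu>: prob_space \<mu> using \<mu>' by (simp add: energy_inputs_def input_laws_def)
  have s1: "sets \<mu>1 = sets (block_space N n1)" and s2: "sets \<mu>2 = sets (block_space N n2)" by (rule d1.sets_input, rule d2.sets_input)
  have jm: "block_join n1 n2 \<in> \<mu>1 \<Otimes>\<^sub>M \<mu>2 \<rightarrow>\<^sub>M block_space N n"
    using block_join_measurable[of n1 n2 N, folded n_def] by (simp add: measurable_cong_sets[OF sets_pair_measure_cong[OF s1 s2] refl])
  have sj: "x1 \<in> space (block_space N n1)" "x2 \<in> space (block_space N n2)" if "(x1, x2) \<in> space (\<mu>1 \<Otimes>\<^sub>M \<mu>2)" for x1 x2
    using that by (auto simp: space_pair_measure d1.space_input d2.space_input)
  have q1: "block_part 0 n1 \<in> block_space N n \<rightarrow>\<^sub>M block_space N n1" and q2: "block_part t n2 \<in> block_space N n \<rightarrow>\<^sub>M block_space N n2"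
    by (auto intro!: block_part_measurable simp: t_def n_def)
  define R1 where "R1 x y = lik n1 x y / likbar n1 \<mu>1 y" for x y
  define R2 where "R2 x y = lik n2 x y / likbar n2 \<mu>2 y" for x y
  have R1m: "(\<lambda>p. R1 (fst p) (snd p)) \<in> borel_measurable (block_space N n1 \<Otimes>\<^sub>M block_space N n1)"
    using d1.f_measurable d1.fbar_measurable unfolding R1_def case_prod_unfold by measurable
  have R2m: "(\<lambda>p. R2 (fst p) (snd p)) \<in> borel_measurable (block_space N n2 \<Otimes>\<^sub>M block_space N n2)"
    using d2.f_measurable d2.fbar_measurable unfolding R2_def case_prod_unfold by measurable
  have R1p: "0 < R1 x y" if "x \<in> space (block_space N n1)" "y \<in> space (block_space N n1)" for x y
    using d1.f_pos[OF that] d1.fbar_pos[OF that(2)] by (simp add: R1_def)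
  have R2p: "0 < R2 x y" if "x \<in> space (block_space N n2)" "y \<in> space (block_space N n2)" for x y
    using d2.f_pos[OF that] d2.fbar_pos[OF that(2)] by (simp add: R2_def)
  have R1x: "(\<lambda>x. R1 x y) \<in> borel_measurable \<mu>1" if "y \<in> space (block_space N n1)" for y
    using measurable_compose[OF measurable_Pair2'[OF that] R1m] by (simp add: measurable_cong_sets[OF s1 refl])
  have R2x: "(\<lambda>x. R2 x y) \<in> borel_measurable \<mu>2" if "y \<in> space (block_space N n2)" for y
    using measurable_compose[OF measurable_Pair2'[OF that] R2m] by (simp add: measurable_cong_sets[OF s2 refl])
  have I1: "(\<integral>\<^sup>+x. ennreal (R1 x y) \<partial>\<mu>1) = 1" if y: "y \<in> space (block_space N n1)" for y
  proof -
    have "(\<lambda>x. lik n1 x y) \<in> borel_measurable \<mu>1"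
      using measurable_compose[OF measurable_Pair2'[OF y] d1.f_measurable] by (simp add: measurable_cong_sets[OF s1 refl])
    then have "(\<integral>\<^sup>+x. ennreal (R1 x y) \<partial>\<mu>1) = (\<integral>\<^sup>+x. ennreal (lik n1 x y) \<partial>\<mu>1) / ennreal (likbar n1 \<mu>1 y)"
      unfolding R1_def using d1.fbar_pos[OF y] d1.f_pos[OF _ y]
      by (subst nn_integral_divide[symmetric]) (auto intro!: nn_integral_cong simp: divide_ennreal less_imp_le d1.space_input)
    also have "\<dots> = 1" using d1.fbar_pos[OF y] by (simp add: d1.fbar_eq[OF y] divide_ennreal)
    finally show ?thesis .
  qed
  have I2: "(\<integral>\<^sup>+x. ennreal (R2 x y) \<partial>\<mu>2) = 1" if y: "y \<in> space (block_space N n2)" for y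
  proof -
    have "(\<lambda>x. lik n2 x y) \<in> borel_measurable \<mu>2"
      using measurable_compose[OF measurable_Pair2'[OF y] d2.f_measurable] by (simp add: measurable_cong_sets[OF s2 refl])
    then have "(\<integral>\<^sup>+x. ennreal (R2 x y) \<partial>\<mu>2) = (\<integral>\<^sup>+x. ennreal (lik n2 x y) \<partial>\<mu>2) / ennreal (likbar n2 \<mu>2 y)"
      unfolding R2_def using d2.fbar_pos[OF y] d2.f_pos[OF _ y]
      by (subst nn_integral_divide[symmetric]) (auto intro!: nn_integral_cong simp: divide_ennreal less_imp_le d2.space_input)
    also have "\<dots> = 1" using d2.fbar_pos[OF y] by (simp add: d2.fbar_eq[OF y] divide_ennreal)
    finally show ?thesis .
  qed
  define \<phi> where "\<phi> x y = R1 (block_part 0 n1 x) (block_part 0 n1 y) * R2 (block_part t n2 x) (block_part t n2 y)" for x y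
  have ps: "block_part 0 n1 x \<in> space (block_space N n1)" "block_part t n2 x \<in> space (block_space N n2)"
    if "x \<in> space (block_space N n)" for x
    using measurable_space[OF q1 that] measurable_space[OF q2 that] .
  \<comment> \<open>Cutting the concatenated input recovers the two factors, so the mean of a
    function of one half under \<open>\<mu>\<close> is its mean under \<open>\<mu>1\<close> or
    \<open>\<mu>2\<close>.\<close>
  have A1: "distr (\<mu> \<Otimes>\<^sub>M M) (\<mu>1 \<Otimes>\<^sub>M M) (\<lambda>p. (block_part 0 n1 (fst p), snd p)) = \<mu>1 \<Otimes>\<^sub>M M"
    and A2: "distr (\<mu> \<Otimes>\<^sub>M M) (\<mu>2 \<Otimes>\<^sub>M M) (\<lambda>p. (block_part t n2 (fst p), snd p)) = \<mu>2 \<Otimes>\<^sub>M M"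
  proof -
    have m1: "block_part 0 n1 \<in> \<mu> \<rightarrow>\<^sub>M \<mu>1" "block_part t n2 \<in> \<mu> \<rightarrow>\<^sub>M \<mu>2"
      using q1 q2 by (simp_all add: \<mu>d measurable_cong_sets[OF refl s1] measurable_cong_sets[OF refl s2])
    have e1: "distr \<mu> \<mu>1 (block_part 0 n1) = \<mu>1"
    proof -
      have "distr \<mu> \<mu>1 (block_part 0 n1) = distr (\<mu>1 \<Otimes>\<^sub>M \<mu>2) \<mu>1 (block_part 0 n1 \<circ> block_join n1 n2)"
        unfolding \<mu>d using jm q1 by (subst distr_distr) (auto simp: measurable_cong_sets[OF refl s1])
      also have "\<dots> = distr (\<mu>1 \<Otimes>\<^sub>M \<mu>2) \<mu>1 fst"
      proof (rule distr_cong)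
        fix p assume "p \<in> space (\<mu>1 \<Otimes>\<^sub>M \<mu>2)"
        then show "(block_part 0 n1 \<circ> block_join n1 n2) p = fst p"
          using sj[of "fst p" "snd p"] block_part_join(1)[of "fst p" N n1 "snd p" n2] by simp
      qed simp_all
      finally show ?thesis by (simp add: d2.input.distr_pair_fst)
    qed
    have e2: "distr \<mu> \<mu>2 (block_part t n2) = \<mu>2"
    proof -
      have "distr \<mu> \<mu>2 (block_part t n2) = distr (\<mu>1 \<Otimes>\<^sub>M \<mu>2) \<mu>2 (block_part t n2 \<circ> block_join n1 n2)"
        unfolding \<mu>d using jm q2 by (subst distr_distr) (auto simp: measurable_cong_sets[OF refl s2])
      also have "\<dots> = distr (\<mu>1 \<Otimes>\<^sub>M \<mu>2) \<mu>2 snd"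
      proof (rule distr_cong)
        fix p assume "p \<in> space (\<mu>1 \<Otimes>\<^sub>M \<mu>2)"
        then show "(block_part t n2 \<circ> block_join n1 n2) p = snd p"
          using sj[of "fst p" "snd p"] block_part_join(2)[of "fst p" N n1 "snd p" n2, folded t_def] by simp
      qed simp_all
      also have "\<dots> = \<mu>2" by (rule distr_pair_snd'[OF d1.input.prob_space_axioms d2.input.prob_space_axioms])
      finally show ?thesis .
    qed
    have sf: "sigma_finite_measure (distr M M (\<lambda>x. x))" by (simp add: sigma_finite_measure_axioms)
    show "distr (\<mu> \<Otimes>\<^sub>M M) (\<mu>1 \<Otimes>\<^sub>M M) (\<lambda>p. (block_part 0 n1 (fst p), snd p)) = \<mu>1 \<Otimes>\<^sub>M M"
      using pair_measure_distr[OF m1(1) measurable_ident_sets[OF refl, of M] sf] by (simp add: e1 case_prod_unfold)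
    show "distr (\<mu> \<Otimes>\<^sub>M M) (\<mu>2 \<Otimes>\<^sub>M M) (\<lambda>p. (block_part t n2 (fst p), snd p)) = \<mu>2 \<Otimes>\<^sub>M M"
      using pair_measure_distr[OF m1(2) measurable_ident_sets[OF refl, of M] sf] by (simp add: e2 case_prod_unfold)
  qed
  have jm0: "(\<lambda>p. (fst p, outs s n (fst p) (snd p))) \<in> \<nu> \<Otimes>\<^sub>M M \<rightarrow>\<^sub>M block_space N n \<Otimes>\<^sub>M block_space N n"
    if "\<nu> \<in> energy_inputs N n" for \<nu> s n
    by (rule dominated_channel.pair_meas[OF dominated(1)[OF that]])
  define F1 where "F1 p = ln (R1 (fst p) (outs 0 n1 (fst p) (snd p)))" for p
  define F2 where "F2 p = ln (R2 (fst p) (outs t n2 (fst p) (snd p)))" for p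
  have L1: "(\<lambda>p. ln (R1 (fst p) (snd p))) \<in> borel_measurable (block_space N n1 \<Otimes>\<^sub>M block_space N n1)"
    and L2: "(\<lambda>p. ln (R2 (fst p) (snd p))) \<in> borel_measurable (block_space N n2 \<Otimes>\<^sub>M block_space N n2)"
    using R1m R2m by (auto intro: borel_measurable_ln)
  have F1m: "F1 \<in> borel_measurable (\<mu>1 \<Otimes>\<^sub>M M)" and F2m: "F2 \<in> borel_measurable (\<mu>2 \<Otimes>\<^sub>M M)"
    using measurable_compose[OF jm0[OF \<mu>1] L1, of 0] measurable_compose[OF jm0[OF \<mu>2] L2, of t]
    by (simp_all add: F1_def[abs_def] F2_def[abs_def])
  have F1i: "integrable (\<mu>1 \<Otimes>\<^sub>M M) F1" "(\<integral>p. F1 p \<partial>(\<mu>1 \<Otimes>\<^sub>M M)) = block_information M N H W n1 \<mu>1"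
    using llr_integrable[OF \<mu>1] block_information_eq[OF \<mu>1] by (simp_all add: F1_def[abs_def] R1_def)
  \<comment> \<open>The second half uses the window beginning at \<open>t\<close>; by time
    invariance its expected log-likelihood ratio is the one at time 0.\<close>
  have F2i: "integrable (\<mu>2 \<Otimes>\<^sub>M M) F2" "(\<integral>p. F2 p \<partial>(\<mu>2 \<Otimes>\<^sub>M M)) = block_information M N H W n2 \<mu>2"
    using llr_integrable[OF \<mu>2] block_information_eq[OF \<mu>2] expectation_outs[OF \<mu>2 L2, of t]
    by (simp_all add: F2_def[abs_def] R2_def)
  define G1 where "G1 p = F1 (block_part 0 n1 (fst p), snd p)" for p
  define G2 where "G2 p = F2 (block_part t n2 (fst p), snd p)" for p
  have m1: "(\<lambda>p. (block_part 0 n1 (fst p), snd p)) \<in> \<mu> \<Otimes>\<^sub>M M \<rightarrow>\<^sub>M \<mu>1 \<Otimes>\<^sub>M M"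
    and m2: "(\<lambda>p. (block_part t n2 (fst p), snd p)) \<in> \<mu> \<Otimes>\<^sub>M M \<rightarrow>\<^sub>M \<mu>2 \<Otimes>\<^sub>M M"
  proof -
    have "block_part 0 n1 \<in> \<mu> \<rightarrow>\<^sub>M \<mu>1" "block_part t n2 \<in> \<mu> \<rightarrow>\<^sub>M \<mu>2"
      using q1 q2 by (simp_all add: \<mu>d measurable_cong_sets[OF refl s1] measurable_cong_sets[OF refl s2])
    then show "(\<lambda>p. (block_part 0 n1 (fst p), snd p)) \<in> \<mu> \<Otimes>\<^sub>M M \<rightarrow>\<^sub>M \<mu>1 \<Otimes>\<^sub>M M"
      "(\<lambda>p. (block_part t n2 (fst p), snd p)) \<in> \<mu> \<Otimes>\<^sub>M M \<rightarrow>\<^sub>M \<mu>2 \<Otimes>\<^sub>M M"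
      by (auto intro!: measurable_Pair intro: measurable_compose[OF measurable_fst])
  qed
  have G1i: "integrable (\<mu> \<Otimes>\<^sub>M M) G1" "(\<integral>p. G1 p \<partial>(\<mu> \<Otimes>\<^sub>M M)) = block_information M N H W n1 \<mu>1"
    using integrable_distr_eq[OF m1 F1m] integral_distr[OF m1 F1m] F1i by (simp_all add: A1 G1_def[abs_def])
  have G2i: "integrable (\<mu> \<Otimes>\<^sub>M M) G2" "(\<integral>p. G2 p \<partial>(\<mu> \<Otimes>\<^sub>M M)) = block_information M N H W n2 \<mu>2"
    using integrable_distr_eq[OF m2 F2m] integral_distr[OF m2 F2m] F2i by (simp_all add: A2 G2_def[abs_def])
  have om: "(\<lambda>p. (fst p, outs 0 n (fst p) (snd p))) \<in> \<mu> \<Otimes>\<^sub>M M \<rightarrow>\<^sub>M block_space N n \<Otimes>\<^sub>M block_space N n"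
    by (rule jm0[OF \<mu>'])
  have ln\<phi>: "ln (\<phi> (fst p) (outs 0 n (fst p) (snd p))) = G1 p + G2 p" if p: "p \<in> space (\<mu> \<Otimes>\<^sub>M M)" for p
  proof -
    from measurable_space[OF om p] have x: "fst p \<in> space (block_space N n)" and y: "outs 0 n (fst p) (snd p) \<in> space (block_space N n)"
      by (auto simp: space_pair_measure)
    have o1: "block_part 0 n1 (outs 0 n (fst p) (snd p)) = outs 0 n1 (block_part 0 n1 (fst p)) (snd p)"
      by (rule outs_part) (simp add: t_def n_def)
    have o2: "block_part t n2 (outs 0 n (fst p) (snd p)) = outs t n2 (block_part t n2 (fst p)) (snd p)"
      by (rule outs_part) (simp add: t_def n_def)
    show ?thesis
      using R1p[OF ps(1)[OF x] ps(1)[OF y]] R2p[OF ps(2)[OF x] ps(2)[OF y]]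
      unfolding \<phi>_def o1 o2 by (simp add: ln_mult G1_def G2_def F1_def F2_def)
  qed
  have "block_information M N H W n1 \<mu>1 + block_information M N H W n2 \<mu>2 = (\<integral>p. G1 p + G2 p \<partial>(\<mu> \<Otimes>\<^sub>M M))"
    using G1i G2i by simp
  also have "\<dots> = (\<integral>p. ln (\<phi> (fst p) (outs 0 n (fst p) (snd p))) \<partial>(\<mu> \<Otimes>\<^sub>M M))"
    by (intro Bochner_Integration.integral_cong refl) (simp add: ln\<phi>)
  also have "\<dots> \<le> block_information M N H W n \<mu>"
  proof (rule block_information_ge[OF \<mu>'])
    show pm: "(\<lambda>p. \<phi> (fst p) (snd p)) \<in> borel_measurable (block_space N n \<Otimes>\<^sub>M block_space N n)"
    proof -
      have "(\<lambda>p. (block_part 0 n1 (fst p), block_part 0 n1 (snd p))) \<in> block_space N n \<Otimes>\<^sub>M block_space N n \<rightarrow>\<^sub>M block_space N n1 \<Otimes>\<^sub>M block_space N n1"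
        "(\<lambda>p. (block_part t n2 (fst p), block_part t n2 (snd p))) \<in> block_space N n \<Otimes>\<^sub>M block_space N n \<rightarrow>\<^sub>M block_space N n2 \<Otimes>\<^sub>M block_space N n2"
        using q1 q2 by (auto intro!: measurable_Pair intro: measurable_compose[OF measurable_fst] measurable_compose[OF measurable_snd])
      from measurable_compose[OF this(1) R1m] measurable_compose[OF this(2) R2m]
      show ?thesis unfolding \<phi>_def by (intro borel_measurable_times) simp_all
    qed
    show "0 < \<phi> x y" if "x \<in> space (block_space N n)" "y \<in> space (block_space N n)" for x y
      unfolding \<phi>_def using R1p R2p ps[OF that(1)] ps[OF that(2)] by (intro mult_pos_pos) auto
    show "(\<integral>\<^sup>+x. ennreal (\<phi> x y) \<partial>\<mu>) \<le> 1" if y: "y \<in> space (block_space N n)" for y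
    proof -
      \<comment> \<open>The halves of the input are independent, so the average of the guess
        factors, and each likelihood ratio has input average 1.\<close>
      let ?y1 = "block_part 0 n1 y" and ?y2 = "block_part t n2 y"
      have "(\<lambda>x. ennreal (\<phi> x y)) \<in> borel_measurable (block_space N n)"
        using measurable_compose[OF measurable_compose[OF measurable_Pair2'[OF y] pm] measurable_ennreal] by simp
      then have "(\<integral>\<^sup>+x. ennreal (\<phi> x y) \<partial>\<mu>) = (\<integral>\<^sup>+p. ennreal (\<phi> (block_join n1 n2 p) y) \<partial>(\<mu>1 \<Otimes>\<^sub>M \<mu>2))"
        unfolding \<mu>d using jm by (subst nn_integral_distr) auto
      also have "\<dots> = (\<integral>\<^sup>+p. ennreal (R1 (fst p) ?y1) * ennreal (R2 (snd p) ?y2) \<partial>(\<mu>1 \<Otimes>\<^sub>M \<mu>2))"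
      proof (rule nn_integral_cong)
        fix p assume "p \<in> space (\<mu>1 \<Otimes>\<^sub>M \<mu>2)"
        with sj[of "fst p" "snd p"] have s: "fst p \<in> space (block_space N n1)" "snd p \<in> space (block_space N n2)" by auto
        have "\<phi> (block_join n1 n2 p) y = R1 (fst p) ?y1 * R2 (snd p) ?y2"
          unfolding \<phi>_def using block_part_join[OF s, folded t_def] by simp
        then show "ennreal (\<phi> (block_join n1 n2 p) y) = ennreal (R1 (fst p) ?y1) * ennreal (R2 (snd p) ?y2)"
          using R1p[OF s(1) ps(1)[OF y]] by (simp add: ennreal_mult' less_imp_le)
      qed
      also have "\<dots> = (\<integral>\<^sup>+x1. \<integral>\<^sup>+x2. ennreal (R1 x1 ?y1) * ennreal (R2 x2 ?y2) \<partial>\<mu>2 \<partial>\<mu>1)"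
        using measurable_compose[OF measurable_fst R1x[OF ps(1)[OF y]], of \<mu>2] measurable_compose[OF measurable_snd R2x[OF ps(2)[OF y]], of \<mu>1]
        by (subst d2.input.nn_integral_fst[symmetric]) (auto intro!: borel_measurable_times_ennreal)
      also have "\<dots> = (\<integral>\<^sup>+x1. ennreal (R1 x1 ?y1) \<partial>\<mu>1)"
        using R2x[OF ps(2)[OF y]] by (subst nn_integral_cmult) (auto simp: I2[OF ps(2)[OF y]])
      also have "\<dots> = 1" by (rule I1[OF ps(1)[OF y]])
      finally show ?thesis by simp
    qed
    show "integrable (\<mu> \<Otimes>\<^sub>M M) (\<lambda>p. ln (\<phi> (fst p) (outs 0 n (fst p) (snd p))))"
      using Bochner_Integration.integrable_add[OF G1i(1) G2i(1)] by (simp add: ln\<phi> cong: Bochner_Integration.integrable_cong)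
  qed
  finally show ?thesis by (simp only: n_def)
qed

end

section \<open>Stability of the power constraints under concatenation\<close>

lemma block_energy_tx_power: "block_energy N n x = (\<Sum>k\<le>n. tx_power N (x k))"
  by (simp add: block_energy_def tx_power_def)

lemma tx_power_measurable: "tx_power N \<in> borel_measurable (vec_space N)"
  unfolding tx_power_def[abs_def]
  by (intro borel_measurable_sum borel_measurable_power measurable_compose[OF _ borel_measurable_norm] vec_component) auto

lemma tx_power_nonneg: "0 \<le> tx_power N x"
  unfolding tx_power_def by (intro sum_nonneg) auto

lemma tx_power_row_measurable: "k \<le> n \<Longrightarrow> (\<lambda>x. tx_power N (x k)) \<in> borel_measurable (block_space N n)"
  using measurable_compose[OF block_row tx_power_measurable] by simp

lemma peak_inputs_energy: "peak_inputs N px n \<subseteq> energy_inputs N n"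
proof
  fix \<mu> assume \<mu>: "\<mu> \<in> peak_inputs N px n"
  then have il: "\<mu> \<in> input_laws N n" and ae: "\<And>k. k \<le> n \<Longrightarrow> AE x in \<mu>. tx_power N (x k) \<le> real N * px"
    by (auto simp: peak_inputs_def)
  then interpret prob_space \<mu> by (simp add: input_laws_def)
  have st: "sets \<mu> = sets (block_space N n)" using il by (simp add: input_laws_def)
  have "integrable \<mu> (\<lambda>x. tx_power N (x k))" if k: "k \<le> n" for k
  proof (rule integrable_const_bound[of _ "real N * px"])
    show "AE x in \<mu>. norm (tx_power N (x k)) \<le> real N * px" using ae[OF k] by (simp add: tx_power_nonneg)
    show "(\<lambda>x. tx_power N (x k)) \<in> borel_measurable \<mu>"
      using tx_power_row_measurable[OF k, of N] by (simp add: measurable_cong_sets[OF st refl])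
  qed
  then show "\<mu> \<in> energy_inputs N n"
    using il by (auto simp: energy_inputs_def block_energy_tx_power[abs_def] intro!: Bochner_Integration.integrable_sum)
qed

lemma quadratic_inputs_energy: "quadratic_inputs N px \<alpha> n \<subseteq> energy_inputs N n"
proof
  fix \<mu> assume \<mu>: "\<mu> \<in> quadratic_inputs N px \<alpha> n"
  then have il: "\<mu> \<in> input_laws N n" and le: "\<And>k. k \<le> n \<Longrightarrow> (\<integral>\<^sup>+x. ennreal (tx_power N (x k)) \<partial>\<mu>) \<le> ennreal (real N * px)"
    by (auto simp: quadratic_inputs_def)
  have st: "sets \<mu> = sets (block_space N n)" using il by (simp add: input_laws_def)
  have "integrable \<mu> (\<lambda>x. tx_power N (x k))" if k: "k \<le> n" for k
  proof (rule integrableI_nonneg)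
    show "(\<lambda>x. tx_power N (x k)) \<in> borel_measurable \<mu>"
      using tx_power_row_measurable[OF k, of N] by (simp add: measurable_cong_sets[OF st refl])
    show "AE x in \<mu>. 0 \<le> tx_power N (x k)" by (simp add: tx_power_nonneg)
    show "(\<integral>\<^sup>+x. ennreal (tx_power N (x k)) \<partial>\<mu>) < \<infinity>" by (rule le_less_trans[OF le[OF k]]) simp
  qed
  then show "\<mu> \<in> energy_inputs N n"
    using il by (auto simp: energy_inputs_def block_energy_tx_power[abs_def] intro!: Bochner_Integration.integrable_sum)
qed

text \<open>Formulated for integrals of a single row because both power constraints can be expressed
  by such integrals.\<close>

lemma join_input_laws:
  assumes "\<mu>1 \<in> input_laws N n1" "\<mu>2 \<in> input_laws N n2"
  defines "\<mu> \<equiv> distr (\<mu>1 \<Otimes>\<^sub>M \<mu>2) (block_space N (n1 + n2 + 1)) (block_join n1 n2)"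
  shows "\<mu> \<in> input_laws N (n1 + n2 + 1)"
    and "\<And>g k. g \<in> borel_measurable (vec_space N) \<Longrightarrow> k \<le> n1 + n2 + 1 \<Longrightarrow>
       (\<integral>\<^sup>+x. g (x k) \<partial>\<mu>) = (if k \<le> n1 then (\<integral>\<^sup>+x. g (x k) \<partial>\<mu>1) else (\<integral>\<^sup>+x. g (x (k - (n1 + 1))) \<partial>\<mu>2))"
proof -
  interpret p1: prob_space \<mu>1 using assms by (simp add: input_laws_def)
  interpret p2: prob_space \<mu>2 using assms by (simp add: input_laws_def)
  interpret pp: pair_prob_space \<mu>1 \<mu>2 ..
  have s1: "sets \<mu>1 = sets (block_space N n1)" and s2: "sets \<mu>2 = sets (block_space N n2)"
    using assms by (auto simp: input_laws_def)
  have jm: "block_join n1 n2 \<in> \<mu>1 \<Otimes>\<^sub>M \<mu>2 \<rightarrow>\<^sub>M block_space N (n1 + n2 + 1)"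
    using block_join_measurable by (simp add: measurable_cong_sets[OF sets_pair_measure_cong[OF s1 s2] refl])
  show "\<mu> \<in> input_laws N (n1 + n2 + 1)"
    using pp.prob_space_distr[OF jm] by (simp add: \<mu>_def input_laws_def)
  fix g :: "(nat \<Rightarrow> complex) \<Rightarrow> ennreal" and k
  assume g: "g \<in> borel_measurable (vec_space N)" and k: "k \<le> n1 + n2 + 1"
  have gk: "(\<lambda>x. g (x k)) \<in> borel_measurable (block_space N (n1 + n2 + 1))"
    by (rule measurable_compose[OF block_row[OF k] g])
  have e: "(\<integral>\<^sup>+x. g (x k) \<partial>\<mu>) = (\<integral>\<^sup>+p. g (if k \<le> n1 then fst p k else snd p (k - (n1 + 1))) \<partial>(\<mu>1 \<Otimes>\<^sub>M \<mu>2))"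
    unfolding \<mu>_def using jm gk k by (subst nn_integral_distr) (auto simp: block_join_def)
  show "(\<integral>\<^sup>+x. g (x k) \<partial>\<mu>) = (if k \<le> n1 then (\<integral>\<^sup>+x. g (x k) \<partial>\<mu>1) else (\<integral>\<^sup>+x. g (x (k - (n1 + 1))) \<partial>\<mu>2))"
  proof (cases "k \<le> n1")
    case True
    have m: "(\<lambda>x. g (x k)) \<in> borel_measurable \<mu>1"
      using measurable_compose[OF block_row[OF True] g] by (simp add: measurable_cong_sets[OF s1 refl])
    have "(\<integral>\<^sup>+p. g (fst p k) \<partial>(\<mu>1 \<Otimes>\<^sub>M \<mu>2)) = (\<integral>\<^sup>+x. g (x k) \<partial>distr (\<mu>1 \<Otimes>\<^sub>M \<mu>2) \<mu>1 fst)"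
      using m by (subst nn_integral_distr) auto
    then show ?thesis using True by (simp add: e p2.distr_pair_fst)
  next
    case False
    then have k': "k - (n1 + 1) \<le> n2" using k by auto
    have m: "(\<lambda>x. g (x (k - (n1 + 1)))) \<in> borel_measurable \<mu>2"
      using measurable_compose[OF block_row[OF k'] g] by (simp add: measurable_cong_sets[OF s2 refl])
    have "(\<integral>\<^sup>+p. g (snd p (k - (n1 + 1))) \<partial>(\<mu>1 \<Otimes>\<^sub>M \<mu>2)) = (\<integral>\<^sup>+x. g (x (k - (n1 + 1))) \<partial>distr (\<mu>1 \<Otimes>\<^sub>M \<mu>2) \<mu>2 snd)"
      using m by (subst nn_integral_distr) auto
    then show ?thesis using False
      by (simp add: e distr_pair_snd'[OF p1.prob_space_axioms p2.prob_space_axioms])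
  qed
qed

text \<open>Turns the almost sure bound into a vanishing integral over one row, the form to which
  the rule for concatenated inputs applies.\<close>

lemma AE_iff_nn_integral_indicator:
  assumes "sets \<mu> = sets (block_space N n)" "k \<le> n"
  shows "(AE x in \<mu>. tx_power N (x k) \<le> c) \<longleftrightarrow> (\<integral>\<^sup>+x. indicator {v \<in> space (vec_space N). \<not> tx_power N v \<le> c} (x k) \<partial>\<mu>) = 0"
proof -
  have S: "{v \<in> space (vec_space N). \<not> tx_power N v \<le> c} \<in> sets (vec_space N)"
    using tx_power_measurable by measurable
  have m: "(\<lambda>x. indicator {v \<in> space (vec_space N). \<not> tx_power N v \<le> c} (x k) :: ennreal) \<in> borel_measurable \<mu>"
    unfolding measurable_cong_sets[OF assms(1) refl]
    by (rule measurable_compose[OF block_row[OF assms(2)] borel_measurable_indicator[OF S]])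
  show ?thesis unfolding nn_integral_0_iff_AE[OF m]
  proof (rule AE_cong)
    fix x assume "x \<in> space \<mu>"
    then have "x k \<in> space (vec_space N)"
      using measurable_space[OF block_row[OF assms(2)]] sets_eq_imp_space_eq[OF assms(1)] by auto
    then show "(tx_power N (x k) \<le> c) = (indicator {v \<in> space (vec_space N). \<not> tx_power N v \<le> c} (x k) = (0 :: ennreal))"
      by (auto simp: indicator_def)
  qed
qed

lemma peak_inputs_join:
  assumes "\<mu>1 \<in> peak_inputs N px n1" "\<mu>2 \<in> peak_inputs N px n2"
  shows "distr (\<mu>1 \<Otimes>\<^sub>M \<mu>2) (block_space N (n1 + n2 + 1)) (block_join n1 n2) \<in> peak_inputs N px (n1 + n2 + 1)"
proof -
  let ?\<mu> = "distr (\<mu>1 \<Otimes>\<^sub>M \<mu>2) (block_space N (n1 + n2 + 1)) (block_join n1 n2)"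
  have il: "\<mu>1 \<in> input_laws N n1" "\<mu>2 \<in> input_laws N n2" using assms by (auto simp: peak_inputs_def)
  have s: "sets \<mu>1 = sets (block_space N n1)" "sets \<mu>2 = sets (block_space N n2)" using il by (auto simp: input_laws_def)
  have S: "{v \<in> space (vec_space N). \<not> tx_power N v \<le> real N * px} \<in> sets (vec_space N)"
    using tx_power_measurable by measurable
  have "AE x in ?\<mu>. tx_power N (x k) \<le> real N * px" if k: "k \<le> n1 + n2 + 1" for k
    unfolding AE_iff_nn_integral_indicator[OF sets_distr k] join_input_laws(2)[OF il borel_measurable_indicator[OF S] k]
    using AE_iff_nn_integral_indicator[OF s(1), of k "real N * px"]
      AE_iff_nn_integral_indicator[OF s(2), of "k - (n1 + 1)" "real N * px"] assms k
    by (auto simp: peak_inputs_def)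
  then show ?thesis using join_input_laws(1)[OF il] unfolding peak_inputs_def mem_Collect_eq by blast
qed

lemma quadratic_inputs_join:
  assumes "\<mu>1 \<in> quadratic_inputs N px \<alpha> n1" "\<mu>2 \<in> quadratic_inputs N px \<alpha> n2"
  shows "distr (\<mu>1 \<Otimes>\<^sub>M \<mu>2) (block_space N (n1 + n2 + 1)) (block_join n1 n2) \<in> quadratic_inputs N px \<alpha> (n1 + n2 + 1)"
proof -
  let ?\<mu> = "distr (\<mu>1 \<Otimes>\<^sub>M \<mu>2) (block_space N (n1 + n2 + 1)) (block_join n1 n2)"
  have il: "\<mu>1 \<in> input_laws N n1" "\<mu>2 \<in> input_laws N n2" using assms by (auto simp: quadratic_inputs_def)
  have m1: "(\<lambda>v. ennreal (tx_power N v)) \<in> borel_measurable (vec_space N)"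
    and m2: "(\<lambda>v. ennreal ((tx_power N v)\<^sup>2)) \<in> borel_measurable (vec_space N)"
    using tx_power_measurable by (auto intro: borel_measurable_power measurable_compose[OF _ measurable_ennreal])
  have "(\<integral>\<^sup>+x. ennreal (tx_power N (x k)) \<partial>?\<mu>) \<le> ennreal (real N * px) \<and>
    (\<integral>\<^sup>+x. ennreal ((tx_power N (x k))\<^sup>2) \<partial>?\<mu>) \<le> ennreal (\<alpha> * (real N)\<^sup>2 * px\<^sup>2)" if k: "k \<le> n1 + n2 + 1" for k
  proof -
    have "k - (n1 + 1) \<le> n2" using k by auto
    then show ?thesis
      unfolding join_input_laws(2)[OF il m1 k] join_input_laws(2)[OF il m2 k]
      using assms k by (auto simp: quadratic_inputs_def)
  qed
  then show ?thesis using join_input_laws(1)[OF il] unfolding quadratic_inputs_def mem_Collect_eq by blast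
qed

context ofdm_channel
begin

text \<open>\<open>lim\<close> is informative only for convergent sequences. Superadditivity
  supplies the convergence, after which the capacity can be compared with the limit of any sequence
  \<open>l\<close> of achievable rates.\<close>

lemma capacity_ge:
  assumes en: "\<And>n. I n \<subseteq> energy_inputs N n"
    and join: "\<And>n1 n2 \<mu>1 \<mu>2. \<mu>1 \<in> I n1 \<Longrightarrow> \<mu>2 \<in> I n2 \<Longrightarrow>
       distr (\<mu>1 \<Otimes>\<^sub>M \<mu>2) (block_space N (n1 + n2 + 1)) (block_join n1 n2) \<in> I (n1 + n2 + 1)"
    and lb: "\<And>n. \<exists>\<mu>\<in>I n. l n \<le> block_information M N H W n \<mu> / (real N * real (n + 1))"
    and lim: "l \<longlonglongrightarrow> K"
  shows "ereal K \<le> capacity M N H W I"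
proof -
  define A where "A n = block_information M N H W n ` I n" for n
  define u where "u n = (SUP \<mu>\<in>I n. ereal (block_information M N H W n \<mu> / (real N * real (n + 1))))" for n
  have N: "0 < real N" using L_pos L_le_N by simp
  have "(\<lambda>n. SUP v\<in>A n. ereal (v / (real N * real (n + 1)))) \<longlonglongrightarrow> (SUP n. SUP v\<in>A n. ereal (v / (real N * real (n + 1))))"
  proof (rule superadditive_limit[OF N])
    fix m n u v assume "u \<in> A m" "v \<in> A n"
    then obtain \<mu>1 \<mu>2 where "\<mu>1 \<in> I m" "u = block_information M N H W m \<mu>1" "\<mu>2 \<in> I n" "v = block_information M N H W n \<mu>2"
      by (auto simp: A_def)
    then show "\<exists>w\<in>A (m + n + 1). u + v \<le> w"
      using block_information_join[of \<mu>1 m \<mu>2 n] join[of \<mu>1 m \<mu>2 n] en by (auto simp: A_def)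
  next
    fix n
    obtain \<mu> where "\<mu> \<in> I n" using lb[of n] by auto
    then show "\<exists>v\<in>A n. 0 \<le> v" using block_information_nonneg[of \<mu> n] en by (auto simp: A_def)
  qed
  then have c: "u \<longlonglongrightarrow> (SUP n. SUP v\<in>A n. ereal (v / (real N * real (n + 1))))"
    unfolding u_def A_def image_image .
  then have "lim u = (SUP n. SUP v\<in>A n. ereal (v / (real N * real (n + 1))))" by (rule limI)
  moreover have "capacity M N H W I = lim u" unfolding capacity_def u_def ..
  ultimately have c': "u \<longlonglongrightarrow> capacity M N H W I" using c by simp
  have "ereal (l n) \<le> u n" for n
  proof -
    obtain \<mu> where \<mu>: "\<mu> \<in> I n" "l n \<le> block_information M N H W n \<mu> / (real N * real (n + 1))" using lb[of n] by auto
    have "ereal (l n) \<le> ereal (block_information M N H W n \<mu> / (real N * real (n + 1)))" using \<mu>(2) by simp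
    also have "\<dots> \<le> u n" unfolding u_def using \<mu>(1) by (rule SUP_upper)
    finally show ?thesis .
  qed
  moreover have "(\<lambda>n. ereal (l n)) \<longlonglongrightarrow> ereal K" using lim by simp
  ultimately show ?thesis using c' by (intro LIMSEQ_le[where X = "\<lambda>n. ereal (l n)" and Y = u]) auto
qed

end

subsection \<open>Linear prediction from a noisy past\<close>

text \<open>Completing the square: the form at b - a is nonnegative, and M a = D turns its cross
  terms into D^H b and its conjugate. Hence 2 Re (D^H b) - b^H M b is largest at b = a, with the
  value D^H a.\<close>

lemma hermitian_solution:
  fixes M :: "nat \<Rightarrow> nat \<Rightarrow> complex"
  assumes herm: "\<And>i j. M j i = cnj (M i j)"
    and pos: "\<And>v. 0 \<le> Re (\<Sum>i<K. \<Sum>j<K. cnj (v i) * M i j * v j)"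
    and sol: "\<And>i. i < K \<Longrightarrow> (\<Sum>j<K. M i j * a j) = D i"
  shows "(\<Sum>i<K. \<Sum>j<K. cnj (a i) * M i j * a j) = (\<Sum>j<K. cnj (D j) * a j)"
    and "Im (\<Sum>j<K. cnj (D j) * a j) = 0"
    and "2 * Re (\<Sum>j<K. cnj (D j) * b j) - Re (\<Sum>i<K. \<Sum>j<K. cnj (b i) * M i j * b j) \<le> Re (\<Sum>j<K. cnj (D j) * a j)"
proof -
  have L: "(\<Sum>i<K. \<Sum>j<K. cnj (b i) * M i j * a j) = (\<Sum>j<K. cnj (b j) * D j)" for b
  proof (rule sum.cong[OF refl])
    fix i assume "i \<in> {..<K}"
    then show "(\<Sum>j<K. cnj (b i) * M i j * a j) = cnj (b i) * D i"
      using sol[of i] by (simp add: sum_distrib_left[symmetric] mult.assoc)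
  qed
  have R: "(\<Sum>i<K. \<Sum>j<K. cnj (a i) * M i j * b j) = (\<Sum>j<K. cnj (D j) * b j)" for b
  proof -
    have "(\<Sum>i<K. \<Sum>j<K. cnj (a i) * M i j * b j) = (\<Sum>j<K. \<Sum>i<K. cnj (a i) * M i j * b j)" by (rule sum.swap)
    also have "\<dots> = (\<Sum>j<K. cnj (D j) * b j)"
    proof (rule sum.cong[OF refl])
      fix j assume "j \<in> {..<K}"
      then have "cnj (D j) = (\<Sum>i<K. cnj (M j i) * cnj (a i))" using sol[of j] by (simp flip: cnj_sum complex_cnj_mult)
      also have "\<dots> = (\<Sum>i<K. cnj (a i) * M i j)" by (intro sum.cong refl) (simp add: herm[of _ j] mult.commute)
      finally show "(\<Sum>i<K. cnj (a i) * M i j * b j) = cnj (D j) * b j" by (simp add: sum_distrib_right)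
    qed
    finally show ?thesis .
  qed
  show aa: "(\<Sum>i<K. \<Sum>j<K. cnj (a i) * M i j * a j) = (\<Sum>j<K. cnj (D j) * a j)" by (rule R)
  have "cnj (\<Sum>j<K. cnj (D j) * a j) = (\<Sum>j<K. cnj (a j) * D j)" by (simp add: mult.commute)
  also have "\<dots> = (\<Sum>j<K. cnj (D j) * a j)" unfolding L[of a, symmetric] by (rule aa)
  finally show "Im (\<Sum>j<K. cnj (D j) * a j) = 0" by (metis Reals_cnj_iff complex_is_Real_iff)
  have c: "Re (\<Sum>j<K. cnj (b j) * D j) = Re (\<Sum>j<K. cnj (D j) * b j)" for b
  proof -
    have "(\<Sum>j<K. cnj (b j) * D j) = cnj (\<Sum>j<K. cnj (D j) * b j)" by (simp add: mult.commute)
    then show ?thesis by simp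
  qed
  have "(\<Sum>i<K. \<Sum>j<K. cnj (b i - a i) * M i j * (b j - a j)) =
     (\<Sum>i<K. \<Sum>j<K. cnj (b i) * M i j * b j) - (\<Sum>i<K. \<Sum>j<K. cnj (b i) * M i j * a j) -
     (\<Sum>i<K. \<Sum>j<K. cnj (a i) * M i j * b j) + (\<Sum>i<K. \<Sum>j<K. cnj (a i) * M i j * a j)"
    unfolding sum_subtractf[symmetric] sum.distrib[symmetric]
    by (intro sum.cong refl) (simp add: algebra_simps)
  then show "2 * Re (\<Sum>j<K. cnj (D j) * b j) - Re (\<Sum>i<K. \<Sum>j<K. cnj (b i) * M i j * b j) \<le> Re (\<Sum>j<K. cnj (D j) * a j)"
    using pos[of "\<lambda>i. b i - a i"] unfolding L R by (simp only: minus_complex.simps plus_complex.simps c)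
qed

text \<open>v^H Delta v for a past of length \<open>K\<close>, thus with
  \<open>Delta \<rho> (K - 1)\<close>; as a plain sum it also makes sense for
  \<open>K = 0\<close>.\<close>

definition toeplitz_form :: "(int \<Rightarrow> complex) \<Rightarrow> nat \<Rightarrow> (nat \<Rightarrow> complex) \<Rightarrow> complex" where
  "toeplitz_form \<rho> K v = (\<Sum>i<K. \<Sum>j<K. cnj (v i) * \<rho> (int i - int j) * v j)"

text \<open>D^H v with D = \<open>Dcol \<rho> K\<close>: up to conjugation, the correlation between
  the present and a weighted past.\<close>

definition corr_form :: "(int \<Rightarrow> complex) \<Rightarrow> nat \<Rightarrow> (nat \<Rightarrow> complex) \<Rightarrow> complex" where
  "corr_form \<rho> K v = (\<Sum>j<K. cnj (\<rho> (int j - int K)) * v j)"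

text \<open>The matrix inverted in \<open>coh_form\<close>, with \<open>s\<close> for
  \<open>N * p\<close>. The difference inside is a Schur complement: the covariance of the past
  given the present.\<close>

definition reg_mat :: "(int \<Rightarrow> complex) \<Rightarrow> real \<Rightarrow> nat \<Rightarrow> nat \<Rightarrow> nat \<Rightarrow> complex" where
  "reg_mat \<rho> s K i j = of_real s * (\<rho> (int i - int j) - \<rho> (int i - int K) * cnj (\<rho> (int j - int K))) + (if i = j then 1 else 0)"

lemma reg_form:
  "(\<Sum>i<K. \<Sum>j<K. cnj (v i) * reg_mat \<rho> s K i j * v j) =
   of_real s * (toeplitz_form \<rho> K v - cnj (corr_form \<rho> K v) * corr_form \<rho> K v) + (\<Sum>i<K. cnj (v i) * v i)"
proof -
  have "cnj (corr_form \<rho> K v) * corr_form \<rho> K v =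
     (\<Sum>i<K. \<Sum>j<K. cnj (v i) * (\<rho> (int i - int K) * cnj (\<rho> (int j - int K))) * v j)"
    unfolding corr_form_def cnj_sum sum_product by (intro sum.cong refl) (simp add: mult_ac)
  moreover have "(\<Sum>i<K. \<Sum>j<K. cnj (v i) * (if i = j then 1 else 0) * v j) = (\<Sum>i<K. cnj (v i) * v i)"
  proof (rule sum.cong[OF refl])
    fix i assume "i \<in> {..<K}"
    then show "(\<Sum>j<K. cnj (v i) * (if i = j then 1 else 0) * v j) = cnj (v i) * v i"
      by (simp add: if_distrib[of "\<lambda>x. _ * x * _"] cong: if_cong)
  qed
  moreover have "(\<Sum>i<K. \<Sum>j<K. cnj (v i) * reg_mat \<rho> s K i j * v j) =
     (\<Sum>i<K. \<Sum>j<K. of_real s * (cnj (v i) * \<rho> (int i - int j) * v j) -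
       of_real s * (cnj (v i) * (\<rho> (int i - int K) * cnj (\<rho> (int j - int K))) * v j) +
       cnj (v i) * (if i = j then 1 else 0) * v j)"
    unfolding reg_mat_def by (intro sum.cong refl) (simp only: ring_distribs mult_ac)
  ultimately show ?thesis
    by (simp only: toeplitz_form_def sum.distrib sum_subtractf sum_distrib_left[symmetric] right_diff_distrib)
qed

text \<open>Prediction depends on the autocorrelation alone; isolating it keeps the quadratic forms
  apart from the random variables.\<close>

locale autocorrelation =
  fixes \<rho> :: "int \<Rightarrow> complex"
  assumes rho_0: "\<rho> 0 = 1" and rho_minus: "\<And>i. \<rho> (- i) = cnj (\<rho> i)"
    and psd: "\<And>k v. v \<in> carrier_vec (Suc k) \<Longrightarrow> (Delta \<rho> k *\<^sub>v v) \<bullet>c v \<in> \<real>\<^sub>\<ge>\<^sub>0"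
begin

lemma toeplitz_form_nonneg: "0 \<le> Re (toeplitz_form \<rho> (Suc k) v)"
proof -
  define w where "w = vec (Suc k) v"
  have wc: "w \<in> carrier_vec (Suc k)" by (simp add: w_def)
  have "(Delta \<rho> k *\<^sub>v w) \<bullet>c w = (\<Sum>i<Suc k. (\<Sum>j<Suc k. \<rho> (int i - int j) * v j) * cnj (v i))"
    unfolding scalar_prod_def Delta_def w_def
    by (auto simp: scalar_prod_def lessThan_atLeast0[symmetric] simp del: sum.lessThan_Suc intro!: sum.cong)
  also have "\<dots> = toeplitz_form \<rho> (Suc k) v"
    unfolding toeplitz_form_def by (intro sum.cong refl) (simp add: sum_distrib_right sum_distrib_left mult_ac del: sum.lessThan_Suc)
  finally show ?thesis using psd[OF wc] by (auto simp: complex_nonneg_Reals_iff)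
qed

lemma rho_flip: "\<rho> (int j - int i) = cnj (\<rho> (int i - int j))"
  using rho_minus[of "int i - int j"] by simp

text \<open>Schur complement: the form of the bordered matrix \<open>\<Delta>\<^sub>K\<close> at \<open>(v, - D\<^sup>\<dagger> v)\<close>.\<close>

lemma schur_nonneg: "(cmod (corr_form \<rho> K v))\<^sup>2 \<le> Re (toeplitz_form \<rho> K v)"
proof -
  define c where "c = corr_form \<rho> K v"
  define w where "w i = (if i < K then v i else - c)" for i
  have c': "cnj c = (\<Sum>i<K. cnj (v i) * \<rho> (int i - int K))"
    unfolding c_def corr_form_def cnj_sum by (intro sum.cong refl) (simp add: mult.commute)
  have "toeplitz_form \<rho> (Suc K) w =
     (\<Sum>i<K. (\<Sum>j<K. cnj (v i) * \<rho> (int i - int j) * v j) + cnj (v i) * \<rho> (int i - int K) * (- c)) +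
     ((\<Sum>j<K. cnj (- c) * \<rho> (int K - int j) * v j) + cnj (- c) * \<rho> 0 * (- c))"
    unfolding toeplitz_form_def sum.lessThan_Suc w_def by simp
  also have "(\<Sum>i<K. (\<Sum>j<K. cnj (v i) * \<rho> (int i - int j) * v j) + cnj (v i) * \<rho> (int i - int K) * (- c)) =
     toeplitz_form \<rho> K v + cnj c * (- c)"
    unfolding sum.distrib toeplitz_form_def c' sum_distrib_right ..
  also have "(\<Sum>j<K. cnj (- c) * \<rho> (int K - int j) * v j) = cnj (- c) * c"
  proof -
    have "cnj (\<rho> (int j - int K)) = \<rho> (int K - int j)" for j by (subst rho_flip) simp
    then show ?thesis unfolding c_def corr_form_def sum_distrib_left by (simp add: mult.assoc sum_distrib_left)
  qed
  finally have "toeplitz_form \<rho> (Suc K) w = toeplitz_form \<rho> K v - c * cnj c"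
    by (simp add: rho_0 algebra_simps)
  then have "Re (toeplitz_form \<rho> (Suc K) w) = Re (toeplitz_form \<rho> K v) - (cmod c)\<^sup>2"
    by (simp only: complex_norm_square[symmetric] minus_complex.simps Re_complex_of_real)
  with toeplitz_form_nonneg[of K w] show ?thesis by (simp add: c_def)
qed

lemma reg_form_Re:
  "Re (\<Sum>i<K. \<Sum>j<K. cnj (v i) * reg_mat \<rho> s K i j * v j) =
   s * (Re (toeplitz_form \<rho> K v) - (cmod (corr_form \<rho> K v))\<^sup>2) + (\<Sum>i<K. (cmod (v i))\<^sup>2)"
proof -
  have "cnj z * z = complex_of_real ((cmod z)\<^sup>2)" for z
    using complex_norm_square[of z] by (simp add: mult.commute)
  then show ?thesis unfolding reg_form by (simp add: Re_sum)
qed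

text \<open>Replaces the inverse matrix by a solution of the linear system, so that later arguments
  deal with finite sums only.\<close>

lemma coh_form_solution:
  assumes s: "0 \<le> real N * p"
  obtains a where
    "\<And>i. i < Suc k \<Longrightarrow> (\<Sum>j<Suc k. reg_mat \<rho> (real N * p) (Suc k) i j * a j) = \<rho> (int i - int (Suc k))"
    "coh_form N \<rho> p (Suc k) = Re (corr_form \<rho> (Suc k) a)"
proof -
  define K where "K = Suc k"
  define D where "D = Dcol \<rho> K"
  define A where "A = complex_of_real (real N * p) \<cdot>\<^sub>m (Delta \<rho> k - D * mat_adjoint D) + 1\<^sub>m K"
  have Dc: "D \<in> carrier_mat K 1" by (simp add: D_def Dcol_def)
  have Dac: "mat_adjoint D \<in> carrier_mat 1 K"
  proof -
    have "dim_row D = K" "length (cols D) = 1" using Dc by auto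
    then show ?thesis using mat_of_rows_carrier(1)[of K "map conjugate (cols D)"] by (simp add: mat_adjoint_def)
  qed
  have Dl: "Delta \<rho> k \<in> carrier_mat K K" by (simp add: Delta_def K_def)
  have Ac: "A \<in> carrier_mat K K" using Dc Dac Dl by (auto simp: A_def)
  have Di: "D $$ (i, 0) = \<rho> (int i - int K)" if "i < K" for i
    using that by (simp add: D_def Dcol_def Delta_def)
  have Dai: "mat_adjoint D $$ (0, j) = cnj (\<rho> (int j - int K))" if "j < K" for j
    using that Dc Di[OF that] by (simp add: mat_adjoint_def mat_of_rows_index cols_def)
  have Aij: "A $$ (i, j) = reg_mat \<rho> (real N * p) K i j" if ij: "i < K" "j < K" for i j
  proof -
    have "(D * mat_adjoint D) $$ (i, j) = \<rho> (int i - int K) * cnj (\<rho> (int j - int K))"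
      using ij Dc Dac Di[OF ij(1)] Dai[OF ij(2)] by (simp add: scalar_prod_def)
    moreover have "Delta \<rho> k $$ (i, j) = \<rho> (int i - int j)" using ij by (simp add: Delta_def K_def)
    ultimately show ?thesis
      using ij Dc Dac Dl by (simp add: A_def reg_mat_def)
  qed
  have prod: "(A * X) $$ (i, 0) = (\<Sum>j<K. reg_mat \<rho> (real N * p) K i j * X $$ (j, 0))"
    if "X \<in> carrier_mat K 1" "i < K" for X i
    using that Ac Aij[OF that(2)] by (auto simp: scalar_prod_def lessThan_atLeast0 intro!: sum.cong)
  \<comment> \<open>For a kernel vector v the form vanishes, but it equals a nonnegative Schur term
    plus |v|^2; so v would be 0.\<close>
  have "det A \<noteq> 0"
  proof
    assume "det A = 0"
    then obtain v where v: "v \<in> carrier_vec K" "v \<noteq> 0\<^sub>v K" "A *\<^sub>v v = 0\<^sub>v K"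
      using det_0_iff_vec_prod_zero_field[OF Ac] by auto
    have z: "(\<Sum>j<K. reg_mat \<rho> (real N * p) K i j * v $ j) = 0" if "i < K" for i
    proof -
      have "(A *\<^sub>v v) $ i = (\<Sum>j<K. reg_mat \<rho> (real N * p) K i j * v $ j)"
        using that Ac v(1) Aij[OF that] by (auto simp: scalar_prod_def lessThan_atLeast0 intro!: sum.cong)
      then show ?thesis using v(3) that by simp
    qed
    have "(\<Sum>i<K. \<Sum>j<K. cnj (v $ i) * reg_mat \<rho> (real N * p) K i j * v $ j) = (\<Sum>i<K. cnj (v $ i) * 0)"
      by (intro sum.cong refl) (simp add: z mult.assoc sum_distrib_left[symmetric])
    then have "real N * p * (Re (toeplitz_form \<rho> K (\<lambda>i. v $ i)) - (cmod (corr_form \<rho> K (\<lambda>i. v $ i)))\<^sup>2) + (\<Sum>i<K. (cmod (v $ i))\<^sup>2) = 0"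
      using reg_form_Re[where v = "\<lambda>i. v $ i" and s = "real N * p" and K = K] by simp
    moreover have "0 \<le> real N * p * (Re (toeplitz_form \<rho> K (\<lambda>i. v $ i)) - (cmod (corr_form \<rho> K (\<lambda>i. v $ i)))\<^sup>2)"
      using schur_nonneg[of K "\<lambda>i. v $ i"] by (intro mult_nonneg_nonneg[OF s]) simp
    moreover have "0 \<le> (\<Sum>i<K. (cmod (v $ i))\<^sup>2)" by (intro sum_nonneg) auto
    ultimately have "(\<Sum>i<K. (cmod (v $ i))\<^sup>2) = 0" by linarith
    then have "\<forall>i<K. v $ i = 0" by (simp add: sum_nonneg_eq_0_iff)
    then have "v = 0\<^sub>v K" using v(1) by (intro eq_vecI) auto
    with v(2) show False ..
  qed
  then have "mat_inverse A \<noteq> None"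
    using mat_inverse(1)[OF Ac, of "()"] det_non_zero_imp_unit[OF Ac, of "()"] by blast
  then obtain B where B: "mat_inverse A = Some B" by blast
  from mat_inverse(2)[OF Ac B] have AB: "A * B = 1\<^sub>m K" and Bc: "B \<in> carrier_mat K K" by auto
  define a where "a i = (B * D) $$ (i, 0)" for i
  have BD: "B * D \<in> carrier_mat K 1" using Bc Dc by auto
  have "A * (B * D) = D" using Ac Bc Dc AB by (simp add: assoc_mult_mat[symmetric, of A K K B K D 1])
  then have 1: "(\<Sum>j<K. reg_mat \<rho> (real N * p) K i j * a j) = \<rho> (int i - int K)" if "i < K" for i
    using prod[OF BD that] Di[OF that] by (simp add: a_def)
  have "coh_form N \<rho> p K = Re ((mat_adjoint D * B * D) $$ (0, 0))"
  proof -
    have "K - 1 = k" by (simp add: K_def)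
    then show ?thesis
      unfolding coh_form_def Let_def D_def[symmetric] by (simp only: A_def[symmetric] B option.sel)
  qed
  also have "mat_adjoint D * B * D = mat_adjoint D * (B * D)" using Dac Bc Dc by (rule assoc_mult_mat)
  also have "(mat_adjoint D * (B * D)) $$ (0, 0) = corr_form \<rho> K a"
  proof -
    have gen: "(P * X) $$ (0, 0) = (\<Sum>j<K. P $$ (0, j) * X $$ (j, 0))"
      if "P \<in> carrier_mat 1 K" "X \<in> carrier_mat K 1" for P X :: "complex mat"
      using that by (auto simp: scalar_prod_def lessThan_atLeast0 intro!: sum.cong)
    show ?thesis unfolding gen[OF Dac BD] corr_form_def a_def by (intro sum.cong refl) (simp add: Dai)
  qed
  finally have 2: "coh_form N \<rho> p K = Re (corr_form \<rho> K a)" .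
  show thesis by (rule that[of a, folded K_def]) (fact 1 2)+
qed

text \<open>\<open>coh_form\<close> as the value of a concave maximisation: weights attaining it,
  the identity obtained by pairing the linear system with its solution, and the inequality for every
  competitor.\<close>

lemma coh_form_props:
  assumes s: "0 \<le> real N * p"
  obtains a where
    "corr_form \<rho> (Suc k) a = of_real (coh_form N \<rho> p (Suc k))"
    "coh_form N \<rho> p (Suc k) = real N * p * (Re (toeplitz_form \<rho> (Suc k) a) - (coh_form N \<rho> p (Suc k))\<^sup>2) + (\<Sum>i<Suc k. (cmod (a i))\<^sup>2)"
    "0 \<le> coh_form N \<rho> p (Suc k)"
    "\<And>b. 2 * Re (corr_form \<rho> (Suc k) b) - real N * p * (Re (toeplitz_form \<rho> (Suc k) b) - (cmod (corr_form \<rho> (Suc k) b))\<^sup>2)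
        - (\<Sum>i<Suc k. (cmod (b i))\<^sup>2) \<le> coh_form N \<rho> p (Suc k)"
proof -
  define K where "K = Suc k"
  obtain a where a: "\<And>i. i < K \<Longrightarrow> (\<Sum>j<K. reg_mat \<rho> (real N * p) K i j * a j) = \<rho> (int i - int K)"
    and q: "coh_form N \<rho> p K = Re (corr_form \<rho> K a)"
    by (rule coh_form_solution[OF s, of k, folded K_def]) (rule that)
  have herm: "reg_mat \<rho> (real N * p) K j i = cnj (reg_mat \<rho> (real N * p) K i j)" for i j
    unfolding reg_mat_def by (subst rho_flip) (auto simp: mult.commute)
  have pos: "0 \<le> Re (\<Sum>i<K. \<Sum>j<K. cnj (v i) * reg_mat \<rho> (real N * p) K i j * v j)" for v
    unfolding reg_form_Re using schur_nonneg[of K v] by (intro add_nonneg_nonneg mult_nonneg_nonneg[OF s] sum_nonneg) simp_all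
  note hs = hermitian_solution[where M = "reg_mat \<rho> (real N * p) K" and K = K and a = a and D = "\<lambda>i. \<rho> (int i - int K)", OF herm pos a,
      folded corr_form_def]
  have im: "Im (corr_form \<rho> K a) = 0" using hs(2) by simp
  have 1: "corr_form \<rho> K a = of_real (coh_form N \<rho> p K)" unfolding q by (rule complex_eqI) (simp_all add: im)
  have qq: "coh_form N \<rho> p K = real N * p * (Re (toeplitz_form \<rho> K a) - (coh_form N \<rho> p K)\<^sup>2) + (\<Sum>i<K. (cmod (a i))\<^sup>2)"
    using arg_cong[OF hs(1), of Re] unfolding reg_form_Re 1 by simp
  have nn: "0 \<le> coh_form N \<rho> p K" using pos[of a] hs(1) by (simp add: q)
  have mx: "2 * Re (corr_form \<rho> K b) - real N * p * (Re (toeplitz_form \<rho> K b) - (cmod (corr_form \<rho> K b))\<^sup>2)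
        - (\<Sum>i<K. (cmod (b i))\<^sup>2) \<le> coh_form N \<rho> p K" for b
    using hs(3)[of b] unfolding reg_form_Re q by simp
  show thesis by (rule that[of a, folded K_def]) (fact 1 qq nn mx)+
qed

lemma coh_form_max:
  assumes s: "0 \<le> real N * p"
  shows "2 * Re (corr_form \<rho> (Suc k) b) - real N * p * (Re (toeplitz_form \<rho> (Suc k) b) - (cmod (corr_form \<rho> (Suc k) b))\<^sup>2)
        - (\<Sum>i<Suc k. (cmod (b i))\<^sup>2) \<le> coh_form N \<rho> p (Suc k)"
proof -
  obtain a :: "nat \<Rightarrow> complex" where
    "\<And>b. 2 * Re (corr_form \<rho> (Suc k) b) - real N * p * (Re (toeplitz_form \<rho> (Suc k) b) - (cmod (corr_form \<rho> (Suc k) b))\<^sup>2)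
        - (\<Sum>i<Suc k. (cmod (b i))\<^sup>2) \<le> coh_form N \<rho> p (Suc k)"
    by (rule coh_form_props[OF s, of k]) (rule that)
  then show ?thesis .
qed

text \<open>Giving weight 0 to the oldest sample embeds the shorter past into the longer one. All
  parts of the objective keep their values, because they depend on time differences only, so the
  maximum cannot decrease.\<close>

lemma coh_form_mono:
  assumes s: "0 \<le> real N * p"
  shows "coh_form N \<rho> p (Suc k) \<le> coh_form N \<rho> p (Suc (Suc k))"
proof -
  let ?K = "Suc k"
  obtain a where 1: "corr_form \<rho> ?K a = of_real (coh_form N \<rho> p ?K)"
    and 2: "coh_form N \<rho> p ?K = real N * p * (Re (toeplitz_form \<rho> ?K a) - (coh_form N \<rho> p ?K)\<^sup>2) + (\<Sum>i<?K. (cmod (a i))\<^sup>2)"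
    by (rule coh_form_props[OF s, of k]) (rule that)
  define b where "b i = (case i of 0 \<Rightarrow> 0 | Suc j \<Rightarrow> a j)" for i
  have c: "corr_form \<rho> (Suc ?K) b = corr_form \<rho> ?K a"
    unfolding corr_form_def by (subst sum.lessThan_Suc_shift) (simp add: b_def diff_diff_eq add.commute del: sum.lessThan_Suc)
  have t: "toeplitz_form \<rho> (Suc ?K) b = toeplitz_form \<rho> ?K a"
    unfolding toeplitz_form_def by (subst sum.lessThan_Suc_shift, subst (2) sum.lessThan_Suc_shift) (simp add: b_def del: sum.lessThan_Suc)
  have e: "(\<Sum>i<Suc ?K. (cmod (b i))\<^sup>2) = (\<Sum>i<?K. (cmod (a i))\<^sup>2)"
    by (subst sum.lessThan_Suc_shift) (simp add: b_def del: sum.lessThan_Suc)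
  have "2 * Re (corr_form \<rho> (Suc ?K) b) - real N * p * (Re (toeplitz_form \<rho> (Suc ?K) b) - (cmod (corr_form \<rho> (Suc ?K) b))\<^sup>2)
        - (\<Sum>i<Suc ?K. (cmod (b i))\<^sup>2) \<le> coh_form N \<rho> p (Suc ?K)"
    by (rule coh_form_max[OF s])
  then show ?thesis unfolding c t e 1 using 2 by simp
qed

end

subsection \<open>QPSK over a fading channel\<close>

definition std_N :: "real measure" where "std_N = std_normal_distribution"

lemma prob_space_std_N: "prob_space std_N"
  unfolding std_N_def by (rule prob_space_normal_density) simp

interpretation std_N: prob_space std_N by (rule prob_space_std_N)

lemma sets_std_N[simp, measurable_cong]: "sets std_N = sets borel"
  by (simp add: std_N_def)

lemma integrable_std_N_square: "integrable std_N (\<lambda>x. x\<^sup>2)"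
  unfolding std_N_def by (rule integrable_std_normal_distribution_moment)

lemma distr_Re_std_CN': "cmod c = 1 \<Longrightarrow> distr std_CN borel (\<lambda>z. sqrt 2 * Re (c * z)) = std_N"
  unfolding std_N_def by (rule distr_Re_std_CN)

definition softplus :: "real \<Rightarrow> real" where "softplus t = ln (1 + exp (- t))"

lemma softplus_measurable[measurable]: "softplus \<in> borel_measurable borel"
  unfolding softplus_def[abs_def] by simp

lemma softplus_nonneg: "0 \<le> softplus t"
  by (simp add: softplus_def)

lemma softplus_le: "softplus t \<le> ln 2 + \<bar>t\<bar>"
proof -
  have "1 + exp (- t) \<le> 2 * exp \<bar>t\<bar>"
    by (smt (verit) exp_le_cancel_iff one_le_exp_iff abs_ge_zero abs_ge_minus_self)
  then have "ln (1 + exp (- t)) \<le> ln (2 * exp \<bar>t\<bar>)"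
    by (subst ln_le_cancel_iff) (auto intro: add_pos_pos)
  then show ?thesis by (simp add: softplus_def ln_mult)
qed

lemma continuous_softplus: "isCont softplus t"
  unfolding softplus_def[abs_def] by (intro continuous_intros) (auto simp: add_pos_pos add_nonneg_eq_0_iff intro!: less_imp_neq[symmetric])

text \<open>The factor 2 counts the two bits of a symbol; the constants agree since 2 / sqrt (2 pi)
  = sqrt (2 / pi).\<close>

lemma C_QPSK_eq: "C_QPSK s = ln 4 - 2 * (\<integral>y. softplus (2 * (s + sqrt s * y)) \<partial>std_N)"
proof -
  have "(\<integral>y. softplus (2 * (s + sqrt s * y)) \<partial>std_N) = (\<integral>y. std_normal_density y *\<^sub>R softplus (2 * (s + sqrt s * y)) \<partial>lborel)"
    unfolding std_N_def by (rule integral_density) auto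
  also have "\<dots> = (\<integral>y. (1 / sqrt (2 * pi)) * (exp (- y\<^sup>2 / 2) * softplus (2 * (s + sqrt s * y))) \<partial>lborel)"
    by (simp add: std_normal_density_def mult.assoc)
  also have "\<dots> = (1 / sqrt (2 * pi)) * (\<integral>y. exp (- y\<^sup>2 / 2) * softplus (2 * (s + sqrt s * y)) \<partial>lborel)"
    by (rule integral_mult_right_zero)
  finally have "2 * (\<integral>y. softplus (2 * (s + sqrt s * y)) \<partial>std_N) = (2 / sqrt (2 * pi)) * (\<integral>y. exp (- y\<^sup>2 / 2) * softplus (2 * (s + sqrt s * y)) \<partial>lborel)"
    by simp
  moreover have "2 / sqrt (2 * pi) = sqrt (2 / pi)"
    by (simp add: real_sqrt_mult real_sqrt_divide real_div_sqrt flip: divide_divide_eq_left)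
  moreover have "C_QPSK s = ln 4 - sqrt (2 / pi) * (\<integral>y. exp (- y\<^sup>2 / 2) * softplus (2 * (s + sqrt s * y)) \<partial>lborel)"
    by (simp only: C_QPSK_def softplus_def mult_minus_left)
  ultimately show ?thesis by (simp only:)
qed

text \<open>2 sqrt s |y| \<le> s + y^2. The bound is uniform for bounded \<open>s\<close> and serves
  as the majorant in limits under the integral.\<close>

lemma softplus_snr_le:
  assumes "0 \<le> s"
  shows "softplus (2 * (s + sqrt s * y)) \<le> ln 2 + 3 * s + y\<^sup>2"
proof -
  have "\<bar>2 * (s + sqrt s * y)\<bar> \<le> 2 * s + 2 * (sqrt s * \<bar>y\<bar>)"
    using assms abs_triangle_ineq[of "2 * s" "2 * (sqrt s * y)"] by (simp add: abs_mult ring_distribs)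
  moreover have "2 * (sqrt s * \<bar>y\<bar>) \<le> s + y\<^sup>2"
    using sum_squares_bound[of "sqrt s" "\<bar>y\<bar>"] assms by (simp add: mult.assoc)
  ultimately show ?thesis using softplus_le[of "2 * (s + sqrt s * y)"] by linarith
qed

lemma integrable_softplus_snr: "0 \<le> s \<Longrightarrow> integrable std_N (\<lambda>y. softplus (2 * (s + sqrt s * y)))"
proof (rule Bochner_Integration.integrable_bound)
  show "integrable std_N (\<lambda>y. ln 2 + 3 * s + y\<^sup>2)" using integrable_std_N_square by simp
  assume "0 \<le> s"
  then show "AE y in std_N. norm (softplus (2 * (s + sqrt s * y))) \<le> norm (ln 2 + 3 * s + y\<^sup>2)"
    using softplus_snr_le softplus_nonneg by (intro AE_I2) (auto intro: order_trans[OF _ abs_ge_self])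
qed simp

lemma abs_bound_aux: "E \<le> b \<Longrightarrow> 0 \<le> E \<Longrightarrow> 0 \<le> l \<Longrightarrow> \<bar>l - 2 * E\<bar> \<le> l + 2 * b" for E b l :: real
  by (simp add: abs_le_iff)

text \<open>Only linear growth in \<open>s\<close> matters here: it makes the value integrable over
  a fading gain with finite second moment.\<close>

lemma C_QPSK_abs_le: "0 \<le> s \<Longrightarrow> \<bar>C_QPSK s\<bar> \<le> ln 4 + 2 * (ln 2 + 3 * s + (\<integral>y. y\<^sup>2 \<partial>std_N))"
proof -
  assume s: "0 \<le> s"
  have "(\<integral>y. softplus (2 * (s + sqrt s * y)) \<partial>std_N) \<le> (\<integral>y. ln 2 + 3 * s + y\<^sup>2 \<partial>std_N)"
    using integrable_softplus_snr[OF s] integrable_std_N_square softplus_snr_le[OF s] by (intro integral_mono) auto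
  also have "\<dots> = ln 2 + 3 * s + (\<integral>y. y\<^sup>2 \<partial>std_N)"
    using integrable_std_N_square by (simp add: std_N.prob_space)
  finally have "(\<integral>y. softplus (2 * (s + sqrt s * y)) \<partial>std_N) \<le> ln 2 + 3 * s + (\<integral>y. y\<^sup>2 \<partial>std_N)" .
  moreover have "0 \<le> (\<integral>y. softplus (2 * (s + sqrt s * y)) \<partial>std_N)"
    by (intro integral_nonneg_AE AE_I2 softplus_nonneg)
  moreover have "0 \<le> ln (4 :: real)" by simp
  ultimately show ?thesis unfolding C_QPSK_eq using abs_bound_aux by blast
qed

lemma C_QPSK_measurable[measurable]: "C_QPSK \<in> borel_measurable borel"
proof -
  have "(\<lambda>(s, y). softplus (2 * (s + sqrt s * y))) \<in> borel_measurable (borel \<Otimes>\<^sub>M std_N)" by measurable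
  from std_N.borel_measurable_lebesgue_integral[OF this] show ?thesis
    unfolding C_QPSK_eq[abs_def] by simp
qed

lemma C_QPSK_tendsto:
  assumes s: "\<And>n. 0 \<le> s n" and l: "s \<longlonglongrightarrow> l"
  shows "(\<lambda>n. C_QPSK (s n)) \<longlonglongrightarrow> C_QPSK l"
proof -
  obtain B where B: "\<And>n. s n \<le> B"
    using convergent_imp_Bseq[OF convergentI[OF l]] by (auto simp: Bseq_def) (metis abs_le_D1)
  have "(\<lambda>n. \<integral>y. softplus (2 * (s n + sqrt (s n) * y)) \<partial>std_N) \<longlonglongrightarrow> (\<integral>y. softplus (2 * (l + sqrt l * y)) \<partial>std_N)"
  proof (rule integral_dominated_convergence[where w = "\<lambda>y. ln 2 + 3 * B + y\<^sup>2"])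
    show "integrable std_N (\<lambda>y. ln 2 + 3 * B + y\<^sup>2)" using integrable_std_N_square by simp
    show "AE y in std_N. (\<lambda>n. softplus (2 * (s n + sqrt (s n) * y))) \<longlonglongrightarrow> softplus (2 * (l + sqrt l * y))"
      by (intro AE_I2 isCont_tendsto_compose[OF continuous_softplus] tendsto_intros l)
    show "AE y in std_N. norm (softplus (2 * (s n + sqrt (s n) * y))) \<le> ln 2 + 3 * B + y\<^sup>2" for n
    proof (rule AE_I2)
      fix y
      have "softplus (2 * (s n + sqrt (s n) * y)) \<le> ln 2 + 3 * s n + y\<^sup>2" by (rule softplus_snr_le[OF s])
      then show "norm (softplus (2 * (s n + sqrt (s n) * y))) \<le> ln 2 + 3 * B + y\<^sup>2"
        using B[of n] by (simp add: softplus_nonneg)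
    qed
  qed auto
  then show ?thesis unfolding C_QPSK_eq by (intro tendsto_intros)
qed

text \<open>The argument of \<open>C_QPSK\<close> in the bound; \<open>\<sigma>\<close> will be 1 /
  A^2, the noise-to-signal ratio of a carrier with symbol amplitude A.\<close>

definition fade_snr :: "complex \<Rightarrow> real \<Rightarrow> real \<Rightarrow> complex \<Rightarrow> real" where
  "fade_snr m \<sigma> e u = (cmod (m + complex_of_real (sqrt (1 - e)) * u))\<^sup>2 / (\<sigma> + e)"

lemma fade_snr_measurable[measurable]: "fade_snr m \<sigma> e \<in> borel_measurable borel"
  unfolding fade_snr_def[abs_def] by simp

lemma fade_norm_bound:
  assumes "0 \<le> e" "e \<le> 1"
  shows "(cmod (m + complex_of_real (sqrt (1 - e)) * u))\<^sup>2 \<le> 2 * (cmod m)\<^sup>2 + 2 * (cmod u)\<^sup>2"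
proof -
  have "cmod (m + complex_of_real (sqrt (1 - e)) * u) \<le> cmod m + sqrt (1 - e) * cmod u"
    using norm_triangle_ineq[of m "complex_of_real (sqrt (1 - e)) * u"] assms by (simp add: norm_mult)
  also have "\<dots> \<le> cmod m + 1 * cmod u"
    using assms by (intro add_left_mono mult_right_mono) auto
  finally have "(cmod (m + complex_of_real (sqrt (1 - e)) * u))\<^sup>2 \<le> (cmod m + cmod u)\<^sup>2" by (intro power_mono) auto
  also have "\<dots> \<le> 2 * (cmod m)\<^sup>2 + 2 * (cmod u)\<^sup>2"
    using sum_squares_bound[of "cmod m" "cmod u"] by (simp add: power2_sum)
  finally show ?thesis .
qed

lemma fade_snr_bounds:
  assumes "0 < \<sigma>" "0 \<le> e" "e \<le> 1"
  shows "0 \<le> fade_snr m \<sigma> e u" "fade_snr m \<sigma> e u \<le> (2 * (cmod m)\<^sup>2 + 2 * (cmod u)\<^sup>2) / \<sigma>"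
proof -
  show "0 \<le> fade_snr m \<sigma> e u" using assms by (simp add: fade_snr_def)
  show "fade_snr m \<sigma> e u \<le> (2 * (cmod m)\<^sup>2 + 2 * (cmod u)\<^sup>2) / \<sigma>"
    unfolding fade_snr_def using assms fade_norm_bound[of e m u] by (intro frac_le) auto
qed

lemma fade_QPSK_bound:
  assumes "0 < \<sigma>" "0 \<le> e" "e \<le> 1"
  shows "\<bar>C_QPSK (fade_snr m \<sigma> e u)\<bar> \<le> ln 4 + 2 * (ln 2 + 3 * ((2 * (cmod m)\<^sup>2 + 2 * (cmod u)\<^sup>2) / \<sigma>) + (\<integral>y. y\<^sup>2 \<partial>std_N))"
  by (rule order_trans[OF C_QPSK_abs_le[OF fade_snr_bounds(1)[OF assms]]])
     (intro add_left_mono add_right_mono mult_left_mono fade_snr_bounds(2)[OF assms], simp_all)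

lemma integrable_fade_QPSK_bound:
  "integrable std_CN (\<lambda>u. ln 4 + 2 * (ln 2 + 3 * ((2 * (cmod m)\<^sup>2 + 2 * (cmod u)\<^sup>2) / \<sigma>) + (\<integral>y. y\<^sup>2 \<partial>std_N)))"
  using integrable_std_CN_cmod2 by simp

text \<open>Allows the error variance to be replaced by its limit. The majorant is quadratic in |u|
  and free of the error, because \<open>\<sigma>\<close> already bounds the denominator from
  below.\<close>

lemma fade_QPSK_tendsto:
  assumes \<sigma>: "0 < \<sigma>" and e: "\<And>n. 0 \<le> e n" "\<And>n. e n \<le> 1" and l: "e \<longlonglongrightarrow> l"
  shows "(\<lambda>n. \<integral>u. C_QPSK (fade_snr m \<sigma> (e n) u) \<partial>std_CN) \<longlonglongrightarrow> (\<integral>u. C_QPSK (fade_snr m \<sigma> l u) \<partial>std_CN)"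
proof (rule integral_dominated_convergence[OF _ _ integrable_fade_QPSK_bound[of m \<sigma>]])
  have l0: "0 \<le> l" by (rule LIMSEQ_le_const[OF l]) (use e in auto)
  show "AE u in std_CN. (\<lambda>n. C_QPSK (fade_snr m \<sigma> (e n) u)) \<longlonglongrightarrow> C_QPSK (fade_snr m \<sigma> l u)"
  proof (rule AE_I2)
    fix u
    have "(\<lambda>n. fade_snr m \<sigma> (e n) u) \<longlonglongrightarrow> fade_snr m \<sigma> l u"
      unfolding fade_snr_def using \<sigma> l0 by (intro tendsto_intros l) auto
    then show "(\<lambda>n. C_QPSK (fade_snr m \<sigma> (e n) u)) \<longlonglongrightarrow> C_QPSK (fade_snr m \<sigma> l u)"
      by (intro C_QPSK_tendsto fade_snr_bounds(1) \<sigma> e)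
  qed
  show "AE u in std_CN. norm (C_QPSK (fade_snr m \<sigma> (e n) u)) \<le> ln 4 + 2 * (ln 2 + 3 * ((2 * (cmod m)\<^sup>2 + 2 * (cmod u)\<^sup>2) / \<sigma>) + (\<integral>y. y\<^sup>2 \<partial>std_N))" for n
    using fade_QPSK_bound[OF \<sigma> e] by (intro AE_I2) simp
qed auto

subsection \<open>Soft decisions for QPSK\<close>

text \<open>Log-likelihood ratios of the two bits for \<open>x\<close> as sent. Changing the sign of
  Re x increases |y - h x|^2 / v by (4 / v) Re x Re (y cnj h), and likewise for the imaginary part:
  QPSK splits into two binary signals.\<close>

definition llr_arg :: "real \<Rightarrow> complex \<Rightarrow> complex \<Rightarrow> complex \<Rightarrow> real \<times> real" where
  "llr_arg v h y x = ((4 / v) * (Re x * Re (y * cnj h)), (4 / v) * (Im x * Im (y * cnj h)))"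

text \<open>Ratio of the posterior to the prior probability of the symbol \<open>x\<close>, for output \<open>y\<close>, gain \<open>h\<close>
  and noise variance \<open>v\<close>. It is \<open>1\<close> at \<open>x = 0\<close>, so that unused carriers need no case distinction.\<close>

definition soft :: "real \<Rightarrow> complex \<Rightarrow> complex \<Rightarrow> complex \<Rightarrow> real" where
  "soft v h y x = 4 / ((1 + exp (- fst (llr_arg v h y x))) * (1 + exp (- snd (llr_arg v h y x))))"

lemma soft_pos: "0 < soft v h y x"
  unfolding soft_def by (intro divide_pos_pos mult_pos_pos add_pos_pos) auto

lemma soft_zero: "soft v h y 0 = 1"
  by (simp add: soft_def llr_arg_def)

lemma ln_soft: "ln (soft v h y x) = ln 4 - softplus (fst (llr_arg v h y x)) - softplus (snd (llr_arg v h y x))"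
proof -
  have "0 < 1 + exp t" for t :: real by (simp add: add_pos_pos)
  then show ?thesis by (simp add: soft_def softplus_def ln_div ln_mult less_imp_neq[symmetric])
qed

definition qpsk :: "real \<Rightarrow> complex set" where
  "qpsk A = {Complex (A / sqrt 2) (A / sqrt 2), Complex (A / sqrt 2) (- A / sqrt 2),
     Complex (- A / sqrt 2) (A / sqrt 2), Complex (- A / sqrt 2) (- A / sqrt 2)}"

lemma card_qpsk: "0 < A \<Longrightarrow> card (qpsk A) = 4"
  by (simp add: qpsk_def card_insert_if)

lemma finite_qpsk: "finite (qpsk A)" by (simp add: qpsk_def)

lemma cmod_qpsk: "x \<in> qpsk A \<Longrightarrow> (cmod x)\<^sup>2 = A\<^sup>2"
  by (auto simp: qpsk_def cmod_power2 power_divide)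

text \<open>1 / (1 + a) + 1 / (1 + 1 / a) = 1 for each bit, that is, the posterior probabilities of
  the four symbols add up to 1.\<close>

lemma sum_soft:
  assumes A: "0 < A"
  shows "(\<Sum>x\<in>qpsk A. soft v h y x) = 4"
proof -
  define a where "a = exp (- ((4 / v) * (A / sqrt 2 * Re (y * cnj h))))"
  define b where "b = exp (- ((4 / v) * (A / sqrt 2 * Im (y * cnj h))))"
  have p: "0 < a" "0 < b" by (simp_all add: a_def b_def)
  have ia: "exp ((4 / v) * (A / sqrt 2 * Re (y * cnj h))) = 1 / a" and ib: "exp ((4 / v) * (A / sqrt 2 * Im (y * cnj h))) = 1 / b"
    by (simp_all add: a_def b_def exp_minus field_simps del: minus_mult_right)
  have "(\<Sum>x\<in>qpsk A. soft v h y x) = 4 / ((1 + a) * (1 + b)) + 4 / ((1 + a) * (1 + 1 / b)) + 4 / ((1 + 1 / a) * (1 + b)) + 4 / ((1 + 1 / a) * (1 + 1 / b))"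
    using A unfolding qpsk_def
    by (simp add: soft_def llr_arg_def a_def[symmetric] b_def[symmetric] ia ib del: times_divide_eq_left times_divide_eq_right times_complex.sel cnj.sel)
  also have "\<dots> = 4"
  proof -
    have "1 + a \<noteq> 0" "1 + b \<noteq> 0" "a \<noteq> 0" "b \<noteq> 0" "b + 1 \<noteq> 0" "a + 1 \<noteq> 0" using p by auto
    then show ?thesis by (simp add: divide_simps) (simp add: algebra_simps)
  qed
  finally show ?thesis .
qed

lemma soft_measurable:
  assumes [measurable]: "h \<in> borel_measurable M" "y \<in> borel_measurable M" "x \<in> borel_measurable M"
  shows "(\<lambda>p. soft v (h p) (y p) (x p)) \<in> borel_measurable M"
proof -
  have [measurable]: "(\<lambda>p. y p * cnj (h p)) \<in> borel_measurable M"
  proof -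
    have "(\<lambda>p. cnj (h p)) \<in> borel_measurable M"
      by (rule borel_measurable_continuous_on[where f = cnj]) (auto intro: continuous_intros)
    then show ?thesis by simp
  qed
  show ?thesis unfolding soft_def llr_arg_def fst_conv snd_conv by measurable
qed

text \<open>Softplus grows linearly, so a product |y| |h| suffices; it has finite mean when both
  factors are square integrable.\<close>

lemma ln_soft_abs_le:
  assumes x: "cmod x \<le> A" and v: "0 < v"
  shows "\<bar>ln (soft v h y x)\<bar> \<le> ln 4 + 2 * ln 2 + (8 * A / v) * (cmod y * cmod h)"
proof -
  have A: "0 \<le> A" using x norm_ge_zero order_trans by blast
  have b: "\<bar>Re x * Re (y * cnj h)\<bar> \<le> A * (cmod y * cmod h)" "\<bar>Im x * Im (y * cnj h)\<bar> \<le> A * (cmod y * cmod h)"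
    using abs_Re_le_cmod[of x] abs_Im_le_cmod[of x] abs_Re_le_cmod[of "y * cnj h"] abs_Im_le_cmod[of "y * cnj h"] x A
    unfolding abs_mult by (auto simp: norm_mult intro!: mult_mono)
  have "\<bar>fst (llr_arg v h y x)\<bar> \<le> (4 / v) * (A * (cmod y * cmod h))" "\<bar>snd (llr_arg v h y x)\<bar> \<le> (4 / v) * (A * (cmod y * cmod h))"
    using v mult_left_mono[OF b(1), of "4 / v"] mult_left_mono[OF b(2), of "4 / v"]
    by (simp_all add: llr_arg_def abs_mult del: times_complex.sel)
  moreover have "(4 / v) * (A * (cmod y * cmod h)) + (4 / v) * (A * (cmod y * cmod h)) = (8 * A / v) * (cmod y * cmod h)"
    by (simp add: field_simps)
  moreover have "0 \<le> ln (4 :: real)" "0 \<le> ln (2 :: real)" by simp_all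
  ultimately show ?thesis
    unfolding ln_soft using softplus_le[of "fst (llr_arg v h y x)"] softplus_le[of "snd (llr_arg v h y x)"]
      softplus_nonneg[of "fst (llr_arg v h y x)"] softplus_nonneg[of "snd (llr_arg v h y x)"]
    unfolding abs_le_iff by (intro conjI) linarith+
qed

lemma expectation_softplus_std_CN:
  assumes c: "cmod c = 1" and s: "0 \<le> s"
  shows "integrable std_CN (\<lambda>w. softplus (2 * (s + sqrt s * (sqrt 2 * Re (c * w)))))"
    and "(\<integral>w. softplus (2 * (s + sqrt s * (sqrt 2 * Re (c * w)))) \<partial>std_CN) = (\<integral>y. softplus (2 * (s + sqrt s * y)) \<partial>std_N)"
proof -
  have m: "(\<lambda>w. sqrt 2 * Re (c * w)) \<in> std_CN \<rightarrow>\<^sub>M borel" by measurable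
  have g: "(\<lambda>y. softplus (2 * (s + sqrt s * y))) \<in> borel_measurable borel" by measurable
  show "integrable std_CN (\<lambda>w. softplus (2 * (s + sqrt s * (sqrt 2 * Re (c * w)))))"
    using integrable_softplus_snr[OF s] integrable_distr_eq[OF m g] by (simp only: distr_Re_std_CN'[OF c])
  show "(\<integral>w. softplus (2 * (s + sqrt s * (sqrt 2 * Re (c * w)))) \<partial>std_CN) = (\<integral>y. softplus (2 * (s + sqrt s * y)) \<partial>std_N)"
    using integral_distr[OF m g] by (simp only: distr_Re_std_CN'[OF c])
qed

text \<open>Pure field arithmetic: \<open>r\<close>, \<open>t\<close>, \<open>g\<close>,
  \<open>h\<close> stand for sqrt v, sqrt 2, the sign of the bit and the modulus of the gain, and
  \<open>R\<close> for the projected noise.\<close>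

lemma softplus_component_aux:
  fixes r t g h A R :: real
  assumes "r \<noteq> 0" "t * t = 2" "g * g = 1" "h \<noteq> 0"
  shows "(4 / (r * r)) * ((g * A / t) * ((g * A / t) * h\<^sup>2 + r * R)) = 2 * (h\<^sup>2 * A\<^sup>2 / (r * r) + (h * A / r) * (t * (g / h * R)))"
proof -
  have t: "t \<noteq> 0" using assms(2) by auto
  have t': "4 / t = 2 * t" using t assms(2) by (simp add: field_simps)
  have "(4 / (r * r)) * ((g * A / t) * ((g * A / t) * h\<^sup>2 + r * R)) =
      4 / (r * r) * (g * g) * A\<^sup>2 * h\<^sup>2 / (t * t) + (4 / t) * (g * A * R / r)"
    using assms(1) t by (simp add: field_simps power2_eq_square)
  also have "\<dots> = 2 * (h\<^sup>2 * A\<^sup>2 / (r * r) + (h * A / r) * (t * (g / h * R)))"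
    unfolding t' assms(2,3) using assms(1,4) by (simp add: field_simps)
  finally show ?thesis .
qed

text \<open>One bit is a binary signal in real noise: the phase of the gain and the sign of the bit
  are absorbed into a unit number \<open>c\<close> multiplying the noise. \<open>k\<close> is 1 for
  the real and -i for the imaginary component.\<close>

lemma softplus_component:
  assumes a: "\<bar>a\<bar> = A / sqrt 2" and A: "0 < A" and v: "0 < v" and k: "cmod k = 1"
  obtains c where "cmod c = 1"
    "\<And>w. (4 / v) * (a * (a * (cmod h)\<^sup>2 + sqrt v * Re (k * (w * cnj h)))) =
       2 * ((cmod h)\<^sup>2 * A\<^sup>2 / v + sqrt ((cmod h)\<^sup>2 * A\<^sup>2 / v) * (sqrt 2 * Re (c * w)))"
proof -
  \<comment> \<open>For a vanishing gain the signal-to-noise ratio is 0 and any \<open>c\<close> of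
    modulus 1 will do.\<close>
  define c where "c = (if h = 0 then 1 else complex_of_real (sgn a) * (k * cnj h) / complex_of_real (cmod h))"
  have a0: "a \<noteq> 0" using a A by auto
  have "cmod c = 1" using k a0 by (simp add: c_def norm_mult norm_divide abs_sgn_eq)
  moreover have "(4 / v) * (a * (a * (cmod h)\<^sup>2 + sqrt v * Re (k * (w * cnj h)))) =
       2 * ((cmod h)\<^sup>2 * A\<^sup>2 / v + sqrt ((cmod h)\<^sup>2 * A\<^sup>2 / v) * (sqrt 2 * Re (c * w)))" for w
  proof (cases "h = 0")
    case True then show ?thesis by simp
  next
    case False
    have ss: "sqrt ((cmod h)\<^sup>2 * A\<^sup>2 / v) = cmod h * A / sqrt v" using A by (simp add: real_sqrt_mult real_sqrt_divide)
    have "c * w = complex_of_real (sgn a / cmod h) * (k * (w * cnj h))" using False by (simp add: c_def)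
    then have R: "Re (c * w) = sgn a / cmod h * Re (k * (w * cnj h))"
      by (metis Re_complex_of_real Im_complex_of_real times_complex.simps(1) mult_zero_left diff_zero)
    have aa: "a = sgn a * A / sqrt 2" using a by (simp add: sgn_if abs_if split: if_splits)
    have g: "sgn a * sgn a = 1" using a0 by (simp add: sgn_if)
    have vv: "v = sqrt v * sqrt v" using v by simp
    have "(4 / (sqrt v * sqrt v)) * ((sgn a * A / sqrt 2) * ((sgn a * A / sqrt 2) * (cmod h)\<^sup>2 + sqrt v * Re (k * (w * cnj h)))) =
       2 * ((cmod h)\<^sup>2 * A\<^sup>2 / (sqrt v * sqrt v) + (cmod h * A / sqrt v) * (sqrt 2 * (sgn a / cmod h * Re (k * (w * cnj h)))))"
      by (rule softplus_component_aux) (use v False g in auto)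
    then show ?thesis unfolding ss R aa[symmetric] vv[symmetric] .
  qed
  ultimately show ?thesis by (rule that)
qed

text \<open>By rotation invariance of the noise both bits contribute the same integral, and neither
  the symbol sent nor the phase of the gain leaves a trace in the value.\<close>

lemma expectation_ln_soft:
  assumes x: "x \<in> qpsk A" and A: "0 < A" and v: "0 < v"
  shows "integrable std_CN (\<lambda>w. ln (soft v h (h * x + complex_of_real (sqrt v) * w) x))"
    and "(\<integral>w. ln (soft v h (h * x + complex_of_real (sqrt v) * w) x) \<partial>std_CN) = C_QPSK ((cmod h)\<^sup>2 * A\<^sup>2 / v)"
proof -
  define s where "s = (cmod h)\<^sup>2 * A\<^sup>2 / v"
  have s0: "0 \<le> s" using v by (simp add: s_def)
  have ab: "\<bar>Re x\<bar> = A / sqrt 2" "\<bar>Im x\<bar> = A / sqrt 2" using x A by (auto simp: qpsk_def)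
  have hh: "h * cnj h = complex_of_real ((cmod h)\<^sup>2)" by (rule complex_norm_square[symmetric])
  have e: "(h * x + complex_of_real (sqrt v) * w) * cnj h = complex_of_real ((cmod h)\<^sup>2) * x + complex_of_real (sqrt v) * (w * cnj h)" for w
    unfolding hh[symmetric] by (simp add: algebra_simps)
  have f: "fst (llr_arg v h (h * x + complex_of_real (sqrt v) * w) x) = (4 / v) * (Re x * (Re x * (cmod h)\<^sup>2 + sqrt v * Re (1 * (w * cnj h))))"
    and f': "snd (llr_arg v h (h * x + complex_of_real (sqrt v) * w) x) = (4 / v) * (Im x * (Im x * (cmod h)\<^sup>2 + sqrt v * Re (- \<i> * (w * cnj h))))" for w
    unfolding llr_arg_def e fst_conv snd_conv by (simp_all add: mult.commute)
  obtain c1 where c1: "cmod c1 = 1" "\<And>w. (4 / v) * (Re x * (Re x * (cmod h)\<^sup>2 + sqrt v * Re (1 * (w * cnj h)))) = 2 * (s + sqrt s * (sqrt 2 * Re (c1 * w)))"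
    unfolding s_def by (rule softplus_component[OF ab(1) A v, of 1 h]) auto
  obtain c2 where c2: "cmod c2 = 1" "\<And>w. (4 / v) * (Im x * (Im x * (cmod h)\<^sup>2 + sqrt v * Re (- \<i> * (w * cnj h)))) = 2 * (s + sqrt s * (sqrt 2 * Re (c2 * w)))"
    unfolding s_def by (rule softplus_component[OF ab(2) A v, of "- \<i>" h]) auto
  have L: "ln (soft v h (h * x + complex_of_real (sqrt v) * w) x) =
     ln 4 - softplus (2 * (s + sqrt s * (sqrt 2 * Re (c1 * w)))) - softplus (2 * (s + sqrt s * (sqrt 2 * Re (c2 * w))))" for w
    unfolding ln_soft f f' c1(2) c2(2) ..
  note i1 = expectation_softplus_std_CN[OF c1(1) s0] and i2 = expectation_softplus_std_CN[OF c2(1) s0]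
  show "integrable std_CN (\<lambda>w. ln (soft v h (h * x + complex_of_real (sqrt v) * w) x))"
    unfolding L by (intro Bochner_Integration.integrable_diff i1(1) i2(1) std_CN.integrable_const)
  have "(\<integral>w. ln (soft v h (h * x + complex_of_real (sqrt v) * w) x) \<partial>std_CN) =
     ln 4 - (\<integral>y. softplus (2 * (s + sqrt s * y)) \<partial>std_N) - (\<integral>y. softplus (2 * (s + sqrt s * y)) \<partial>std_N)"
    unfolding L i1(2)[symmetric]
    by (subst Bochner_Integration.integral_diff, intro Bochner_Integration.integrable_diff i1(1) std_CN.integrable_const, rule i2(1),
        subst Bochner_Integration.integral_diff, rule std_CN.integrable_const, rule i1(1))
       (simp only: i1(2) i2(2), simp add: std_CN.prob_space[unfolded space_std_CN])
  then show "(\<integral>w. ln (soft v h (h * x + complex_of_real (sqrt v) * w) x) \<partial>std_CN) = C_QPSK ((cmod h)\<^sup>2 * A\<^sup>2 / v)"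
    unfolding C_QPSK_eq s_def by simp
qed

text \<open>\<open>v\<close> is the channel noise plus an estimation error of variance
  \<open>e\<close> seen through a symbol of energy A^2. Given the gain, the channel is AWGN with
  ratio |h|^2 A^2 / v, and the phase \<open>\<zeta>\<close> drops out of the modulus.\<close>

lemma expectation_fade_soft:
  fixes m \<zeta> :: complex
  assumes x: "x \<in> qpsk A" and A: "0 < A" and e: "0 \<le> e" "e \<le> 1" and \<zeta>: "cmod \<zeta> = 1"
  defines "v \<equiv> 1 + e * A\<^sup>2"
  defines "h \<equiv> \<lambda>u. \<zeta> * (m + complex_of_real (sqrt (1 - e)) * u)"
  shows "integrable (std_CN \<Otimes>\<^sub>M std_CN) (\<lambda>p. ln (soft v (h (fst p)) (h (fst p) * x + complex_of_real (sqrt v) * snd p) x))"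
    and "(\<integral>p. ln (soft v (h (fst p)) (h (fst p) * x + complex_of_real (sqrt v) * snd p) x) \<partial>(std_CN \<Otimes>\<^sub>M std_CN)) =
      (\<integral>u. C_QPSK (fade_snr m (1 / A\<^sup>2) e u) \<partial>std_CN)"
proof -
  interpret pp: pair_prob_space std_CN std_CN ..
  have v: "0 < v" using e by (simp add: v_def add_pos_nonneg)
  have c: "f \<in> borel_measurable std_CN" if "f \<in> borel_measurable borel" for f :: "complex \<Rightarrow> complex"
    using that by (simp add: measurable_cong_sets[OF sets_std_CN refl])
  have fm: "(\<lambda>p. f (fst p)) \<in> borel_measurable (std_CN \<Otimes>\<^sub>M std_CN)"
    and sm: "(\<lambda>p. f (snd p)) \<in> borel_measurable (std_CN \<Otimes>\<^sub>M std_CN)"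
    if "f \<in> borel_measurable borel" for f :: "complex \<Rightarrow> complex"
    by (rule measurable_compose[OF measurable_fst c[OF that]], rule measurable_compose[OF measurable_snd c[OF that]])
  have hm: "h \<in> borel_measurable borel"
    unfolding h_def by (intro borel_measurable_times borel_measurable_add borel_measurable_const measurable_ident_sets) simp
  let ?F = "\<lambda>p. ln (soft v (h (fst p)) (h (fst p) * x + complex_of_real (sqrt v) * snd p) x)"
  have Fm: "?F \<in> borel_measurable (std_CN \<Otimes>\<^sub>M std_CN)"
    by (intro borel_measurable_ln soft_measurable borel_measurable_times borel_measurable_add borel_measurable_const fm[OF hm])
       (rule sm[OF measurable_ident_sets[OF refl]])
  have xA: "cmod x = A" using cmod_qpsk[OF x] A by (simp add: power2_eq_iff_nonneg)
  show Fi: "integrable (std_CN \<Otimes>\<^sub>M std_CN) ?F"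
  proof (rule Bochner_Integration.integrable_bound[OF _ Fm])
    let ?B = "\<lambda>p. ln 4 + 2 * ln 2 + (8 * A / v) * ((A + sqrt v) * (2 * (cmod m)\<^sup>2 + 2 * (cmod (fst p))\<^sup>2) + sqrt v * (cmod (snd p))\<^sup>2)"
    have "integrable (std_CN \<Otimes>\<^sub>M std_CN) (\<lambda>p. (cmod (fst p))\<^sup>2)" "integrable (std_CN \<Otimes>\<^sub>M std_CN) (\<lambda>p. (cmod (snd p))\<^sup>2)"
      using integrable_std_CN_cmod2
      by (auto intro!: integrable_distr[of fst _ std_CN] integrable_distr[of snd _ std_CN]
          simp: std_CN.distr_pair_fst distr_pair_snd'[OF prob_space_std_CN prob_space_std_CN])
    then show "integrable (std_CN \<Otimes>\<^sub>M std_CN) ?B" by simp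
    show "AE p in std_CN \<Otimes>\<^sub>M std_CN. norm (?F p) \<le> norm (?B p)"
    proof (rule AE_I2)
      fix p :: "complex \<times> complex"
      let ?h = "h (fst p)" and ?w = "snd p"
      have h2: "(cmod ?h)\<^sup>2 \<le> 2 * (cmod m)\<^sup>2 + 2 * (cmod (fst p))\<^sup>2"
        using fade_norm_bound[OF e, of m "fst p"] by (simp add: h_def norm_mult \<zeta>)
      have "cmod (?h * x + complex_of_real (sqrt v) * ?w) * cmod ?h \<le> (cmod ?h * A + sqrt v * cmod ?w) * cmod ?h"
        using norm_triangle_ineq[of "?h * x" "complex_of_real (sqrt v) * ?w"] v xA by (intro mult_right_mono) (auto simp: norm_mult)
      also have "\<dots> = A * (cmod ?h)\<^sup>2 + sqrt v * (cmod ?w * cmod ?h)" by (simp add: power2_eq_square algebra_simps)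
      also have "\<dots> \<le> A * (cmod ?h)\<^sup>2 + sqrt v * ((cmod ?w)\<^sup>2 + (cmod ?h)\<^sup>2)"
      proof -
        have "2 * (cmod ?w * cmod ?h) \<le> (cmod ?w)\<^sup>2 + (cmod ?h)\<^sup>2"
          using sum_squares_bound[of "cmod ?w" "cmod ?h"] by (simp add: mult.assoc)
        moreover have "0 \<le> cmod ?w * cmod ?h" by simp
        ultimately have "cmod ?w * cmod ?h \<le> (cmod ?w)\<^sup>2 + (cmod ?h)\<^sup>2" by linarith
        then show ?thesis using v by (intro add_left_mono mult_left_mono) auto
      qed
      also have "\<dots> = (A + sqrt v) * (cmod ?h)\<^sup>2 + sqrt v * (cmod ?w)\<^sup>2" by (simp add: algebra_simps)
      also have "\<dots> \<le> (A + sqrt v) * (2 * (cmod m)\<^sup>2 + 2 * (cmod (fst p))\<^sup>2) + sqrt v * (cmod ?w)\<^sup>2"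
        using h2 A v by (intro add_right_mono mult_left_mono) auto
      finally have "(8 * A / v) * (cmod (?h * x + complex_of_real (sqrt v) * ?w) * cmod ?h) \<le>
        (8 * A / v) * ((A + sqrt v) * (2 * (cmod m)\<^sup>2 + 2 * (cmod (fst p))\<^sup>2) + sqrt v * (cmod ?w)\<^sup>2)"
        using A v by (intro mult_left_mono) auto
      then have "\<bar>?F p\<bar> \<le> ?B p"
        using ln_soft_abs_le[of x A v ?h "?h * x + complex_of_real (sqrt v) * ?w"] xA v by linarith
      then show "norm (?F p) \<le> norm (?B p)" unfolding real_norm_def by linarith
    qed
  qed
  have "(\<integral>p. ?F p \<partial>(std_CN \<Otimes>\<^sub>M std_CN)) = (\<integral>u. \<integral>w. ?F (u, w) \<partial>std_CN \<partial>std_CN)"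
    by (rule pp.integral_fst'[OF Fi, symmetric])
  also have "\<dots> = (\<integral>u. C_QPSK ((cmod (h u))\<^sup>2 * A\<^sup>2 / v) \<partial>std_CN)"
    unfolding fst_conv snd_conv expectation_ln_soft(2)[OF x A v] ..
  also have "(\<lambda>u. (cmod (h u))\<^sup>2 * A\<^sup>2 / v) = fade_snr m (1 / A\<^sup>2) e"
  proof
    fix u
    have "cmod (h u) = cmod (m + complex_of_real (sqrt (1 - e)) * u)" by (simp only: h_def norm_mult[of \<zeta>] \<zeta> mult_1)
    moreover have "X * A\<^sup>2 / v = X / (1 / A\<^sup>2 + e)" for X
    proof -
      have "A\<^sup>2 \<noteq> 0" using A by simp
      then have "1 / A\<^sup>2 + e = v / A\<^sup>2" by (simp add: v_def add_divide_distrib)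
      then show ?thesis by simp
    qed
    ultimately show "(cmod (h u))\<^sup>2 * A\<^sup>2 / v = fade_snr m (1 / A\<^sup>2) e u" by (simp only: fade_snr_def)
  qed
  finally show "(\<integral>p. ?F p \<partial>(std_CN \<Otimes>\<^sub>M std_CN)) = (\<integral>u. C_QPSK (fade_snr m (1 / A\<^sup>2) e u) \<partial>std_CN)" .
qed

subsection \<open>Blocks of QPSK symbols\<close>

text \<open>A chain rule. The factor at time \<open>k\<close> involves only earlier symbols and the
  current one, and sums to \<open>q\<close> over the current one; the last time is therefore summed
  out first, with everything before it held fixed.\<close>

lemma sum_PiE_sequential:
  fixes \<psi> :: "nat \<Rightarrow> (nat \<Rightarrow> 'a) \<Rightarrow> 'a \<Rightarrow> real"
  assumes Q: "finite Q"
    and causal: "\<And>k x x' c. (\<And>j. j < k \<Longrightarrow> x j = x' j) \<Longrightarrow> \<psi> k x c = \<psi> k x' c"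
    and one: "\<And>k x. (\<Sum>c\<in>Q. \<psi> k x c) = q"
  shows "(\<Sum>x\<in>Pi\<^sub>E {..<n} (\<lambda>_. Q). \<Prod>k<n. \<psi> k x (x k)) = q ^ n"
proof (induction n)
  case 0 then show ?case by simp
next
  case (Suc n)
  have S: "{..<Suc n} = insert n {..<n}" by auto
  have inj: "inj_on (\<lambda>(c, x). x(n := c)) (Q \<times> Pi\<^sub>E {..<n} (\<lambda>_. Q))"
  proof (rule inj_onI, clarify)
    fix c x c' x' assume x: "x \<in> Pi\<^sub>E {..<n} (\<lambda>_. Q)" and x': "x' \<in> Pi\<^sub>E {..<n} (\<lambda>_. Q)" and e: "x(n := c) = x'(n := c')"
    have "x j = x' j" for j
      using fun_cong[OF e, of j] x x' by (cases "j = n") (auto simp: PiE_iff extensional_def)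
    then show "c = c' \<and> x = x'" using fun_cong[OF e, of n] by auto
  qed
  have "(\<Sum>x\<in>Pi\<^sub>E {..<Suc n} (\<lambda>_. Q). \<Prod>k<Suc n. \<psi> k x (x k)) =
    (\<Sum>p\<in>Q \<times> Pi\<^sub>E {..<n} (\<lambda>_. Q). \<Prod>k<Suc n. \<psi> k ((snd p)(n := fst p)) (((snd p)(n := fst p)) k))"
    unfolding S PiE_insert_eq by (subst sum.reindex[OF inj]) (simp add: case_prod_unfold S[symmetric])
  also have "\<dots> = (\<Sum>p\<in>Q \<times> Pi\<^sub>E {..<n} (\<lambda>_. Q). (\<Prod>k<n. \<psi> k (snd p) (snd p k)) * \<psi> n (snd p) (fst p))"
  proof (rule sum.cong[OF refl])
    fix p :: "'a \<times> (nat \<Rightarrow> 'a)"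
    have "(\<Prod>k<n. \<psi> k ((snd p)(n := fst p)) (((snd p)(n := fst p)) k)) = (\<Prod>k<n. \<psi> k (snd p) (snd p k))"
    proof (rule prod.cong[OF refl])
      fix k assume "k \<in> {..<n}"
      then show "\<psi> k ((snd p)(n := fst p)) (((snd p)(n := fst p)) k) = \<psi> k (snd p) (snd p k)"
        using causal[of k "(snd p)(n := fst p)" "snd p"] by auto
    qed
    moreover have "\<psi> n ((snd p)(n := fst p)) (fst p) = \<psi> n (snd p) (fst p)" by (rule causal) simp
    ultimately show "(\<Prod>k<Suc n. \<psi> k ((snd p)(n := fst p)) (((snd p)(n := fst p)) k)) = (\<Prod>k<n. \<psi> k (snd p) (snd p k)) * \<psi> n (snd p) (fst p)"
      by simp
  qed
  also have "\<dots> = (\<Sum>x\<in>Pi\<^sub>E {..<n} (\<lambda>_. Q). \<Sum>c\<in>Q. (\<Prod>k<n. \<psi> k x (x k)) * \<psi> n x c)"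
    by (subst sum.swap) (simp add: sum.cartesian_product case_prod_unfold)
  also have "\<dots> = (\<Sum>x\<in>Pi\<^sub>E {..<n} (\<lambda>_. Q). \<Prod>k<n. \<psi> k x (x k)) * q"
    by (simp add: sum_distrib_left[symmetric] one sum_distrib_right)
  finally show ?case by (simp add: Suc)
qed

text \<open>Silent carriers get the singleton {0}, so that a row is a product set over all carriers;
  \<open>soft\<close> equals 1 on them.\<close>

definition qpsk_row :: "nat \<Rightarrow> nat \<Rightarrow> real \<Rightarrow> (nat \<Rightarrow> complex) set" where
  "qpsk_row N r A = (\<Pi>\<^sub>E m\<in>{..<N}. if m < r then qpsk A else {0})"

definition qpsk_blocks :: "nat \<Rightarrow> nat \<Rightarrow> real \<Rightarrow> nat \<Rightarrow> (nat \<Rightarrow> nat \<Rightarrow> complex) set" where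
  "qpsk_blocks N r A n = (\<Pi>\<^sub>E k\<in>{..n}. qpsk_row N r A)"

lemma finite_qpsk_row: "finite (qpsk_row N r A)"
  unfolding qpsk_row_def by (intro finite_PiE) (auto simp: finite_qpsk)

lemma finite_qpsk_blocks: "finite (qpsk_blocks N r A n)"
  unfolding qpsk_blocks_def by (intro finite_PiE) (auto simp: finite_qpsk_row)

lemma qpsk_row_sum:
  assumes A: "0 < A"
  shows "(\<Sum>c\<in>qpsk_row N r A. \<Prod>m<N. soft (v m) (h m) (y m) (c m)) = real (card (qpsk_row N r A))"
proof -
  have s: "(\<Sum>x\<in>(if m < r then qpsk A else {0}). soft (v m) (h m) (y m) x) = real (card (if m < r then qpsk A else {0}))" for m
    using A by (simp add: sum_soft card_qpsk soft_zero)
  have "(\<Sum>c\<in>qpsk_row N r A. \<Prod>m<N. soft (v m) (h m) (y m) (c m)) = (\<Prod>m<N. \<Sum>x\<in>(if m < r then qpsk A else {0}). soft (v m) (h m) (y m) x)"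
    unfolding qpsk_row_def by (rule prod_sum_PiE[symmetric]) (auto simp: finite_qpsk)
  also have "\<dots> = real (card (qpsk_row N r A))"
    unfolding s qpsk_row_def by (simp add: card_PiE)
  finally show ?thesis .
qed

text \<open>The gain used at time \<open>k\<close> may depend on past symbols and on all outputs.
  Causality in the symbols is what makes the total independent of the gain, so a posterior ratio
  with a poor estimate is still properly normalised.\<close>

lemma qpsk_blocks_sum:
  assumes A: "0 < A"
    and causal: "\<And>k x x' m. (\<And>j. j < k \<Longrightarrow> x j = x' j) \<Longrightarrow> h k x m = h k x' m"
  shows "(\<Sum>x\<in>qpsk_blocks N r A n. \<Prod>k\<le>n. \<Prod>m<N. soft (v k m) (h k x m) (y k m) (x k m)) = real (card (qpsk_blocks N r A n))"
proof -
  have "(\<Sum>x\<in>Pi\<^sub>E {..<Suc n} (\<lambda>_. qpsk_row N r A). \<Prod>k<Suc n. \<Prod>m<N. soft (v k m) (h k x m) (y k m) (x k m)) = real (card (qpsk_row N r A)) ^ Suc n"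
  proof (rule sum_PiE_sequential[OF finite_qpsk_row, where \<psi> = "\<lambda>k x c. \<Prod>m<N. soft (v k m) (h k x m) (y k m) (c m)"])
    fix k and x x' :: "nat \<Rightarrow> nat \<Rightarrow> complex" and c :: "nat \<Rightarrow> complex" assume "\<And>j. j < k \<Longrightarrow> x j = x' j"
    then have "h k x m = h k x' m" for m by (rule causal)
    then show "(\<Prod>m<N. soft (v k m) (h k x m) (y k m) (c m)) = (\<Prod>m<N. soft (v k m) (h k x' m) (y k m) (c m))" by simp
  qed (rule qpsk_row_sum[OF A])
  then show ?thesis by (simp only: lessThan_Suc_atMost qpsk_blocks_def card_PiE[OF finite_atMost] prod_constant card_atMost of_nat_power)
qed

subsection \<open>Gaussian channel estimates\<close>

text \<open>Entries of sqrt N F^H: a tap reaches a carrier with a mere phase.\<close>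

definition tw :: "nat \<Rightarrow> nat \<Rightarrow> nat \<Rightarrow> complex" where
  "tw N l m = complex_of_real (sqrt (real N)) * cnj (dft N l m)"

lemma gain_tw: "gain N h m = (\<Sum>l<N. tw N l m * h l)"
  unfolding gain_def freq_resp_def tw_def sum_distrib_left by (simp only: mult.assoc)

lemma tw_eq: "0 < N \<Longrightarrow> tw N l m = cis (2 * pi * real l * real m / real N)"
proof -
  assume N: "0 < N"
  have "dft N l m = complex_of_real (1 / sqrt (real N)) * cis (- (2 * pi * real l * real m / real N))"
    unfolding dft_def cis_conv_exp by (simp add: field_simps)
  then show ?thesis using N by (simp add: tw_def cis_cnj real_sqrt_gt_zero del: of_real_sqrt)
qed

lemma cmod_tw: "0 < N \<Longrightarrow> cmod (tw N l m) = 1"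
  by (simp add: tw_eq)

lemma tw_cnj: "0 < N \<Longrightarrow> tw N l m * cnj (tw N l m) = 1"
  by (simp add: complex_norm_square[symmetric] cmod_tw)

lemma sum_atMost_split: "(\<Sum>i\<le>k. g i) = (\<Sum>i<k. g i) + g k" for g :: "nat \<Rightarrow> 'b::comm_monoid_add"
  by (simp add: lessThan_Suc_atMost[symmetric])

lemma sum_if_less: "r \<le> N \<Longrightarrow> (\<Sum>m<N. if m < r then g m else 0) = (\<Sum>m<r. g m)"
  for g :: "nat \<Rightarrow> 'b::comm_monoid_add"
  by (rule sum.mono_neutral_cong_right) auto

lemma integral_pair_mult:
  fixes f :: "'a \<Rightarrow> complex" and g :: "'b \<Rightarrow> complex"
  assumes "prob_space A" "prob_space B"
    and f: "f \<in> borel_measurable A" "\<And>x. cmod (f x) \<le> 1" and g: "g \<in> borel_measurable B" "\<And>x. cmod (g x) \<le> 1"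
  shows "(\<integral>p. f (fst p) * g (snd p) \<partial>(A \<Otimes>\<^sub>M B)) = (\<integral>x. f x \<partial>A) * (\<integral>y. g y \<partial>B)"
proof -
  interpret A: prob_space A by fact
  interpret B: prob_space B by fact
  interpret pair_prob_space A B ..
  have m: "(\<lambda>p. f (fst p) * g (snd p)) \<in> borel_measurable (A \<Otimes>\<^sub>M B)"
    by (intro borel_measurable_times measurable_compose[OF measurable_fst f(1)] measurable_compose[OF measurable_snd g(1)])
  have "cmod (f (fst p) * g (snd p)) \<le> 1" for p
    using mult_mono[OF f(2)[of "fst p"] g(2)[of "snd p"]] by (simp add: norm_mult)
  then have i: "integrable (A \<Otimes>\<^sub>M B) (\<lambda>p. f (fst p) * g (snd p))"
    using m by (intro integrable_const_bound[of _ 1]) auto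
  have "(\<integral>p. f (fst p) * g (snd p) \<partial>(A \<Otimes>\<^sub>M B)) = (\<integral>x. \<integral>y. f x * g y \<partial>B \<partial>A)"
    using integral_fst'[OF i] by simp
  also have "\<dots> = (\<integral>x. f x \<partial>A) * (\<integral>y. g y \<partial>B)"
    by (simp only: integral_mult_right_zero integral_mult_left_zero)
  finally show ?thesis .
qed

lemma char_white_block:
  "(\<integral>w. iexp (Re (\<Sum>k\<le>n. \<Sum>m<N. c k m * w k m)) \<partial>white_block N n) = exp (- (\<Sum>k\<le>n. \<Sum>m<N. (cmod (c k m))\<^sup>2) / 4)"
proof -
  interpret product_prob_space "\<lambda>_. white_vec N" "{..n}" by (rule product_prob_spaceI[OF prob_space_white_vec])
  interpret finite_product_sigma_finite "\<lambda>_. white_vec N" "{..n}" by standard simp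
  have rm: "(\<lambda>z. iexp (Re (\<Sum>m<N. c k m * z m))) \<in> borel_measurable (white_vec N)" for k
  proof -
    have "(\<lambda>z. \<Sum>m<N. c k m * z m) \<in> borel_measurable (white_vec N)"
      unfolding measurable_cong_sets[OF sets_white_vec refl]
      by (intro borel_measurable_sum borel_measurable_times borel_measurable_const vec_component) simp
    then show ?thesis by measurable
  qed
  have "(\<integral>w. iexp (Re (\<Sum>k\<le>n. \<Sum>m<N. c k m * w k m)) \<partial>white_block N n) =
     (\<integral>w. (\<Prod>k\<le>n. iexp (Re (\<Sum>m<N. c k m * w k m))) \<partial>(\<Pi>\<^sub>M k\<in>{..n}. white_vec N))"
    unfolding white_block_def Re_sum[of _ "{..n}"] of_real_sum[of _ "{..n}"] sum_distrib_left[of _ _ "{..n}"] exp_sum[OF finite_atMost] ..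
  also have "\<dots> = (\<Prod>k\<le>n. (\<integral>z. iexp (Re (\<Sum>m<N. c k m * z m)) \<partial>white_vec N))"
  proof (rule product_integral_prod)
    show "integrable (white_vec N) (\<lambda>z. iexp (Re (\<Sum>m<N. c k m * z m)))" for k
      by (rule finite_measure.integrable_const_bound[OF prob_space.axioms(1)[OF prob_space_white_vec] _ rm, where B = 1]) simp
  qed simp
  also have "\<dots> = (\<Prod>k\<le>n. complex_of_real (exp (- (\<Sum>m<N. (cmod (c k m))\<^sup>2) / 4)))"
    unfolding char_white_vec ..
  also have "\<dots> = exp (- (\<Sum>k\<le>n. \<Sum>m<N. (cmod (c k m))\<^sup>2) / 4)"
    unfolding of_real_prod[symmetric] exp_sum[OF finite_atMost, symmetric]
    by (simp add: sum_negf sum_divide_distrib)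
  finally show ?thesis .
qed

context ofdm_channel
begin

lemma N_pos: "0 < N" using L_pos L_le_N by simp

definition "Hc k l \<omega> = H k \<omega> l - mean M (\<lambda>\<omega>. H 0 \<omega> l)" for k l :: nat
definition "gmean m = (\<Sum>l<N. tw N l m * mean M (\<lambda>\<omega>. H 0 \<omega> l))" for m :: nat

lemma gain_centered: "gain N (H k \<omega>) m = gmean m + (\<Sum>l<N. tw N l m * Hc k l \<omega>)"
  unfolding gain_tw gmean_def Hc_def right_diff_distrib sum_subtractf by simp

text \<open>The Kronecker structure of the covariance decouples the taps: one Toeplitz form for
  each, weighted with its power.\<close>

lemma H_char:
  "(\<integral>\<omega>. iexp (Re (\<Sum>i\<le>n. \<Sum>l<N. \<alpha> i l * Hc i l \<omega>)) \<partial>M) =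
   exp (- Re (\<Sum>l<N. complex_of_real (cH l) * (\<Sum>i\<le>n. \<Sum>j\<le>n. \<alpha> i l * cnj (\<alpha> j l) * \<rho> (int i - int j))) / 4)"
proof -
  let ?J = "{..n} \<times> {..<N}"
  let ?Z = "\<lambda>(k, l) \<omega>. H k \<omega> l"
  let ?c = "\<lambda>(k, l). \<alpha> k l"
  have z: "?c j * (?Z j \<omega> - mean M (?Z j)) = (case j of (i, l) \<Rightarrow> \<alpha> i l * Hc i l \<omega>)" if "j \<in> ?J" for j \<omega>
    using that H_mean_const[of "snd j" "fst j"] by (cases j) (simp add: Hc_def)
  have "(\<Sum>j\<in>?J. ?c j * (?Z j \<omega> - mean M (?Z j))) = (\<Sum>i\<le>n. \<Sum>l<N. \<alpha> i l * Hc i l \<omega>)" for \<omega>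
    unfolding sum.cartesian_product by (rule sum.cong[OF refl z])
  moreover have "(\<Sum>j\<in>?J. \<Sum>k\<in>?J. ?c j * cnj (?c k) * covar M (?Z j) (?Z k)) =
     (\<Sum>l<N. complex_of_real (cH l) * (\<Sum>i\<le>n. \<Sum>j\<le>n. \<alpha> i l * cnj (\<alpha> j l) * \<rho> (int i - int j)))"
  proof -
    have c: "covar M (\<lambda>\<omega>. H i \<omega> l) (\<lambda>\<omega>. H j \<omega> l') = (if l = l' then \<rho> (int i - int j) * complex_of_real (cH l) else 0)"
      if "i \<le> n" "j \<le> n" "l < N" "l' < N" for i j l l'
      using that by (simp add: H_cov Delta_def)
    have "(\<Sum>j\<in>?J. \<Sum>k\<in>?J. ?c j * cnj (?c k) * covar M (?Z j) (?Z k)) =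
       (\<Sum>i\<le>n. \<Sum>l<N. \<Sum>j\<le>n. \<Sum>l'<N. \<alpha> i l * cnj (\<alpha> j l') * covar M (\<lambda>\<omega>. H i \<omega> l) (\<lambda>\<omega>. H j \<omega> l'))"
      unfolding sum.cartesian_product' prod.case ..
    also have "\<dots> = (\<Sum>i\<le>n. \<Sum>l<N. \<Sum>j\<le>n. \<alpha> i l * cnj (\<alpha> j l) * (\<rho> (int i - int j) * complex_of_real (cH l)))"
    proof (intro sum.cong refl)
      fix i l j assume i: "i \<in> {..n}" and l: "l \<in> {..<N}" and j: "j \<in> {..n}"
      have "(\<Sum>l'<N. \<alpha> i l * cnj (\<alpha> j l') * covar M (\<lambda>\<omega>. H i \<omega> l) (\<lambda>\<omega>. H j \<omega> l')) =
         (\<Sum>l'<N. if l = l' then \<alpha> i l * cnj (\<alpha> j l') * (\<rho> (int i - int j) * complex_of_real (cH l)) else 0)"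
        using i l j by (intro sum.cong refl) (auto simp: c)
      then show "(\<Sum>l'<N. \<alpha> i l * cnj (\<alpha> j l') * covar M (\<lambda>\<omega>. H i \<omega> l) (\<lambda>\<omega>. H j \<omega> l')) =
         \<alpha> i l * cnj (\<alpha> j l) * (\<rho> (int i - int j) * complex_of_real (cH l))" using l by simp
    qed
    also have "\<dots> = (\<Sum>l<N. \<Sum>i\<le>n. \<Sum>j\<le>n. \<alpha> i l * cnj (\<alpha> j l) * (\<rho> (int i - int j) * complex_of_real (cH l)))"
      by (rule sum.swap)
    also have "\<dots> = (\<Sum>l<N. complex_of_real (cH l) * (\<Sum>i\<le>n. \<Sum>j\<le>n. \<alpha> i l * cnj (\<alpha> j l) * \<rho> (int i - int j)))"
      unfolding sum_distrib_left by (intro sum.cong refl) simp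
    finally show ?thesis .
  qed
  moreover have "(\<integral>\<omega>. iexp (Re (\<Sum>j\<in>?J. ?c j * (?Z j \<omega> - mean M (?Z j)))) \<partial>M) =
      exp (- Re (\<Sum>j\<in>?J. \<Sum>k\<in>?J. ?c j * cnj (?c k) * covar M (?Z j) (?Z k)) / 4)"
    by (rule proper_gaussian_char[OF prob_space_axioms H_gaussian]) auto
  ultimately show ?thesis by (simp only:)
qed

text \<open>Fading, noise and dither are independent, so their variances add. Estimate and residual
  are linear forms of this kind, and their joint law is read off from the coefficients.\<close>

lemma form_char:
  "(\<integral>p. iexp (Re ((\<Sum>i\<le>n. \<Sum>l<N. \<alpha> i l * Hc i l (fst p)) + (\<Sum>i\<le>n. \<Sum>m<N. \<eta> i m * W i (fst p) m) + t * snd p)) \<partial>(M \<Otimes>\<^sub>M std_CN)) =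
   exp (- (Re (\<Sum>l<N. complex_of_real (cH l) * (\<Sum>i\<le>n. \<Sum>j\<le>n. \<alpha> i l * cnj (\<alpha> j l) * \<rho> (int i - int j)))
     + (\<Sum>i\<le>n. \<Sum>m<N. (cmod (\<eta> i m))\<^sup>2) + (cmod t)\<^sup>2) / 4)"
proof -
  let ?mu = "\<lambda>l. mean M (\<lambda>\<omega>. H 0 \<omega> l)"
  define f where "f h = iexp (Re (\<Sum>i\<le>n. \<Sum>l<N. \<alpha> i l * (h i l - ?mu l)))" for h :: "nat \<Rightarrow> nat \<Rightarrow> complex"
  define g where "g w = iexp (Re (\<Sum>i\<le>n. \<Sum>m<N. \<eta> i m * w i m))" for w :: "nat \<Rightarrow> nat \<Rightarrow> complex"
  have fm: "f \<in> borel_measurable (block_space N n)"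
  proof -
    have "(\<lambda>h. \<Sum>i\<le>n. \<Sum>l<N. \<alpha> i l * (h i l - ?mu l)) \<in> borel_measurable (block_space N n)"
      by (intro borel_measurable_sum borel_measurable_times borel_measurable_diff borel_measurable_const block_component) auto
    then show ?thesis unfolding f_def[abs_def] by measurable
  qed
  have gm: "g \<in> borel_measurable (block_space N n)"
  proof -
    have "(\<lambda>h. \<Sum>i\<le>n. \<Sum>m<N. \<eta> i m * h i m) \<in> borel_measurable (block_space N n)"
      by (intro borel_measurable_sum borel_measurable_times borel_measurable_const block_component) auto
    then show ?thesis unfolding g_def[abs_def] by measurable
  qed
  have fH: "f (Hb n \<omega>) = iexp (Re (\<Sum>i\<le>n. \<Sum>l<N. \<alpha> i l * Hc i l \<omega>))" for \<omega> by (simp add: f_def Hb_def Hc_def)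
  have gW: "g (Wb n \<omega>) = iexp (Re (\<Sum>i\<le>n. \<Sum>m<N. \<eta> i m * W i \<omega> m))" for \<omega> by (simp add: g_def Wb_def)
  have nf: "cmod (f h) \<le> 1" "cmod (g h) \<le> 1" for h by (simp_all add: f_def g_def)
  have gm': "g \<in> borel_measurable (white_block N n)" using gm by (simp add: measurable_cong_sets[OF sets_white_block refl])
  have pairm: "(\<lambda>q. f (fst q) * g (snd q)) \<in> borel_measurable (block_space N n \<Otimes>\<^sub>M block_space N n)"
    by (intro borel_measurable_times measurable_compose[OF measurable_fst fm] measurable_compose[OF measurable_snd gm])
  have FG: "(\<integral>\<omega>. f (Hb n \<omega>) * g (Wb n \<omega>) \<partial>M) = (\<integral>\<omega>. f (Hb n \<omega>) \<partial>M) * (\<integral>w. g w \<partial>white_block N n)"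
  proof -
    have "(\<integral>\<omega>. f (Hb n \<omega>) * g (Wb n \<omega>) \<partial>M) = (\<integral>q. f (fst q) * g (snd q) \<partial>distr M (block_space N n \<Otimes>\<^sub>M block_space N n) (\<lambda>\<omega>. (Hb n \<omega>, Wb n \<omega>)))"
      using pairm by (subst integral_distr) auto
    also have "\<dots> = (\<integral>h. f h \<partial>distr M (block_space N n) (Hb n)) * (\<integral>w. g w \<partial>white_block N n)"
      unfolding Hb_Wb_law
      by (rule integral_pair_mult) (use fm gm' nf in \<open>auto intro: prob_space_distr prob_space_white_block\<close>)
    also have "(\<integral>h. f h \<partial>distr M (block_space N n) (Hb n)) = (\<integral>\<omega>. f (Hb n \<omega>) \<partial>M)"
      using fm by (subst integral_distr) auto
    finally show ?thesis .
  qed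
  have "(\<integral>p. iexp (Re ((\<Sum>i\<le>n. \<Sum>l<N. \<alpha> i l * Hc i l (fst p)) + (\<Sum>i\<le>n. \<Sum>m<N. \<eta> i m * W i (fst p) m) + t * snd p)) \<partial>(M \<Otimes>\<^sub>M std_CN)) =
     (\<integral>p. (f (Hb n (fst p)) * g (Wb n (fst p))) * iexp (Re (t * snd p)) \<partial>(M \<Otimes>\<^sub>M std_CN))"
    unfolding fH gW by (intro Bochner_Integration.integral_cong refl) (simp only: exp_add[symmetric] ring_distribs plus_complex.simps of_real_add)
  also have "\<dots> = (\<integral>\<omega>. f (Hb n \<omega>) * g (Wb n \<omega>) \<partial>M) * (\<integral>z. iexp (Re (t * z)) \<partial>std_CN)"
  proof (rule integral_pair_mult[OF prob_space_axioms prob_space_std_CN])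
    show "(\<lambda>\<omega>. f (Hb n \<omega>) * g (Wb n \<omega>)) \<in> borel_measurable M"
      by (intro borel_measurable_times measurable_compose[OF Hb_measurable fm] measurable_compose[OF Wb_measurable gm])
    show "cmod (f (Hb n \<omega>) * g (Wb n \<omega>)) \<le> 1" for \<omega>
      using mult_mono[OF nf(1) nf(2)] by (simp add: norm_mult)
  qed auto
  also have "\<dots> = exp (- Re (\<Sum>l<N. complex_of_real (cH l) * (\<Sum>i\<le>n. \<Sum>j\<le>n. \<alpha> i l * cnj (\<alpha> j l) * \<rho> (int i - int j))) / 4) *
     exp (- (\<Sum>i\<le>n. \<Sum>m<N. (cmod (\<eta> i m))\<^sup>2) / 4) * exp (- (cmod t)\<^sup>2 / 4)"
    by (simp only: FG) (simp only: fH H_char char_std_CN, simp only: g_def char_white_block of_real_mult)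
  also have "\<dots> = exp (- (Re (\<Sum>l<N. complex_of_real (cH l) * (\<Sum>i\<le>n. \<Sum>j\<le>n. \<alpha> i l * cnj (\<alpha> j l) * \<rho> (int i - int j)))
     + (\<Sum>i\<le>n. \<Sum>m<N. (cmod (\<eta> i m))\<^sup>2) + (cmod t)\<^sup>2) / 4)"
    by (simp only: exp_add[symmetric] of_real_mult[symmetric] add_divide_distrib minus_add_distrib)
  finally show ?thesis .
qed

text \<open>Covariances are Hermitian. The powers sum to 1, so some tap has positive power, and
  dividing by it transfers the symmetry to \<open>\<rho>\<close>.\<close>

lemma rho_herm: "\<rho> (- i) = cnj (\<rho> i)"
proof -
  have "\<exists>l<N. cH l \<noteq> 0"
  proof (rule ccontr)
    assume "\<not> ?thesis" then have "(\<Sum>l<N. cH l) = 0" by (intro sum.neutral) auto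
    with cH_trace show False by simp
  qed
  then obtain l where l: "l < N" "cH l \<noteq> 0" by blast
  have swap: "covar M U V = cnj (covar M V U)" for U V
    unfolding covar_def Bochner_Integration.integral_cnj[symmetric] by (simp add: mult.commute)
  have c: "covar M (\<lambda>\<omega>. H i \<omega> l) (\<lambda>\<omega>. H j \<omega> l) = \<rho> (int i - int j) * complex_of_real (cH l)" for i j
    using l(1) H_cov[of i "max i j" j l l] by (simp add: Delta_def)
  have h: "\<rho> (int j - int i) = cnj (\<rho> (int i - int j))" for i j
    using swap[of "\<lambda>\<omega>. H j \<omega> l" "\<lambda>\<omega>. H i \<omega> l"] l(2) unfolding c by simp
  show ?thesis
  proof (cases "0 \<le> i")
    case True then show ?thesis using h[of 0 "nat i"] by simp
  next
    case False then show ?thesis using h[of "nat (- i)" 0] by simp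
  qed
qed

sublocale autocorrelation \<rho>
  by unfold_locales (rule Delta_diag rho_herm Delta_psd, assumption?)+

text \<open>For one normalised tap this is the variance of d X + f h, where X combines the past with
  weights cnj a and h is the present: X has the Toeplitz form as variance and the real number
  \<open>q\<close> as covariance with h.\<close>

lemma bordered_form:
  assumes q: "corr_form \<rho> k a = complex_of_real q"
  defines "\<beta> \<equiv> \<lambda>d f i. if i < k then d * cnj (a i) else f"
  shows "Re (\<Sum>i\<le>k. \<Sum>j\<le>k. \<beta> d f i * cnj (\<beta> d f j) * \<rho> (int i - int j)) =
    (cmod d)\<^sup>2 * Re (toeplitz_form \<rho> k a) + 2 * q * Re (d * cnj f) + (cmod f)\<^sup>2"
proof -
  have S: "(\<Sum>i<k. \<Sum>j<k. cnj (a i) * a j * \<rho> (int i - int j)) = toeplitz_form \<rho> k a"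
    unfolding toeplitz_form_def by (intro sum.cong refl) simp
  have c1: "(\<Sum>j<k. a j * \<rho> (int k - int j)) = complex_of_real q"
    unfolding q[symmetric] corr_form_def by (intro sum.cong refl) (subst rho_flip, simp add: mult.commute)
  have c2: "(\<Sum>i<k. cnj (a i) * \<rho> (int i - int k)) = complex_of_real q"
  proof -
    have "(\<Sum>i<k. cnj (a i) * \<rho> (int i - int k)) = cnj (corr_form \<rho> k a)"
      unfolding corr_form_def cnj_sum by (intro sum.cong refl) (simp add: mult.commute)
    then show ?thesis by (simp add: q)
  qed
  have "(\<Sum>i\<le>k. \<Sum>j\<le>k. \<beta> d f i * cnj (\<beta> d f j) * \<rho> (int i - int j)) =
    (\<Sum>i<k. \<Sum>j<k. d * cnj d * (cnj (a i) * a j * \<rho> (int i - int j))) + (\<Sum>j<k. f * cnj d * (a j * \<rho> (int k - int j))) +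
    ((\<Sum>i<k. d * cnj f * (cnj (a i) * \<rho> (int i - int k))) + f * cnj f)"
    unfolding sum_atMost_split sum.distrib
    by (intro arg_cong2[where f = "(+)"] sum.cong refl) (auto simp: \<beta>_def rho_0)
  also have "\<dots> = d * cnj d * toeplitz_form \<rho> k a + f * cnj d * complex_of_real q + (d * cnj f * complex_of_real q + f * cnj f)"
    unfolding sum_distrib_left[symmetric] S c1 c2 ..
  also have "\<dots> = complex_of_real ((cmod d)\<^sup>2) * toeplitz_form \<rho> k a + complex_of_real q * (d * cnj f + cnj (d * cnj f)) + complex_of_real ((cmod f)\<^sup>2)"
    unfolding complex_norm_square by (simp add: algebra_simps)
  finally show ?thesis by (simp add: algebra_simps)
qed

text \<open>Deviation of the estimate from the mean gain. Division by the sent symbols removes the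
  modulation, \<open>P\<close> combines carriers, \<open>a\<close> combines past times, and the
  second component of \<open>p\<close> is the dither.\<close>

definition "est_dev k r \<kappa> a P x \<tau> p =
  (\<Sum>i<k. \<Sum>m<r. complex_of_real \<kappa> * cnj (a i) * P m * ((gain N (H i (fst p)) m * x i m + W i (fst p) m) / x i m - gmean m)) +
   complex_of_real \<tau> * snd p" for k r :: nat and \<kappa> \<tau> :: real and a P :: "nat \<Rightarrow> complex" and x :: "nat \<Rightarrow> nat \<Rightarrow> complex" and p :: "'a \<times> complex"

lemma est_dev_measurable: "r \<le> N \<Longrightarrow> est_dev k r \<kappa> a P x \<tau> \<in> borel_measurable (M \<Otimes>\<^sub>M std_CN)"
proof -
  assume r: "r \<le> N"
  have g: "(\<lambda>\<omega>. gain N (H i \<omega>) m) \<in> borel_measurable M" if "m < r" for i m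
    using measurable_compose[OF H_meas gain_measurable] that r by simp
  have s: "snd \<in> borel_measurable (M \<Otimes>\<^sub>M std_CN)"
    using measurable_snd[of M std_CN] by (simp add: measurable_cong_sets[OF refl sets_std_CN])
  show ?thesis unfolding est_dev_def[abs_def]
    by (intro borel_measurable_add borel_measurable_sum borel_measurable_times borel_measurable_const borel_measurable_diff
        borel_measurable_divide measurable_compose[OF measurable_fst g] measurable_compose[OF measurable_fst W_component] s)
       (use r in auto)
qed

text \<open>After division by the symbols the fading part is free of data, and the noise part
  depends on them only through factors whose modulus is known.\<close>

lemma est_dev_form:
  assumes x: "\<And>i m. i < k \<Longrightarrow> m < r \<Longrightarrow> x i m \<noteq> 0"
  shows "est_dev k r \<kappa> a P x \<tau> p =
    (\<Sum>i<k. \<Sum>l<N. complex_of_real \<kappa> * cnj (a i) * (\<Sum>m<r. P m * tw N l m) * Hc i l (fst p)) +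
    (\<Sum>i<k. \<Sum>m<r. complex_of_real \<kappa> * cnj (a i) * P m / x i m * W i (fst p) m) + complex_of_real \<tau> * snd p"
proof -
  have "(\<Sum>m<r. complex_of_real \<kappa> * cnj (a i) * P m * ((gain N (H i (fst p)) m * x i m + W i (fst p) m) / x i m - gmean m)) =
     (\<Sum>l<N. complex_of_real \<kappa> * cnj (a i) * (\<Sum>m<r. P m * tw N l m) * Hc i l (fst p)) +
     (\<Sum>m<r. complex_of_real \<kappa> * cnj (a i) * P m / x i m * W i (fst p) m)" if i: "i < k" for i
  proof -
    have "(\<Sum>m<r. complex_of_real \<kappa> * cnj (a i) * P m * ((gain N (H i (fst p)) m * x i m + W i (fst p) m) / x i m - gmean m)) =
       (\<Sum>m<r. (\<Sum>l<N. complex_of_real \<kappa> * cnj (a i) * (P m * tw N l m) * Hc i l (fst p)) + complex_of_real \<kappa> * cnj (a i) * P m / x i m * W i (fst p) m)"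
    proof (rule sum.cong[OF refl])
      fix m assume "m \<in> {..<r}"
      then have x0: "x i m \<noteq> 0" using x[OF i] by simp
      have "(gain N (H i (fst p)) m * x i m + W i (fst p) m) / x i m - gmean m = (\<Sum>l<N. tw N l m * Hc i l (fst p)) + W i (fst p) m / x i m"
        using x0 by (simp add: gain_centered add_divide_distrib)
      then show "complex_of_real \<kappa> * cnj (a i) * P m * ((gain N (H i (fst p)) m * x i m + W i (fst p) m) / x i m - gmean m) =
        (\<Sum>l<N. complex_of_real \<kappa> * cnj (a i) * (P m * tw N l m) * Hc i l (fst p)) + complex_of_real \<kappa> * cnj (a i) * P m / x i m * W i (fst p) m"
        by (simp only: distrib_left sum_distrib_left) (simp add: mult.assoc)
    qed
    also have "\<dots> = (\<Sum>l<N. \<Sum>m<r. complex_of_real \<kappa> * cnj (a i) * (P m * tw N l m) * Hc i l (fst p)) +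
       (\<Sum>m<r. complex_of_real \<kappa> * cnj (a i) * P m / x i m * W i (fst p) m)"
      unfolding sum.distrib by (subst sum.swap) (rule refl)
    finally show ?thesis by (simp only: sum_distrib_left sum_distrib_right)
  qed
  then have "(\<Sum>i<k. \<Sum>m<r. complex_of_real \<kappa> * cnj (a i) * P m * ((gain N (H i (fst p)) m * x i m + W i (fst p) m) / x i m - gmean m)) =
     (\<Sum>i<k. (\<Sum>l<N. complex_of_real \<kappa> * cnj (a i) * (\<Sum>m<r. P m * tw N l m) * Hc i l (fst p)) +
     (\<Sum>m<r. complex_of_real \<kappa> * cnj (a i) * P m / x i m * W i (fst p) m))"
    by (intro sum.cong refl) simp
  then show ?thesis unfolding est_dev_def sum.distrib by simp
qed

text \<open>There is no cross term in \<open>c1\<close> and \<open>c2\<close>: estimate and residual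
  are independent. The estimate has covariance \<open>\<kappa> * q\<close> with the target, and the
  choice of \<open>\<tau>\<close> raises its variance to that same number; the error is then
  uncorrelated with the estimate and has variance \<open>1 - \<kappa> * q\<close>.\<close>

lemma estimator_char:
  assumes r: "r \<le> N" and m0: "m0 < r" and A: "0 < A"
    and x: "\<And>i m. i \<le> k \<Longrightarrow> m < r \<Longrightarrow> (cmod (x i m))\<^sup>2 = A\<^sup>2"
    and P: "\<And>l. l < L \<Longrightarrow> (\<Sum>m<r. P m * tw N l m) = tw N l m0"
    and q: "corr_form \<rho> k a = complex_of_real q"
    and \<tau>: "\<tau>\<^sup>2 = \<kappa> * q - \<kappa>\<^sup>2 * (Re (toeplitz_form \<rho> k a) + (\<Sum>i<k. (cmod (a i))\<^sup>2) * ((\<Sum>m<r. (cmod (P m))\<^sup>2) / A\<^sup>2))"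
  shows "(\<integral>p. iexp (Re (c1 * est_dev k r \<kappa> a P x \<tau> p +
       c2 * ((gain N (H k (fst p)) m0 - gmean m0 - est_dev k r \<kappa> a P x \<tau> p) * x k m0 + W k (fst p) m0))) \<partial>(M \<Otimes>\<^sub>M std_CN)) =
     exp (- (\<kappa> * q * (cmod c1)\<^sup>2 + (1 + (1 - \<kappa> * q) * A\<^sup>2) * (cmod c2)\<^sup>2) / 4)"
proof -
  \<comment> \<open>The form equals d * estimate + f * gain deviation + c2 * noise; in these
    coefficients past and present are separated.\<close>
  define f where "f = c2 * x k m0"
  define d where "d = c1 - f"
  define T where "T l = (\<Sum>m<r. P m * tw N l m)" for l
  have x0: "x i m \<noteq> 0" if "i \<le> k" "m < r" for i m using x[OF that] A by auto
  define \<alpha> where "\<alpha> i l = (if i < k then d * (complex_of_real \<kappa> * cnj (a i) * T l) else f * tw N l m0)" for i l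
  define \<eta> where "\<eta> i m = (if i < k then (if m < r then d * (complex_of_real \<kappa> * cnj (a i) * P m / x i m) else 0) else if m = m0 then c2 else 0)" for i m
  have form: "c1 * est_dev k r \<kappa> a P x \<tau> p + c2 * ((gain N (H k (fst p)) m0 - gmean m0 - est_dev k r \<kappa> a P x \<tau> p) * x k m0 + W k (fst p) m0) =
      (\<Sum>i\<le>k. \<Sum>l<N. \<alpha> i l * Hc i l (fst p)) + (\<Sum>i\<le>k. \<Sum>m<N. \<eta> i m * W i (fst p) m) + (d * complex_of_real \<tau>) * snd p" for p
  proof -
    have e: "est_dev k r \<kappa> a P x \<tau> p =
       (\<Sum>i<k. \<Sum>l<N. complex_of_real \<kappa> * cnj (a i) * T l * Hc i l (fst p)) +
       (\<Sum>i<k. \<Sum>m<r. complex_of_real \<kappa> * cnj (a i) * P m / x i m * W i (fst p) m) + complex_of_real \<tau> * snd p"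
      unfolding T_def by (rule est_dev_form) (rule x0, auto)
    have u: "gain N (H k (fst p)) m0 - gmean m0 = (\<Sum>l<N. tw N l m0 * Hc k l (fst p))" by (simp add: gain_centered)
    have a1: "(\<Sum>i\<le>k. \<Sum>l<N. \<alpha> i l * Hc i l (fst p)) =
        d * (\<Sum>i<k. \<Sum>l<N. complex_of_real \<kappa> * cnj (a i) * T l * Hc i l (fst p)) + f * (\<Sum>l<N. tw N l m0 * Hc k l (fst p))"
      unfolding sum_atMost_split sum_distrib_left by (intro arg_cong2[where f = "(+)"] sum.cong refl) (simp_all add: \<alpha>_def mult.assoc)
    note rN = sum_if_less[OF r]
    have a2: "(\<Sum>i\<le>k. \<Sum>m<N. \<eta> i m * W i (fst p) m) =
        d * (\<Sum>i<k. \<Sum>m<r. complex_of_real \<kappa> * cnj (a i) * P m / x i m * W i (fst p) m) + c2 * W k (fst p) m0"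
    proof -
      have "(\<Sum>m<N. \<eta> i m * W i (fst p) m) = (\<Sum>m<r. d * (complex_of_real \<kappa> * cnj (a i) * P m / x i m * W i (fst p) m))" if "i < k" for i
        unfolding rN[symmetric] using that by (intro sum.cong refl) (auto simp: \<eta>_def)
      moreover have "(\<Sum>m<N. \<eta> k m * W k (fst p) m) = c2 * W k (fst p) m0"
      proof -
        have "(\<Sum>m<N. \<eta> k m * W k (fst p) m) = (\<Sum>m<N. if m = m0 then c2 * W k (fst p) m else 0)"
          by (intro sum.cong refl) (auto simp: \<eta>_def)
        then show ?thesis using m0 r by simp
      qed
      ultimately show ?thesis unfolding sum_atMost_split sum_distrib_left by simp
    qed
    have alg: "c1 * E + c2 * ((U - E) * x k m0 + w) = d * E + f * U + c2 * w" for E U w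
      by (simp add: d_def f_def algebra_simps)
    have alg': "d * (S1 + S2 + t * s) + f * U + w = d * S1 + f * U + (d * S2 + w) + d * t * s" for S1 S2 t s U w
      by (simp add: algebra_simps)
    show ?thesis unfolding alg u a1 a2 e by (rule alg')
  qed
  have Hpart: "Re (\<Sum>l<N. complex_of_real (cH l) * (\<Sum>i\<le>k. \<Sum>j\<le>k. \<alpha> i l * cnj (\<alpha> j l) * \<rho> (int i - int j))) =
     (cmod (d * complex_of_real \<kappa>))\<^sup>2 * Re (toeplitz_form \<rho> k a) + 2 * q * Re (d * complex_of_real \<kappa> * cnj f) + (cmod f)\<^sup>2"
  proof -
    define B where "B = (\<Sum>i\<le>k. \<Sum>j\<le>k. (if i < k then d * complex_of_real \<kappa> * cnj (a i) else f) *
       cnj (if j < k then d * complex_of_real \<kappa> * cnj (a j) else f) * \<rho> (int i - int j))"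
    have "complex_of_real (cH l) * (\<Sum>i\<le>k. \<Sum>j\<le>k. \<alpha> i l * cnj (\<alpha> j l) * \<rho> (int i - int j)) = complex_of_real (cH l) * B" if l: "l < N" for l
    \<comment> \<open>Taps from \<open>L\<close> on have no power. On the others \<open>P\<close>
      reproduces the response on carrier \<open>m0\<close>, so all taps carry the same form up to a
      phase of modulus 1.\<close>
    proof (cases "l < L")
      case False
      then show ?thesis using cH_zero[of l] l by simp
    next
      case True
      have al: "\<alpha> i l = (if i < k then d * complex_of_real \<kappa> * cnj (a i) else f) * tw N l m0" for i
        using P[OF True] by (simp add: \<alpha>_def T_def)
      have "\<alpha> i l * cnj (\<alpha> j l) = (if i < k then d * complex_of_real \<kappa> * cnj (a i) else f) * cnj (if j < k then d * complex_of_real \<kappa> * cnj (a j) else f) * (tw N l m0 * cnj (tw N l m0))" for i j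
        unfolding al complex_cnj_mult by (simp only: mult_ac)
      then show ?thesis by (simp only: B_def tw_cnj[OF N_pos] mult_1_right)
    qed
    then have "(\<Sum>l<N. complex_of_real (cH l) * (\<Sum>i\<le>k. \<Sum>j\<le>k. \<alpha> i l * cnj (\<alpha> j l) * \<rho> (int i - int j))) = (\<Sum>l<N. complex_of_real (cH l)) * B"
      unfolding sum_distrib_right by (intro sum.cong refl) simp
    also have "(\<Sum>l<N. complex_of_real (cH l)) = 1" by (simp only: of_real_sum[symmetric] cH_trace of_real_1)
    finally show ?thesis
      using bordered_form[OF q, of "d * complex_of_real \<kappa>" f] by (simp only: B_def mult_1)
  qed
  have Wpart: "(\<Sum>i\<le>k. \<Sum>m<N. (cmod (\<eta> i m))\<^sup>2) = (cmod (d * complex_of_real \<kappa>))\<^sup>2 * ((\<Sum>i<k. (cmod (a i))\<^sup>2) * ((\<Sum>m<r. (cmod (P m))\<^sup>2) / A\<^sup>2)) + (cmod c2)\<^sup>2"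
  proof -
    note rN = sum_if_less[OF r]
    have "(\<Sum>m<N. (cmod (\<eta> i m))\<^sup>2) = (cmod (d * complex_of_real \<kappa>))\<^sup>2 * ((cmod (a i))\<^sup>2 * ((\<Sum>m<r. (cmod (P m))\<^sup>2) / A\<^sup>2))" if i: "i < k" for i
    proof -
      have "(\<Sum>m<N. (cmod (\<eta> i m))\<^sup>2) = (\<Sum>m<r. (cmod (d * complex_of_real \<kappa>))\<^sup>2 * ((cmod (a i))\<^sup>2 * ((cmod (P m))\<^sup>2 / A\<^sup>2)))"
        unfolding rN[symmetric] using i x
        by (intro sum.cong refl) (auto simp: \<eta>_def norm_mult norm_divide power_mult_distrib power_divide)
      then show ?thesis by (simp only: sum_distrib_left sum_divide_distrib)
    qed
    moreover have "(\<Sum>m<N. (cmod (\<eta> k m))\<^sup>2) = (cmod c2)\<^sup>2"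
    proof -
      have "(\<Sum>m<N. (cmod (\<eta> k m))\<^sup>2) = (\<Sum>m<N. if m = m0 then (cmod c2)\<^sup>2 else 0)"
        by (intro sum.cong refl) (auto simp: \<eta>_def)
      then show ?thesis using m0 r by simp
    qed
    moreover have "(\<Sum>i<k. (cmod (d * complex_of_real \<kappa>))\<^sup>2 * ((cmod (a i))\<^sup>2 * ((\<Sum>m<r. (cmod (P m))\<^sup>2) / A\<^sup>2))) =
        (cmod (d * complex_of_real \<kappa>))\<^sup>2 * ((\<Sum>i<k. (cmod (a i))\<^sup>2) * ((\<Sum>m<r. (cmod (P m))\<^sup>2) / A\<^sup>2))"
      by (simp only: sum_distrib_left[symmetric] sum_distrib_right[symmetric])
    ultimately show ?thesis unfolding sum_atMost_split by simp
  qed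
  \<comment> \<open>Variance and covariance of the estimate being equal, |d|^2 and 2 Re (d cnj f)
    enter with the same factor and combine with |f|^2 to |d + f|^2 = |c1|^2.\<close>
  have fin: "Re (\<Sum>l<N. complex_of_real (cH l) * (\<Sum>i\<le>k. \<Sum>j\<le>k. \<alpha> i l * cnj (\<alpha> j l) * \<rho> (int i - int j)))
     + (\<Sum>i\<le>k. \<Sum>m<N. (cmod (\<eta> i m))\<^sup>2) + (cmod (d * complex_of_real \<tau>))\<^sup>2 =
     \<kappa> * q * (cmod c1)\<^sup>2 + (1 + (1 - \<kappa> * q) * A\<^sup>2) * (cmod c2)\<^sup>2"
  proof -
    have 1: "(cmod (d * complex_of_real \<kappa>))\<^sup>2 = (cmod d)\<^sup>2 * \<kappa>\<^sup>2" "(cmod (d * complex_of_real \<tau>))\<^sup>2 = (cmod d)\<^sup>2 * \<tau>\<^sup>2"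
      by (simp_all add: norm_mult power_mult_distrib)
    have 2: "(cmod f)\<^sup>2 = (cmod c2)\<^sup>2 * A\<^sup>2" using x[OF order_refl m0] by (simp add: f_def norm_mult power_mult_distrib)
    have 3: "(cmod c1)\<^sup>2 = (cmod d)\<^sup>2 + 2 * Re (d * cnj f) + (cmod f)\<^sup>2"
    proof -
      have "c1 = d + f" by (simp add: d_def)
      moreover have "(cmod (d + f))\<^sup>2 = (cmod d)\<^sup>2 + 2 * Re (d * cnj f) + (cmod f)\<^sup>2"
        unfolding cmod_power2 by (simp add: power2_eq_square algebra_simps)
      ultimately show ?thesis by simp
    qed
    have 4: "Re (d * complex_of_real \<kappa> * cnj f) = \<kappa> * Re (d * cnj f)" by (simp add: algebra_simps)
    show ?thesis unfolding Hpart Wpart 1 \<tau> 4 3 using 2 by (simp add: algebra_simps)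
  qed
  show ?thesis unfolding form form_char fin ..
qed

text \<open>Two independent scaled standard variables have the same characteristic function. The
  factor \<open>cnj \<zeta>\<close> refers the estimate to the phase of the mean on carrier 0, which
  circular symmetry permits.\<close>

lemma estimator_law:
  assumes r: "r \<le> N" and m0: "m0 < r" and A: "0 < A"
    and x: "\<And>i m. i \<le> k \<Longrightarrow> m < r \<Longrightarrow> (cmod (x i m))\<^sup>2 = A\<^sup>2"
    and P: "\<And>l. l < L \<Longrightarrow> (\<Sum>m<r. P m * tw N l m) = tw N l m0"
    and q: "corr_form \<rho> k a = complex_of_real q" and C: "0 \<le> \<kappa> * q" "\<kappa> * q \<le> 1" and \<zeta>: "cmod \<zeta> = 1"
    and \<tau>: "\<tau>\<^sup>2 = \<kappa> * q - \<kappa>\<^sup>2 * (Re (toeplitz_form \<rho> k a) + (\<Sum>i<k. (cmod (a i))\<^sup>2) * ((\<Sum>m<r. (cmod (P m))\<^sup>2) / A\<^sup>2))"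
  shows "distr (M \<Otimes>\<^sub>M std_CN) (borel \<Otimes>\<^sub>M borel) (\<lambda>p. (cnj \<zeta> * est_dev k r \<kappa> a P x \<tau> p,
       (gain N (H k (fst p)) m0 - gmean m0 - est_dev k r \<kappa> a P x \<tau> p) * x k m0 + W k (fst p) m0)) =
     distr (std_CN \<Otimes>\<^sub>M std_CN) (borel \<Otimes>\<^sub>M borel) (\<lambda>p. (complex_of_real (sqrt (\<kappa> * q)) * fst p, complex_of_real (sqrt (1 + (1 - \<kappa> * q) * A\<^sup>2)) * snd p))"
proof -
  interpret MC: pair_prob_space M std_CN ..
  interpret CC: pair_prob_space std_CN std_CN ..
  define G1 where "G1 p = cnj \<zeta> * est_dev k r \<kappa> a P x \<tau> p" for p
  define G2 where "G2 p = (gain N (H k (fst p)) m0 - gmean m0 - est_dev k r \<kappa> a P x \<tau> p) * x k m0 + W k (fst p) m0" for p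
  define s where "s = sqrt (\<kappa> * q)"
  define v where "v = sqrt (1 + (1 - \<kappa> * q) * A\<^sup>2)"
  have v2: "v\<^sup>2 = 1 + (1 - \<kappa> * q) * A\<^sup>2" "s\<^sup>2 = \<kappa> * q" unfolding v_def s_def using C by (simp_all add: add_nonneg_nonneg)
  have em: "est_dev k r \<kappa> a P x \<tau> \<in> borel_measurable (M \<Otimes>\<^sub>M std_CN)" by (rule est_dev_measurable[OF r])
  have m0N: "m0 < N" using m0 r by simp
  have gm: "(\<lambda>p. gain N (H k (fst p)) m0) \<in> borel_measurable (M \<Otimes>\<^sub>M std_CN)"
    by (rule measurable_compose[OF measurable_fst measurable_compose[OF H_meas gain_measurable[OF m0N]]])
  have G1m: "G1 \<in> borel_measurable (M \<Otimes>\<^sub>M std_CN)"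
    unfolding G1_def[abs_def] by (intro borel_measurable_times borel_measurable_const em)
  have G2m: "G2 \<in> borel_measurable (M \<Otimes>\<^sub>M std_CN)"
    unfolding G2_def[abs_def]
    by (intro borel_measurable_add borel_measurable_times borel_measurable_diff borel_measurable_const em gm
        measurable_compose[OF measurable_fst W_component[OF m0N]])
  have fm: "(\<lambda>p. complex_of_real t * fst p) \<in> borel_measurable (std_CN \<Otimes>\<^sub>M std_CN)"
    and sm: "(\<lambda>p. complex_of_real t * snd p) \<in> borel_measurable (std_CN \<Otimes>\<^sub>M std_CN)" for t
    using measurable_fst[of std_CN std_CN] measurable_snd[of std_CN std_CN]
    by (simp_all add: measurable_cong_sets[OF refl sets_std_CN])
  let ?J = "{0, 1 :: nat}"
  let ?X = "\<lambda>j p. if j = 0 then G1 p else G2 p"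
  let ?Y = "\<lambda>j p. if j = 0 then complex_of_real s * fst p else complex_of_real v * snd p"
  have X: "?X j \<in> borel_measurable (M \<Otimes>\<^sub>M std_CN)" for j using G1m G2m by (cases "j = 0") simp_all
  have Y: "?Y j \<in> borel_measurable (std_CN \<Otimes>\<^sub>M std_CN)" for j using fm sm by (cases "j = 0") simp_all
  have D: "distr (M \<Otimes>\<^sub>M std_CN) (\<Pi>\<^sub>M j\<in>?J. borel) (\<lambda>p. \<lambda>j\<in>?J. ?X j p) = distr (std_CN \<Otimes>\<^sub>M std_CN) (\<Pi>\<^sub>M j\<in>?J. borel) (\<lambda>p. \<lambda>j\<in>?J. ?Y j p)"
  proof (rule complex_joint_char_unique[OF MC.prob_space_axioms CC.prob_space_axioms])
    fix c :: "nat \<Rightarrow> complex"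
    have "(\<integral>p. iexp (Re (\<Sum>j\<in>?J. c j * ?X j p)) \<partial>(M \<Otimes>\<^sub>M std_CN)) =
       (\<integral>p. iexp (Re ((c 0 * cnj \<zeta>) * est_dev k r \<kappa> a P x \<tau> p + c 1 * G2 p)) \<partial>(M \<Otimes>\<^sub>M std_CN))"
      by (simp add: G1_def mult.assoc)
    also have "\<dots> = exp (- (\<kappa> * q * (cmod (c 0 * cnj \<zeta>))\<^sup>2 + (1 + (1 - \<kappa> * q) * A\<^sup>2) * (cmod (c 1))\<^sup>2) / 4)"
      unfolding G2_def by (rule estimator_char[OF r m0 A x P q \<tau>])
    also have "\<dots> = exp (- (cmod (c 0 * complex_of_real s))\<^sup>2 / 4) * exp (- (cmod (c 1 * complex_of_real v))\<^sup>2 / 4)"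
    proof -
      have n: "(cmod (c 0 * cnj \<zeta>))\<^sup>2 = (cmod (c 0))\<^sup>2" "(cmod (c 0 * complex_of_real s))\<^sup>2 = (cmod (c 0))\<^sup>2 * (\<kappa> * q)"
        "(cmod (c 1 * complex_of_real v))\<^sup>2 = (cmod (c 1))\<^sup>2 * (1 + (1 - \<kappa> * q) * A\<^sup>2)"
        by (simp_all add: norm_mult power_mult_distrib v2 \<zeta>)
      have "- (P * X + V * Y) / 4 = - (X * P) / 4 + - (Y * V) / 4" for P X V Y :: real
        by (simp add: add_divide_distrib mult.commute)
      then show ?thesis unfolding n of_real_mult[symmetric] exp_add[symmetric] by (simp only:)
    qed
    also have "\<dots> = (\<integral>z. iexp (Re ((c 0 * complex_of_real s) * z)) \<partial>std_CN) * (\<integral>z. iexp (Re ((c 1 * complex_of_real v) * z)) \<partial>std_CN)"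
      unfolding char_std_CN of_real_mult[of "exp _" "exp _"] ..
    also have "\<dots> = (\<integral>p. iexp (Re ((c 0 * complex_of_real s) * fst p)) * iexp (Re ((c 1 * complex_of_real v) * snd p)) \<partial>(std_CN \<Otimes>\<^sub>M std_CN))"
      by (rule integral_pair_mult[OF prob_space_std_CN prob_space_std_CN, symmetric]) auto
    also have "\<dots> = (\<integral>p. iexp (Re (\<Sum>j\<in>?J. c j * ?Y j p)) \<partial>(std_CN \<Otimes>\<^sub>M std_CN))"
      unfolding exp_add[symmetric] distrib_left[symmetric] of_real_add[symmetric] plus_complex.simps[symmetric]
      by (simp add: mult.assoc)
    finally show "(\<integral>p. iexp (Re (\<Sum>j\<in>?J. c j * ?X j p)) \<partial>(M \<Otimes>\<^sub>M std_CN)) = (\<integral>p. iexp (Re (\<Sum>j\<in>?J. c j * ?Y j p)) \<partial>(std_CN \<Otimes>\<^sub>M std_CN))" .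
  qed (use X Y in simp_all)
  have pm: "(\<lambda>f. (f 0, f 1)) \<in> (\<Pi>\<^sub>M j\<in>?J. borel) \<rightarrow>\<^sub>M borel \<Otimes>\<^sub>M (borel :: complex measure)"
    by (intro measurable_Pair measurable_component_singleton) auto
  have Xr: "(\<lambda>p. \<lambda>j\<in>?J. ?X j p) \<in> M \<Otimes>\<^sub>M std_CN \<rightarrow>\<^sub>M (\<Pi>\<^sub>M j\<in>?J. borel)" by (rule measurable_restrict) (rule X)
  have Yr: "(\<lambda>p. \<lambda>j\<in>?J. ?Y j p) \<in> std_CN \<Otimes>\<^sub>M std_CN \<rightarrow>\<^sub>M (\<Pi>\<^sub>M j\<in>?J. borel)" by (rule measurable_restrict) (rule Y)
  have "distr (M \<Otimes>\<^sub>M std_CN) (borel \<Otimes>\<^sub>M borel) (\<lambda>p. (G1 p, G2 p)) =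
     distr (distr (M \<Otimes>\<^sub>M std_CN) (\<Pi>\<^sub>M j\<in>?J. borel) (\<lambda>p. \<lambda>j\<in>?J. ?X j p)) (borel \<Otimes>\<^sub>M borel) (\<lambda>f. (f 0, f 1))"
    unfolding distr_distr[OF pm Xr] by (simp add: comp_def)
  also have "\<dots> = distr (std_CN \<Otimes>\<^sub>M std_CN) (borel \<Otimes>\<^sub>M borel) (\<lambda>p. (complex_of_real s * fst p, complex_of_real v * snd p))"
    unfolding D distr_distr[OF pm Yr] by (simp add: comp_def)
  finally show ?thesis by (simp only: G1_def G2_def s_def v_def)
qed

end

subsection \<open>Coded blocks and estimator coefficients\<close>

text \<open>Time sharing between a uniformly chosen codeword and \<open>x0\<close>, built from pmfs
  so that integrals are finite sums. Nonnegative integrals serve the constraints and the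
  normalisation, Bochner integrals the expected logarithms.\<close>

lemma finite_mixture:
  fixes X :: "(nat \<Rightarrow> nat \<Rightarrow> complex) set"
  assumes X: "finite X" "X \<noteq> {}" "X \<subseteq> space (block_space N n)" and x0: "x0 \<in> space (block_space N n)"
    and c: "0 \<le> c" "c \<le> 1"
  obtains \<mu> where "\<mu> \<in> input_laws N n"
    "\<And>g. g \<in> borel_measurable (block_space N n) \<Longrightarrow>
       (\<integral>\<^sup>+x. g x \<partial>\<mu>) = ennreal c * ((\<Sum>x\<in>X. g x) / of_nat (card X)) + ennreal (1 - c) * g x0"
    "\<And>g :: (nat \<Rightarrow> nat \<Rightarrow> complex) \<Rightarrow> real. g \<in> borel_measurable (block_space N n) \<Longrightarrow>
       (\<integral>x. g x \<partial>\<mu>) = c * ((\<Sum>x\<in>X. g x) / real (card X)) + (1 - c) * g x0"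
proof -
  define pm where "pm = bind_pmf (bernoulli_pmf c) (\<lambda>b. if b then pmf_of_set X else return_pmf x0)"
  \<comment> \<open>A pmf lives on all functions; \<open>R\<close> retracts to the block space and
    fixes the support.\<close>
  define R where "R x = (if x \<in> space (block_space N n) then x else x0)" for x
  define \<mu> where "\<mu> = distr (measure_pmf pm) (block_space N n) R"
  have Rm: "R \<in> measure_pmf pm \<rightarrow>\<^sub>M block_space N n" using x0 by (auto simp: R_def)
  have R: "R x = x" if "x \<in> X \<or> x = x0" for x using that X(3) x0 by (auto simp: R_def)
  show thesis
  proof (rule that[of \<mu>])
    show "\<mu> \<in> input_laws N n"
      using measure_pmf.prob_space_distr[OF Rm] by (simp add: \<mu>_def input_laws_def)
  next
    fix g :: "(nat \<Rightarrow> nat \<Rightarrow> complex) \<Rightarrow> ennreal" assume g: "g \<in> borel_measurable (block_space N n)"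
    have "(\<integral>\<^sup>+x. g x \<partial>\<mu>) = (\<integral>\<^sup>+x. g (R x) \<partial>measure_pmf pm)"
      unfolding \<mu>_def using Rm g by (subst nn_integral_distr) auto
    also have "\<dots> = (\<integral>\<^sup>+b. (\<integral>\<^sup>+x. g (R x) \<partial>measure_pmf (if b then pmf_of_set X else return_pmf x0)) \<partial>measure_pmf (bernoulli_pmf c))"
      unfolding pm_def by (rule nn_integral_bind_pmf)
    also have "\<dots> = (\<integral>\<^sup>+x. g (R x) \<partial>measure_pmf (pmf_of_set X)) * ennreal c + (\<integral>\<^sup>+x. g (R x) \<partial>measure_pmf (return_pmf x0)) * ennreal (1 - c)"
      using c by (subst nn_integral_bernoulli_pmf) auto
    also have "(\<integral>\<^sup>+x. g (R x) \<partial>measure_pmf (pmf_of_set X)) = (\<Sum>x\<in>X. g (R x)) / of_nat (card X)"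
      using X by (subst nn_integral_pmf_of_set) (auto simp: )
    also have "(\<Sum>x\<in>X. g (R x)) = (\<Sum>x\<in>X. g x)" by (intro sum.cong refl) (simp add: R)
    also have "(\<integral>\<^sup>+x. g (R x) \<partial>measure_pmf (return_pmf x0)) = g x0" by (simp add: R)
    finally show "(\<integral>\<^sup>+x. g x \<partial>\<mu>) = ennreal c * ((\<Sum>x\<in>X. g x) / of_nat (card X)) + ennreal (1 - c) * g x0"
      by (simp add: mult.commute)
  next
    fix g :: "(nat \<Rightarrow> nat \<Rightarrow> complex) \<Rightarrow> real" assume g: "g \<in> borel_measurable (block_space N n)"
    have "(\<integral>x. g x \<partial>\<mu>) = (\<integral>x. g (R x) \<partial>measure_pmf pm)"
      unfolding \<mu>_def using Rm g by (subst integral_distr) auto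
    also have "\<dots> = (\<Sum>b\<in>UNIV. pmf (bernoulli_pmf c) b *\<^sub>R (\<integral>x. g (R x) \<partial>measure_pmf (if b then pmf_of_set X else return_pmf x0)))"
      unfolding pm_def using X by (intro pmf_expectation_bind) auto
    also have "\<dots> = c * (\<integral>x. g (R x) \<partial>measure_pmf (pmf_of_set X)) + (1 - c) * (\<integral>x. g (R x) \<partial>measure_pmf (return_pmf x0))"
      using c by (simp add: UNIV_bool)
    also have "(\<integral>x. g (R x) \<partial>measure_pmf (pmf_of_set X)) = (\<Sum>x\<in>X. g (R x)) / real (card X)"
      using X by (subst integral_pmf_of_set) auto
    also have "(\<Sum>x\<in>X. g (R x)) = (\<Sum>x\<in>X. g x)" by (intro sum.cong refl) (simp add: R)
    also have "(\<integral>x. g (R x) \<partial>measure_pmf (return_pmf x0)) = g x0" by (simp add: R)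
    finally show "(\<integral>x. g x \<partial>\<mu>) = c * ((\<Sum>x\<in>X. g x) / real (card X)) + (1 - c) * g x0" .
  qed
qed

text \<open>A geometric sum over powers of an N-th root of unity \<open>z\<close>, which differs
  from 1 because the two indices differ modulo N.\<close>

lemma tw_orthogonal:
  assumes l: "l < N" "l' < N"
  shows "(\<Sum>m<N. tw N l m * cnj (tw N l' m)) = (if l = l' then of_nat N else 0)"
proof (cases "l = l'")
  case True
  then show ?thesis using l by (simp add: tw_cnj)
next
  case False
  have N: "0 < N" using l by simp
  define z where "z = tw N l 1 * cnj (tw N l' 1)"
  have p: "tw N l m = tw N l 1 ^ m" for l m
    using N by (simp add: tw_eq Complex.DeMoivre mult_ac)
  have s: "tw N l m * cnj (tw N l' m) = z ^ m" for m
    unfolding z_def p[of l m] p[of l' m] by (simp add: power_mult_distrib)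
  have zN: "z ^ N = 1"
  proof -
    have "tw N l N = 1" for l
    proof -
      have "tw N l N = cis (2 * pi * real l)" using N by (simp add: tw_eq)
      then show ?thesis by (simp add: cis_multiple_2pi)
    qed
    then show ?thesis using s[of N] by simp
  qed
  have z1: "z \<noteq> 1"
  proof
    assume z: "z = 1"
    have "tw N l 1 = tw N l 1 * (tw N l' 1 * cnj (tw N l' 1))" by (simp only: tw_cnj[OF N] mult_1_right)
    also have "\<dots> = z * tw N l' 1" unfolding z_def by (simp only: mult_ac)
    also have "\<dots> = tw N l' 1" by (simp only: z mult_1_left)
    finally have e: "tw N l 1 = tw N l' 1" .
    have ex: "tw N l 1 = exp (2 * of_real pi * \<i> * of_nat l / of_nat N)" for l
      using N by (simp add: tw_eq cis_conv_exp mult_ac)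
    have "l mod N = l' mod N"
      using e N complex_root_unity_eq[of N l l'] unfolding ex by (simp add: cong_def)
    then show False using l False by simp
  qed
  have "(z - 1) * (\<Sum>m<N. z ^ m) = z ^ N - 1" by (rule power_diff_1_eq[symmetric])
  then have "(\<Sum>m<N. z ^ m) = 0" using zN z1 by simp
  then show ?thesis using False by (simp add: s)
qed

context ofdm_channel
begin

text \<open>The kernel for \<open>r < N\<close>: each carrier is estimated from its own past
  outputs, without averaging of noise over carriers, whence the norm 1.\<close>

lemma partial_kernel:
  assumes "m0 < r"
  shows "(\<Sum>m<r. (if m = m0 then 1 else 0) * tw N l m) = tw N l m0"
    and "(\<Sum>m<r. (cmod (if m = m0 then 1 else 0))\<^sup>2) = 1"
  using assms by (simp_all add: if_distrib[of "\<lambda>x. x * _"] if_distrib[of "\<lambda>x. x\<^sup>2"] if_distrib[of cmod] cong: if_cong)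

text \<open>Interpolation of the response on carrier \<open>m0\<close> from all carriers through the \<open>L\<close> taps.\<close>

definition "full_kernel m0 m = (\<Sum>l<L. tw N l m0 * cnj (tw N l m)) / of_nat N" for m0 m :: nat

text \<open>The kernel is the orthogonal projection onto frequency responses of impulse responses
  with \<open>L\<close> taps. It reproduces these, and the squared norm of a row is the diagonal
  entry L / N.\<close>

lemma full_kernel_tw:
  shows "l < L \<Longrightarrow> (\<Sum>m<N. full_kernel m0 m * tw N l m) = tw N l m0"
    and "(\<Sum>m<N. (cmod (full_kernel m0 m))\<^sup>2) = real L / real N"
proof -
  have N0: "of_nat N \<noteq> (0 :: complex)" using N_pos by simp
  show kern: "(\<Sum>m<N. full_kernel m0 m * tw N l m) = tw N l m0" if l: "l < L" for l
  proof -
    have "(\<Sum>m<N. full_kernel m0 m * tw N l m) = (\<Sum>m<N. \<Sum>l'<L. tw N l' m0 * (tw N l m * cnj (tw N l' m)) / of_nat N)"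
      unfolding full_kernel_def by (intro sum.cong refl) (simp add: sum_divide_distrib sum_distrib_right sum_distrib_left mult_ac)
    also have "\<dots> = (\<Sum>l'<L. \<Sum>m<N. tw N l' m0 * (tw N l m * cnj (tw N l' m)) / of_nat N)" by (rule sum.swap)
    also have "\<dots> = (\<Sum>l'<L. if l = l' then tw N l' m0 else 0)"
    proof (rule sum.cong[OF refl])
      fix l' assume l': "l' \<in> {..<L}"
      have "(\<Sum>m<N. tw N l' m0 * (tw N l m * cnj (tw N l' m)) / of_nat N) = tw N l' m0 * (\<Sum>m<N. tw N l m * cnj (tw N l' m)) / of_nat N"
        by (simp only: sum_distrib_left sum_divide_distrib)
      also have "\<dots> = (if l = l' then tw N l' m0 else 0)"
        using l l' L_le_N N0 by (subst tw_orthogonal) auto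
      finally show "(\<Sum>m<N. tw N l' m0 * (tw N l m * cnj (tw N l' m)) / of_nat N) = (if l = l' then tw N l' m0 else 0)" .
    qed
    also have "\<dots> = tw N l m0" using l by simp
    finally show ?thesis .
  qed
  have "complex_of_real (\<Sum>m<N. (cmod (full_kernel m0 m))\<^sup>2) = (\<Sum>m<N. full_kernel m0 m * cnj (full_kernel m0 m))"
    unfolding of_real_sum complex_norm_square ..
  also have "\<dots> = (\<Sum>m<N. \<Sum>l<L. cnj (tw N l m0) / of_nat N * (full_kernel m0 m * tw N l m))"
  proof (rule sum.cong[OF refl])
    fix m
    have "cnj (full_kernel m0 m) = (\<Sum>l<L. cnj (tw N l m0) / of_nat N * tw N l m)"
      unfolding full_kernel_def by (simp add: sum_divide_distrib)
    then show "full_kernel m0 m * cnj (full_kernel m0 m) = (\<Sum>l<L. cnj (tw N l m0) / of_nat N * (full_kernel m0 m * tw N l m))"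
      by (simp add: sum_distrib_left mult_ac)
  qed
  also have "\<dots> = (\<Sum>l<L. \<Sum>m<N. cnj (tw N l m0) / of_nat N * (full_kernel m0 m * tw N l m))" by (rule sum.swap)
  also have "\<dots> = (\<Sum>l<L. 1 / of_nat N)"
  proof (rule sum.cong[OF refl])
    fix l assume "l \<in> {..<L}"
    then have "(\<Sum>m<N. cnj (tw N l m0) / of_nat N * (full_kernel m0 m * tw N l m)) = cnj (tw N l m0) / of_nat N * tw N l m0"
      unfolding sum_distrib_left[symmetric] by (simp add: kern)
    also have "\<dots> = 1 / of_nat N" using tw_cnj[OF N_pos, of l m0] by (simp add: mult.commute)
    finally show "(\<Sum>m<N. cnj (tw N l m0) / of_nat N * (full_kernel m0 m * tw N l m)) = 1 / of_nat N" .
  qed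
  also have "\<dots> = complex_of_real (real L / real N)" by simp
  finally show "(\<Sum>m<N. (cmod (full_kernel m0 m))\<^sup>2) = real L / real N" unfolding of_real_eq_iff .
qed

text \<open>At time 0 there is no past; the value 0 gives the prediction error 1. For
  \<open>k > 0\<close> this is the sequence whose limit defines \<open>Tc\<close>.\<close>

definition "pred_q p k = (if k = 0 then 0 else coh_form N \<rho> p k)" for p :: real and k :: nat

lemma pred_q_nonneg: "0 \<le> p \<Longrightarrow> 0 \<le> pred_q p k"
proof -
  assume p: "0 \<le> p"
  have s: "0 \<le> real N * p" using p by simp
  show ?thesis
  proof (cases k)
    case (Suc j)
    have "0 \<le> coh_form N \<rho> p (Suc j)" by (rule coh_form_props[OF s, of j])
    then show ?thesis using Suc by (simp add: pred_q_def)
  qed (simp add: pred_q_def)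
qed

text \<open>The gain \<open>\<kappa>\<close> of the estimator is the one for which its covariance with the target is exactly
  \<open>1 - e\<close>; its variance is then at most \<open>1 - e\<close>, and \<open>\<tau>\<close> supplies the missing part.\<close>

lemma estimator_params:
  assumes p: "0 < p" and \<Lambda>: "1 \<le> \<Lambda>"
  defines "s \<equiv> real N * p"
  obtains a \<kappa> \<tau> where "corr_form \<rho> k a = complex_of_real (pred_q p k)"
    "\<kappa> * pred_q p k = 1 - \<Lambda> / (\<Lambda> + s * pred_q p k)"
    "\<tau>\<^sup>2 = \<kappa> * pred_q p k - \<kappa>\<^sup>2 * (Re (toeplitz_form \<rho> k a) + (\<Sum>i<k. (cmod (a i))\<^sup>2) * (\<Lambda> / s))"
proof -
  define q where "q = pred_q p k"
  have s: "0 < s" using p N_pos by (simp add: s_def)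
  have q0: "0 \<le> q" unfolding q_def using p by (intro pred_q_nonneg) simp
  have "\<exists>a. corr_form \<rho> k a = complex_of_real q \<and> q = s * (Re (toeplitz_form \<rho> k a) - q\<^sup>2) + (\<Sum>i<k. (cmod (a i))\<^sup>2)"
  proof (cases k)
    case 0
    then show ?thesis by (intro exI[of _ "\<lambda>_. 0"]) (simp add: corr_form_def toeplitz_form_def q_def pred_q_def)
  next
    case (Suc j)
    obtain a where "corr_form \<rho> (Suc j) a = of_real (coh_form N \<rho> p (Suc j))"
      "coh_form N \<rho> p (Suc j) = real N * p * (Re (toeplitz_form \<rho> (Suc j) a) - (coh_form N \<rho> p (Suc j))\<^sup>2) + (\<Sum>i<Suc j. (cmod (a i))\<^sup>2)"
      by (rule coh_form_props[OF less_imp_le[OF s[unfolded s_def]], of j]) (rule that)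
    then show ?thesis unfolding Suc q_def pred_q_def s_def by (intro exI[of _ a]) (simp del: sum.lessThan_Suc)
  qed
  then obtain a where c: "corr_form \<rho> k a = complex_of_real q"
    and qe: "q = s * (Re (toeplitz_form \<rho> k a) - q\<^sup>2) + (\<Sum>i<k. (cmod (a i))\<^sup>2)" by blast
  define S where "S = Re (toeplitz_form \<rho> k a)"
  define B where "B = (\<Sum>i<k. (cmod (a i))\<^sup>2)"
  \<comment> \<open>A minimiser of 1 - 2 \<kappa> q + \<kappa>^2 (q^2 + \<Lambda> q / s), the mean
    square error if the variance bound below were attained.\<close>
  define \<kappa> where "\<kappa> = s / (\<Lambda> + s * q)"
  have den: "0 < \<Lambda> + s * q" using \<Lambda> s q0 by (intro add_pos_nonneg) auto
  have kq: "\<kappa> * q = 1 - \<Lambda> / (\<Lambda> + s * q)" using den by (simp add: \<kappa>_def field_simps)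
  have Sq: "q\<^sup>2 \<le> S" using schur_nonneg[of k a] by (simp add: c S_def)
  \<comment> \<open>The gap between the two sides is (\<Lambda> - 1) (S - q^2). It closes for
    \<Lambda> = 1, and then \<open>\<tau>\<close> is 0.\<close>
  have "S + B * (\<Lambda> / s) \<le> q\<^sup>2 + \<Lambda> * q / s"
  proof -
    have "\<Lambda> * q / s = \<Lambda> * (s * (S - q\<^sup>2) + B) / s"
      using qe unfolding S_def[symmetric] B_def[symmetric] by (rule arg_cong)
    also have "\<dots> = \<Lambda> * (S - q\<^sup>2) + B * (\<Lambda> / s)" using s by (simp add: add_divide_distrib distrib_left)
    finally have "\<Lambda> * q / s = \<Lambda> * (S - q\<^sup>2) + B * (\<Lambda> / s)" .
    moreover have "1 * (S - q\<^sup>2) \<le> \<Lambda> * (S - q\<^sup>2)" using Sq \<Lambda> by (intro mult_right_mono) auto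
    ultimately show ?thesis by simp
  qed
  then have "\<kappa>\<^sup>2 * (S + B * (\<Lambda> / s)) \<le> \<kappa>\<^sup>2 * (q\<^sup>2 + \<Lambda> * q / s)" by (intro mult_left_mono) auto
  also have "\<dots> = \<kappa> * q * (\<kappa> * ((\<Lambda> + s * q) / s))" using s by (simp add: field_simps power2_eq_square)
  also have "\<kappa> * ((\<Lambda> + s * q) / s) = 1" using s den by (simp add: \<kappa>_def)
  finally have nn: "0 \<le> \<kappa> * q - \<kappa>\<^sup>2 * (S + B * (\<Lambda> / s))" by simp
  show thesis
  proof (rule that[of a \<kappa> "sqrt (\<kappa> * q - \<kappa>\<^sup>2 * (S + B * (\<Lambda> / s)))"])
    show "corr_form \<rho> k a = complex_of_real (pred_q p k)" using c by (simp add: q_def)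
    show "\<kappa> * pred_q p k = 1 - \<Lambda> / (\<Lambda> + s * pred_q p k)" using kq by (simp add: q_def)
    show "(sqrt (\<kappa> * q - \<kappa>\<^sup>2 * (S + B * (\<Lambda> / s))))\<^sup>2 =
      \<kappa> * pred_q p k - \<kappa>\<^sup>2 * (Re (toeplitz_form \<rho> k a) + (\<Sum>i<k. (cmod (a i))\<^sup>2) * (\<Lambda> / s))"
      using nn by (simp add: q_def[symmetric] S_def B_def)
  qed
qed

text \<open>A mean carried by one tap has a frequency response of constant modulus, so the mean on
  carrier 0 stands for all carriers up to a phase.\<close>

lemma gmean_rotation:
  obtains \<zeta> where "cmod \<zeta> = 1" "gmean m = \<zeta> * gmean 0"
proof -
  obtain l0 where l0: "l0 < N" "\<And>k l. l < N \<Longrightarrow> l \<noteq> l0 \<Longrightarrow> mean M (\<lambda>\<omega>. H k \<omega> l) = 0"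
    using H_mean_flat by blast
  have g: "gmean m = tw N l0 m * mean M (\<lambda>\<omega>. H 0 \<omega> l0)" for m
  proof -
    have "gmean m = (\<Sum>l<N. if l = l0 then tw N l m * mean M (\<lambda>\<omega>. H 0 \<omega> l) else 0)"
      unfolding gmean_def using l0(2) by (intro sum.cong refl) simp
    then show ?thesis using l0(1) by simp
  qed
  have "tw N l0 0 = 1" using N_pos by (simp add: tw_eq)
  then show thesis using N_pos by (intro that[of "tw N l0 m"]) (simp_all add: cmod_tw g)
qed

text \<open>The expected log posterior ratio of one active carrier, for symbol amplitude
  \<open>A\<close> and error variance \<open>e\<close>.\<close>

definition "fade_QPSK A e = (\<integral>u. C_QPSK (fade_snr (gmean 0) (1 / A\<^sup>2) e u) \<partial>std_CN)" for A e :: real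

text \<open>The output is the estimate times the symbol plus the residual, and these two are
  independent Gaussian variables. The average over fading, noise and dither is therefore that of a
  coherent channel with gain variance 1 - e and noise variance 1 + e A^2.\<close>

lemma expectation_soft_estimate:
  assumes r: "r \<le> N" and m0: "m0 < r" and A: "0 < A"
    and x: "\<And>i m. i \<le> k \<Longrightarrow> m < r \<Longrightarrow> x i m \<in> qpsk A"
    and P: "\<And>l. l < L \<Longrightarrow> (\<Sum>m<r. P m * tw N l m) = tw N l m0"
    and q: "corr_form \<rho> k a = complex_of_real q" and e: "\<kappa> * q = 1 - e" "0 \<le> e" "e \<le> 1"
    and \<tau>: "\<tau>\<^sup>2 = \<kappa> * q - \<kappa>\<^sup>2 * (Re (toeplitz_form \<rho> k a) + (\<Sum>i<k. (cmod (a i))\<^sup>2) * ((\<Sum>m<r. (cmod (P m))\<^sup>2) / A\<^sup>2))"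
  defines "T \<equiv> \<lambda>p. ln (soft (1 + e * A\<^sup>2) (gmean m0 + est_dev k r \<kappa> a P x \<tau> p) (gain N (H k (fst p)) m0 * x k m0 + W k (fst p) m0) (x k m0))"
  shows "integrable (M \<Otimes>\<^sub>M std_CN) T"
    and "(\<integral>p. T p \<partial>(M \<Otimes>\<^sub>M std_CN)) = fade_QPSK A e"
proof -
  obtain \<zeta> where \<zeta>: "cmod \<zeta> = 1" "gmean m0 = \<zeta> * gmean 0" by (rule gmean_rotation)
  define v where "v = 1 + e * A\<^sup>2"
  define F where "F z = ln (soft v (\<zeta> * (gmean 0 + fst z)) (\<zeta> * (gmean 0 + fst z) * x k m0 + snd z) (x k m0))" for z
  define G1 where "G1 p = (cnj \<zeta> * est_dev k r \<kappa> a P x \<tau> p,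
       (gain N (H k (fst p)) m0 - gmean m0 - est_dev k r \<kappa> a P x \<tau> p) * x k m0 + W k (fst p) m0)" for p
  define G2 where "G2 p = (complex_of_real (sqrt (1 - e)) * fst p, complex_of_real (sqrt v) * snd p)" for p
  have zz: "\<zeta> * (cnj \<zeta> * w) = w" for w
  proof -
    have "\<zeta> * cnj \<zeta> = 1" using \<zeta>(1) by (simp add: complex_norm_square[symmetric])
    then show ?thesis by (simp add: mult.assoc[symmetric])
  qed
  have Fm: "F \<in> borel_measurable (borel \<Otimes>\<^sub>M borel)"
    unfolding F_def by (intro borel_measurable_ln soft_measurable) simp_all
  have m0N: "m0 < N" using m0 r by simp
  have em: "est_dev k r \<kappa> a P x \<tau> \<in> borel_measurable (M \<Otimes>\<^sub>M std_CN)" by (rule est_dev_measurable[OF r])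
  have gm: "(\<lambda>p. gain N (H k (fst p)) m0) \<in> borel_measurable (M \<Otimes>\<^sub>M std_CN)"
    by (rule measurable_compose[OF measurable_fst measurable_compose[OF H_meas gain_measurable[OF m0N]]])
  have G1m: "G1 \<in> M \<Otimes>\<^sub>M std_CN \<rightarrow>\<^sub>M borel \<Otimes>\<^sub>M borel"
    unfolding G1_def[abs_def]
    by (intro measurable_Pair borel_measurable_add borel_measurable_times borel_measurable_diff borel_measurable_const em gm
        measurable_compose[OF measurable_fst W_component[OF m0N]])
  have fm: "fst \<in> borel_measurable (std_CN \<Otimes>\<^sub>M std_CN)" and sm: "snd \<in> borel_measurable (std_CN \<Otimes>\<^sub>M std_CN)"
    using measurable_fst[of std_CN std_CN] measurable_snd[of std_CN std_CN]
    by (simp_all add: measurable_cong_sets[OF refl sets_std_CN])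
  have G2m: "G2 \<in> std_CN \<Otimes>\<^sub>M std_CN \<rightarrow>\<^sub>M borel \<Otimes>\<^sub>M borel"
    unfolding G2_def[abs_def] by (intro measurable_Pair borel_measurable_times borel_measurable_const fm sm)
  have TF: "T = (\<lambda>p. F (G1 p))"
  proof (rule ext)
    fix p
    have h: "\<zeta> * (gmean 0 + cnj \<zeta> * est_dev k r \<kappa> a P x \<tau> p) = gmean m0 + est_dev k r \<kappa> a P x \<tau> p"
      unfolding distrib_left zz \<zeta>(2) ..
    have y: "(g + d) * X + ((gn - g - d) * X + w) = gn * X + w" for g d X gn w :: complex
      by (simp add: algebra_simps)
    show "T p = F (G1 p)" unfolding T_def F_def G1_def fst_conv snd_conv h y v_def ..
  qed
  have FG2: "(\<lambda>p. F (G2 p)) = (\<lambda>p. ln (soft v (\<zeta> * (gmean 0 + complex_of_real (sqrt (1 - e)) * fst p))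
      (\<zeta> * (gmean 0 + complex_of_real (sqrt (1 - e)) * fst p) * x k m0 + complex_of_real (sqrt v) * snd p) (x k m0)))"
    by (simp add: F_def G2_def)
  note ex = expectation_fade_soft[OF x[OF order_refl m0] A e(2,3) \<zeta>(1), where m = "gmean 0", folded v_def]
  have law: "distr (M \<Otimes>\<^sub>M std_CN) (borel \<Otimes>\<^sub>M borel) G1 = distr (std_CN \<Otimes>\<^sub>M std_CN) (borel \<Otimes>\<^sub>M borel) G2"
  proof -
    have 1: "1 - (1 - e) = e" by simp
    have k: "0 \<le> \<kappa> * q" "\<kappa> * q \<le> 1" using e by simp_all
    show ?thesis
      unfolding G1_def[abs_def] G2_def[abs_def] v_def
      by (rule estimator_law[where x = x and P = P, OF r m0 A _ _ q k \<zeta>(1) \<tau>, unfolded e(1) 1])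
         (use cmod_qpsk[OF x] P in auto)
  qed
  show "integrable (M \<Otimes>\<^sub>M std_CN) T"
    unfolding TF integrable_distr_eq[OF G1m Fm, symmetric] law integrable_distr_eq[OF G2m Fm] FG2 by (rule ex(1))
  show "(\<integral>p. T p \<partial>(M \<Otimes>\<^sub>M std_CN)) = fade_QPSK A e"
    unfolding TF integral_distr[OF G1m Fm, symmetric] law integral_distr[OF G2m Fm] FG2 fade_QPSK_def by (rule ex(2))
qed

text \<open>The estimate as a function of what the guess may use: symbols, outputs and a value of
  the dither. On actual outputs it agrees with \<open>gmean m\<close> plus
  \<open>est_dev\<close>.\<close>

definition "chan_est k r \<kappa> a P \<tau> x y \<theta> m =
  gmean m + ((\<Sum>i<k. \<Sum>j<r. complex_of_real \<kappa> * cnj (a i) * P m j * (y i j / x i j - gmean j)) + complex_of_real \<tau> * \<theta>)"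
  for k r m :: nat and \<kappa> \<tau> :: real and a :: "nat \<Rightarrow> complex" and P :: "nat \<Rightarrow> nat \<Rightarrow> complex" and x y :: "nat \<Rightarrow> nat \<Rightarrow> complex" and \<theta> :: complex

lemma outs_entry: "k \<le> n \<Longrightarrow> m < N \<Longrightarrow> outs 0 n x \<omega> k m = gain N (H k \<omega>) m * x k m + W k \<omega> m"
  by (simp add: outs_0 channel_output_def gain_def)

lemma chan_est_outs:
  assumes "k \<le> n" "r \<le> N"
  shows "chan_est k r \<kappa> a P \<tau> x (outs 0 n x \<omega>) \<theta> m = gmean m + est_dev k r \<kappa> a (P m) x \<tau> (\<omega>, \<theta>)"
proof -
  have "(\<Sum>i<k. \<Sum>j<r. complex_of_real \<kappa> * cnj (a i) * P m j * (outs 0 n x \<omega> i j / x i j - gmean j)) =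
     (\<Sum>i<k. \<Sum>j<r. complex_of_real \<kappa> * cnj (a i) * P m j * ((gain N (H i \<omega>) j * x i j + W i \<omega> j) / x i j - gmean j))"
    using assms by (intro sum.cong refl) (simp add: outs_entry)
  then show ?thesis by (simp add: chan_est_def est_dev_def)
qed

lemma chan_est_measurable:
  assumes "k \<le> n" "r \<le> N"
  shows "(\<lambda>p. chan_est k r \<kappa> a P \<tau> (fst p) (snd p) \<theta> m) \<in> borel_measurable (block_space N n \<Otimes>\<^sub>M block_space N n)"
  unfolding chan_est_def
  by (intro borel_measurable_add borel_measurable_sum borel_measurable_times borel_measurable_const borel_measurable_diff
      borel_measurable_divide measurable_compose[OF measurable_fst block_component] measurable_compose[OF measurable_snd block_component])
     (use assms in auto)

lemma chan_est_causal: "(\<And>j. j < k \<Longrightarrow> x j = x' j) \<Longrightarrow> chan_est k r \<kappa> a P \<tau> x y \<theta> m = chan_est k r \<kappa> a P \<tau> x' y \<theta> m"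
  by (simp add: chan_est_def)

lemma qpsk_blocks_space: "qpsk_blocks N r A n \<subseteq> space (block_space N n)"
  unfolding qpsk_blocks_def qpsk_row_def space_block_space by (intro PiE_mono) auto

lemma qpsk_blocks_entry:
  "x \<in> qpsk_blocks N r A n \<Longrightarrow> k \<le> n \<Longrightarrow> m < N \<Longrightarrow> x k m \<in> (if m < r then qpsk A else {0})"
proof -
  assume x: "x \<in> qpsk_blocks N r A n" and k: "k \<le> n" and m: "m < N"
  have "x k \<in> qpsk_row N r A" using PiE_mem[OF x[unfolded qpsk_blocks_def], of k] k by simp
  from PiE_mem[OF this[unfolded qpsk_row_def], of m]
  show "x k m \<in> (if m < r then qpsk A else {0})" using m by (simp only: lessThan_iff)
qed

lemma qpsk_blocks_nonempty: "qpsk_blocks N r A n \<noteq> {}"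
  unfolding qpsk_blocks_def qpsk_row_def by (simp add: PiE_eq_empty_iff qpsk_def)

text \<open>Gibbs' inequality holds for every frozen dither value at which the logarithm is
  integrable. Averaging over the dither turns the left side into the exact QPSK value, while the
  information on the right is constant. Silent blocks add nothing, hence the factor
  \<open>c\<close>.\<close>

lemma mixture_information_ge:
  assumes r: "r \<le> N" and A: "0 < A" and p: "0 < p" and \<Lambda>: "1 \<le> \<Lambda>" and c: "0 \<le> c" "c \<le> 1"
    and P: "\<And>m l. m < r \<Longrightarrow> l < L \<Longrightarrow> (\<Sum>j<r. P m j * tw N l j) = tw N l m"
    and P2: "\<And>m. m < r \<Longrightarrow> (\<Sum>j<r. (cmod (P m j))\<^sup>2) / A\<^sup>2 = \<Lambda> / (real N * p)"
    and x0: "x0 \<in> space (block_space N n)" "\<And>k m. k \<le> n \<Longrightarrow> m < N \<Longrightarrow> x0 k m = 0"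
    and \<mu>: "\<mu> \<in> energy_inputs N n"
    and mix: "\<And>g. g \<in> borel_measurable (block_space N n) \<Longrightarrow>
       (\<integral>\<^sup>+x. g x \<partial>\<mu>) = ennreal c * ((\<Sum>x\<in>qpsk_blocks N r A n. g x) / of_nat (card (qpsk_blocks N r A n))) + ennreal (1 - c) * g x0"
      "\<And>g :: (nat \<Rightarrow> nat \<Rightarrow> complex) \<Rightarrow> real. g \<in> borel_measurable (block_space N n) \<Longrightarrow>
       (\<integral>x. g x \<partial>\<mu>) = c * ((\<Sum>x\<in>qpsk_blocks N r A n. g x) / real (card (qpsk_blocks N r A n))) + (1 - c) * g x0"
  shows "c * (real r * (\<Sum>k\<le>n. fade_QPSK A (\<Lambda> / (\<Lambda> + real N * p * pred_q p k)))) \<le> block_information M N H W n \<mu>"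
proof -
  interpret MC: pair_prob_space M std_CN ..
  let ?X = "qpsk_blocks N r A n"
  define K where "K = real (card ?X)"
  have K: "0 < K" using finite_qpsk_blocks qpsk_blocks_nonempty by (simp add: K_def card_gt_0_iff)
  have cardK: "of_nat (card ?X) = ennreal K" by (simp add: K_def ennreal_of_nat_eq_real_of_nat)
  have st: "sets \<mu> = sets (block_space N n)" using \<mu> by (simp add: energy_inputs_def input_laws_def)
  interpret \<mu>: prob_space \<mu> using \<mu> by (simp add: energy_inputs_def input_laws_def)
  interpret \<mu>M: pair_prob_space \<mu> M ..
  define e where "e k = \<Lambda> / (\<Lambda> + real N * p * pred_q p k)" for k
  have e01: "0 \<le> e k" "e k \<le> 1" for k
  proof -
    have "0 \<le> real N * p * pred_q p k" using p by (intro mult_nonneg_nonneg pred_q_nonneg) auto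
    then show "0 \<le> e k" "e k \<le> 1" using \<Lambda> by (auto simp: e_def)
  qed
  \<comment> \<open>Weights, gain and dither strength are needed for all times at once; packed into
    a triple, they are obtained by a single choice.\<close>
  define OKp where "OKp k a \<kappa> \<tau> \<longleftrightarrow> corr_form \<rho> k a = complex_of_real (pred_q p k) \<and> \<kappa> * pred_q p k = 1 - e k \<and>
    \<tau>\<^sup>2 = \<kappa> * pred_q p k - \<kappa>\<^sup>2 * (Re (toeplitz_form \<rho> k a) + (\<Sum>i<k. (cmod (a i))\<^sup>2) * (\<Lambda> / (real N * p)))"
    for k a \<kappa> \<tau>
  have "\<exists>t. OKp k (fst t) (fst (snd t)) (snd (snd t))" for k
  proof -
    obtain a \<kappa> \<tau> where "OKp k a \<kappa> \<tau>" unfolding OKp_def e_def by (rule estimator_params[OF p \<Lambda>, of k]) blast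
    then show ?thesis by (intro exI[of _ "(a, \<kappa>, \<tau>)"]) simp
  qed
  then obtain t where t: "\<And>k. OKp k (fst (t k)) (fst (snd (t k))) (snd (snd (t k)))" by metis
  define a where "a k = fst (t k)" for k
  define \<kappa> where "\<kappa> k = fst (snd (t k))" for k
  define \<tau> where "\<tau> k = snd (snd (t k))" for k
  have par: "corr_form \<rho> k (a k) = complex_of_real (pred_q p k)" "\<kappa> k * pred_q p k = 1 - e k"
    "(\<tau> k)\<^sup>2 = \<kappa> k * pred_q p k - (\<kappa> k)\<^sup>2 * (Re (toeplitz_form \<rho> k (a k)) + (\<Sum>i<k. (cmod (a k i))\<^sup>2) * (\<Lambda> / (real N * p)))" for k
    using t[of k] by (simp_all add: OKp_def a_def \<kappa>_def \<tau>_def)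
  define h where "h \<theta> y k x m = chan_est k r (\<kappa> k) (a k) P (\<tau> k) x y \<theta> m" for \<theta> y k x m
  define S where "S \<theta> x y k m = soft (1 + e k * A\<^sup>2) (h \<theta> y k x m) (y k m) (x k m)" for \<theta> x y k m
  define \<phi> where "\<phi> \<theta> x y = (\<Prod>k\<le>n. \<Prod>m<N. S \<theta> x y k m)" for \<theta> x y
  have Spos: "0 < S \<theta> x y k m" for \<theta> x y k m by (simp add: S_def soft_pos)
  have Sne: "S \<theta> x y k m \<noteq> 0" for \<theta> x y k m using Spos[of \<theta> x y k m] by simp
  have pos: "0 < \<phi> \<theta> x y" for \<theta> x y unfolding \<phi>_def by (intro prod_pos ballI) (rule Spos)
  have Sm: "(\<lambda>p. S \<theta> (fst p) (snd p) k m) \<in> borel_measurable (block_space N n \<Otimes>\<^sub>M block_space N n)"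
    if "k \<le> n" "m < N" for \<theta> k m
    unfolding S_def h_def using that r
    by (intro soft_measurable chan_est_measurable measurable_compose[OF measurable_fst block_component] measurable_compose[OF measurable_snd block_component])
  have \<phi>m: "(\<lambda>p. \<phi> \<theta> (fst p) (snd p)) \<in> borel_measurable (block_space N n \<Otimes>\<^sub>M block_space N n)" for \<theta>
    unfolding \<phi>_def by (intro borel_measurable_prod Sm) auto
  \<comment> \<open>On the silent block all symbols are 0: the guess is 1 there, so it keeps the
    normalisation and its logarithm vanishes.\<close>
  have \<phi>0: "\<phi> \<theta> x0 y = 1" for \<theta> y by (simp add: \<phi>_def S_def x0(2) soft_zero)
  have norm: "(\<integral>\<^sup>+x. ennreal (\<phi> \<theta> x y) \<partial>\<mu>) \<le> 1" if y: "y \<in> space (block_space N n)" for \<theta> y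
  proof -
    have m: "(\<lambda>x. ennreal (\<phi> \<theta> x y)) \<in> borel_measurable (block_space N n)"
      by (rule measurable_compose[OF measurable_compose[OF measurable_Pair2'[OF y] \<phi>m[of \<theta>], unfolded fst_conv snd_conv] measurable_ennreal])
    have "(\<Sum>x\<in>?X. \<phi> \<theta> x y) = K"
      unfolding \<phi>_def S_def K_def
      by (rule qpsk_blocks_sum[OF A, where h = "h \<theta> y" and v = "\<lambda>k m. 1 + e k * A\<^sup>2"]) (unfold h_def, rule chan_est_causal, blast)
    then have "(\<Sum>x\<in>?X. ennreal (\<phi> \<theta> x y)) = ennreal K" using pos by (subst sum_ennreal) (auto intro: less_imp_le)
    then have "(\<integral>\<^sup>+x. ennreal (\<phi> \<theta> x y) \<partial>\<mu>) = ennreal c * (ennreal K / ennreal K) + ennreal (1 - c)"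
      unfolding mix(1)[OF m] cardK by (simp add: \<phi>0)
    also have "ennreal K / ennreal K = 1" using K by (simp add: ennreal_divide_self)
    also have "ennreal c * 1 + ennreal (1 - c) = 1" using c by (simp flip: ennreal_plus)
    finally show ?thesis by simp
  qed
  define T where "T \<theta> x \<omega> k m = ln (S \<theta> x (outs 0 n x \<omega>) k m)" for \<theta> x \<omega> k m
  have ln\<phi>: "ln (\<phi> \<theta> x (outs 0 n x \<omega>)) = (\<Sum>k\<le>n. \<Sum>m<N. T \<theta> x \<omega> k m)" for \<theta> x \<omega>
  proof -
    have "ln (\<phi> \<theta> x (outs 0 n x \<omega>)) = (\<Sum>k\<le>n. ln (\<Prod>m<N. S \<theta> x (outs 0 n x \<omega>) k m))"
      unfolding \<phi>_def by (rule ln_prod) (simp_all add: Sne)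
    also have "\<dots> = (\<Sum>k\<le>n. \<Sum>m<N. T \<theta> x \<omega> k m)"
      unfolding T_def by (intro sum.cong refl ln_prod) (simp_all add: Sne)
    finally show ?thesis .
  qed
  have Tint: "integrable (M \<Otimes>\<^sub>M std_CN) (\<lambda>q. T (snd q) x (fst q) k m)"
    and Tval: "(\<integral>q. T (snd q) x (fst q) k m \<partial>(M \<Otimes>\<^sub>M std_CN)) = (if m < r then fade_QPSK A (e k) else 0)"
    if x: "x \<in> ?X" and k: "k \<le> n" and m: "m < N" for x k m
  proof -
    have "integrable (M \<Otimes>\<^sub>M std_CN) (\<lambda>q. T (snd q) x (fst q) k m) \<and>
       (\<integral>q. T (snd q) x (fst q) k m \<partial>(M \<Otimes>\<^sub>M std_CN)) = (if m < r then fade_QPSK A (e k) else 0)"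
    proof (cases "m < r")
      case False
      then have "x k m = 0" using qpsk_blocks_entry[OF x k m] by simp
      then show ?thesis using False by (simp add: T_def S_def soft_zero)
    next
      case True
      have Tq: "T (snd q) x (fst q) k m = ln (soft (1 + e k * A\<^sup>2) (gmean m + est_dev k r (\<kappa> k) (a k) (P m) x (\<tau> k) q)
          (gain N (H k (fst q)) m * x k m + W k (fst q) m) (x k m))" for q
        unfolding T_def S_def h_def chan_est_outs[OF k r] outs_entry[OF k m] by simp
      have xq: "x i j \<in> qpsk A" if "i \<le> k" "j < r" for i j
        using qpsk_blocks_entry[OF x, of i j] that k r by simp
      note E = expectation_soft_estimate[where x = x and P = "P m", OF r True A _ _ par(1)[of k] par(2)[of k] e01[of k] par(3)[of k, folded P2[OF True]]]
      show ?thesis unfolding Tq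
        by (rule conjI, rule E(1), (use xq P[OF True] in auto)[2], simp only: True if_True, rule E(2)) (use xq P[OF True] in auto)
    qed
    then show "integrable (M \<Otimes>\<^sub>M std_CN) (\<lambda>q. T (snd q) x (fst q) k m)"
      "(\<integral>q. T (snd q) x (fst q) k m \<partial>(M \<Otimes>\<^sub>M std_CN)) = (if m < r then fade_QPSK A (e k) else 0)" by blast+
  qed
  define g where "g \<theta> x \<omega> = ln (\<phi> \<theta> x (outs 0 n x \<omega>))" for \<theta> x \<omega>
  have gint: "integrable (M \<Otimes>\<^sub>M std_CN) (\<lambda>q. g (snd q) x (fst q))"
    and gval: "(\<integral>q. g (snd q) x (fst q) \<partial>(M \<Otimes>\<^sub>M std_CN)) = real r * (\<Sum>k\<le>n. fade_QPSK A (e k))"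
    if x: "x \<in> ?X" for x
  proof -
    show "integrable (M \<Otimes>\<^sub>M std_CN) (\<lambda>q. g (snd q) x (fst q))"
      unfolding g_def ln\<phi> by (intro Bochner_Integration.integrable_sum Tint[OF x]) auto
    have "(\<integral>q. g (snd q) x (fst q) \<partial>(M \<Otimes>\<^sub>M std_CN)) = (\<Sum>k\<le>n. \<Sum>m<N. \<integral>q. T (snd q) x (fst q) k m \<partial>(M \<Otimes>\<^sub>M std_CN))"
      unfolding g_def ln\<phi>
      by (subst Bochner_Integration.integral_sum; (intro sum.cong refl Bochner_Integration.integral_sum Bochner_Integration.integrable_sum)?) (auto intro!: Tint[OF x])
    also have "\<dots> = (\<Sum>k\<le>n. \<Sum>m<N. if m < r then fade_QPSK A (e k) else 0)"
      by (intro sum.cong refl Tval[OF x]) auto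
    also have "\<dots> = real r * (\<Sum>k\<le>n. fade_QPSK A (e k))"
      unfolding sum_if_less[OF r] by (simp add: sum_distrib_left)
    finally show "(\<integral>q. g (snd q) x (fst q) \<partial>(M \<Otimes>\<^sub>M std_CN)) = real r * (\<Sum>k\<le>n. fade_QPSK A (e k))" .
  qed
  have gm: "(\<lambda>p. g \<theta> (fst p) (snd p)) \<in> borel_measurable (block_space N n \<Otimes>\<^sub>M M)" for \<theta>
  proof -
    have "(\<lambda>p. (fst p, outs 0 n (fst p) (snd p))) \<in> block_space N n \<Otimes>\<^sub>M M \<rightarrow>\<^sub>M block_space N n \<Otimes>\<^sub>M block_space N n"
      using outs_measurable[of 0 n] by (intro measurable_Pair measurable_fst) (simp add: case_prod_unfold)
    from measurable_compose[OF this \<phi>m[of \<theta>]] show ?thesis unfolding g_def by (intro borel_measurable_ln) simp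
  qed
  have gm': "(\<lambda>p. g \<theta> (fst p) (snd p)) \<in> borel_measurable (\<mu> \<Otimes>\<^sub>M M)" for \<theta>
    using gm[of \<theta>] by (simp add: measurable_cong_sets[OF sets_pair_measure_cong[OF st refl] refl])
  have g0: "g \<theta> x0 \<omega> = 0" for \<theta> \<omega> by (simp add: g_def \<phi>0)
  have gz: "g \<theta> x0 = (\<lambda>_. 0)" for \<theta> by (rule ext) (rule g0)
  \<comment> \<open>Fubini gives integrability over fading and noise for almost every dither value;
    as there are finitely many blocks, one null set serves for all.\<close>
  have ae: "AE \<theta> in std_CN. \<forall>x\<in>?X. integrable M (g \<theta> x)"
  proof -
    have "AE \<theta> in std_CN. integrable M (g \<theta> x)" if x: "x \<in> ?X" for x
      by (rule MC.AE_integrable_snd) (use gint[OF x] in \<open>simp add: case_prod_unfold\<close>)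
    then show ?thesis by (subst AE_ball_countable) (auto simp: finite_qpsk_blocks countable_finite)
  qed
  have key: "c * ((\<Sum>x\<in>?X. \<integral>\<omega>. g \<theta> x \<omega> \<partial>M) / K) \<le> block_information M N H W n \<mu>"
    if \<theta>: "\<forall>x\<in>?X. integrable M (g \<theta> x)" for \<theta>
  proof -
    have nm: "(\<lambda>x. \<integral>\<^sup>+\<omega>. ennreal (norm (g \<theta> x \<omega>)) \<partial>M) \<in> borel_measurable (block_space N n)"
    proof -
      have "(\<lambda>p. ennreal (norm (g \<theta> (fst p) (snd p)))) \<in> borel_measurable (block_space N n \<Otimes>\<^sub>M M)"
        using gm[of \<theta>] by measurable
      from borel_measurable_nn_integral_fst[OF this] show ?thesis by simp
    qed
    have im: "(\<lambda>x. \<integral>\<omega>. g \<theta> x \<omega> \<partial>M) \<in> borel_measurable (block_space N n)"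
      by (rule borel_measurable_lebesgue_integral) (use gm[of \<theta>] in \<open>simp add: case_prod_unfold\<close>)
    have fin: "(\<integral>\<^sup>+p. ennreal (norm (g \<theta> (fst p) (snd p))) \<partial>(\<mu> \<Otimes>\<^sub>M M)) < \<infinity>"
    proof -
      have "(\<integral>\<^sup>+p. ennreal (norm (g \<theta> (fst p) (snd p))) \<partial>(\<mu> \<Otimes>\<^sub>M M)) = (\<integral>\<^sup>+x. \<integral>\<^sup>+\<omega>. ennreal (norm (g \<theta> x \<omega>)) \<partial>M \<partial>\<mu>)"
        using gm'[of \<theta>] by (subst nn_integral_fst[symmetric]) simp_all
      also have "\<dots> = ennreal c * ((\<Sum>x\<in>?X. \<integral>\<^sup>+\<omega>. ennreal (norm (g \<theta> x \<omega>)) \<partial>M) / of_nat (card ?X))"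
        unfolding mix(1)[OF nm] by (simp add: g0)
      also have "\<dots> < \<infinity>"
      proof -
        have "(\<Sum>x\<in>?X. \<integral>\<^sup>+\<omega>. ennreal (norm (g \<theta> x \<omega>)) \<partial>M) < \<infinity>"
          using \<theta> finite_qpsk_blocks by (simp add: integrable_iff_bounded)
        moreover have "ennreal c * (Z / ennreal K) < \<infinity>" if "Z < \<infinity>" for Z
          using that K by (cases Z) (simp_all add: divide_ennreal ennreal_mult_less_top)
        ultimately show ?thesis unfolding cardK by blast
      qed
      finally show ?thesis .
    qed
    have I: "integrable (\<mu> \<Otimes>\<^sub>M M) (\<lambda>p. g \<theta> (fst p) (snd p))"
      using gm'[of \<theta>] fin by (simp add: integrable_iff_bounded)
    have "(\<integral>p. g \<theta> (fst p) (snd p) \<partial>(\<mu> \<Otimes>\<^sub>M M)) = (\<integral>x. \<integral>\<omega>. g \<theta> x \<omega> \<partial>M \<partial>\<mu>)"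
      using \<mu>M.integral_fst'[OF I] by simp
    also have "\<dots> = c * ((\<Sum>x\<in>?X. \<integral>\<omega>. g \<theta> x \<omega> \<partial>M) / K)"
      unfolding mix(2)[OF im] gz by (simp add: K_def)
    finally have "c * ((\<Sum>x\<in>?X. \<integral>\<omega>. g \<theta> x \<omega> \<partial>M) / K) = (\<integral>p. g \<theta> (fst p) (snd p) \<partial>(\<mu> \<Otimes>\<^sub>M M))" by (rule sym)
    also have "\<dots> \<le> block_information M N H W n \<mu>"
      unfolding g_def by (rule block_information_ge[OF \<mu>]) (rule \<phi>m, rule pos, erule norm, rule I[unfolded g_def])
    finally show ?thesis .
  qed
  define G where "G x \<theta> = (\<integral>\<omega>. g \<theta> x \<omega> \<partial>M)" for x \<theta>
  have Gint: "integrable std_CN (G x)" and Gval: "(\<integral>\<theta>. G x \<theta> \<partial>std_CN) = real r * (\<Sum>k\<le>n. fade_QPSK A (e k))" if x: "x \<in> ?X" for x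
    using MC.integrable_snd[of "\<lambda>\<omega> \<theta>. g \<theta> x \<omega>"] MC.integral_snd[of "\<lambda>\<omega> \<theta>. g \<theta> x \<omega>"] gint[OF x] gval[OF x]
    by (simp_all add: case_prod_unfold G_def[abs_def])
  \<comment> \<open>The mean over the dither is the same for every codeword, because all symbols
    have the same modulus.\<close>
  have "c * (real r * (\<Sum>k\<le>n. fade_QPSK A (e k))) = c * ((\<Sum>x\<in>?X. \<integral>\<theta>. G x \<theta> \<partial>std_CN) / K)"
    using K by (simp add: Gval K_def)
  also have "\<dots> = (\<integral>\<theta>. c * ((\<Sum>x\<in>?X. G x \<theta>) / K) \<partial>std_CN)"
    using Gint by (simp add: Bochner_Integration.integral_sum)
  also have "\<dots> \<le> (\<integral>\<theta>. block_information M N H W n \<mu> \<partial>std_CN)"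
  proof (rule integral_mono_AE)
    show "integrable std_CN (\<lambda>\<theta>. c * ((\<Sum>x\<in>?X. G x \<theta>) / K))" using Gint by (simp add: Bochner_Integration.integrable_sum)
    show "AE \<theta> in std_CN. c * ((\<Sum>x\<in>?X. G x \<theta>) / K) \<le> block_information M N H W n \<mu>"
      using ae by (rule AE_mp) (intro AE_I2 impI, unfold G_def, rule key)
  qed simp
  also have "\<dots> = block_information M N H W n \<mu>" by (simp only: lebesgue_integral_const std_CN.prob_space scaleR_one)
  finally show ?thesis by (simp only: e_def)
qed

end

subsection \<open>The limit of long blocks\<close>

text \<open>Turns convergence of the contributions at time \<open>k\<close> into convergence of the
  rate: the initial times with a short past are negligible.\<close>

lemma cesaro_mean:
  fixes f :: "nat \<Rightarrow> real"
  assumes f: "f \<longlonglongrightarrow> l"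
  shows "(\<lambda>n. (\<Sum>k\<le>n. f k) / real (n + 1)) \<longlonglongrightarrow> l"
proof (rule LIMSEQ_I)
  fix \<epsilon> :: real assume \<epsilon>: "0 < \<epsilon>"
  obtain K where K: "\<And>k. K \<le> k \<Longrightarrow> norm (f k - l) < \<epsilon> / 2" using LIMSEQ_D[OF f, of "\<epsilon> / 2"] \<epsilon> by auto
  define B where "B = (\<Sum>k<K. norm (f k - l))"
  have B: "0 \<le> B" unfolding B_def by (intro sum_nonneg) simp
  \<comment> \<open>Beyond \<open>n0\<close> the total deviation of the first \<open>K\<close> terms
    is less than half of what is allowed.\<close>
  obtain n0 :: nat where n0: "2 * B / \<epsilon> < real n0" using reals_Archimedean2 by blast
  show "\<exists>no. \<forall>n\<ge>no. norm ((\<Sum>k\<le>n. f k) / real (n + 1) - l) < \<epsilon>"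
  proof (intro exI[of _ n0] allI impI)
    fix n assume n: "n0 \<le> n"
    have n1: "0 < real (n + 1)" by simp
    have half: "a * (b / 2) = (b * a) / 2" for a b :: real by simp
    have "norm (f k - l) \<le> (if k < K then norm (f k - l) else 0) + \<epsilon> / 2" for k
      using K[of k] \<epsilon> by (cases "k < K") auto
    then have "(\<Sum>k\<le>n. norm (f k - l)) \<le> (\<Sum>k\<le>n. (if k < K then norm (f k - l) else 0) + \<epsilon> / 2)" by (intro sum_mono) simp
    also have "\<dots> = (\<Sum>k\<le>n. if k < K then norm (f k - l) else 0) + real (n + 1) * (\<epsilon> / 2)" by (simp add: sum.distrib)
    also have "(\<Sum>k\<le>n. if k < K then norm (f k - l) else 0) = (\<Sum>k\<in>{..n} \<inter> {..<K}. norm (f k - l))"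
      by (rule sum.mono_neutral_cong_right) auto
    also have "\<dots> \<le> B" unfolding B_def by (intro sum_mono2) auto
    also have "2 * B < \<epsilon> * real (n + 1)"
    proof -
      have "2 * B / \<epsilon> < real (n + 1)" using n0 n by linarith
      then show ?thesis using \<epsilon> by (simp add: divide_less_eq mult.commute)
    qed
    then have "B + real (n + 1) * (\<epsilon> / 2) < \<epsilon> * real (n + 1)" using half[of "real (n + 1)" \<epsilon>] by linarith
    finally have s: "(\<Sum>k\<le>n. norm (f k - l)) < \<epsilon> * real (n + 1)" by simp
    have "(\<Sum>k\<le>n. f k) / real (n + 1) - l = (\<Sum>k\<le>n. f k - l) / real (n + 1)"
      using n1 by (simp add: sum_subtractf diff_divide_distrib)
    then have "norm ((\<Sum>k\<le>n. f k) / real (n + 1) - l) = norm (\<Sum>k\<le>n. f k - l) / real (n + 1)" by simp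
    also have "\<dots> \<le> (\<Sum>k\<le>n. norm (f k - l)) / real (n + 1)" using n1 by (intro divide_right_mono norm_sum) simp
    also have "\<dots> < \<epsilon>" using s n1 by (simp add: divide_less_eq)
    finally show "norm ((\<Sum>k\<le>n. f k) / real (n + 1) - l) < \<epsilon>" .
  qed
qed

context ofdm_channel
begin

text \<open>\<open>coh_form\<close> increases in \<open>k\<close>, so the limit in \<open>Tc\<close>
  exists, finite or infinite. With q for that limit, Tc - N = 2 N q, and the factor p / \<Lambda> /
  2 turns this into N p q / \<Lambda>.\<close>

lemma prediction_error_tendsto:
  assumes p: "0 < p" and \<Lambda>: "1 \<le> \<Lambda>"
  shows "(\<lambda>k. \<Lambda> / (\<Lambda> + real N * p * pred_q p k)) \<longlonglongrightarrow>
     real_of_ereal (1 / (1 + ereal (p / \<Lambda> / 2) * (Tc N \<rho> p - ereal (real N))))"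
proof -
  define Q where "Q = (SUP k. ereal (coh_form N \<rho> p (Suc k)))"
  have s: "0 < real N * p" using p N_pos by simp
  have mono: "incseq (\<lambda>k. ereal (coh_form N \<rho> p (Suc k)))"
    using coh_form_mono[OF less_imp_le[OF s]] by (intro incseq_SucI) simp
  have lim: "(\<lambda>k. ereal (coh_form N \<rho> p (Suc k))) \<longlonglongrightarrow> Q" unfolding Q_def by (rule LIMSEQ_SUP[OF mono])
  have Tc: "Tc N \<rho> p = 2 * ereal (real N) * Q + ereal (real N)" unfolding Tc_def limI[OF lim] ..
  have q: "pred_q p (Suc k) = coh_form N \<rho> p (Suc k)" for k by (simp add: pred_q_def)
  have nn: "0 \<le> coh_form N \<rho> p (Suc k)" for k using pred_q_nonneg[of p "Suc k"] p by (simp add: q)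
  have Q0: "0 \<le> Q" unfolding Q_def by (rule SUP_upper2[of 0]) (use nn in auto)
  show ?thesis
  proof (cases Q)
    case (real q)
    have q0: "0 \<le> q" using Q0 real by simp
    have l: "(\<lambda>k. pred_q p (Suc k)) \<longlonglongrightarrow> q" using lim by (simp add: real q)
    have den: "0 < \<Lambda> + real N * p * q" using \<Lambda> by (intro add_pos_nonneg mult_nonneg_nonneg[OF less_imp_le[OF s] q0]) simp
    have "(\<lambda>k. \<Lambda> / (\<Lambda> + real N * p * pred_q p (Suc k))) \<longlonglongrightarrow> \<Lambda> / (\<Lambda> + real N * p * q)"
      using den by (intro tendsto_intros l) simp
    moreover have "real_of_ereal (1 / (1 + ereal (p / \<Lambda> / 2) * (Tc N \<rho> p - ereal (real N)))) = \<Lambda> / (\<Lambda> + real N * p * q)"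
    proof -
      have 1: "2 * ereal (real N) * ereal q + ereal (real N) - ereal (real N) = ereal (2 * real N * q)"
        by simp
      have 2: "1 + p / \<Lambda> / 2 * (2 * real N * q) = (\<Lambda> + real N * p * q) / \<Lambda>" using \<Lambda> by (simp add: field_simps)
      have "1 + ereal (p / \<Lambda> / 2) * (Tc N \<rho> p - ereal (real N)) = ereal (1 + p / \<Lambda> / 2 * (2 * real N * q))"
        unfolding Tc real 1 by (simp add: one_ereal_def)
      also have "\<dots> = ereal ((\<Lambda> + real N * p * q) / \<Lambda>)" by (rule arg_cong[OF 2])
      finally have E: "1 + ereal (p / \<Lambda> / 2) * (Tc N \<rho> p - ereal (real N)) = ereal ((\<Lambda> + real N * p * q) / \<Lambda>)" .
      show ?thesis unfolding E using den \<Lambda> by (simp add: one_ereal_def)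
    qed
    ultimately show ?thesis by (subst filterlim_sequentially_Suc[symmetric]) simp
  next
    \<comment> \<open>Asymptotically perfect prediction: the errors tend to 0, which is also the
      reciprocal of infinity in \<open>ereal\<close>.\<close>
    case PInf
    have "filterlim (\<lambda>k. pred_q p (Suc k)) at_top sequentially" using lim by (simp add: PInf q tendsto_PInfty_eq_at_top)
    then have "filterlim (\<lambda>k. \<Lambda> + real N * p * pred_q p (Suc k)) at_top sequentially"
      by (intro filterlim_tendsto_add_at_top[OF tendsto_const] filterlim_tendsto_pos_mult_at_top[OF tendsto_const s])
    then have "(\<lambda>k. \<Lambda> / (\<Lambda> + real N * p * pred_q p (Suc k))) \<longlonglongrightarrow> 0"
      by (intro real_tendsto_divide_at_top[OF tendsto_const])
    moreover have "real_of_ereal (1 / (1 + ereal (p / \<Lambda> / 2) * (Tc N \<rho> p - ereal (real N)))) = 0"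
    proof -
      have "2 * ereal (real N) * \<infinity> + ereal (real N) - ereal (real N) = (\<infinity> :: ereal)"
        using N_pos by simp
      moreover have "p / \<Lambda> / 2 \<noteq> 0" "0 < p / \<Lambda> / 2" using p \<Lambda> by simp_all
      ultimately show ?thesis unfolding Tc PInf using p \<Lambda> by simp
    qed
    ultimately show ?thesis by (subst filterlim_sequentially_Suc[symmetric]) simp
  next
    case MInf
    then show ?thesis using Q0 by simp
  qed
qed

lemma qpsk_blocks_power:
  assumes x: "x \<in> qpsk_blocks N r A n" and k: "k \<le> n" and r: "r \<le> N"
  shows "tx_power N (x k) = real r * A\<^sup>2"
proof -
  have "tx_power N (x k) = (\<Sum>m<N. if m < r then A\<^sup>2 else 0)"
    unfolding tx_power_def
  proof (rule sum.cong[OF refl])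
    fix m assume "m \<in> {..<N}"
    then show "(cmod (x k m))\<^sup>2 = (if m < r then A\<^sup>2 else 0)"
      using qpsk_blocks_entry[OF x k, of m] cmod_qpsk[of "x k m" A] by (cases "m < r") auto
  qed
  then show ?thesis by (simp add: sum_if_less[OF r])
qed

lemma gmean_0: "complex_of_real (sqrt (real N)) * mean M (\<lambda>\<omega>. freq_resp N (H 0 \<omega>) 0) = gmean 0"
proof -
  have i: "integrable M (\<lambda>\<omega>. H 0 \<omega> l)" if l: "l < N" for l
    using l by (intro cmod_square_integrable_imp_integrable[OF prob_space_axioms H_component]
        jointly_gaussian_square_integrable[where i = "(0, l)" and Z = "\<lambda>(k, l) \<omega>. H k \<omega> l" and I = "UNIV \<times> {..<N}", unfolded prod.case])
       (use H_gaussian in \<open>auto simp: proper_gaussian_def prob_space_axioms\<close>)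
  have "mean M (\<lambda>\<omega>. freq_resp N (H 0 \<omega>) 0) = (\<Sum>l<N. cnj (dft N l 0) * mean M (\<lambda>\<omega>. H 0 \<omega> l))"
    unfolding mean_def freq_resp_def using i by (subst Bochner_Integration.integral_sum) auto
  then show ?thesis by (simp add: gmean_def tw_def sum_distrib_left mult.assoc)
qed

text \<open>Serves both constraints. The class \<open>I\<close> must have finite energy, be stable
  under concatenation, and contain each law for which every time has power N \<beta> px with
  probability 1 / \<beta> and power 0 otherwise; the last condition is phrased by integrals.\<close>

lemma LB_QPSK_le_capacity:
  assumes px: "0 < px" and r: "1 \<le> r" "r \<le> N" and \<beta>: "1 \<le> \<beta>"
    and en: "\<And>n. I n \<subseteq> energy_inputs N n"
    and join: "\<And>n1 n2 \<mu>1 \<mu>2. \<mu>1 \<in> I n1 \<Longrightarrow> \<mu>2 \<in> I n2 \<Longrightarrow>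
       distr (\<mu>1 \<Otimes>\<^sub>M \<mu>2) (block_space N (n1 + n2 + 1)) (block_join n1 n2) \<in> I (n1 + n2 + 1)"
    and mem: "\<And>n \<mu>. \<mu> \<in> input_laws N n \<Longrightarrow>
       (\<And>k u. k \<le> n \<Longrightarrow> u \<in> borel_measurable borel \<Longrightarrow>
         (\<integral>\<^sup>+x. u (tx_power N (x k)) \<partial>\<mu>) = ennreal (1 / \<beta>) * u (real N * \<beta> * px) + ennreal (1 - 1 / \<beta>) * u 0) \<Longrightarrow> \<mu> \<in> I n"
  shows "ereal (LB_QPSK M N L \<rho> H px r \<beta>) \<le> capacity M N H W I"
proof -
  \<comment> \<open>The power N \<beta> px of an active time is shared equally by \<open>r\<close>
    carriers.\<close>
  define A where "A = sqrt (real N * \<beta> * px / real r)"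
  have rpos: "0 < real r" using r by simp
  have A2: "A\<^sup>2 = real N * \<beta> * px / real r" using px \<beta> by (simp add: A_def)
  have A: "0 < A" unfolding A_def using px \<beta> r N_pos by simp
  \<comment> \<open>The noise in the normalised observation is 1 / A^2 = 1 / (N p) for a single
    carrier when r < N, and (L / N) / A^2 = L / (N p) after interpolation when r = N. Both read
    \<Lambda> / (N p).\<close>
  define p where "p = (if r < N then \<beta> / real r * px else \<beta> * px)"
  define \<Lambda> where "\<Lambda> = (if r < N then 1 else real L)"
  define P where "P m j = (if r < N then (if j = m then 1 else 0) else full_kernel m j)" for m j :: nat
  have p: "0 < p" using px \<beta> rpos by (simp add: p_def)
  have \<Lambda>: "1 \<le> \<Lambda>" using L_pos by (simp add: \<Lambda>_def)
  have Pk: "(\<Sum>j<r. P m j * tw N l j) = tw N l m" if "m < r" "l < L" for m l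
    using partial_kernel(1)[OF that(1), of l] full_kernel_tw(1)[OF that(2), of m] r by (cases "r < N") (simp_all add: P_def)
  have P2: "(\<Sum>j<r. (cmod (P m j))\<^sup>2) / A\<^sup>2 = \<Lambda> / (real N * p)" if m: "m < r" for m
  proof (cases "r < N")
    case True
    then show ?thesis using partial_kernel(2)[OF m] by (simp add: P_def A2 \<Lambda>_def p_def)
  next
    case False
    then have rN: "r = N" using r by simp
    then show ?thesis using full_kernel_tw(2)[of m] N_pos by (simp add: P_def A2 \<Lambda>_def p_def)
  qed
  define e where "e k = \<Lambda> / (\<Lambda> + real N * p * pred_q p k)" for k
  have e01: "0 \<le> e k" "e k \<le> 1" for k
  proof -
    have "0 \<le> real N * p * pred_q p k" using p by (intro mult_nonneg_nonneg pred_q_nonneg) auto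
    then show "0 \<le> e k" "e k \<le> 1" using \<Lambda> by (auto simp: e_def)
  qed
  define D where "D = pred_err N L \<rho> px r \<beta>"
  have elim: "e \<longlonglongrightarrow> D"
  proof -
    have "D = real_of_ereal (1 / (1 + ereal (p / \<Lambda> / 2) * (Tc N \<rho> p - ereal (real N))))"
      by (cases "r < N") (simp_all add: D_def pred_err_def p_def \<Lambda>_def)
    then show ?thesis using prediction_error_tendsto[OF p \<Lambda>] unfolding e_def[abs_def] by (simp only:)
  qed
  have flim: "(\<lambda>k. fade_QPSK A (e k)) \<longlonglongrightarrow> fade_QPSK A D"
    unfolding fade_QPSK_def using A by (intro fade_QPSK_tendsto e01 elim) simp
  define l where "l n = real r / (real N * \<beta>) * ((\<Sum>k\<le>n. fade_QPSK A (e k)) / real (n + 1))" for n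
  have LB: "LB_QPSK M N L \<rho> H px r \<beta> = real r / (real N * \<beta>) * fade_QPSK A D"
  proof -
    have "real r / real N * (1 / (\<beta> * px)) = 1 / A\<^sup>2" by (simp add: A2)
    then show ?thesis unfolding LB_QPSK_def Let_def fade_QPSK_def fade_snr_def gmean_0 D_def by (simp only:)
  qed
  show ?thesis unfolding LB
  proof (rule capacity_ge[where l = l, OF en join])
    show "l \<longlonglongrightarrow> real r / (real N * \<beta>) * fade_QPSK A D"
      unfolding l_def by (intro tendsto_mult tendsto_const cesaro_mean flim)
  next
    fix n
    let ?X = "qpsk_blocks N r A n"
    define x0 :: "nat \<Rightarrow> nat \<Rightarrow> complex" where "x0 = (\<lambda>k\<in>{..n}. \<lambda>m\<in>{..<N}. 0)"
    have x0: "x0 \<in> space (block_space N n)" "\<And>k m. k \<le> n \<Longrightarrow> m < N \<Longrightarrow> x0 k m = 0"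
      by (auto simp: x0_def space_block_space)
    have c: "0 \<le> 1 / \<beta>" "1 / \<beta> \<le> 1" using \<beta> by simp_all
    obtain \<mu> where \<mu>: "\<mu> \<in> input_laws N n"
      and mix: "\<And>g. g \<in> borel_measurable (block_space N n) \<Longrightarrow>
         (\<integral>\<^sup>+x. g x \<partial>\<mu>) = ennreal (1 / \<beta>) * ((\<Sum>x\<in>?X. g x) / of_nat (card ?X)) + ennreal (1 - 1 / \<beta>) * g x0"
        "\<And>g :: (nat \<Rightarrow> nat \<Rightarrow> complex) \<Rightarrow> real. g \<in> borel_measurable (block_space N n) \<Longrightarrow>
         (\<integral>x. g x \<partial>\<mu>) = 1 / \<beta> * ((\<Sum>x\<in>?X. g x) / real (card ?X)) + (1 - 1 / \<beta>) * g x0"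
      by (rule finite_mixture[OF finite_qpsk_blocks qpsk_blocks_nonempty qpsk_blocks_space x0(1) c]) (rule that)
    have mI: "\<mu> \<in> I n"
    proof (rule mem[OF \<mu>])
      fix k and u :: "real \<Rightarrow> ennreal" assume k: "k \<le> n" and u: "u \<in> borel_measurable borel"
      have t: "tx_power N (x k) = real N * \<beta> * px" if "x \<in> ?X" for x
        using qpsk_blocks_power[OF that k r(2)] rpos by (simp add: A2)
      have t0: "tx_power N (x0 k) = 0" using k by (simp add: tx_power_def x0(2))
      have X: "of_nat (card ?X) \<noteq> (0 :: ennreal)" using finite_qpsk_blocks qpsk_blocks_nonempty by (simp add: card_eq_0_iff)
      have "(\<Sum>x\<in>?X. u (tx_power N (x k))) / of_nat (card ?X) = u (real N * \<beta> * px) * of_nat (card ?X) / of_nat (card ?X)"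
        by (simp add: t mult.commute)
      also have "\<dots> = u (real N * \<beta> * px)" using X by (intro ennreal_mult_divide_eq) simp_all
      finally show "(\<integral>\<^sup>+x. u (tx_power N (x k)) \<partial>\<mu>) = ennreal (1 / \<beta>) * u (real N * \<beta> * px) + ennreal (1 - 1 / \<beta>) * u 0"
        unfolding mix(1)[OF measurable_compose[OF tx_power_row_measurable[OF k] u]] t0 by (simp only:)
    qed
    show "\<exists>\<mu>\<in>I n. l n \<le> block_information M N H W n \<mu> / (real N * real (n + 1))"
    proof (rule bexI[OF _ mI])
      have "1 / \<beta> * (real r * (\<Sum>k\<le>n. fade_QPSK A (e k))) \<le> block_information M N H W n \<mu>"
        unfolding e_def by (rule mixture_information_ge[where P = P, OF r(2) A p \<Lambda> c Pk P2 x0 _ mix]) (use mI en in auto)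
      then have "1 / \<beta> * (real r * (\<Sum>k\<le>n. fade_QPSK A (e k))) / (real N * real (n + 1)) \<le> block_information M N H W n \<mu> / (real N * real (n + 1))"
        by (rule divide_right_mono) simp
      also have "1 / \<beta> * (real r * (\<Sum>k\<le>n. fade_QPSK A (e k))) / (real N * real (n + 1)) = l n"
        unfolding l_def by (simp add: mult.commute)
      finally show "l n \<le> block_information M N H W n \<mu> / (real N * real (n + 1))" .
    qed
  qed
qed

text \<open>For \<beta> = 1 no block is silent and the power is exactly N px, so the indicator of
  exceeding it integrates to 0.\<close>

lemma peak_capacity_ge:
  assumes px: "0 < px" and r: "1 \<le> r" "r \<le> N"
  shows "ereal (LB_QPSK M N L \<rho> H px r 1) \<le> capacity M N H W (peak_inputs N px)"
proof (rule LB_QPSK_le_capacity[OF px r order_refl peak_inputs_energy peak_inputs_join])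
  fix n \<mu>
  assume \<mu>: "\<mu> \<in> input_laws N n"
    and u: "\<And>k u. k \<le> n \<Longrightarrow> u \<in> borel_measurable borel \<Longrightarrow>
      (\<integral>\<^sup>+x. u (tx_power N (x k)) \<partial>\<mu>) = ennreal (1 / 1) * u (real N * 1 * px) + ennreal (1 - 1 / 1) * u 0"
  have "AE x in \<mu>. tx_power N (x k) \<le> real N * px" if k: "k \<le> n" for k
  proof -
    have st: "sets \<mu> = sets (block_space N n)" using \<mu> by (simp add: input_laws_def)
    have m: "(\<lambda>x. tx_power N (x k)) \<in> borel_measurable \<mu>"
      using tx_power_row_measurable[OF k, of N] by (simp add: measurable_cong_sets[OF st refl])
    have "(\<integral>\<^sup>+x. indicator {real N * px<..} (tx_power N (x k)) \<partial>\<mu>) = 0"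
      using u[OF k, of "indicator {real N * px<..}"] by simp
    then have "AE x in \<mu>. (indicator {real N * px<..} (tx_power N (x k)) :: ennreal) = 0"
      using m by (subst (asm) nn_integral_0_iff_AE) auto
    then show ?thesis by (rule AE_mp) (auto simp: indicator_def not_less split: if_splits)
  qed
  then show "\<mu> \<in> peak_inputs N px n" using \<mu> by (simp add: peak_inputs_def)
qed

text \<open>Power N \<beta> px with probability 1 / \<beta> has mean N px and second moment \<beta>
  N^2 px^2; this is where \<beta> \<le> \<alpha> enters.\<close>

lemma quadratic_capacity_ge:
  assumes px: "0 < px" and r: "1 \<le> r" "r \<le> N" and \<beta>: "1 \<le> \<beta>" "\<beta> \<le> \<alpha>"
  shows "ereal (LB_QPSK M N L \<rho> H px r \<beta>) \<le> capacity M N H W (quadratic_inputs N px \<alpha>)"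
proof (rule LB_QPSK_le_capacity[OF px r \<beta>(1) quadratic_inputs_energy quadratic_inputs_join])
  fix n \<mu>
  assume \<mu>: "\<mu> \<in> input_laws N n"
    and u: "\<And>k u. k \<le> n \<Longrightarrow> u \<in> borel_measurable borel \<Longrightarrow>
      (\<integral>\<^sup>+x. u (tx_power N (x k)) \<partial>\<mu>) = ennreal (1 / \<beta>) * u (real N * \<beta> * px) + ennreal (1 - 1 / \<beta>) * u 0"
  have "(\<integral>\<^sup>+x. ennreal (tx_power N (x k)) \<partial>\<mu>) \<le> ennreal (real N * px)" if k: "k \<le> n" for k
    using u[OF k, of ennreal] px \<beta> by (simp flip: ennreal_mult)
  moreover have "(\<integral>\<^sup>+x. ennreal ((tx_power N (x k))\<^sup>2) \<partial>\<mu>) \<le> ennreal (\<alpha> * (real N)\<^sup>2 * px\<^sup>2)" if k: "k \<le> n" for k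
  proof -
    have "1 / \<beta> * (real N * \<beta> * px)\<^sup>2 = \<beta> * (real N)\<^sup>2 * px\<^sup>2" using \<beta> by (simp add: power2_eq_square)
    also have "\<dots> \<le> \<alpha> * (real N)\<^sup>2 * px\<^sup>2" using \<beta> by (intro mult_right_mono) auto
    finally have "ennreal (1 / \<beta> * (real N * \<beta> * px)\<^sup>2) \<le> ennreal (\<alpha> * (real N)\<^sup>2 * px\<^sup>2)" by (rule ennreal_leI)
    moreover have "ennreal (1 / \<beta>) * ennreal ((real N * \<beta> * px)\<^sup>2) = ennreal (1 / \<beta> * (real N * \<beta> * px)\<^sup>2)"
      using \<beta> by (intro ennreal_mult[symmetric]) simp_all
    ultimately show ?thesis using u[OF k, of "\<lambda>t. ennreal (t\<^sup>2)"] by simp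
  qed
  ultimately show "\<mu> \<in> quadratic_inputs N px \<alpha> n" using \<mu> by (simp add: quadratic_inputs_def)
qed

end

theorem theorem2:
  fixes M :: "'a measure"
    and N L :: nat
    and \<rho> :: "int \<Rightarrow> complex"
    and cH :: "nat \<Rightarrow> real"
    and H W :: "nat \<Rightarrow> 'a \<Rightarrow> nat \<Rightarrow> complex"
    and px \<alpha> :: real
  assumes "ofdm_channel M N L \<rho> cH H W"
    and "px > 0"
    and "\<alpha> \<ge> 1"
  shows "capacity M N H W (peak_inputs N px)
           \<ge> Max ((\<lambda>r. ereal (LB_QPSK M N L \<rho> H px r 1)) ` {1..N}) \<and>
         capacity M N H W (quadratic_inputs N px \<alpha>)
           \<ge> Max ((\<lambda>r. SUP \<beta>\<in>{1..\<alpha>}. ereal (LB_QPSK M N L \<rho> H px r \<beta>)) ` {1..N})"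
proof -
  interpret ofdm_channel M N L \<rho> cH H W by fact
  have "{1..N} \<noteq> {}" using N_pos by simp
  then show ?thesis
    using peak_capacity_ge[OF assms(2)] quadratic_capacity_ge[OF assms(2)]
    by (intro conjI Max.boundedI) (auto intro!: SUP_least)
qed

end
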